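(* Let $(\mathcal{G},\Gamma)$ be a finite graph of groups such that all vertex groups $G_v$, $v \in V\Gamma$, are finitely generated and abelian. Suppose that there is a maximal tree $T$ in $\Gamma$ such that for every $e \in E\Gamma \setminus ET$ the edge group $G_e = \langle c_e \rangle$ is cyclic (with $c_{\overline{e}} = c_e$), and denote $a_e := \alpha_e(c_e) \in G_{\alpha(e)}$. Let $G_T$ be the fundamental group of the subgraph of groups $(\mathcal{G}_T, T)$ obtained by restricting $(\mathcal{G},\Gamma)$ to $T$, let $A$ be the abelianization of $G_T$ and let $\rho: G_T \to A$ be the abelianization homomorphism. If the collection $\{\rho(a_e)\}_{e \in E\Gamma \setminus ET}$ is nearly linearly independent in $A$ then the fundamental group $G$ of $(\mathcal{G},\Gamma)$ has property (VRC).
   Context: A subgroup $H$ of a group $G$ is a virtual retract of $G$ if there is a finite index subgroup $K$ of $G$ such that $H \subseteq K$ and there is a homomorphism $\rho: K \to H$ whose restriction to $H$ is the identity map. A group has property (VRC) if every cyclic subgroup is a virtual retract. A collection (indexed family, repetitions allowed) $\{\vec v_i\}_{i \in I}$ of vectors in a finite dimensional real vector space is nearly linearly independent if there exists a subset $J \subseteq I$ such that the vectors $\{\vec v_j\}_{j \in J}$ are linearly independent and for each $i \in I$ there exist $j \in J$ and $\varepsilon \in \{\pm 1\}$ such that $\vec v_i = \varepsilon\, \vec v_j$. Elements of a finitely generated abelian group $A$ are nearly linearly independent if their images in $A \otimes_{\mathbb{Z}} \mathbb{R}$ are nearly linearly independent. Graphs are in the sense of Serre: a graph $\Gamma$ has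 a vertex set $V\Gamma$, an edge set $E\Gamma$, an inversion map $e \mapsto \overline{e}$ on $E\Gamma$ with $\overline{e} \ne e$ and $\overline{\overline{e}} = e$, and incidence maps $\alpha,\omega: E\Gamma \to V\Gamma$ with $\omega(\overline{e}) = \alpha(e)$. An orientation is a decomposition $E\Gamma = E\Gamma^+ \sqcup E\Gamma^-$ with $E\Gamma^- = \{\overline{e} \mid e \in E\Gamma^+\}$. A finite graph of groups $(\mathcal{G},\Gamma)$ consists of a non-empty finite connected graph $\Gamma$, vertex groups $G_v$ ($v \in V\Gamma$), edge groups $G_e$ ($e \in E\Gamma$) with $G_e = G_{\overline{e}}$, and monomorphisms $\alpha_e: G_e \to G_{\alpha(e)}$ ($e \in E\Gamma$); put $\omega_e := \alpha_{\overline{e}}: G_e \to G_{\omega(e)}$. Given a maximal tree $T$ in $\Gamma$ and an orientation, its fundamental group is the group generated by all $G_v$, $v \in V\Gamma$, and free letters $t_e$, $e \in E\Gamma^+$, subject to the relations of the vertex groups, $t_e\, \omega_e(a)\, t_e^{-1} = \alpha_e(a)$ for all $e \in E\Gamma^+$, $a \in G_e$, and $t_f = 1$ for all $f \in ET \cap E\Gamma^+$; up to isomorphism it does not depend on the choices. The vertex groups embed naturally in the fundamental group and are treated as its subgroups. The subgraph of groups $(\mathcal{G}_T,T)$ has vertex groups $G_v$, $v \in V\Gamma = VT$, edge groups $G_e$, $e \in ET$, and monomorphisms $\alpha_e$, $e \in ET$; its fundamental group $G_T$ is taken with respect to the maximal tree $T$ of $T$, so each $G_v \leqslant G_T$. 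*)

theory Defs
  imports
    "HOL-Combinatorics.Orbits"
    "HOL-Algebra.Generated_Groups"
    "HOL-Algebra.Free_Abelian_Groups"
    "Jordan_Normal_Form.VS_Connect"
    "Graph_Theory.Bidirected_Digraph"
    "Graph_Theory.Digraph_Component"
begin

section \<open>Virtual retracts\<close>

definition virtual_retract :: "'a set \<Rightarrow> ('a, 'm) monoid_scheme \<Rightarrow> bool" where
  "virtual_retract H G \<longleftrightarrow> subgroup H G \<and>
    (\<exists>K \<rho>. subgroup K G \<and> finite (rcosets\<^bsub>G\<^esub> K) \<and> H \<subseteq> K \<and>
       \<rho> \<in> hom (G\<lparr>carrier := K\<rparr>) (G\<lparr>carrier := H\<rparr>) \<and> (\<forall>h\<in>H. \<rho> h = h))"

definition property_VRC :: "('a, 'm) monoid_scheme \<Rightarrow> bool" where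
  "property_VRC G \<longleftrightarrow> (\<forall>g\<in>carrier G. virtual_retract (generate G {g}) G)"

definition finitely_generated_group :: "('a, 'm) monoid_scheme \<Rightarrow> bool" where
  "finitely_generated_group G \<longleftrightarrow>
    (\<exists>S. finite S \<and> S \<subseteq> carrier G \<and> carrier G = generate G S)"

definition abelianization :: "('a, 'm) monoid_scheme \<Rightarrow> 'a set monoid" where
  "abelianization G = G Mod derived G (carrier G)"

definition abelianization_hom :: "('a, 'm) monoid_scheme \<Rightarrow> 'a \<Rightarrow> 'a set" where
  "abelianization_hom G g = derived G (carrier G) #>\<^bsub>G\<^esub> g"


section \<open>The real vector space \<open>A \<otimes>\<^sub>\<int> \<real>\<close>\<close>

text \<open>
  For an abelian group \<open>A\<close> (written multiplicatively), \<open>A \<otimes>\<^sub>\<int> \<real>\<close> is the free abelian group on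
  the symbols \<open>(a, r)\<close> modulo the subgroup generated by the bilinearity relations; a real number
  \<open>r\<close> acts by \<open>(a, s) \<mapsto> (a, r * s)\<close>.
\<close>

definition tensor_real_free :: "('a, 'm) monoid_scheme \<Rightarrow> (('a \<times> real) \<Rightarrow>\<^sub>0 int) monoid" where
  "tensor_real_free A = free_Abelian_group (carrier A \<times> UNIV)"

definition tensor_real_rels :: "('a, 'm) monoid_scheme \<Rightarrow> (('a \<times> real) \<Rightarrow>\<^sub>0 int) set" where
  "tensor_real_rels A =
     {frag_of (a \<otimes>\<^bsub>A\<^esub> b, r) - frag_of (a, r) - frag_of (b, r) | a b r.
        a \<in> carrier A \<and> b \<in> carrier A} \<union>
     {frag_of (a, r + s) - frag_of (a, r) - frag_of (a, s) | a r s. a \<in> carrier A}"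

definition tensor_real_kernel :: "('a, 'm) monoid_scheme \<Rightarrow> (('a \<times> real) \<Rightarrow>\<^sub>0 int) set" where
  "tensor_real_kernel A = generate (tensor_real_free A) (tensor_real_rels A)"

definition tensor_real_scale :: "real \<Rightarrow> (('a \<times> real) \<Rightarrow>\<^sub>0 int) \<Rightarrow> (('a \<times> real) \<Rightarrow>\<^sub>0 int)" where
  "tensor_real_scale r = frag_extend (\<lambda>(a, s). frag_of (a, r * s))"

text \<open>
  In a \<open>module\<close> record the vector addition is the field \<open>add\<close>; \<open>mult\<close> and \<open>one\<close> play no role.
  Scaling maps a coset \<open>X\<close> of the kernel into a single coset, and multiplying by the kernel
  fills that coset up (needed for \<open>r = 0\<close>).
\<close>

definition tensor_real :: "('a, 'm) monoid_scheme \<Rightarrow> (real, (('a \<times> real) \<Rightarrow>\<^sub>0 int) set) module" where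
  "tensor_real A =
    \<lparr>carrier = carrier (tensor_real_free A Mod tensor_real_kernel A),
     mult = undefined, one = undefined,
     zero = \<one>\<^bsub>tensor_real_free A Mod tensor_real_kernel A\<^esub>,
     add = (\<lambda>X Y. X \<otimes>\<^bsub>tensor_real_free A Mod tensor_real_kernel A\<^esub> Y),
     smult = (\<lambda>r X. tensor_real_kernel A <#>\<^bsub>tensor_real_free A\<^esub> (tensor_real_scale r ` X))\<rparr>"

definition tensor_real_image :: "('a, 'm) monoid_scheme \<Rightarrow> 'a \<Rightarrow> (('a \<times> real) \<Rightarrow>\<^sub>0 int) set" where
  "tensor_real_image A a = tensor_real_kernel A #>\<^bsub>tensor_real_free A\<^esub> frag_of (a, 1)"


lemma tensor_real_scale_add:
  "tensor_real_scale r (x + y) = tensor_real_scale r x + tensor_real_scale r y"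
  by (simp add: tensor_real_scale_def frag_extend_add)

lemma tensor_real_scale_diff:
  "tensor_real_scale r (x - y) = tensor_real_scale r x - tensor_real_scale r y"
  by (simp add: tensor_real_scale_def frag_extend_diff)

lemma tensor_real_scale_of [simp]: "tensor_real_scale r (frag_of (a, s)) = frag_of (a, r * s)"
  by (simp add: tensor_real_scale_def)

lemma tensor_real_scale_0 [simp]: "tensor_real_scale r 0 = 0"
  by (simp add: tensor_real_scale_def)

lemma comm_group_tensor_real_free: "comm_group (tensor_real_free A)"
  by (simp add: tensor_real_free_def abelian_free_Abelian_group)

lemma mult_tensor_real_free [simp]: "x \<otimes>\<^bsub>tensor_real_free A\<^esub> y = x + y"
  by (simp add: tensor_real_free_def)

lemma one_tensor_real_free [simp]: "\<one>\<^bsub>tensor_real_free A\<^esub> = 0"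
  by (simp add: tensor_real_free_def)

lemma tensor_real_free_induct [consumes 1, case_names zero diff of]:
  assumes "x \<in> carrier (tensor_real_free A)" "P 0"
    "\<And>x y. x \<in> carrier (tensor_real_free A) \<Longrightarrow> y \<in> carrier (tensor_real_free A) \<Longrightarrow>
      P x \<Longrightarrow> P y \<Longrightarrow> P (x - y)"
    "\<And>a s. a \<in> carrier A \<Longrightarrow> P (frag_of (a, s))"
  shows "P x"
proof -
  have *: "Poly_Mapping.keys x \<subseteq> carrier A \<times> UNIV"
    using assms(1) by (simp add: tensor_real_free_def)
  show ?thesis
    by (rule free_Abelian_group_induct[OF *])
       (use assms(2-) in \<open>auto simp: tensor_real_free_def\<close>)
qed

lemma diff_tensor_real_free:
  assumes "x \<in> carrier (tensor_real_free A)" "y \<in> carrier (tensor_real_free A)"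
  shows "x - y \<in> carrier (tensor_real_free A)"
  using assms keys_diff[of x y] by (auto simp: tensor_real_free_def)

lemma frag_of_tensor_real_free [simp]:
  "frag_of (a, r) \<in> carrier (tensor_real_free A) \<longleftrightarrow> a \<in> carrier A"
  by (simp add: tensor_real_free_def)

lemma tensor_real_scale_closed:
  assumes "x \<in> carrier (tensor_real_free A)"
  shows "tensor_real_scale r x \<in> carrier (tensor_real_free A)"
  using assms
proof (induction rule: tensor_real_free_induct)
  case zero
  then show ?case by (simp add: tensor_real_free_def)
qed (auto simp: tensor_real_scale_diff diff_tensor_real_free)

lemma tensor_real_rels_subset:
  assumes "comm_group A"
  shows "tensor_real_rels A \<subseteq> carrier (tensor_real_free A)"
proof -
  interpret comm_group A by fact
  show ?thesis
    by (auto simp: tensor_real_rels_def intro!: diff_tensor_real_free)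
qed

lemma tensor_real_kernel_normal:
  assumes "comm_group A"
  shows "tensor_real_kernel A \<lhd> tensor_real_free A"
proof -
  interpret F: comm_group "tensor_real_free A" by (rule comm_group_tensor_real_free)
  show ?thesis
    unfolding tensor_real_kernel_def
    by (intro F.subgroup_imp_normal F.generate_is_subgroup tensor_real_rels_subset assms)
qed

lemma tensor_real_scale_rels:
  "x \<in> tensor_real_rels A \<Longrightarrow> tensor_real_scale r x \<in> tensor_real_rels A"
  unfolding tensor_real_rels_def
  by (auto simp: tensor_real_scale_diff ring_distribs) blast+

lemma inv_tensor_real_free:
  "x \<in> carrier (tensor_real_free A) \<Longrightarrow> inv\<^bsub>tensor_real_free A\<^esub> x = - x"
  by (simp add: tensor_real_free_def)

lemma tensor_real_scale_kernel:
  assumes A: "comm_group A" and "x \<in> tensor_real_kernel A"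
  shows "tensor_real_scale r x \<in> tensor_real_kernel A"
  using assms(2) unfolding tensor_real_kernel_def
proof (induction rule: generate.induct)
  case one
  show ?case using generate.one[of "tensor_real_free A"] by simp
next
  case (incl h)
  then show ?case by (intro generate.incl tensor_real_scale_rels)
next
  case (inv h)
  then have h: "h \<in> carrier (tensor_real_free A)" using tensor_real_rels_subset[OF A] by blast
  have "tensor_real_scale r (inv\<^bsub>tensor_real_free A\<^esub> h) = inv\<^bsub>tensor_real_free A\<^esub> (tensor_real_scale r h)"
    using h tensor_real_scale_closed[OF h, of r] tensor_real_scale_diff[of r 0 h]
    by (simp add: inv_tensor_real_free)
  then show ?case using inv by (simp add: generate.inv tensor_real_scale_rels)
next
  case (eng g h)
  then show ?case
    using generate.eng[of _ "tensor_real_free A"] by (fastforce simp: tensor_real_scale_add)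
qed

lemma smult_tensor_real:
  assumes A: "comm_group A" and x: "x \<in> carrier (tensor_real_free A)"
  shows "r \<odot>\<^bsub>tensor_real A\<^esub> (tensor_real_kernel A #>\<^bsub>tensor_real_free A\<^esub> x)
    = tensor_real_kernel A #>\<^bsub>tensor_real_free A\<^esub> tensor_real_scale r x"
proof -
  let ?F = "tensor_real_free A" and ?N = "tensor_real_kernel A"
  interpret N: normal ?N ?F by (rule tensor_real_kernel_normal[OF A])
  have mult: "?N <#>\<^bsub>?F\<^esub> Y = {h + y | h y. h \<in> ?N \<and> y \<in> Y}" for Y
    by (auto simp: set_mult_def)
  have coset: "?N #>\<^bsub>?F\<^esub> y = {h + y | h. h \<in> ?N}" for y
    by (auto simp: r_coset_def)
  have "?N <#>\<^bsub>?F\<^esub> (tensor_real_scale r ` (?N #>\<^bsub>?F\<^esub> x)) = ?N #>\<^bsub>?F\<^esub> tensor_real_scale r x"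
  proof (intro equalityI subsetI)
    fix z assume "z \<in> ?N <#>\<^bsub>?F\<^esub> (tensor_real_scale r ` (?N #>\<^bsub>?F\<^esub> x))"
    then obtain h k where hk: "h \<in> ?N" "k \<in> ?N" "z = h + tensor_real_scale r (k + x)"
      unfolding mult coset by blast
    have "h + tensor_real_scale r k \<in> ?N"
      using subgroup.m_closed[OF N.subgroup_axioms hk(1) tensor_real_scale_kernel[OF A hk(2)]] by simp
    moreover have "z = (h + tensor_real_scale r k) + tensor_real_scale r x"
      by (simp only: hk(3) tensor_real_scale_add add.assoc)
    ultimately show "z \<in> ?N #>\<^bsub>?F\<^esub> tensor_real_scale r x"
      unfolding coset by blast
  next
    fix z assume "z \<in> ?N #>\<^bsub>?F\<^esub> tensor_real_scale r x"
    moreover have "x \<in> ?N #>\<^bsub>?F\<^esub> x" by (rule N.rcos_self[OF x N.subgroup_axioms])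
    ultimately show "z \<in> ?N <#>\<^bsub>?F\<^esub> (tensor_real_scale r ` (?N #>\<^bsub>?F\<^esub> x))"
      unfolding mult coset[of "tensor_real_scale r x"] by blast
  qed
  then show ?thesis
    by (simp add: tensor_real_def)
qed

lemma module_tensor_real:
  assumes A: "comm_group A"
  shows "Module.module class_ring (tensor_real A)"
proof -
  let ?F = "tensor_real_free A" and ?N = "tensor_real_kernel A"
  let ?q = "\<lambda>x. ?N #>\<^bsub>?F\<^esub> x"
  interpret F: comm_group ?F by (rule comm_group_tensor_real_free)
  interpret N: normal ?N ?F by (rule tensor_real_kernel_normal[OF A])
  interpret Q: comm_group "?F Mod ?N"
    using N.subgroup_axioms by (rule F.abelian_FactGroup)
  have carr: "carrier (tensor_real A) = ?q ` carrier ?F"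
    by (auto simp: tensor_real_def FactGroup_def RCOSETS_def)
  have add: "?q x \<oplus>\<^bsub>tensor_real A\<^esub> ?q y = ?q (x + y)"
    if "x \<in> carrier ?F" "y \<in> carrier ?F" for x y
    using that by (simp add: tensor_real_def FactGroup_def N.rcos_sum)
  note sm = smult_tensor_real[OF A]
  have rel1: "?q x = ?q y" if "x \<in> carrier ?F" "y \<in> carrier ?F" "x - y \<in> ?N" for x y
  proof -
    have "x \<in> ?q y" using that(3) by (force simp: r_coset_def)
    then show ?thesis using F.repr_independence[OF _ _ N.subgroup_axioms] that by metis
  qed
  show ?thesis
  proof (rule Module.moduleI)
    show "cring (class_ring :: real ring)" by (rule class_cring.cring_axioms)
    show "abelian_group (tensor_real A)"
    proof (rule abelian_groupI)
      fix X Y Z assume "X \<in> carrier (tensor_real A)" "Y \<in> carrier (tensor_real A)" "Z \<in> carrier (tensor_real A)"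
      then show "X \<oplus>\<^bsub>tensor_real A\<^esub> Y \<oplus>\<^bsub>tensor_real A\<^esub> Z = X \<oplus>\<^bsub>tensor_real A\<^esub> (Y \<oplus>\<^bsub>tensor_real A\<^esub> Z)"
        using Q.m_assoc by (simp add: tensor_real_def)
    next
      fix X Y assume "X \<in> carrier (tensor_real A)" "Y \<in> carrier (tensor_real A)"
      then show "X \<oplus>\<^bsub>tensor_real A\<^esub> Y = Y \<oplus>\<^bsub>tensor_real A\<^esub> X"
        using Q.m_comm by (simp add: tensor_real_def)
    next
      fix X assume "X \<in> carrier (tensor_real A)"
      then show "\<exists>Y\<in>carrier (tensor_real A). Y \<oplus>\<^bsub>tensor_real A\<^esub> X = \<zero>\<^bsub>tensor_real A\<^esub>"
        using Q.l_inv_ex by (simp add: tensor_real_def)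
    qed (use Q.m_closed Q.one_closed Q.l_one in \<open>simp_all add: tensor_real_def\<close>)
  next
    fix r X assume "X \<in> carrier (tensor_real A)"
    then show "r \<odot>\<^bsub>tensor_real A\<^esub> X \<in> carrier (tensor_real A)"
      by (auto simp: carr sm tensor_real_scale_closed)
  next
    fix r s :: real and X assume "X \<in> carrier (tensor_real A)"
    then obtain x where x: "x \<in> carrier ?F" "X = ?q x" by (auto simp: carr)
    have "tensor_real_scale (r + s) x - (tensor_real_scale r x + tensor_real_scale s x) \<in> ?N"
      using x(1)
    proof (induction rule: tensor_real_free_induct)
      case zero
      then show ?case using subgroup.one_closed[OF N.subgroup_axioms] by simp
    next
      case (diff x y)
      let ?d = "\<lambda>x. tensor_real_scale (r + s) x - (tensor_real_scale r x + tensor_real_scale s x)"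
      have "?d x \<otimes>\<^bsub>?F\<^esub> inv\<^bsub>?F\<^esub> ?d y \<in> ?N"
        using diff by (intro subgroup.m_closed[OF N.subgroup_axioms] subgroup.m_inv_closed[OF N.subgroup_axioms])
      moreover have "inv\<^bsub>?F\<^esub> ?d y = - ?d y"
        using diff N.subset by (intro inv_tensor_real_free) blast
      ultimately show ?case by (simp add: tensor_real_scale_diff algebra_simps)
    next
      case (of a t)
      then have "frag_of (a, r * t + s * t) - frag_of (a, r * t) - frag_of (a, s * t) \<in> tensor_real_rels A"
        unfolding tensor_real_rels_def by blast
      then show ?case
        by (auto simp: tensor_real_kernel_def ring_distribs diff_diff_eq intro: generate.incl)
    qed
    then have "?q (tensor_real_scale (r + s) x) = ?q (tensor_real_scale r x + tensor_real_scale s x)"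
      using tensor_real_scale_closed[OF x(1)]
        F.m_closed[OF tensor_real_scale_closed[OF x(1), of r] tensor_real_scale_closed[OF x(1), of s]]
      by (intro rel1) simp_all
    then show "(r \<oplus>\<^bsub>class_ring\<^esub> s) \<odot>\<^bsub>tensor_real A\<^esub> X
        = r \<odot>\<^bsub>tensor_real A\<^esub> X \<oplus>\<^bsub>tensor_real A\<^esub> s \<odot>\<^bsub>tensor_real A\<^esub> X"
      using x by (simp add: sm add tensor_real_scale_closed)
  next
    fix r :: real and X Y assume "X \<in> carrier (tensor_real A)" "Y \<in> carrier (tensor_real A)"
    then obtain x y where x: "x \<in> carrier ?F" "X = ?q x" "y \<in> carrier ?F" "Y = ?q y"
      by (auto simp: carr)
    then have "x + y \<in> carrier ?F" using F.m_closed[of x y] by simp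
    then show "r \<odot>\<^bsub>tensor_real A\<^esub> (X \<oplus>\<^bsub>tensor_real A\<^esub> Y)
        = r \<odot>\<^bsub>tensor_real A\<^esub> X \<oplus>\<^bsub>tensor_real A\<^esub> r \<odot>\<^bsub>tensor_real A\<^esub> Y"
      using x by (simp add: sm add tensor_real_scale_closed tensor_real_scale_add)
  next
    fix r s :: real and X assume "X \<in> carrier (tensor_real A)"
    then obtain x where x: "x \<in> carrier ?F" "X = ?q x" by (auto simp: carr)
    have "tensor_real_scale (r * s) x = tensor_real_scale r (tensor_real_scale s x)"
      using x(1) by (induction rule: tensor_real_free_induct) (auto simp: tensor_real_scale_diff mult.assoc)
    then show "(r \<otimes>\<^bsub>class_ring\<^esub> s) \<odot>\<^bsub>tensor_real A\<^esub> X = r \<odot>\<^bsub>tensor_real A\<^esub> (s \<odot>\<^bsub>tensor_real A\<^esub> X)"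
      using x by (simp add: sm tensor_real_scale_closed)
  next
    fix X assume "X \<in> carrier (tensor_real A)"
    then obtain x where x: "x \<in> carrier ?F" "X = ?q x" by (auto simp: carr)
    have "tensor_real_scale 1 x = x"
      using x(1) by (induction rule: tensor_real_free_induct) (auto simp: tensor_real_scale_diff)
    then show "\<one>\<^bsub>class_ring\<^esub> \<odot>\<^bsub>tensor_real A\<^esub> X = X"
      using x by (simp add: sm)
  qed
qed


section \<open>Nearly linearly independent families\<close>

text \<open>
  A family indexed by \<open>J\<close> is linearly independent iff it is injective on \<open>J\<close> and the set of its
  members is linearly independent.
\<close>

definition nearly_linearly_independent ::
    "(real, 'c, 'm) module_scheme \<Rightarrow> 'i set \<Rightarrow> ('i \<Rightarrow> 'c) \<Rightarrow> bool" where
  "nearly_linearly_independent M I v \<longleftrightarrow>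
    (\<exists>J\<subseteq>I. inj_on v J \<and> \<not> module.lin_dep class_ring M (v ` J) \<and>
       (\<forall>i\<in>I. \<exists>j\<in>J. \<exists>\<epsilon>\<in>{1, -1}. v i = \<epsilon> \<odot>\<^bsub>M\<^esub> v j))"

definition nearly_independent_in ::
    "('a, 'm) monoid_scheme \<Rightarrow> 'i set \<Rightarrow> ('i \<Rightarrow> 'a) \<Rightarrow> bool" where
  "nearly_independent_in A I a \<longleftrightarrow>
    nearly_linearly_independent (tensor_real A) I (\<lambda>i. tensor_real_image A (a i))"


section \<open>Group presentations\<close>

text \<open>
  A word in \<open>S \<union> S\<^sup>-\<^sup>1\<close> is a list over \<open>S \<times> bool\<close>: \<open>(x, True)\<close> is the generator \<open>x\<close> and
  \<open>(x, False)\<close> its formal inverse.  A relation \<open>l = r\<close> is the pair \<open>(l, r)\<close>.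
\<close>

type_synonym 'g word = "('g \<times> bool) list"

inductive presented_eq :: "'g set \<Rightarrow> ('g word \<times> 'g word) set \<Rightarrow> 'g word \<Rightarrow> 'g word \<Rightarrow> bool"
  for S R where
  refl: "w \<in> lists (S \<times> UNIV) \<Longrightarrow> presented_eq S R w w"
| sym: "presented_eq S R u w \<Longrightarrow> presented_eq S R w u"
| trans: "presented_eq S R u v \<Longrightarrow> presented_eq S R v w \<Longrightarrow> presented_eq S R u w"
| cancel: "u \<in> lists (S \<times> UNIV) \<Longrightarrow> w \<in> lists (S \<times> UNIV) \<Longrightarrow> x \<in> S \<Longrightarrow>
    presented_eq S R (u @ [(x, b), (x, \<not> b)] @ w) (u @ w)"
| rel: "u \<in> lists (S \<times> UNIV) \<Longrightarrow> w \<in> lists (S \<times> UNIV) \<Longrightarrow>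
    l \<in> lists (S \<times> UNIV) \<Longrightarrow> r \<in> lists (S \<times> UNIV) \<Longrightarrow> (l, r) \<in> R \<Longrightarrow>
    presented_eq S R (u @ l @ w) (u @ r @ w)"

definition word_class :: "'g set \<Rightarrow> ('g word \<times> 'g word) set \<Rightarrow> 'g word \<Rightarrow> 'g word set" where
  "word_class S R w = {w'. presented_eq S R w w'}"

definition presented_group :: "'g set \<Rightarrow> ('g word \<times> 'g word) set \<Rightarrow> 'g word set monoid" where
  "presented_group S R =
    \<lparr>carrier = word_class S R ` lists (S \<times> UNIV),
     mult = (\<lambda>X Y. \<Union>x\<in>X. \<Union>y\<in>Y. word_class S R (x @ y)),
     one = word_class S R []\<rparr>"


lemma presented_eq_in_lists:
  "presented_eq S R u w \<Longrightarrow> u \<in> lists (S \<times> UNIV) \<and> w \<in> lists (S \<times> UNIV)"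
  by (induction rule: presented_eq.induct) (auto simp: in_lists_conv_set)

lemma presented_eq_append:
  assumes "presented_eq S R u w" "x \<in> lists (S \<times> UNIV)" "y \<in> lists (S \<times> UNIV)"
  shows "presented_eq S R (x @ u @ y) (x @ w @ y)"
  using assms
proof (induction rule: presented_eq.induct)
  case (cancel u w z b)
  then have "presented_eq S R ((x @ u) @ [(z, b), (z, \<not> b)] @ (w @ y)) ((x @ u) @ (w @ y))"
    by (intro presented_eq.cancel) auto
  then show ?case by simp
next
  case (rel u w l r)
  then have "presented_eq S R ((x @ u) @ l @ (w @ y)) ((x @ u) @ r @ (w @ y))"
    by (intro presented_eq.rel) auto
  then show ?case by simp
next
  case (refl w)
  then show ?case by (intro presented_eq.refl) auto
qed (blast intro: presented_eq.sym presented_eq.trans)+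

lemma word_class_eq_iff:
  assumes "u \<in> lists (S \<times> UNIV)"
  shows "word_class S R u = word_class S R w \<longleftrightarrow> presented_eq S R u w"
  using assms unfolding word_class_def
  by (blast intro: presented_eq.intros)

lemma word_class_mult:
  assumes "u \<in> lists (S \<times> UNIV)" "w \<in> lists (S \<times> UNIV)"
  shows "word_class S R u \<otimes>\<^bsub>presented_group S R\<^esub> word_class S R w = word_class S R (u @ w)"
proof -
  have eq: "word_class S R (x @ y) = word_class S R (u @ w)"
    if "presented_eq S R u x" "presented_eq S R w y" for x y
  proof -
    have xy: "x \<in> lists (S \<times> UNIV)" "y \<in> lists (S \<times> UNIV)"
      using that presented_eq_in_lists by blast+
    have "presented_eq S R ([] @ u @ w) ([] @ x @ w)" "presented_eq S R (x @ w @ []) (x @ y @ [])"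
      using that assms xy by (auto intro!: presented_eq_append simp del: append_Nil append_Nil2)
    then have "presented_eq S R (u @ w) (x @ y)"
      by (auto intro: presented_eq.trans)
    then show ?thesis
      using assms by (subst eq_commute, subst word_class_eq_iff) auto
  qed
  have "(\<Union>x\<in>word_class S R u. \<Union>y\<in>word_class S R w. word_class S R (x @ y))
      = (\<Union>x\<in>word_class S R u. \<Union>y\<in>word_class S R w. word_class S R (u @ w))"
    by (intro SUP_cong refl eq) (simp_all add: word_class_def)
  moreover have "u \<in> word_class S R u" "w \<in> word_class S R w"
    using assms by (auto simp: word_class_def intro: presented_eq.refl)
  ultimately show ?thesis
    by (auto simp: presented_group_def)
qed

lemma presented_eq_inverse:
  "u \<in> lists (S \<times> UNIV) \<Longrightarrow> presented_eq S R (rev (map (\<lambda>(x, b). (x, \<not> b)) u) @ u) []"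
proof (induction u)
  case Nil
  then show ?case by (simp add: presented_eq.refl)
next
  case (Cons a u)
  obtain x b where a: "a = (x, b)" by force
  let ?i = "rev (map (\<lambda>(x, b). (x, \<not> b)) u)"
  have "?i \<in> lists (S \<times> UNIV)" using Cons.prems by (auto simp: in_lists_conv_set)
  then have "presented_eq S R (?i @ [(x, \<not> b), (x, \<not> \<not> b)] @ u) (?i @ u)"
    using Cons.prems a by (intro presented_eq.cancel) auto
  then show ?case
    using Cons a by (auto intro: presented_eq.trans)
qed

lemma group_presented_group: "group (presented_group S R)"
proof (rule groupI)
  fix X assume "X \<in> carrier (presented_group S R)"
  then obtain u where u: "u \<in> lists (S \<times> UNIV)" "X = word_class S R u"
    by (auto simp: presented_group_def)
  let ?i = "rev (map (\<lambda>(x, b). (x, \<not> b)) u)"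
  have i: "?i \<in> lists (S \<times> UNIV)" using u by (auto simp: in_lists_conv_set)
  then have "word_class S R ?i \<otimes>\<^bsub>presented_group S R\<^esub> X = word_class S R []"
    using u word_class_eq_iff[of "?i @ u" S R "[]"] presented_eq_inverse[of u S R]
    by (simp add: word_class_mult)
  then show "\<exists>Y\<in>carrier (presented_group S R). Y \<otimes>\<^bsub>presented_group S R\<^esub> X = \<one>\<^bsub>presented_group S R\<^esub>"
    using i by (intro bexI[of _ "word_class S R ?i"]) (auto simp: presented_group_def)
next
  fix X assume "X \<in> carrier (presented_group S R)"
  then show "\<one>\<^bsub>presented_group S R\<^esub> \<otimes>\<^bsub>presented_group S R\<^esub> X = X"
    using word_class_mult[of "[]" S _ R] by (auto simp: presented_group_def)
next
  fix X Y assume "X \<in> carrier (presented_group S R)" "Y \<in> carrier (presented_group S R)"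
  then obtain u w where "u \<in> lists (S \<times> UNIV)" "X = word_class S R u"
      "w \<in> lists (S \<times> UNIV)" "Y = word_class S R w"
    by (auto simp: presented_group_def)
  then show "X \<otimes>\<^bsub>presented_group S R\<^esub> Y \<in> carrier (presented_group S R)"
    by (simp add: word_class_mult) (simp add: presented_group_def)
next
  fix X Y Z assume "X \<in> carrier (presented_group S R)" "Y \<in> carrier (presented_group S R)"
    "Z \<in> carrier (presented_group S R)"
  then obtain u w z where "u \<in> lists (S \<times> UNIV)" "X = word_class S R u"
      "w \<in> lists (S \<times> UNIV)" "Y = word_class S R w"
      "z \<in> lists (S \<times> UNIV)" "Z = word_class S R z"
    by (auto simp: presented_group_def)
  then show "X \<otimes>\<^bsub>presented_group S R\<^esub> Y \<otimes>\<^bsub>presented_group S R\<^esub> Z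
      = X \<otimes>\<^bsub>presented_group S R\<^esub> (Y \<otimes>\<^bsub>presented_group S R\<^esub> Z)"
    by (simp add: word_class_mult)
qed (auto simp: presented_group_def)


section \<open>Serre graphs\<close>

text \<open>
  A graph in the sense of Serre is a \<^locale>\<open>bidirected_digraph\<close>: \<open>tail\<close> is \<open>\<alpha>\<close>, \<open>head\<close> is
  \<open>\<omega>\<close>, \<open>arev\<close> is the inversion (which that locale extends by the identity outside the edge set).
  Every edge being accompanied by its inverse, connectedness is \<^const>\<open>strongly_connected\<close>,
  which includes non-emptiness.
\<close>

definition serre_orientation :: "('v, 'e) pre_digraph \<Rightarrow> ('e \<Rightarrow> 'e) \<Rightarrow> 'e set \<Rightarrow> bool" where
  "serre_orientation \<Gamma> arev P \<longleftrightarrow>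
    P \<subseteq> arcs \<Gamma> \<and> arcs \<Gamma> = P \<union> arev ` P \<and> P \<inter> arev ` P = {}"

text \<open>
  The digraph-theoretic \<open>cycle\<close> includes \<open>[e, arev e]\<close>; requiring the cycle to be reduced
  leaves exactly the circuits of a Serre graph.
\<close>

definition serre_circuit :: "('v, 'e) pre_digraph \<Rightarrow> ('e \<Rightarrow> 'e) \<Rightarrow> 'e list \<Rightarrow> bool" where
  "serre_circuit \<Gamma> arev p \<longleftrightarrow> pre_digraph.cycle \<Gamma> p \<and>
    (\<forall>i. Suc i < length p \<longrightarrow> p ! Suc i \<noteq> arev (p ! i))"

definition serre_tree :: "('e \<Rightarrow> 'e) \<Rightarrow> ('v, 'e) pre_digraph \<Rightarrow> bool" where
  "serre_tree arev T \<longleftrightarrow> bidirected_digraph T (perm_restrict arev (arcs T)) \<and>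
    strongly_connected T \<and> (\<nexists>p. serre_circuit T arev p)"

definition maximal_tree :: "('v, 'e) pre_digraph \<Rightarrow> ('e \<Rightarrow> 'e) \<Rightarrow> ('v, 'e) pre_digraph \<Rightarrow> bool" where
  "maximal_tree \<Gamma> arev T \<longleftrightarrow> pre_digraph.max_subgraph \<Gamma> (serre_tree arev) T"


section \<open>Graphs of groups\<close>

record ('v, 'e, 'a, 'b) graph_of_groups =
  gog_graph :: "('v, 'e) pre_digraph"
  gog_rev :: "'e \<Rightarrow> 'e"
  vgroup :: "'v \<Rightarrow> 'a monoid"
  egroup :: "'e \<Rightarrow> 'b monoid"
  emono :: "'e \<Rightarrow> 'b \<Rightarrow> 'a"  \<comment> \<open>\<open>emono e\<close> is \<open>\<alpha>\<^sub>e\<close>\<close>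

definition finite_graph_of_groups :: "('v, 'e, 'a, 'b) graph_of_groups \<Rightarrow> bool" where
  "finite_graph_of_groups \<G> \<longleftrightarrow>
    bidirected_digraph (gog_graph \<G>) (gog_rev \<G>) \<and>
    fin_digraph (gog_graph \<G>) \<and>
    strongly_connected (gog_graph \<G>) \<and>
    (\<forall>v\<in>verts (gog_graph \<G>). group (vgroup \<G> v)) \<and>
    (\<forall>e\<in>arcs (gog_graph \<G>).
       group (egroup \<G> e) \<and>
       egroup \<G> (gog_rev \<G> e) = egroup \<G> e \<and>
       emono \<G> e \<in> mon (egroup \<G> e) (vgroup \<G> (tail (gog_graph \<G>) e)))"

definition emono_omega :: "('v, 'e, 'a, 'b) graph_of_groups \<Rightarrow> 'e \<Rightarrow> 'b \<Rightarrow> 'a" where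
  "emono_omega \<G> e = emono \<G> (gog_rev \<G> e)"

definition restrict_gog ::
    "('v, 'e, 'a, 'b) graph_of_groups \<Rightarrow> ('v, 'e) pre_digraph \<Rightarrow> ('v, 'e, 'a, 'b) graph_of_groups" where
  "restrict_gog \<G> T = \<G>\<lparr>gog_graph := T, gog_rev := perm_restrict (gog_rev \<G>) (arcs T)\<rparr>"

lemma finite_graph_of_groups_restrict:
  assumes "finite_graph_of_groups \<G>" "maximal_tree (gog_graph \<G>) (gog_rev \<G>) T"
  shows "finite_graph_of_groups (restrict_gog \<G> T)"
proof -
  have T: "subgraph T (gog_graph \<G>)" "bidirected_digraph T (perm_restrict (gog_rev \<G>) (arcs T))"
      "strongly_connected T"
    using assms(2) by (auto simp: maximal_tree_def pre_digraph.max_subgraph_def serre_tree_def)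
  interpret G: fin_digraph "gog_graph \<G>" using assms(1) by (simp add: finite_graph_of_groups_def)
  have "fin_digraph T"
    using T(1) finite_subset[of "verts T"] finite_subset[of "arcs T"]
    by (auto simp: subgraph_def fin_digraph_def fin_digraph_axioms_def)
  then show ?thesis
    using assms(1) T
    by (auto simp: finite_graph_of_groups_def restrict_gog_def subgraph_def compatible_def perm_restrict_def)
qed

datatype ('v, 'e, 'a) gog_gen = Vert 'v 'a | Stable 'e

definition fund_gens ::
    "('v, 'e, 'a, 'b) graph_of_groups \<Rightarrow> 'e set \<Rightarrow> ('v, 'e, 'a) gog_gen set" where
  "fund_gens \<G> P =
    {Vert v g | v g. v \<in> verts (gog_graph \<G>) \<and> g \<in> carrier (vgroup \<G> v)} \<union> Stable ` P"

text \<open>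
  The relations of a vertex group are given by its multiplication table.
\<close>

definition fund_rels ::
    "('v, 'e, 'a, 'b) graph_of_groups \<Rightarrow> ('v, 'e) pre_digraph \<Rightarrow> 'e set \<Rightarrow>
     (('v, 'e, 'a) gog_gen word \<times> ('v, 'e, 'a) gog_gen word) set" where
  "fund_rels \<G> T P =
    {([(Vert v g, True), (Vert v h, True)], [(Vert v (g \<otimes>\<^bsub>vgroup \<G> v\<^esub> h), True)]) | v g h.
       v \<in> verts (gog_graph \<G>) \<and> g \<in> carrier (vgroup \<G> v) \<and> h \<in> carrier (vgroup \<G> v)} \<union>
    {([(Stable e, True), (Vert (head (gog_graph \<G>) e) (emono_omega \<G> e a), True), (Stable e, False)],
      [(Vert (tail (gog_graph \<G>) e) (emono \<G> e a), True)]) | e a.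
       e \<in> P \<and> a \<in> carrier (egroup \<G> e)} \<union>
    {([(Stable f, True)], []) | f. f \<in> arcs T \<inter> P}"

definition fund_group ::
    "('v, 'e, 'a, 'b) graph_of_groups \<Rightarrow> ('v, 'e) pre_digraph \<Rightarrow> 'e set \<Rightarrow>
     ('v, 'e, 'a) gog_gen word set monoid" where
  "fund_group \<G> T P = presented_group (fund_gens \<G> P) (fund_rels \<G> T P)"

definition fund_vert ::
    "('v, 'e, 'a, 'b) graph_of_groups \<Rightarrow> ('v, 'e) pre_digraph \<Rightarrow> 'e set \<Rightarrow>
     'v \<Rightarrow> 'a \<Rightarrow> ('v, 'e, 'a) gog_gen word set" where
  "fund_vert \<G> T P v g = word_class (fund_gens \<G> P) (fund_rels \<G> T P) [(Vert v g, True)]"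

definition tree_group ::
    "('v, 'e, 'a, 'b) graph_of_groups \<Rightarrow> ('v, 'e) pre_digraph \<Rightarrow> 'e set \<Rightarrow>
     ('v, 'e, 'a) gog_gen word set monoid" where
  "tree_group \<G> T P = fund_group (restrict_gog \<G> T) T (P \<inter> arcs T)"

definition tree_group_vert ::
    "('v, 'e, 'a, 'b) graph_of_groups \<Rightarrow> ('v, 'e) pre_digraph \<Rightarrow> 'e set \<Rightarrow>
     'v \<Rightarrow> 'a \<Rightarrow> ('v, 'e, 'a) gog_gen word set" where
  "tree_group_vert \<G> T P = fund_vert (restrict_gog \<G> T) T (P \<inter> arcs T)"

end

theory Submission
  imports Defs "HOL-Combinatorics.Permutations"
begin

text \<open>Near independence supplies rational functionals \<open>\<phi>\<^sub>j\<close> on \<open>A\<close> (\<open>j\<close> in the independent subset) whose value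
  at \<open>\<rho>(a\<^sub>e)\<close> is \<open>\<plusminus>1\<close> if \<open>\<rho>(a\<^sub>e) = \<plusminus>\<rho>(a\<^sub>j)\<close> in \<open>A \<otimes> \<real>\<close> and \<open>0\<close> otherwise. A cyclic subgroup
  \<open>\<langle>g\<rangle>\<close> is a virtual retract as soon as \<open>G\<close> acts on a finite set with integer weights in such a way
  that \<open>g\<close> fixes a point with nonzero weight, or as soon as some finite quotient is faithful on \<open>\<langle>g\<rangle>\<close>.

  If \<open>g\<close> is conjugate to an element \<open>y\<close> of infinite order of a vertex group, the weights are signed
  multiples of the \<open>\<phi>\<^sub>j\<close>, permuted by the stable letters, or, when all \<open>\<phi>\<^sub>j\<close> vanish at \<open>y\<close>, a functional that is
  nonzero at \<open>y\<close> and kills every \<open>a\<^sub>e\<close>. In the other two cases one maps the vertex groups to a finite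
  product of finite cyclic groups, including among the coordinates all \<open>\<phi>\<^sub>j/M\<close> modulo \<open>1\<close>; for suitable
  \<open>M\<close> all \<open>a\<^sub>e\<close> then have order exactly \<open>M\<close>, and the stable letters can act on copies of the regular
  representation. For \<open>y\<close> of finite order this separates \<open>\<langle>y\<rangle>\<close>. If \<open>g\<close> is hyperbolic, the coordinates also
  separate the finitely many backtracking points of a cyclically reduced closed path for \<open>g\<close>; this path is
  embedded in copies of the regular representation as a closed orbit, as in Marshall Hall's theorem, and its
  last edge receives weight \<open>1\<close>.\<close>

section \<open>Virtual retracts from weighted permutations\<close>

text \<open>The obstacle is that \<open>a_e\<close> and its partner at the other end of
  \<open>e\<close> become conjugate in G, so a functional on A extends to G only if it agrees on the
  two. A subgroup of finite index is less rigid: it is enough that the stable letters permute a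
  finite set of functionals compatibly. The coordinates \<plusminus>1 are what makes this possible.
  If the ends were c and its square, as in the Baumslag-Solitar group BS(1,2), weights would have to
  double along a finite orbit and therefore vanish, and the conclusion fails there.

  The same \<plusminus>1 governs the finite quotients: \<open>a_e\<close> and its partner must get
  equal orders, and a coordinate \<plusminus>1/M modulo 1 gives order M to both whatever the edge
  is.

  Permutations with integer weights form the wreath product of the integers with a symmetric group.
  Maps into it can be prescribed on vertex groups and stable letters; the subgroup of finite index
  and its map to the integers, which depend on the element g, then come from the stabiliser of a
  point.\<close>

definition perm_group :: "'x set \<Rightarrow> ('x \<Rightarrow> 'x) monoid" where
  "perm_group X = \<lparr>carrier = {f. f permutes X}, mult = (\<circ>), one = id\<rparr>"

text \<open>Permutations of \<open>X\<close> with integer weights, encoded as the permutations of \<open>X \<times> \<int>\<close> that commute with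
  the translations of \<open>\<int>\<close>.\<close>

definition shift_group :: "'x set \<Rightarrow> ('x \<times> int \<Rightarrow> 'x \<times> int) monoid" where
  "shift_group X =
    \<lparr>carrier = {f. f permutes X \<times> UNIV \<and>
       (\<forall>x\<in>X. \<forall>k j. f (x, k + j) = (fst (f (x, k)), snd (f (x, k)) + j))},
     mult = (\<circ>), one = id\<rparr>"

lemma group_perm_group: "group (perm_group X)"
proof (rule groupI)
  fix f assume "f \<in> carrier (perm_group X)"
  then have f: "f permutes X" by (simp add: perm_group_def)
  show "\<exists>g\<in>carrier (perm_group X). g \<otimes>\<^bsub>perm_group X\<^esub> f = \<one>\<^bsub>perm_group X\<^esub>"
    by (rule bexI[of _ "inv_into UNIV f"])
      (use f in \<open>auto simp: perm_group_def permutes_inv permutes_inv_o\<close>)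
qed (auto simp: perm_group_def permutes_id comp_assoc intro: permutes_compose)

lemma shift_groupD:
  assumes "f \<in> carrier (shift_group X)" "x \<in> X"
  shows "f (x, k + j) = (fst (f (x, k)), snd (f (x, k)) + j)" "fst (f (x, k)) \<in> X"
proof -
  have f: "f permutes X \<times> UNIV"
    and *: "\<forall>x\<in>X. \<forall>k j. f (x, k + j) = (fst (f (x, k)), snd (f (x, k)) + j)"
    using assms(1) by (simp_all add: shift_group_def)
  then show "f (x, k + j) = (fst (f (x, k)), snd (f (x, k)) + j)" using assms(2) by blast
  have "f (x, k) \<in> X \<times> UNIV" using permutes_in_image[OF f, of "(x, k)"] assms(2) by simp
  then show "fst (f (x, k)) \<in> X" by (auto simp: mem_Times_iff)
qed

lemma group_shift_group: "group (shift_group X)"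
proof (rule groupI)
  fix f assume f': "f \<in> carrier (shift_group X)"
  then have f: "f permutes X \<times> UNIV" by (simp add: shift_group_def)
  let ?g = "inv_into UNIV f"
  have g: "?g permutes X \<times> UNIV" using f by (rule permutes_inv)
  have "?g (x, k + j) = (fst (?g (x, k)), snd (?g (x, k)) + j)" if "x \<in> X" for x k j
  proof -
    obtain y l where y: "?g (x, k) = (y, l)" by force
    have "?g (x, k) \<in> X \<times> UNIV" using permutes_in_image[OF g, of "(x, k)"] that by simp
    then have yX: "y \<in> X" using y by simp
    have "f (y, l) = (x, k)" using y permutes_inverses(1)[OF f] by metis
    then have "f (y, l + j) = (x, k + j)" using shift_groupD(1)[OF f' yX, of l j] by simp
    then have "?g (x, k + j) = (y, l + j)" using permutes_inverses(2)[OF f] by metis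
    then show ?thesis by (simp add: y)
  qed
  then have "?g \<in> carrier (shift_group X)" using g by (simp add: shift_group_def)
  then show "\<exists>g\<in>carrier (shift_group X). g \<otimes>\<^bsub>shift_group X\<^esub> f = \<one>\<^bsub>shift_group X\<^esub>"
    by (rule bexI[rotated]) (use f in \<open>auto simp: shift_group_def permutes_inv_o\<close>)
next
  fix f g assume fg: "f \<in> carrier (shift_group X)" "g \<in> carrier (shift_group X)"
  then have "f \<circ> g permutes X \<times> UNIV" by (auto simp: shift_group_def intro: permutes_compose)
  moreover have "(f \<circ> g) (x, k + j) = (fst ((f \<circ> g) (x, k)), snd ((f \<circ> g) (x, k)) + j)"
    if "x \<in> X" for x k j
    using shift_groupD(1)[OF fg(2) that, of k j]
      shift_groupD(1)[OF fg(1) shift_groupD(2)[OF fg(2) that], of k "snd (g (x, k))" j] by simp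
  ultimately show "f \<otimes>\<^bsub>shift_group X\<^esub> g \<in> carrier (shift_group X)"
    by (simp add: shift_group_def)
qed (auto simp: shift_group_def permutes_id comp_assoc)

text \<open>One representative for each value of \<open>f\<close> meets every right coset, because
  equal values force equal cosets; \<open>f\<close> itself may be any map with finite image.\<close>

lemma (in group) finite_rcosetsI:
  assumes K: "subgroup K G" and fin: "finite (f ` carrier G)"
    and *: "\<And>a b. a \<in> carrier G \<Longrightarrow> b \<in> carrier G \<Longrightarrow> f a = f b \<Longrightarrow> a \<otimes> inv b \<in> K"
  shows "finite (rcosets K)"
proof -
  have eq: "K #> a = K #> b" if "a \<in> carrier G" "b \<in> carrier G" "f a = f b" for a b
  proof -
    have "a = (a \<otimes> inv b) \<otimes> b" using that by (simp add: m_assoc)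
    then have "a \<in> K #> b" using *[OF that] by (auto simp: r_coset_def)
    then show ?thesis using repr_independence[OF _ that(2) K] by simp
  qed
  let ?h = "\<lambda>y. K #> (SOME a. a \<in> carrier G \<and> f a = y)"
  have "rcosets K \<subseteq> ?h ` f ` carrier G"
  proof
    fix C assume "C \<in> rcosets K"
    then obtain a where a: "a \<in> carrier G" "C = K #> a" by (auto simp: RCOSETS_def)
    have "(SOME b. b \<in> carrier G \<and> f b = f a) \<in> carrier G \<and> f (SOME b. b \<in> carrier G \<and> f b = f a) = f a"
      by (rule someI[of _ a]) (use a in simp)
    then have "C = ?h (f a)" unfolding a(2) using eq a(1) by metis
    then show "C \<in> ?h ` f ` carrier G" using a(1) by blast
  qed
  then show ?thesis using fin finite_surj by blast
qed

text \<open>The elements that fix \<open>x\<close> with a weight \<open>j w\<close> form a subgroup of finite index, retracted by \<open>k \<mapsto> g\<^sup>j\<close>.\<close>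

lemma virtual_retract_of_weight:
  assumes G: "group G" and hom: "\<Phi> \<in> hom G (shift_group X)" and fin: "finite X"
    and g: "g \<in> carrier G" and x: "x \<in> X" and w: "w \<noteq> 0" "\<Phi> g (x, 0) = (x, w)"
  shows "virtual_retract (generate G {g}) G"
proof -
  interpret G: group G by fact
  interpret S: group "shift_group X" by (rule group_shift_group)
  interpret \<Phi>: group_hom G "shift_group X" \<Phi> by unfold_locales (rule hom)
  have mult: "\<Phi> (a \<otimes>\<^bsub>G\<^esub> b) p = \<Phi> a (\<Phi> b p)" if "a \<in> carrier G" "b \<in> carrier G" for a b p
    using \<Phi>.hom_mult[OF that] by (simp add: shift_group_def)
  have one: "\<Phi> \<one>\<^bsub>G\<^esub> p = p" for p using \<Phi>.hom_one by (simp add: shift_group_def)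
  have sh: "\<Phi> a (y, j) = (fst (\<Phi> a (y, 0)), snd (\<Phi> a (y, 0)) + j)"
    if "a \<in> carrier G" "y \<in> X" for a y j
    using shift_groupD(1)[OF \<Phi>.hom_closed[OF that(1)] that(2), of 0 j] by simp
  define K where "K = {k \<in> carrier G. \<exists>j. \<Phi> k (x, 0) = (x, j * w)}"
  \<comment> \<open>Weights are measured in units of \<open>w\<close>, so that \<open>g\<close> gets
    1 and the retraction can send \<open>k\<close> to the power of \<open>g\<close> with exponent
    \<open>wt k\<close>.\<close>
  define wt where "wt k = snd (\<Phi> k (x, 0)) div w" for k
  have Kmem: "\<Phi> k (x, l) = (x, wt k * w + l)" if "k \<in> K" for k l
    using that x w(1) sh[of k x l] by (auto simp: K_def wt_def)
  have K: "subgroup K G"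
  proof (rule G.subgroupI)
    show "K \<subseteq> carrier G" by (auto simp: K_def)
    have "\<Phi> \<one>\<^bsub>G\<^esub> (x, 0) = (x, 0 * w)" by (simp only: one mult_zero_left)
    then have "\<one>\<^bsub>G\<^esub> \<in> K" unfolding K_def by blast
    then show "K \<noteq> {}" by blast
  next
    fix a assume a: "a \<in> K"
    then obtain j where j: "a \<in> carrier G" "\<Phi> a (x, 0) = (x, j * w)" by (auto simp: K_def)
    have "\<Phi> a (x, (- j) * w) = (x, 0)" using sh[OF j(1) x, of "(- j) * w"] j by simp
    then have "\<Phi> (inv\<^bsub>G\<^esub> a) (x, 0) = \<Phi> (inv\<^bsub>G\<^esub> a \<otimes>\<^bsub>G\<^esub> a) (x, (- j) * w)"
      using mult[of "inv\<^bsub>G\<^esub> a" a "(x, (- j) * w)"] j(1) by simp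
    then have "\<Phi> (inv\<^bsub>G\<^esub> a) (x, 0) = (x, (- j) * w)" using j(1) one by simp
    then show "inv\<^bsub>G\<^esub> a \<in> K" using j(1) unfolding K_def by blast
  next
    fix a b assume ab: "a \<in> K" "b \<in> K"
    have c: "a \<in> carrier G" "b \<in> carrier G" using ab by (auto simp: K_def)
    have "\<Phi> (a \<otimes>\<^bsub>G\<^esub> b) (x, 0) =
      (x, (wt a + wt b) * w)"
      by (simp only: mult[OF c] Kmem[OF ab(2), of 0] Kmem[OF ab(1)] add_0_right distrib_right)
    then show "a \<otimes>\<^bsub>G\<^esub> b \<in> K" using c unfolding K_def by blast
  qed
  have gK: "g \<in> K" using g w by (auto simp: K_def intro: exI[of _ 1])
  then have HK: "generate G {g} \<subseteq> K" using G.generate_subgroup_incl[OF _ K] by simp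
  define \<rho> where "\<rho> k = g [^]\<^bsub>G\<^esub> wt k" for k
  have gen: "generate G {g} = range (\<lambda>k::int. g [^]\<^bsub>G\<^esub> k)"
    using G.generate_pow[OF g] by auto
  have mulK: "wt (a \<otimes>\<^bsub>G\<^esub> b) = wt a + wt b"
    if "a \<in> K" "b \<in> K" for a b
  proof -
    have c: "a \<in> carrier G" "b \<in> carrier G" using that by (auto simp: K_def)
    have "\<Phi> (a \<otimes>\<^bsub>G\<^esub> b) (x, 0) =
      (x, (wt a + wt b) * w)"
      by (simp only: mult[OF c] Kmem[OF that(2), of 0] Kmem[OF that(1)] add_0_right distrib_right)
    then show ?thesis using w(1) by (simp add: wt_def)
  qed
  have \<rho>: "\<rho> \<in> hom (G\<lparr>carrier := K\<rparr>) (G\<lparr>carrier := generate G {g}\<rparr>)"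
    by (rule homI) (auto simp: \<rho>_def gen mulK G.int_pow_mult g)
  have val: "wt (g [^]\<^bsub>G\<^esub> (j::int)) = j" for j
  proof -
    interpret Z: group integer_group by simp
    interpret KG: group "G\<lparr>carrier := K\<rparr>" using K G.subgroup_imp_group by blast
    have "wt \<in> hom (G\<lparr>carrier := K\<rparr>) integer_group"
      by (rule homI) (auto simp: mulK)
    then interpret f: group_hom "G\<lparr>carrier := K\<rparr>" integer_group wt by unfold_locales
    have "g [^]\<^bsub>G\<^esub> j = g [^]\<^bsub>G\<lparr>carrier := K\<rparr>\<^esub> j"
      by (rule G.int_pow_consistent[OF K gK])
    moreover have "wt (g [^]\<^bsub>G\<lparr>carrier := K\<rparr>\<^esub> j) = j * wt g"
      using f.hom_int_pow[of g j] gK by (simp add: mult.commute)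
    ultimately show ?thesis using w by (simp add: wt_def)
  qed
  have id: "\<forall>h\<in>generate G {g}. \<rho> h = h" by (auto simp: gen \<rho>_def val)
  have "finite (rcosets\<^bsub>G\<^esub> K)"
  proof (rule G.finite_rcosetsI[OF K])
    \<comment> \<open>The right coset of \<open>a\<close> is recognised by where the inverse of
      \<open>a\<close> sends \<open>x\<close>, with the weight reduced modulo \<open>w\<close>. The
      symmetric bounds below serve for either sign of \<open>w\<close>.\<close>
    let ?f = "\<lambda>a. (fst (\<Phi> (inv\<^bsub>G\<^esub> a) (x, 0)), snd (\<Phi> (inv\<^bsub>G\<^esub> a) (x, 0)) mod w)"
    have "?f ` carrier G \<subseteq> X \<times> {- \<bar>w\<bar>..\<bar>w\<bar>}"
    proof clarify
      fix a assume a: "a \<in> carrier G"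
      have "\<bar>k mod w\<bar> < \<bar>w\<bar>" for k :: int using w(1) by (rule abs_mod_less)
      then have "k mod w \<in> {- \<bar>w\<bar>..\<bar>w\<bar>}" for k :: int
        by (simp add: abs_le_iff less_imp_le minus_le_iff) (metis abs_le_iff less_imp_le minus_le_iff)
      then show "fst (\<Phi> (inv\<^bsub>G\<^esub> a) (x, 0)) \<in> X \<and>
          snd (\<Phi> (inv\<^bsub>G\<^esub> a) (x, 0)) mod w \<in> {- \<bar>w\<bar>..\<bar>w\<bar>}"
        using shift_groupD(2)[OF \<Phi>.hom_closed[OF G.inv_closed[OF a]] x] by blast
    qed
    then show "finite (?f ` carrier G)" by (rule finite_subset) (simp add: fin)
  next
    fix a b assume ab: "a \<in> carrier G" "b \<in> carrier G"
      and eq: "(fst (\<Phi> (inv\<^bsub>G\<^esub> a) (x, 0)), snd (\<Phi> (inv\<^bsub>G\<^esub> a) (x, 0)) mod w) =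
        (fst (\<Phi> (inv\<^bsub>G\<^esub> b) (x, 0)), snd (\<Phi> (inv\<^bsub>G\<^esub> b) (x, 0)) mod w)"
    obtain y s where y: "\<Phi> (inv\<^bsub>G\<^esub> a) (x, 0) = (y, s)" by force
    obtain t where t: "\<Phi> (inv\<^bsub>G\<^esub> b) (x, 0) = (y, t)" using eq y by (cases "\<Phi> (inv\<^bsub>G\<^esub> b) (x, 0)") auto
    have "s mod w = t mod w" using eq y t by simp
    then have "w dvd t - s" by (metis mod_eq_dvd_iff)
    then obtain j where j: "t = s + j * w" by (metis add_diff_cancel_left' diff_add_cancel dvd_def mult.commute add.commute)
    have yX: "y \<in> X" using shift_groupD(2)[OF \<Phi>.hom_closed x, of "inv\<^bsub>G\<^esub> a" 0] ab y by simp
    have "\<Phi> a (y, s) = (x, 0)"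
      using mult[of a "inv\<^bsub>G\<^esub> a" "(x, 0)"] ab y one by simp
    then have "\<Phi> a (y, t) = (x, j * w)"
      using shift_groupD(1)[OF \<Phi>.hom_closed yX, of a s "j * w"] ab j by simp
    then have "\<Phi> (a \<otimes>\<^bsub>G\<^esub> inv\<^bsub>G\<^esub> b) (x, 0) = (x, j * w)"
      using mult[of a "inv\<^bsub>G\<^esub> b" "(x, 0)"] ab t by simp
    then show "a \<otimes>\<^bsub>G\<^esub> inv\<^bsub>G\<^esub> b \<in> K" using ab by (auto simp: K_def)
  qed
  then show ?thesis
    unfolding virtual_retract_def using G.generate_is_subgroup[of "{g}"] g K HK \<rho> id by blast
qed

text \<open>\<open>K\<close> is the preimage of the image of the cyclic group. It contains the
  kernel of \<open>\<Phi>\<close>, hence has finite index, and as \<open>\<Phi>\<close> is injective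
  on the cyclic group, the retraction is \<open>\<Phi>\<close> followed by the inverse of that
  restriction.\<close>

lemma virtual_retract_of_faithful:
  assumes G: "group G" and H: "group H" and hom: "\<Phi> \<in> hom G H" and fin: "finite (carrier H)"
    and g: "g \<in> carrier G"
    and inj: "\<And>k::int. \<Phi> (g [^]\<^bsub>G\<^esub> k) = \<one>\<^bsub>H\<^esub> \<Longrightarrow> g [^]\<^bsub>G\<^esub> k = \<one>\<^bsub>G\<^esub>"
  shows "virtual_retract (generate G {g}) G"
proof -
  interpret G: group G by fact
  interpret H: group H by fact
  interpret \<Phi>: group_hom G H \<Phi> by unfold_locales (rule hom)
  let ?C = "generate G {g}"
  have C: "subgroup ?C G" using G.generate_is_subgroup[of "{g}"] g by simp
  have gen: "?C = range (\<lambda>k::int. g [^]\<^bsub>G\<^esub> k)" using G.generate_pow[OF g] by auto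
  have injC: "inj_on \<Phi> ?C"
  proof (rule inj_onI)
    fix a b assume ab: "a \<in> ?C" "b \<in> ?C" "\<Phi> a = \<Phi> b"
    have c: "a \<in> carrier G" "b \<in> carrier G" using ab subgroup.subset[OF C] by auto
    have "a \<otimes>\<^bsub>G\<^esub> inv\<^bsub>G\<^esub> b \<in> ?C" using ab C by (simp add: subgroup.m_closed subgroup.m_inv_closed)
    then obtain k :: int where k: "a \<otimes>\<^bsub>G\<^esub> inv\<^bsub>G\<^esub> b = g [^]\<^bsub>G\<^esub> k" unfolding gen by blast
    have "\<Phi> (a \<otimes>\<^bsub>G\<^esub> inv\<^bsub>G\<^esub> b) = \<one>\<^bsub>H\<^esub>" using ab(3) c by simp
    then have "a \<otimes>\<^bsub>G\<^esub> inv\<^bsub>G\<^esub> b = \<one>\<^bsub>G\<^esub>" using inj k by simp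
    then show "a = b" using c by (metis G.inv_closed G.inv_equality G.inv_inv)
  qed
  define K where "K = {k \<in> carrier G. \<Phi> k \<in> \<Phi> ` ?C}"
  have im: "subgroup (\<Phi> ` ?C) H" using \<Phi>.subgroup_img_is_subgroup[OF C] .
  have K: "subgroup K G"
  proof (rule G.subgroupI)
    show "K \<noteq> {}" using subgroup.one_closed[OF C] by (auto simp: K_def)
  qed (use im in \<open>auto simp: K_def subgroup.m_closed subgroup.m_inv_closed\<close>)
  have CK: "?C \<subseteq> K" using subgroup.subset[OF C] by (auto simp: K_def)
  define \<rho> where "\<rho> k = inv_into ?C \<Phi> (\<Phi> k)" for k
  have \<rho>C: "\<rho> k \<in> ?C" "\<Phi> (\<rho> k) = \<Phi> k" if "k \<in> K" for k
    using that by (auto simp: K_def \<rho>_def inv_into_into f_inv_into_f)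
  have id: "\<forall>h\<in>?C. \<rho> h = h" by (simp add: \<rho>_def injC)
  have "\<rho> \<in> hom (G\<lparr>carrier := K\<rparr>) (G\<lparr>carrier := ?C\<rparr>)"
  proof (rule homI)
    fix a b assume "a \<in> carrier (G\<lparr>carrier := K\<rparr>)" "b \<in> carrier (G\<lparr>carrier := K\<rparr>)"
    then have ab: "a \<in> K" "b \<in> K" by simp_all
    have c: "a \<in> carrier G" "b \<in> carrier G" "\<rho> a \<in> carrier G" "\<rho> b \<in> carrier G"
      using ab \<rho>C(1) subgroup.subset[OF C] by (auto simp: K_def)
    have abK: "a \<otimes>\<^bsub>G\<^esub> b \<in> K" using K ab by (simp add: subgroup.m_closed)
    have "\<Phi> (\<rho> (a \<otimes>\<^bsub>G\<^esub> b)) = \<Phi> (\<rho> a \<otimes>\<^bsub>G\<^esub> \<rho> b)" using \<rho>C(2) ab abK c by simp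
    then have "\<rho> (a \<otimes>\<^bsub>G\<^esub> b) = \<rho> a \<otimes>\<^bsub>G\<^esub> \<rho> b"
      by (rule inj_onD[OF injC]) (use ab abK \<rho>C(1) C in \<open>auto simp: subgroup.m_closed\<close>)
    then show "\<rho> (a \<otimes>\<^bsub>G\<lparr>carrier := K\<rparr>\<^esub> b) = \<rho> a \<otimes>\<^bsub>G\<lparr>carrier := ?C\<rparr>\<^esub> \<rho> b" by simp
  qed (use \<rho>C in simp)
  moreover have "finite (rcosets\<^bsub>G\<^esub> K)"
  proof (rule G.finite_rcosetsI[OF K, of \<Phi>])
    show "finite (\<Phi> ` carrier G)" using fin by (rule finite_subset[rotated]) auto
    fix a b assume "a \<in> carrier G" "b \<in> carrier G" "\<Phi> a = \<Phi> b"
    then show "a \<otimes>\<^bsub>G\<^esub> inv\<^bsub>G\<^esub> b \<in> K" using subgroup.one_closed[OF im] by (simp add: K_def)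
  qed
  ultimately show ?thesis unfolding virtual_retract_def using C K CK id by blast
qed

section \<open>Presented groups and extension of homomorphisms\<close>

fun word_eval :: "('h, 'm) monoid_scheme \<Rightarrow> ('g \<Rightarrow> 'h) \<Rightarrow> 'g word \<Rightarrow> 'h" where
  "word_eval H \<phi> [] = \<one>\<^bsub>H\<^esub>"
| "word_eval H \<phi> ((x, b) # w) = (if b then \<phi> x else inv\<^bsub>H\<^esub> \<phi> x) \<otimes>\<^bsub>H\<^esub> word_eval H \<phi> w"

lemma (in group) word_eval_closed:
  "w \<in> lists (S \<times> UNIV) \<Longrightarrow> \<phi> ` S \<subseteq> carrier G \<Longrightarrow> word_eval G \<phi> w \<in> carrier G"
  by (induction w) auto

lemma (in group) word_eval_append:
  "u \<in> lists (S \<times> UNIV) \<Longrightarrow> w \<in> lists (S \<times> UNIV) \<Longrightarrow> \<phi> ` S \<subseteq> carrier G \<Longrightarrow>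
    word_eval G \<phi> (u @ w) = word_eval G \<phi> u \<otimes> word_eval G \<phi> w"
proof (induction u)
  case Nil
  then show ?case by (simp add: word_eval_closed)
next
  case (Cons a u)
  then show ?case
    using word_eval_closed[of u S \<phi>] word_eval_closed[of w S \<phi>]
    by (cases a) (auto simp: m_assoc)
qed

lemma (in group) presented_eq_word_eval:
  assumes "presented_eq S R u w" and \<phi>: "\<phi> ` S \<subseteq> carrier G"
    and rel: "\<And>l r. (l, r) \<in> R \<Longrightarrow> l \<in> lists (S \<times> UNIV) \<Longrightarrow> r \<in> lists (S \<times> UNIV) \<Longrightarrow>
      word_eval G \<phi> l = word_eval G \<phi> r"
  shows "word_eval G \<phi> u = word_eval G \<phi> w"
  using assms(1)
proof (induction rule: presented_eq.induct)
  case (cancel u w x b)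
  have x: "\<phi> x \<in> carrier G" using cancel \<phi> by auto
  have l: "[(x, b), (x, \<not> b)] \<in> lists (S \<times> UNIV)" using cancel by simp
  have "word_eval G \<phi> ([(x, b), (x, \<not> b)] @ w) = word_eval G \<phi> w"
    using x word_eval_closed[OF cancel(2) \<phi>] by (auto simp: m_assoc[symmetric])
  then show ?case
    using cancel l by (simp add: word_eval_append[OF _ _ \<phi>] del: append.simps)
next
  case (rel u w l r)
  then have "word_eval G \<phi> l = word_eval G \<phi> r" using assms(3) by blast
  then show ?case using rel by (simp add: word_eval_append[OF _ _ \<phi>])
qed auto

text \<open>Von Dyck's theorem. Words in one class have the same value, so evaluating the
  representative picked by \<open>SOME\<close> is harmless.\<close>

lemma presented_group_universal:
  assumes H: "group H" and \<phi>: "\<phi> ` S \<subseteq> carrier H"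
    and rel: "\<And>l r. (l, r) \<in> R \<Longrightarrow> l \<in> lists (S \<times> UNIV) \<Longrightarrow> r \<in> lists (S \<times> UNIV) \<Longrightarrow>
      word_eval H \<phi> l = word_eval H \<phi> r"
  shows "\<exists>\<Phi>\<in>hom (presented_group S R) H.
    \<forall>w\<in>lists (S \<times> UNIV). \<Phi> (word_class S R w) = word_eval H \<phi> w"
proof -
  interpret H: group H by fact
  define \<Phi> where "\<Phi> X = word_eval H \<phi> (SOME w. w \<in> X)" for X
  have \<Phi>: "\<Phi> (word_class S R w) = word_eval H \<phi> w" if "w \<in> lists (S \<times> UNIV)" for w
  proof -
    have "w \<in> word_class S R w" using that by (simp add: word_class_def presented_eq.refl)
    then have "(SOME u. u \<in> word_class S R w) \<in> word_class S R w" by (rule someI)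
    then have "presented_eq S R w (SOME u. u \<in> word_class S R w)" by (simp add: word_class_def)
    from H.presented_eq_word_eval[OF this \<phi> rel] show ?thesis by (simp add: \<Phi>_def)
  qed
  have "\<Phi> \<in> hom (presented_group S R) H"
  proof (rule homI)
    fix X assume "X \<in> carrier (presented_group S R)"
    then obtain w where w: "w \<in> lists (S \<times> UNIV)" "X = word_class S R w"
      by (auto simp: presented_group_def)
    show "\<Phi> X \<in> carrier H" unfolding w(2) \<Phi>[OF w(1)] by (rule H.word_eval_closed[OF w(1) \<phi>])
  next
    fix X Y assume "X \<in> carrier (presented_group S R)" "Y \<in> carrier (presented_group S R)"
    then obtain u w where uw: "u \<in> lists (S \<times> UNIV)" "X = word_class S R u"
      "w \<in> lists (S \<times> UNIV)" "Y = word_class S R w" by (auto simp: presented_group_def)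
    then have "u @ w \<in> lists (S \<times> UNIV)" by simp
    note \<Phi>[OF this] \<Phi>[OF uw(1)] \<Phi>[OF uw(3)]
    then show "\<Phi> (X \<otimes>\<^bsub>presented_group S R\<^esub> Y) = \<Phi> X \<otimes>\<^bsub>H\<^esub> \<Phi> Y"
      unfolding uw(2,4) word_class_mult[OF uw(1,3)] by (simp add: H.word_eval_append[OF uw(1,3) \<phi>])
  qed
  then show ?thesis using \<Phi> by blast
qed

definition divisible_group :: "('d, 'm) monoid_scheme \<Rightarrow> bool" where
  "divisible_group D \<longleftrightarrow>
    (\<forall>d\<in>carrier D. \<forall>n>0. \<exists>d'\<in>carrier D. d' [^]\<^bsub>D\<^esub> (n::nat) = d)"

text \<open>A homomorphism from a subgroup of \<open>A\<close> to \<open>D\<close>, encoded as its graph.\<close>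

definition partial_hom :: "('a, 'm) monoid_scheme \<Rightarrow> ('d, 'n) monoid_scheme \<Rightarrow> ('a \<times> 'd) set \<Rightarrow> bool" where
  "partial_hom A D R \<longleftrightarrow> subgroup R (A \<times>\<times> D) \<and> (\<forall>d. (\<one>\<^bsub>A\<^esub>, d) \<in> R \<longrightarrow> d = \<one>\<^bsub>D\<^esub>)"

text \<open>On the subgroup generated by the domain of \<open>R\<close> and \<open>x\<close>, the
  rule sending \<open>y x^k\<close> to \<open>e d^k\<close> is well defined exactly because
  \<open>d\<close> respects the values already fixed at powers of \<open>x\<close>.\<close>

lemma partial_hom_adjoin:
  assumes A: "comm_group A" and D: "comm_group D" and R: "partial_hom A D R"
    and x: "x \<in> carrier A"
    and d: "d \<in> carrier D" "\<And>k::int. \<And>e. (x [^]\<^bsub>A\<^esub> k, e) \<in> R \<Longrightarrow> e = d [^]\<^bsub>D\<^esub> k"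
  shows "\<exists>R'. partial_hom A D R' \<and> R \<subseteq> R' \<and> (x, d) \<in> R'"
proof -
  interpret A: comm_group A by fact
  interpret D: comm_group D by fact
  interpret P: group "A \<times>\<times> D" by (intro DirProd_group A.is_group D.is_group)
  have sub: "subgroup R (A \<times>\<times> D)" and fn: "\<And>d. (\<one>\<^bsub>A\<^esub>, d) \<in> R \<Longrightarrow> d = \<one>\<^bsub>D\<^esub>"
    using R by (auto simp: partial_hom_def)
  have Rc: "y \<in> carrier A" "e \<in> carrier D" if "(y, e) \<in> R" for y e
    using subgroup.subset[OF sub] that by auto
  have Rm: "(y \<otimes>\<^bsub>A\<^esub> z, e \<otimes>\<^bsub>D\<^esub> f) \<in> R" if "(y, e) \<in> R" "(z, f) \<in> R" for y z e f
    using subgroup.m_closed[OF sub that] by simp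
  have Ri: "(inv\<^bsub>A\<^esub> y, inv\<^bsub>D\<^esub> e) \<in> R" if "(y, e) \<in> R" for y e
    using subgroup.m_inv_closed[OF sub that] Rc[OF that] by simp
  have R1: "(\<one>\<^bsub>A\<^esub>, \<one>\<^bsub>D\<^esub>) \<in> R" using subgroup.one_closed[OF sub] by simp
  define R' where "R' = {(y \<otimes>\<^bsub>A\<^esub> x [^]\<^bsub>A\<^esub> k, e \<otimes>\<^bsub>D\<^esub> d [^]\<^bsub>D\<^esub> k) | y e (k::int). (y, e) \<in> R}"
  have RR': "R \<subseteq> R'"
  proof clarify
    fix y e assume "(y, e) \<in> R"
    then have "(y, e) \<in> R" "(y, e) = (y \<otimes>\<^bsub>A\<^esub> x [^]\<^bsub>A\<^esub> (0::int), e \<otimes>\<^bsub>D\<^esub> d [^]\<^bsub>D\<^esub> (0::int))"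
      using Rc by auto
    then show "(y, e) \<in> R'" unfolding R'_def by blast
  qed
  have "subgroup R' (A \<times>\<times> D)"
  proof (rule P.subgroupI)
    show "R' \<subseteq> carrier (A \<times>\<times> D)" using Rc x d by (auto simp: R'_def)
    show "R' \<noteq> {}" using R1 RR' by blast
  next
    fix p assume "p \<in> R'"
    then obtain y e k where p: "p = (y \<otimes>\<^bsub>A\<^esub> x [^]\<^bsub>A\<^esub> k, e \<otimes>\<^bsub>D\<^esub> d [^]\<^bsub>D\<^esub> (k::int))" "(y, e) \<in> R"
      by (auto simp: R'_def)
    have "inv\<^bsub>A \<times>\<times> D\<^esub> p =
      (inv\<^bsub>A\<^esub> y \<otimes>\<^bsub>A\<^esub> x [^]\<^bsub>A\<^esub> (- k), inv\<^bsub>D\<^esub> e \<otimes>\<^bsub>D\<^esub> d [^]\<^bsub>D\<^esub> (- k))"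
      using p Rc[OF p(2)] x d(1)
      by (simp add: A.inv_mult D.inv_mult A.int_pow_neg D.int_pow_neg)
    then show "inv\<^bsub>A \<times>\<times> D\<^esub> p \<in> R'" using Ri[OF p(2)] unfolding R'_def by blast
  next
    fix p q assume "p \<in> R'" "q \<in> R'"
    then obtain y e k z f l where p: "p = (y \<otimes>\<^bsub>A\<^esub> x [^]\<^bsub>A\<^esub> k, e \<otimes>\<^bsub>D\<^esub> d [^]\<^bsub>D\<^esub> (k::int))" "(y, e) \<in> R"
      and q: "q = (z \<otimes>\<^bsub>A\<^esub> x [^]\<^bsub>A\<^esub> l, f \<otimes>\<^bsub>D\<^esub> d [^]\<^bsub>D\<^esub> (l::int))" "(z, f) \<in> R"
      by (auto simp: R'_def)
    have "p \<otimes>\<^bsub>A \<times>\<times> D\<^esub> q =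
      ((y \<otimes>\<^bsub>A\<^esub> z) \<otimes>\<^bsub>A\<^esub> x [^]\<^bsub>A\<^esub> (k + l), (e \<otimes>\<^bsub>D\<^esub> f) \<otimes>\<^bsub>D\<^esub> d [^]\<^bsub>D\<^esub> (k + l))"
      using p q Rc[OF p(2)] Rc[OF q(2)] x d(1)
      by (simp add: A.int_pow_mult D.int_pow_mult A.m_ac D.m_ac)
    then show "p \<otimes>\<^bsub>A \<times>\<times> D\<^esub> q \<in> R'" using Rm[OF p(2) q(2)] unfolding R'_def by blast
  qed
  moreover have "f = \<one>\<^bsub>D\<^esub>" if "(\<one>\<^bsub>A\<^esub>, f) \<in> R'" for f
  proof -
    from that obtain y e k where "(\<one>\<^bsub>A\<^esub>, f) = (y \<otimes>\<^bsub>A\<^esub> x [^]\<^bsub>A\<^esub> k, e \<otimes>\<^bsub>D\<^esub> d [^]\<^bsub>D\<^esub> (k::int))"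
      and p3: "(y, e) \<in> R" unfolding R'_def by blast
    then have p: "\<one>\<^bsub>A\<^esub> = y \<otimes>\<^bsub>A\<^esub> x [^]\<^bsub>A\<^esub> k" "f = e \<otimes>\<^bsub>D\<^esub> d [^]\<^bsub>D\<^esub> (k::int)" "(y, e) \<in> R"
      by auto
    have "y = x [^]\<^bsub>A\<^esub> (- k)"
      using p(1) Rc[OF p(3)] x A.inv_equality[of y "x [^]\<^bsub>A\<^esub> k"] by (simp add: A.int_pow_neg)
    then have "e = d [^]\<^bsub>D\<^esub> (- k)" using d(2) p(3) by blast
    then show ?thesis using p(2) d(1) by (simp add: D.int_pow_neg)
  qed
  moreover have "(x, d) = (\<one>\<^bsub>A\<^esub> \<otimes>\<^bsub>A\<^esub> x [^]\<^bsub>A\<^esub> (1::int), \<one>\<^bsub>D\<^esub> \<otimes>\<^bsub>D\<^esub> d [^]\<^bsub>D\<^esub> (1::int))"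
    using x d(1) by simp
  then have "(x, d) \<in> R'" using R1 unfolding R'_def by blast
  ultimately show ?thesis using RR' unfolding partial_hom_def by blast
qed

text \<open>If no positive power of \<open>x\<close> lies in the domain, the value at
  \<open>x\<close> is free and taken to be 1. Otherwise, with \<open>n\<close> the least such
  exponent, it must be an \<open>n\<close>-th root of the value at the \<open>n\<close>-th power,
  and divisibility supplies one.\<close>

lemma partial_hom_step:
  assumes A: "comm_group A" and D: "comm_group D" and div: "divisible_group D"
    and R: "partial_hom A D R" and x: "x \<in> carrier A"
  shows "\<exists>R' d. partial_hom A D R' \<and> R \<subseteq> R' \<and> (x, d) \<in> R'"
proof -
  interpret A: comm_group A by fact
  interpret D: comm_group D by fact
  interpret P: group "A \<times>\<times> D" by (intro DirProd_group A.is_group D.is_group)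
  have sub: "subgroup R (A \<times>\<times> D)" and fn: "\<And>d. (\<one>\<^bsub>A\<^esub>, d) \<in> R \<Longrightarrow> d = \<one>\<^bsub>D\<^esub>"
    using R by (auto simp: partial_hom_def)
  have Rc: "y \<in> carrier A" "e \<in> carrier D" if "(y, e) \<in> R" for y e
    using subgroup.subset[OF sub] that by auto
  have Rm: "(y \<otimes>\<^bsub>A\<^esub> z, e \<otimes>\<^bsub>D\<^esub> f) \<in> R" if "(y, e) \<in> R" "(z, f) \<in> R" for y z e f
    using subgroup.m_closed[OF sub that] by simp
  have Ri: "(inv\<^bsub>A\<^esub> y, inv\<^bsub>D\<^esub> e) \<in> R" if "(y, e) \<in> R" for y e
    using subgroup.m_inv_closed[OF sub that] Rc[OF that] by simp
  have R1: "(\<one>\<^bsub>A\<^esub>, \<one>\<^bsub>D\<^esub>) \<in> R" using subgroup.one_closed[OF sub] by simp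
  have Rp: "(y [^]\<^bsub>A\<^esub> k, e [^]\<^bsub>D\<^esub> k) \<in> R" if "(y, e) \<in> R" for y e and k :: int
  proof -
    have nat: "(y [^]\<^bsub>A\<^esub> n, e [^]\<^bsub>D\<^esub> n) \<in> R" for n :: nat
      by (induction n) (auto simp: R1 that Rm)
    show ?thesis
    proof (cases "k \<ge> 0")
      case True
      then show ?thesis using nat[of "nat k"] int_pow_int[of A y "nat k"] int_pow_int[of D e "nat k"] by simp
    next
      case False
      then show ?thesis
        using Ri[OF nat[of "nat (- k)"]] A.int_pow_neg_int[of y "nat (- k)"] D.int_pow_neg_int[of e "nat (- k)"]
          Rc[OF that] by simp
    qed
  qed
  have "\<exists>d\<in>carrier D. \<forall>k::int. \<forall>e. (x [^]\<^bsub>A\<^esub> k, e) \<in> R \<longrightarrow> e = d [^]\<^bsub>D\<^esub> k"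
  proof (cases "\<exists>n::nat. n > 0 \<and> (\<exists>e. (x [^]\<^bsub>A\<^esub> n, e) \<in> R)")
    case False
    have "k = 0" if "(x [^]\<^bsub>A\<^esub> k, e) \<in> R" for k :: int and e
    proof (rule ccontr)
      assume k: "k \<noteq> 0"
      have "\<exists>e. (x [^]\<^bsub>A\<^esub> (nat \<bar>k\<bar>), e) \<in> R"
      proof (cases "k > 0")
        case True
        then have "x [^]\<^bsub>A\<^esub> k = x [^]\<^bsub>A\<^esub> (nat \<bar>k\<bar>)" using int_pow_int[of A x "nat \<bar>k\<bar>"] by simp
        then show ?thesis using that by metis
      next
        case False
        then have "x [^]\<^bsub>A\<^esub> k = inv\<^bsub>A\<^esub> (x [^]\<^bsub>A\<^esub> (nat \<bar>k\<bar>))"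
          using A.int_pow_neg_int[OF x, of "nat \<bar>k\<bar>"] by simp
        then have "(x [^]\<^bsub>A\<^esub> (nat \<bar>k\<bar>), inv\<^bsub>D\<^esub> e) \<in> R"
          using Ri[OF that] x by simp
        then show ?thesis by blast
      qed
      moreover have "nat \<bar>k\<bar> > 0" using k by simp
      ultimately show False using False by blast
    qed
    then have "e = \<one>\<^bsub>D\<^esub> [^]\<^bsub>D\<^esub> k" if "(x [^]\<^bsub>A\<^esub> k, e) \<in> R" for k :: int and e
      using fn[of e] that by (metis D.int_pow_one int_pow_0)
    then show ?thesis using D.one_closed by blast
  next
    case True
    define dm where "dm n \<longleftrightarrow> n > 0 \<and> (\<exists>e. (x [^]\<^bsub>A\<^esub> n, e) \<in> R)" for n :: nat
    have "\<exists>n. dm n" using True by (simp add: dm_def)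
    then obtain n where "dm n" and min: "\<forall>m<n. \<not> dm m" using exists_least_iff[of dm] by blast
    then have n: "n > 0" "\<exists>e. (x [^]\<^bsub>A\<^esub> n, e) \<in> R" by (simp_all add: dm_def)
    have least: "m = 0" if "m < n" "(x [^]\<^bsub>A\<^esub> m, e) \<in> R" for m e
    proof (rule ccontr)
      assume "m \<noteq> 0"
      then have "dm m" unfolding dm_def using that(2) by (intro conjI exI) simp_all
      then show False using min that(1) by simp
    qed
    obtain e where e: "(x [^]\<^bsub>A\<^esub> n, e) \<in> R" using n(2) by (rule exE)
    obtain d where d: "d \<in> carrier D" "d [^]\<^bsub>D\<^esub> n = e"
      using div n(1) Rc(2)[OF e] by (auto simp: divisible_group_def)
    have "f = d [^]\<^bsub>D\<^esub> k" if f: "(x [^]\<^bsub>A\<^esub> k, f) \<in> R" for k :: int and f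
    proof -
      \<comment> \<open>By minimality of \<open>n\<close> the remainder vanishes, so every exponent
        occurring in the domain is a multiple of \<open>n\<close> and one root settles all of
        them.\<close>
      define q where "q = k div int n"
      define r where "r = nat (k mod int n)"
      have kr: "k = int n * q + int r" and rn: "r < n" using n(1) by (auto simp: q_def r_def nat_less_iff)
      have "((x [^]\<^bsub>A\<^esub> n) [^]\<^bsub>A\<^esub> (- q), e [^]\<^bsub>D\<^esub> (- q)) \<in> R" by (rule Rp[OF e])
      then have "(x [^]\<^bsub>A\<^esub> (- (int n * q)), e [^]\<^bsub>D\<^esub> (- q)) \<in> R"
        using A.int_pow_pow[OF x, of "int n" "- q"] x by (simp add: int_pow_int)
      from Rm[OF f this] have *: "(x [^]\<^bsub>A\<^esub> (int r), f \<otimes>\<^bsub>D\<^esub> e [^]\<^bsub>D\<^esub> (- q)) \<in> R"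
        using A.int_pow_mult[OF x, of k "- (int n * q)"] kr by simp
      then have "r = 0" using least[OF rn] by (simp add: int_pow_int)
      then have "f \<otimes>\<^bsub>D\<^esub> e [^]\<^bsub>D\<^esub> (- q) = \<one>\<^bsub>D\<^esub>" using fn * by simp
      then have "f \<otimes>\<^bsub>D\<^esub> inv\<^bsub>D\<^esub> (e [^]\<^bsub>D\<^esub> q) = \<one>\<^bsub>D\<^esub>"
        using D.int_pow_neg[OF Rc(2)[OF e], of q] by simp
      then have "f = e [^]\<^bsub>D\<^esub> q"
        using Rc(2)[OF f] D.int_pow_closed[OF Rc(2)[OF e], of q] D.inv_equality[of f "inv\<^bsub>D\<^esub> (e [^]\<^bsub>D\<^esub> q)"]
        by simp
      also have "\<dots> = d [^]\<^bsub>D\<^esub> (int n * q)"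
        using D.int_pow_pow[OF d(1), of "int n" q] d by (simp add: int_pow_int)
      finally show ?thesis using kr \<open>r = 0\<close> by simp
    qed
    then show ?thesis using d(1) by blast
  qed
  then obtain d where d: "d \<in> carrier D" "\<And>k::int. \<And>e. (x [^]\<^bsub>A\<^esub> k, e) \<in> R \<Longrightarrow> e = d [^]\<^bsub>D\<^esub> k"
    by blast
  show ?thesis using partial_hom_adjoin[OF A D R x d] by blast
qed

text \<open>Divisible groups are injective. Finite generation replaces Zorn's lemma: adjoining the
  generators one by one gives a partial homomorphism whose domain, a subgroup, is
  everything.\<close>

lemma partial_hom_extend:
  assumes A: "comm_group A" "finitely_generated_group A"
    and D: "comm_group D" "divisible_group D" and R: "partial_hom A D R"
  shows "\<exists>f\<in>hom A D. \<forall>(x, d)\<in>R. f x = d"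
proof -
  interpret A: comm_group A by fact
  interpret D: comm_group D by fact
  interpret P: group "A \<times>\<times> D" by (intro DirProd_group A.is_group D.is_group)
  obtain S where S: "finite S" "S \<subseteq> carrier A" "carrier A = generate A S"
    using A(2) by (auto simp: finitely_generated_group_def)
  have "\<exists>R'. partial_hom A D R' \<and> R \<subseteq> R' \<and> S \<subseteq> Domain R'"
    using S(1,2)
  proof (induction S)
    case (insert x S)
    then obtain R1 where R1: "partial_hom A D R1" "R \<subseteq> R1" "S \<subseteq> Domain R1" by auto
    obtain R2 d where "partial_hom A D R2" "R1 \<subseteq> R2" "(x, d) \<in> R2"
      using partial_hom_step[OF A(1) D R1(1)] insert by blast
    then show ?case using R1 by (intro exI[of _ R2]) blast
  qed (use R in blast)
  then obtain Q where Q: "partial_hom A D Q" "R \<subseteq> Q" "S \<subseteq> Domain Q" by blast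
  have sub: "subgroup Q (A \<times>\<times> D)" and fn: "\<And>d. (\<one>\<^bsub>A\<^esub>, d) \<in> Q \<Longrightarrow> d = \<one>\<^bsub>D\<^esub>"
    using Q by (auto simp: partial_hom_def)
  have Qc: "y \<in> carrier A" "e \<in> carrier D" if "(y, e) \<in> Q" for y e
    using subgroup.subset[OF sub] that by auto
  have Qm: "(y \<otimes>\<^bsub>A\<^esub> z, e \<otimes>\<^bsub>D\<^esub> f) \<in> Q" if "(y, e) \<in> Q" "(z, f) \<in> Q" for y z e f
    using subgroup.m_closed[OF sub that] by simp
  have Qi: "(inv\<^bsub>A\<^esub> y, inv\<^bsub>D\<^esub> e) \<in> Q" if "(y, e) \<in> Q" for y e
    using subgroup.m_inv_closed[OF sub that] Qc[OF that] by simp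
  have Q1: "(\<one>\<^bsub>A\<^esub>, \<one>\<^bsub>D\<^esub>) \<in> Q" using subgroup.one_closed[OF sub] by simp
  have uniq: "d = d'" if "(x, d) \<in> Q" "(x, d') \<in> Q" for x d d'
  proof -
    have "d \<otimes>\<^bsub>D\<^esub> inv\<^bsub>D\<^esub> d' = \<one>\<^bsub>D\<^esub>" using Qm[OF that(1) Qi[OF that(2)]] Qc[OF that(1)] fn by simp
    then show ?thesis using Qc[OF that(1)] Qc[OF that(2)] D.inv_equality[of d "inv\<^bsub>D\<^esub> d'"] by simp
  qed
  have dom: "x \<in> Domain Q" if "x \<in> generate A S" for x
    using that
  proof (induction rule: generate.induct)
    case (eng a b) then show ?case using Qm by blast
  qed (use Q1 Q(3) Qi in blast)+
  define f where "f x = (THE d. (x, d) \<in> Q)" for x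
  have fval: "f x = d" if "(x, d) \<in> Q" for x d
    unfolding f_def using that uniq by blast
  have fQ: "(x, f x) \<in> Q" if "x \<in> carrier A" for x
    using dom fval that S(3) by blast
  have "f \<in> hom A D"
    by (rule homI) (use fQ Qc in blast, use Qm fQ fval in blast)
  then show ?thesis using fval Q(2) by blast
qed

section \<open>Serre trees\<close>

text \<open>The two vertices are entries \<open>j + 2\<close> and \<open>j\<close> of the list of
  vertices of the walk, which is distinct. A simple path therefore never traverses an edge and then
  its inverse.\<close>

lemma (in wf_digraph) apath_reduced:
  assumes "apath u p v" "Suc j < length p" "p ! Suc j \<in> arcs G"
  shows "head G (p ! Suc j) \<noteq> tail G (p ! j)"
proof -
  have aw: "awalk u p v" and d: "distinct (awalk_verts u p)" using assms(1) by (auto simp: apath_def)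
  have ne: "p \<noteq> []" using assms(2) by auto
  have "cas u p v" using aw by (auto simp: awalk_def)
  then have 1: "awalk_verts u p = tail G (hd p) # map (head G) p" using ne by (simp add: awalk_verts_conv')
  have 2: "awalk_verts u p = map (tail G) p @ [head G (last p)]" using ne by (simp add: awalk_verts_conv)
  have len: "length (awalk_verts u p) = Suc (length p)" by (rule length_awalk_verts)
  have "awalk_verts u p ! Suc (Suc j) = head G (p ! Suc j)" using 1 assms(2) by simp
  moreover have "awalk_verts u p ! j = tail G (p ! j)" using 2 assms(2) by (simp add: nth_append)
  moreover have "awalk_verts u p ! Suc (Suc j) \<noteq> awalk_verts u p ! j"
    using d len assms(2) by (simp add: nth_eq_iff_index_eq)
  ultimately show ?thesis by simp
qed

lemma (in wf_digraph) exists_exit_arc: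
  assumes "u \<rightarrow>\<^sup>* v" "u \<in> W" "v \<notin> W"
  shows "\<exists>e\<in>arcs G. tail G e \<in> W \<and> head G e \<notin> W"
proof -
  obtain p where "awalk u p v" using assms(1) by (auto simp: reachable_awalk)
  then show ?thesis
    using assms(2,3)
  proof (induction p arbitrary: u)
    case Nil
    then show ?case by (simp add: awalk_Nil_iff)
  next
    case (Cons e p)
    then have e: "e \<in> arcs G" "tail G e = u" "awalk (head G e) p v" by (auto simp: awalk_Cons_iff)
    then show ?case using Cons by (cases "head G e \<in> W") blast+
  qed
qed

text \<open>Vertices are added one at a time; the absence of circuits makes the arc along which a new
  vertex is attached unique, so that no second condition has to be met.\<close>

lemma serre_tree_labelling:
  assumes T: "serre_tree arev T" and fin: "finite (verts T)" and v0: "v0 \<in> verts T"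
    and sym: "\<And>e y z. e \<in> arcs T \<Longrightarrow> Rel e y z \<Longrightarrow> Rel (arev e) z y"
    and ext: "\<And>e y. e \<in> arcs T \<Longrightarrow> S (tail T e) y \<Longrightarrow> \<exists>z. S (head T e) z \<and> Rel e y z"
    and y0: "S v0 y0"
  shows "\<exists>s. s v0 = y0 \<and> (\<forall>v\<in>verts T. S v (s v)) \<and> (\<forall>e\<in>arcs T. Rel e (s (tail T e)) (s (head T e)))"
proof -
  let ?r = "perm_restrict arev (arcs T)"
  interpret T: bidirected_digraph T ?r using T by (simp add: serre_tree_def)
  have r: "?r e = arev e" if "e \<in> arcs T" for e using that by (simp add: perm_restrict_def)
  have rT: "arev e \<in> arcs T" "arev (arev e) = e" "arev e \<noteq> e" "tail T (arev e) = head T e"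
    "head T (arev e) = tail T e" if "e \<in> arcs T" for e
    using T.arev_in_arcs[OF that] T.arev_arev[of e] T.arev_neq[OF that] T.tail_arev[OF that]
      T.head_arev[OF that] r[OF that] r[of "arev e"] that by auto
  have conn: "u \<rightarrow>\<^sup>*\<^bsub>T\<^esub> v" if "u \<in> verts T" "v \<in> verts T" for u v
    using T that by (auto simp: serre_tree_def strongly_connected_def)
  have nocirc: "\<not> serre_circuit T arev p" for p using T by (auto simp: serre_tree_def)
  have noloop: "tail T e \<noteq> head T e" if "e \<in> arcs T" for e
  proof
    assume "tail T e = head T e"
    then have "T.awalk (tail T e) [e] (tail T e)" using that by (simp add: T.awalk_def)
    then have "T.cycle [e]" unfolding T.cycle_def by (intro exI[of _ "tail T e"]) simp
    then show False using nocirc[of "[e]"] by (simp add: serre_circuit_def)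
  qed
  \<comment> \<open>Connectedness of \<open>W\<close> is recorded by simple paths that stay in
    \<open>W\<close>, the form from which \<open>uniq\<close> builds a circuit.\<close>
  define inside where "inside W u v \<longleftrightarrow> (\<exists>p. T.apath u p v \<and> set (T.awalk_verts u p) \<subseteq> W)" for W u v
  define good where "good W s \<longleftrightarrow> W \<subseteq> verts T \<and> v0 \<in> W \<and> (\<forall>u\<in>W. \<forall>v\<in>W. inside W u v) \<and>
    s v0 = y0 \<and> (\<forall>v\<in>W. S v (s v)) \<and>
    (\<forall>e\<in>arcs T. tail T e \<in> W \<longrightarrow> head T e \<in> W \<longrightarrow> Rel e (s (tail T e)) (s (head T e)))" for W s
  \<comment> \<open>A second arc \<open>e'\<close> from \<open>W\<close> to the same new vertex
    gives a closed walk: \<open>e\<close>, then \<open>e'\<close> reversed, then a simple path in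
    \<open>W\<close> back to the tail of \<open>e\<close>. It is reduced and repeats no vertex,
    hence is a circuit.\<close>
  have uniq: "e' = e" if W: "\<And>u v. u \<in> W \<Longrightarrow> v \<in> W \<Longrightarrow> inside W u v"
    and e: "e \<in> arcs T" "tail T e \<in> W" "head T e \<notin> W"
    and e': "e' \<in> arcs T" "tail T e' \<in> W" "head T e' = head T e" for W e e'
  proof (rule ccontr)
    assume ne: "e' \<noteq> e"
    obtain p where p: "T.apath (tail T e') p (tail T e)" "set (T.awalk_verts (tail T e') p) \<subseteq> W"
      using W[OF e'(2) e(2)] by (auto simp: inside_def)
    have pa: "set p \<subseteq> arcs T" "T.awalk (tail T e') p (tail T e)" "distinct (T.awalk_verts (tail T e') p)"
      using p(1) by (auto simp: T.apath_def T.awalk_def)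
    let ?c = "e # arev e' # p"
    have "T.awalk (tail T e) ?c (tail T e)"
      using e e' pa(2) rT[OF e'(1)] by (simp add: T.awalk_Cons_iff)
    moreover have "distinct (tl (T.awalk_verts (tail T e) ?c))"
      using pa(3) p(2) e(3) e'(3) rT[OF e'(1)] by auto
    ultimately have "T.cycle ?c" unfolding T.cycle_def by blast
    moreover have "?c ! Suc i \<noteq> arev (?c ! i)" if i: "Suc i < length ?c" for i
    proof -
      \<comment> \<open>The junctions: at 0 the arcs \<open>e\<close> and \<open>e'\<close> differ;
        at 1 the path stays in \<open>W\<close> whereas \<open>e'\<close> ends outside; all later
        ones lie inside a simple path.\<close>
      consider "i = 0" | "i = 1" | j where "i = Suc (Suc j)" by (metis One_nat_def not0_implies_Suc)
      then show ?thesis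
      proof cases
        case 1
        then show ?thesis using ne rT(2)[OF e(1)] rT(2)[OF e'(1)] by (simp) metis
      next
        case 2
        then have lp: "p \<noteq> []" using i by auto
        have "cas": "T.cas (tail T e') p (tail T e)" using pa(2) by (simp add: T.awalk_def)
        have "head T (hd p) \<in> set (T.awalk_verts (tail T e') p)"
          using T.awalk_verts_conv'[OF "cas"] lp by simp
        then have "head T (hd p) \<in> W" using p(2) by blast
        then have "hd p \<noteq> e'" using e(3) e'(3) by auto
        then show ?thesis using 2 lp rT(2)[OF e'(1)] by (simp add: hd_conv_nth)
      next
        case (3 j)
        then have j: "Suc j < length p" using i by simp
        then have pj: "p ! j \<in> arcs T" "p ! Suc j \<in> arcs T" using pa(1) by (auto simp: subset_iff)
        have "p ! Suc j \<noteq> arev (p ! j)"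
          using T.apath_reduced[OF p(1) j pj(2)] rT(5)[OF pj(1)] by auto
        then show ?thesis using 3 by simp
      qed
    qed
    ultimately show False using nocirc[of ?c] by (auto simp: serre_circuit_def)
  qed
  have step: "\<exists>w s'. w \<in> verts T - W \<and> good (insert w W) s'" if g: "good W s" and ne: "W \<noteq> verts T" for W s
  proof -
    have W: "W \<subseteq> verts T" "v0 \<in> W" "s v0 = y0"
      and ins: "\<And>u v. u \<in> W \<Longrightarrow> v \<in> W \<Longrightarrow> inside W u v"
      and Ss: "\<And>v. v \<in> W \<Longrightarrow> S v (s v)"
      and Rs: "\<And>e. e \<in> arcs T \<Longrightarrow> tail T e \<in> W \<Longrightarrow> head T e \<in> W \<Longrightarrow> Rel e (s (tail T e)) (s (head T e))"
      using g by (auto simp: good_def)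
    obtain v where v: "v \<in> verts T" "v \<notin> W" using ne W(1) by blast
    obtain e where e: "e \<in> arcs T" "tail T e \<in> W" "head T e \<notin> W"
      using T.exists_exit_arc[OF conn[OF v0 v(1)] W(2) v(2)] by blast
    let ?w = "head T e"
    obtain z where z: "S ?w z" "Rel e (s (tail T e)) z" using ext[OF e(1) Ss[OF e(2)]] by blast
    let ?s = "s(?w := z)"
    have into: "inside (insert ?w W) u ?w" if uW: "u \<in> W" for u
    proof -
      obtain p where p: "T.apath u p (tail T e)" "set (T.awalk_verts u p) \<subseteq> W"
        using ins[OF uW e(2)] by (auto simp: inside_def)
      have aw: "T.awalk u p (tail T e)" using p(1) by (simp add: T.apath_def)
      have "T.awalk u (p @ [e]) ?w"
        using aw e(1) by (simp add: T.awalk_append_iff[of u p] T.awalk_simps)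
      moreover have "T.awalk_verts u (p @ [e]) = T.awalk_verts u p @ [?w]"
        using T.awlast_of_awalk[OF aw] aw e(1)
        by (subst T.awalk_verts_append[OF calculation]) (simp)
      ultimately show ?thesis
        using p e(3) unfolding inside_def T.apath_def by (intro exI[of _ "p @ [e]"]) auto
    qed
    have out: "inside (insert ?w W) ?w u" if uW: "u \<in> W" for u
    proof -
      obtain p where p: "T.apath (tail T e) p u" "set (T.awalk_verts (tail T e) p) \<subseteq> W"
        using ins[OF e(2) uW] by (auto simp: inside_def)
      have "T.apath ?w (arev e # p) u"
        using p e rT[OF e(1)] by (auto simp: T.apath_Cons_iff)
      then show ?thesis
        using p rT[OF e(1)] unfolding inside_def by (intro exI[of _ "arev e # p"]) auto
    qed
    have ins': "inside (insert ?w W) u v" if "u \<in> insert ?w W" "v \<in> insert ?w W" for u v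
    proof -
      have "inside (insert ?w W) ?w ?w"
        unfolding inside_def using e(1) by (intro exI[of _ "[]"]) (simp add: T.apath_Nil_iff)
      moreover have "inside (insert ?w W) u v" if "u \<in> W" "v \<in> W"
        using ins[OF that] unfolding inside_def by blast
      ultimately show ?thesis using that into out by blast
    qed
    have Rs': "Rel f (?s (tail T f)) (?s (head T f))"
      if f: "f \<in> arcs T" "tail T f \<in> insert ?w W" "head T f \<in> insert ?w W" for f
    proof (cases "head T f = ?w")
      case True
      then have "tail T f \<in> W" using f noloop[OF f(1)] by auto
      then have "f = e" using uniq[OF ins e f(1)] True by blast
      then show ?thesis using z e by auto
    next
      case False
      then have hW: "head T f \<in> W" using f by blast
      show ?thesis
      proof (cases "tail T f = ?w")
        case True
        have "arev f = e"
          using uniq[OF ins e rT(1)[OF f(1)]] rT(4,5)[OF f(1)] hW True by auto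
        then have "f = arev e" using rT(2)[OF f(1)] by simp
        then show ?thesis using sym[OF e(1) z(2)] rT(4,5)[OF e(1)] e by auto
      next
        case False
        then show ?thesis using Rs[OF f(1)] f hW \<open>head T f \<noteq> ?w\<close> by auto
      qed
    qed
    have "good (insert ?w W) ?s"
      unfolding good_def using W ins' Rs' Ss z(1) e T.head_in_verts[OF e(1)] by auto
    then show ?thesis using e T.head_in_verts[OF e(1)] by blast
  qed
  have "\<exists>W s. good W s \<and> card W = Suc n" if "n < card (verts T)" for n
    using that
  proof (induction n)
    case 0
    have "good {v0} (\<lambda>_. y0)"
    proof -
      have "inside {v0} v0 v0"
        using v0 unfolding inside_def by (intro exI[of _ "[]"]) (simp add: T.apath_Nil_iff)
      moreover have "False" if "e \<in> arcs T" "tail T e \<in> {v0}" "head T e \<in> {v0}" for e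
        using noloop[OF that(1)] that by simp
      ultimately show ?thesis using v0 y0 unfolding good_def by blast
    qed
    then show ?case by (intro exI[of _ "{v0}"] exI[of _ "\<lambda>_. y0"]) simp
  next
    case (Suc n)
    then obtain W s where W: "good W s" "card W = Suc n" by (metis Suc_lessD)
    have "W \<noteq> verts T" using W(2) Suc(2) by auto
    from step[OF W(1) this] obtain w s' where w: "w \<in> verts T - W" "good (insert w W) s'" by blast
    have "W \<subseteq> verts T" using W(1) by (simp add: good_def)
    then have "finite W" using fin by (rule finite_subset)
    then have "card (insert w W) = Suc (Suc n)" using W(2) w(1) by simp
    then show ?case using w(2) by blast
  qed
  from this[of "card (verts T) - 1"] have "\<exists>W s. good W s \<and> card W = card (verts T)"
  proof -
    have "card (verts T) > 0" using fin v0 by (auto simp: card_gt_0_iff)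
    then have 1: "card (verts T) - 1 < card (verts T)" "Suc (card (verts T) - 1) = card (verts T)" by simp_all
    show ?thesis using \<open>card (verts T) - 1 < card (verts T) \<Longrightarrow>
      \<exists>W s. good W s \<and> card W = Suc (card (verts T) - 1)\<close>[OF 1(1)] unfolding 1(2) .
  qed
  then obtain W s where W: "good W s" "card W = card (verts T)" by (elim exE conjE)
  then have "W = verts T" using fin by (intro card_subset_eq) (auto simp: good_def)
  then have "s v0 = y0" "\<forall>v\<in>verts T. S v (s v)" "\<forall>e\<in>arcs T. Rel e (s (tail T e)) (s (head T e))"
    using W(1) by (auto simp: good_def)
  then show ?thesis by blast
qed

text \<open>Only \<open>e\<close> enters the new vertex and only its inverse leaves it, so a reduced
  circuit can pass there only at its base point, beginning with \<open>arev e\<close> and ending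
  with \<open>e\<close>. Then its first and its last but one arc both have head
  \<open>tail G e\<close>; they are different positions once the length is at least 3, which
  contradicts distinctness. A circuit without these two arcs is a circuit of
  \<open>T\<close>.\<close>

lemma serre_tree_add_leaf:
  assumes G: "bidirected_digraph G arev" and T: "serre_tree arev T" "subgraph T G"
    and e: "e \<in> arcs G" "tail G e \<in> verts T" "head G e \<notin> verts T"
  shows "serre_tree arev (T\<lparr>verts := insert (head G e) (verts T), arcs := {e, arev e} \<union> arcs T\<rparr>)"
proof -
  define Sg where "Sg = T\<lparr>verts := insert (head G e) (verts T), arcs := {e, arev e} \<union> arcs T\<rparr>"
  interpret G: bidirected_digraph G arev by fact
  let ?r = "perm_restrict arev (arcs T)"
  interpret T: bidirected_digraph T ?r using T by (simp add: serre_tree_def)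
  have ht: "head T = head G" "tail T = tail G" and sub: "arcs T \<subseteq> arcs G" "verts T \<subseteq> verts G"
    using T(2) by (auto simp: subgraph_def compatible_def)
  have rT: "arev f \<in> arcs T" if "f \<in> arcs T" for f
    using T.arev_in_arcs[OF that] that by (simp add: perm_restrict_def)
  have tw: "f \<in> arcs T \<Longrightarrow> tail G f \<in> verts T" "f \<in> arcs T \<Longrightarrow> head G f \<in> verts T" for f
    using T.tail_in_verts[of f] T.head_in_verts[of f] by (simp_all add: ht)
  let ?w = "head G e"
  have enT: "e \<notin> arcs T" "arev e \<notin> arcs T" using tw e(1,3) rT[of "arev e"] by auto
  have S: "verts Sg = insert ?w (verts T)" "arcs Sg = {e, arev e} \<union> arcs T" "head Sg = head G" "tail Sg = tail G"
    by (simp_all add: ht Sg_def)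
  have ends: "tail Sg a \<in> verts Sg \<and> head Sg a \<in> verts Sg" if aS: "a \<in> arcs Sg" for a
  proof -
    consider "a = e" | "a = arev e" | "a \<in> arcs T" using aS by (auto simp: S)
    then show ?thesis unfolding S by cases (use e tw in simp_all)
  qed
  interpret S: wf_digraph Sg by unfold_locales (simp_all add: ends)
  have pr: "perm_restrict arev (arcs Sg) f = arev f" if "f \<in> arcs Sg" for f
    using that by (simp add: perm_restrict_def)
  interpret SB: bidirected_digraph Sg "perm_restrict arev (arcs Sg)"
  proof (rule S.bidirected_digraphI)
    fix a assume "a \<notin> arcs Sg" then show "perm_restrict arev (arcs Sg) a = a" by (simp add: perm_restrict_def)
  next
    fix a assume a: "a \<in> arcs Sg"
    then have aG: "a \<in> arcs G" and aS: "arev a \<in> arcs Sg" using e sub rT by (auto simp: S)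
    show "perm_restrict arev (arcs Sg) a \<noteq> a" unfolding pr[OF a] by (rule G.arev_neq[OF aG])
    show "perm_restrict arev (arcs Sg) (perm_restrict arev (arcs Sg) a) = a"
      unfolding pr[OF a] pr[OF aS] by (rule G.arev_arev)
    show "tail Sg (perm_restrict arev (arcs Sg) a) = head Sg a"
      unfolding pr[OF a] S(3,4) by (rule G.tail_arev[OF aG])
  qed
  have TS: "subgraph T Sg"
    unfolding subgraph_def compatible_def using S.wf_digraph_axioms T.wf_digraph_axioms by (auto simp: ht S)
  have TG: "u \<rightarrow>\<^sup>*\<^bsub>Sg\<^esub> v" if "u \<in> verts T" "v \<in> verts T" for u v
  proof -
    have "u \<rightarrow>\<^sup>*\<^bsub>T\<^esub> v" using T(1) that by (auto simp: serre_tree_def strongly_connected_def)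
    then show ?thesis by (rule S.reachable_mono[OF _ TS])
  qed
  have ew: "tail G e \<rightarrow>\<^sup>*\<^bsub>Sg\<^esub> ?w"
  proof -
    have "S.awalk (tail G e) [e] ?w" using e by (simp add: S.awalk_Cons_iff S.awalk_Nil_iff S)
    then show ?thesis by (rule S.reachable_awalkI)
  qed
  have we: "?w \<rightarrow>\<^sup>*\<^bsub>Sg\<^esub> tail G e"
  proof -
    have "S.awalk ?w [arev e] (tail G e)" using e by (simp add: S.awalk_Cons_iff S.awalk_Nil_iff S)
    then show ?thesis by (rule S.reachable_awalkI)
  qed
  have sc: "strongly_connected Sg"
  proof (rule strongly_connectedI)
    fix u v assume uv: "u \<in> verts Sg" "v \<in> verts Sg"
    have 1: "u \<rightarrow>\<^sup>*\<^bsub>Sg\<^esub> tail G e" if "u \<in> verts Sg" for u using that TG[OF _ e(2)] we by (auto simp: S)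
    have 2: "tail G e \<rightarrow>\<^sup>*\<^bsub>Sg\<^esub> v" if "v \<in> verts Sg" for v using that TG[OF e(2)] ew by (auto simp: S)
    show "u \<rightarrow>\<^sup>*\<^bsub>Sg\<^esub> v" using S.reachable_trans[OF 1[OF uv(1)] 2[OF uv(2)]] .
  qed (simp add: S)
  have inc: "a = e" if "a \<in> arcs Sg" "head G a = ?w" for a
  proof -
    have "a \<notin> arcs T" using tw(2)[of a] that(2) e(3) by auto
    moreover have "a \<noteq> arev e" using that(2) e G.head_arev[OF e(1)] by auto
    ultimately show ?thesis using that(1) by (simp add: S)
  qed
  have outc: "a = arev e" if "a \<in> arcs Sg" "tail G a = ?w" for a
  proof -
    have "a \<notin> arcs T" using tw(1)[of a] that(2) e(3) by auto
    moreover have "a \<noteq> e" using that(2) e by auto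
    ultimately show ?thesis using that(1) by (simp add: S)
  qed
  have False if circ: "serre_circuit Sg arev p" for p
  proof -
    obtain u where u: "S.awalk u p u" "distinct (tl (S.awalk_verts u p))" "p \<noteq> []"
      and red: "\<And>i. Suc i < length p \<Longrightarrow> p ! Suc i \<noteq> arev (p ! i)"
      using circ by (auto simp: serre_circuit_def S.cycle_def)
    have pS: "set p \<subseteq> arcs Sg" and "cas": "S.cas u p u" using u(1) by (auto simp: S.awalk_def)
    have vts: "S.awalk_verts u p = tail G (hd p) # map (head G) p"
      using S.awalk_verts_conv'[OF "cas"] u(3) by (simp add: S)
    have vts2: "S.awalk_verts u p = map (tail G) p @ [head G (last p)]"
      using S.awalk_verts_conv[of u p] u(3) by (simp add: S)
    have len: "length (S.awalk_verts u p) = Suc (length p)" by (rule S.length_awalk_verts)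
    have nxt: "head G (p ! i) = tail G (p ! Suc i)" if i: "Suc i < length p" for i
    proof -
      have "S.awalk_verts u p ! Suc i = head G (p ! i)" using vts i by simp
      moreover have "S.awalk_verts u p ! Suc i = tail G (p ! Suc i)" using vts2 i by (simp add: nth_append)
      ultimately show ?thesis by simp
    qed
    have ne: "e \<notin> set (butlast p)"
    proof
      assume "e \<in> set (butlast p)"
      then obtain i where i: "i < length (butlast p)" "butlast p ! i = e" by (auto simp: in_set_conv_nth)
      then have i: "Suc i < length p" "p ! i = e" by (simp_all add: nth_butlast)
      then have "p ! Suc i = arev e" using outc[of "p ! Suc i"] nxt[OF i(1)] pS by (auto simp: subset_iff)
      then show False using red[OF i(1)] i by simp
    qed
    have nr: "arev e \<notin> set (tl p)"
    proof
      assume "arev e \<in> set (tl p)"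
      then obtain i where "i < length (tl p)" "tl p ! i = arev e" by (auto simp: in_set_conv_nth)
      then have i: "Suc i < length p" "p ! Suc i = arev e" by (simp_all add: nth_tl)
      then have "p ! i = e" using inc[of "p ! i"] nxt[OF i(1)] pS e(1) by (auto simp: subset_iff)
      then show False using red[OF i(1)] i by simp
    qed
    show False
    proof (cases "e \<in> set p \<or> arev e \<in> set p")
      case False
      then have "set p \<subseteq> arcs T" using pS by (auto simp: S)
      moreover have "u \<in> verts T"
      proof -
        have "u = tail G (hd p)" using "cas" u(3) by (simp add: S.cas_simp S)
        then show ?thesis using calculation tw(1) u(3) by (metis hd_in_set subsetD)
      qed
      moreover have "T.cas u p u" using "cas" compatible_cas[of T Sg] TS by (simp add: subgraph_def compatible_def)
      moreover have "T.awalk_verts u p = S.awalk_verts u p"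
        using compatible_awalk_verts[of T Sg] TS by (simp add: subgraph_def compatible_def)
      ultimately have "serre_circuit T arev p"
        using u red unfolding serre_circuit_def T.cycle_def T.awalk_def by metis
      then show False using T(1) by (auto simp: serre_tree_def)
    next
      case True
      have ends: "tail G (hd p) = u" "head G (last p) = u"
      proof -
        show "tail G (hd p) = u" using "cas" u(3) by (simp add: S.cas_simp S)
        have "last (S.awalk_verts u p) = u" using S.awlast_if_cas[OF "cas"] .
        then show "head G (last p) = u" unfolding vts2 by simp
      qed
      have "last p = e"
      proof (cases "e \<in> set p")
        case True
        then show ?thesis using ne u(3) by (metis append_butlast_last_id in_set_conv_decomp rotate1.simps(2) set_ConsD set_rotate1)
      next
        case False
        then have "hd p = arev e" using True nr u(3) by (metis list.collapse set_ConsD)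
        then have "head G (last p) = ?w" using ends e(1) by simp
        then show ?thesis using inc[of "last p"] pS u(3) last_in_set by blast
      qed
      then have uw: "u = ?w" using ends by simp
      then have hd: "hd p = arev e" using outc[of "hd p"] ends(1) pS u(3) hd_in_set by blast
      have "e \<noteq> arev e" using G.arev_neq[OF e(1)] by simp
      then have l2: "length p \<ge> 2" using hd \<open>last p = e\<close> u(3)
        by (cases p; cases "tl p") auto
      have "p ! 1 \<noteq> e"
        using red[of 0] l2 hd u(3) G.arev_arev[of e] by (simp add: hd_conv_nth)
      then have l3: "length p \<ge> 3" using l2 \<open>last p = e\<close> u(3)
        by (cases "length p = 2") (auto simp: last_conv_nth)
      have "head G (p ! 0) = tail G e" using hd u(3) e(1) by (simp add: hd_conv_nth)
      moreover have "head G (p ! (length p - 2)) = tail G e"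
        using nxt[of "length p - 2"] l3 \<open>last p = e\<close> u(3) by (simp add: last_conv_nth numeral_2_eq_2 Suc_diff_Suc)
      moreover have "distinct (map (head G) p)" using u(2) unfolding vts by simp
      then have "head G (p ! 0) \<noteq> head G (p ! (length p - 2))"
        using l3 nth_eq_iff_index_eq[of "map (head G) p" 0 "length p - 2"] u(3) by simp
      ultimately show False by simp
    qed
  qed
  then show ?thesis
    unfolding serre_tree_def Sg_def[symmetric] using SB.bidirected_digraph sc by blast
qed

text \<open>By connectedness some arc leads out of a tree that misses a vertex, and attaching its
  end as a leaf gives a larger tree.\<close>

lemma maximal_tree_spanning:
  assumes G: "bidirected_digraph G arev" "strongly_connected G" and T: "maximal_tree G arev T"
  shows "verts T = verts G"
proof (rule ccontr)
  interpret G: bidirected_digraph G arev by fact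
  assume ne: "verts T \<noteq> verts G"
  have sub: "subgraph T G" and st: "serre_tree arev T"
    and max: "\<And>S. S \<noteq> T \<Longrightarrow> subgraph T S \<Longrightarrow> subgraph S G \<Longrightarrow> \<not> serre_tree arev S"
    using T by (auto simp: maximal_tree_def G.max_subgraph_def)
  obtain u where u: "u \<in> verts T" using st by (auto simp: serre_tree_def strongly_connected_def)
  have vs: "verts T \<subseteq> verts G" and ht: "head T = head G" "tail T = tail G" and as: "arcs T \<subseteq> arcs G"
    using sub by (auto simp: subgraph_def compatible_def)
  obtain v where v: "v \<in> verts G" "v \<notin> verts T" using ne vs by blast
  have "u \<rightarrow>\<^sup>*\<^bsub>G\<^esub> v" using G(2) u v vs by (auto simp: strongly_connected_def)
  then obtain e where e: "e \<in> arcs G" "tail G e \<in> verts T" "head G e \<notin> verts T"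
    using G.exists_exit_arc[OF _ u v(2)] by blast
  define S where "S = T\<lparr>verts := insert (head G e) (verts T), arcs := {e, arev e} \<union> arcs T\<rparr>"
  have S: "serre_tree arev S" unfolding S_def by (rule serre_tree_add_leaf[OF G(1) st sub e])
  then have "bidirected_digraph S (perm_restrict arev (arcs S))" by (simp add: serre_tree_def)
  then have wfS: "wf_digraph S" by (rule bidirected_digraph.axioms(1))
  have Ss: "verts S = insert (head G e) (verts T)" "arcs S = {e, arev e} \<union> arcs T"
    "head S = head G" "tail S = tail G" by (simp_all add: S_def ht)
  have "wf_digraph T" using sub by (simp add: subgraph_def)
  then have "subgraph T S" using wfS by (auto simp: subgraph_def compatible_def Ss ht)
  moreover have "subgraph S G"
    using wfS e vs as G.wf_digraph_axioms by (auto simp: subgraph_def compatible_def Ss)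
  moreover have "S \<noteq> T" using e(3) Ss(1) by auto
  ultimately show False using max S by blast
qed

section \<open>Equivariant matchings\<close>

text \<open>All point stabilisers agree (with those of the other action as well), so that both actions have the same
  number of orbits and a partial matching of orbit representatives can be completed greedily.\<close>

lemma equivariant_matching:
  assumes E: "group E" and X: "finite X"
    and lX: "\<And>a y. a \<in> carrier E \<Longrightarrow> y \<in> X \<Longrightarrow> l a y \<in> X"
    and l1: "\<And>y. y \<in> X \<Longrightarrow> l \<one>\<^bsub>E\<^esub> y = y"
    and lm: "\<And>a b y. a \<in> carrier E \<Longrightarrow> b \<in> carrier E \<Longrightarrow> y \<in> X \<Longrightarrow> l (a \<otimes>\<^bsub>E\<^esub> b) y = l a (l b y)"
    and rX: "\<And>a y. a \<in> carrier E \<Longrightarrow> y \<in> X \<Longrightarrow> r a y \<in> X"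
    and r1: "\<And>y. y \<in> X \<Longrightarrow> r \<one>\<^bsub>E\<^esub> y = y"
    and rm: "\<And>a b y. a \<in> carrier E \<Longrightarrow> b \<in> carrier E \<Longrightarrow> y \<in> X \<Longrightarrow> r (a \<otimes>\<^bsub>E\<^esub> b) y = r a (r b y)"
    and stab: "\<And>a y x. a \<in> carrier E \<Longrightarrow> y \<in> X \<Longrightarrow> x \<in> X \<Longrightarrow> l a y = y \<longleftrightarrow> r a x = x"
    and Pr: "Pr \<subseteq> X \<times> X"
    and Prl: "\<And>a y x y' x'. a \<in> carrier E \<Longrightarrow> (y, x) \<in> Pr \<Longrightarrow> (y', x') \<in> Pr \<Longrightarrow> l a y = y' \<Longrightarrow>
      (y, x) = (y', x')"
    and Prr: "\<And>a y x y' x'. a \<in> carrier E \<Longrightarrow> (y, x) \<in> Pr \<Longrightarrow> (y', x') \<in> Pr \<Longrightarrow> r a x = x' \<Longrightarrow>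
      (y, x) = (y', x')"
  shows "\<exists>\<beta>. bij_betw \<beta> X X \<and> (\<forall>a\<in>carrier E. \<forall>y\<in>X. \<beta> (l a y) = r a (\<beta> y)) \<and>
    (\<forall>(y, x)\<in>Pr. \<beta> y = x)"
proof -
  interpret E: group E by fact
  \<comment> \<open>The pairs of \<open>Q\<close> are orbit representatives, matched one to one on
    both sides; \<open>orb Q\<close> is the graph of the equivariant map that they
    determine.\<close>
  define indep where "indep Q \<longleftrightarrow> Q \<subseteq> X \<times> X \<and>
    (\<forall>a y x y' x'. a \<in> carrier E \<longrightarrow> (y, x) \<in> Q \<longrightarrow> (y', x') \<in> Q \<longrightarrow> l a y = y' \<or> r a x = x' \<longrightarrow>
      y = y' \<and> x = x')" for Q
  define orb where "orb Q = {(l a y, r a x) | a y x. a \<in> carrier E \<and> (y, x) \<in> Q}" for Q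
  have orbE: thesis
    if "(p, q) \<in> orb Q" "\<And>a y x. a \<in> carrier E \<Longrightarrow> (y, x) \<in> Q \<Longrightarrow> p = l a y \<Longrightarrow> q = r a x \<Longrightarrow> thesis"
    for p q Q thesis
    using that unfolding orb_def by auto
  have inv_l: "l (inv\<^bsub>E\<^esub> a) (l a y) = y" "l a (l (inv\<^bsub>E\<^esub> a) y) = y" if "a \<in> carrier E" "y \<in> X" for a y
    using lm[of "inv\<^bsub>E\<^esub> a" a y] lm[of a "inv\<^bsub>E\<^esub> a" y] l1 that by auto
  have inv_r: "r (inv\<^bsub>E\<^esub> a) (r a y) = y" "r a (r (inv\<^bsub>E\<^esub> a) y) = y" if "a \<in> carrier E" "y \<in> X" for a y
    using rm[of "inv\<^bsub>E\<^esub> a" a y] rm[of a "inv\<^bsub>E\<^esub> a" y] r1 that by auto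
  have "indep Pr" unfolding indep_def using Pr
  proof (intro conjI allI impI)
    fix a y x y' x' assume "a \<in> carrier E" "(y, x) \<in> Pr" "(y', x') \<in> Pr" "l a y = y' \<or> r a x = x'"
    then show "y = y'" "x = x'" using Prl[of a y x y' x'] Prr[of a y x y' x'] by auto
  qed
  have fin: "finite {Q. indep Q \<and> Pr \<subseteq> Q}"
  proof (rule finite_subset)
    show "{Q. indep Q \<and> Pr \<subseteq> Q} \<subseteq> Pow (X \<times> X)" unfolding indep_def by blast
    show "finite (Pow (X \<times> X))" using X by simp
  qed
  obtain Q where Q: "indep Q" "Pr \<subseteq> Q"
    and max: "\<And>Q'. indep Q' \<Longrightarrow> Pr \<subseteq> Q' \<Longrightarrow> Q \<subseteq> Q' \<Longrightarrow> Q' = Q"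
  proof -
    let ?M = "{Q. indep Q \<and> Pr \<subseteq> Q}"
    have "Pr \<in> ?M" using \<open>indep Pr\<close> by simp
    from finite_has_maximal2[OF fin this] obtain Q where "Q \<in> ?M" "\<forall>Q'\<in>?M. Q \<subseteq> Q' \<longrightarrow> Q = Q'"
      by metis
    then have "indep Q" "Pr \<subseteq> Q" "\<And>Q'. indep Q' \<Longrightarrow> Pr \<subseteq> Q' \<Longrightarrow> Q \<subseteq> Q' \<Longrightarrow> Q' = Q"
      by (simp_all add: eq_commute)
    then show thesis by (rule that)
  qed
  have indepD: "y = y' \<and> x = x'"
    if "a \<in> carrier E" "(y, x) \<in> Q" "(y', x') \<in> Q" "l a y = y' \<or> r a x = x'" for a y x y' x'
    by (rule Q(1)[unfolded indep_def, THEN conjunct2, rule_format, OF that])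
  have QX: "y \<in> X" "x \<in> X" if "(y, x) \<in> Q" for y x using Q(1) that unfolding indep_def by blast+
  \<comment> \<open>Equal stabilisers make \<open>orb Q\<close> single-valued and injective: a
    coincidence on one side reduces to a single pair of \<open>Q\<close> and an element of its
    stabiliser, which fixes the other entry as well.\<close>
  have sv: "r a x = r a' x' \<longleftrightarrow> l a y = l a' y'"
    if "a \<in> carrier E" "a' \<in> carrier E" "(y, x) \<in> Q" "(y', x') \<in> Q" for a a' y x y' x'
  proof -
    let ?b = "inv\<^bsub>E\<^esub> a' \<otimes>\<^bsub>E\<^esub> a"
    have b: "?b \<in> carrier E" using that by simp
    have 1: "l a y = l a' y' \<longleftrightarrow> l ?b y = y'"
    proof
      assume "l a y = l a' y'"
      then show "l ?b y = y'" using that QX lm[of "inv\<^bsub>E\<^esub> a'" a y] inv_l(1)[OF that(2), of y'] by simp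
    next
      assume "l ?b y = y'"
      then show "l a y = l a' y'"
        using that QX lm[of "inv\<^bsub>E\<^esub> a'" a y] inv_l(2)[OF that(2) lX[OF that(1)], of y] by simp
    qed
    have 2: "r a x = r a' x' \<longleftrightarrow> r ?b x = x'"
    proof
      assume "r a x = r a' x'"
      then show "r ?b x = x'" using that QX rm[of "inv\<^bsub>E\<^esub> a'" a x] inv_r(1)[OF that(2), of x'] by simp
    next
      assume "r ?b x = x'"
      then show "r a x = r a' x'"
        using that QX rm[of "inv\<^bsub>E\<^esub> a'" a x] inv_r(2)[OF that(2) rX[OF that(1)], of x] by simp
    qed
    have "l ?b y = y' \<or> r ?b x = x' \<Longrightarrow> y = y' \<and> x = x'"
      by (rule indepD[OF b that(3,4)])
    then show ?thesis using 1 2 stab[OF b QX[OF that(3)]] by auto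
  qed
  have uniq: "x = x'" if o: "(y, x) \<in> orb Q" "(y, x') \<in> orb Q" for y x x'
  proof -
    obtain a u v where 1: "a \<in> carrier E" "(u, v) \<in> Q" "y = l a u" "x = r a v"
      using o(1) by (rule orbE)
    obtain a' u' v' where 2: "a' \<in> carrier E" "(u', v') \<in> Q" "y = l a' u'" "x' = r a' v'"
      using o(2) by (rule orbE)
    show ?thesis using sv[OF 1(1) 2(1) 1(2) 2(2)] 1 2 by simp
  qed
  have uniq': "y = y'" if o: "(y, x) \<in> orb Q" "(y', x) \<in> orb Q" for y y' x
  proof -
    obtain a u v where 1: "a \<in> carrier E" "(u, v) \<in> Q" "y = l a u" "x = r a v"
      using o(1) by (rule orbE)
    obtain a' u' v' where 2: "a' \<in> carrier E" "(u', v') \<in> Q" "y' = l a' u'" "x = r a' v'"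
      using o(2) by (rule orbE)
    show ?thesis using sv[OF 1(1) 2(1) 1(2) 2(2)] 1 2 by simp
  qed
  \<comment> \<open>Counting replaces a comparison of orbits: \<open>orb Q\<close> is a bijection
    from its domain onto its range, both inside the finite set \<open>X\<close>. A point missing on
    the left comes with one missing on the right, and this pair could be added to the maximal
    \<open>Q\<close>.\<close>
  have dom: "X \<subseteq> Domain (orb Q)"
  proof (rule ccontr)
    assume "\<not> X \<subseteq> Domain (orb Q)"
    then obtain y where y: "y \<in> X" "y \<notin> Domain (orb Q)" by blast
    have D: "Domain (orb Q) \<subseteq> X" and Rg: "Range (orb Q) \<subseteq> X" using QX lX rX by (auto simp: orb_def)
    have "card (Domain (orb Q)) = card (Range (orb Q))"
    proof -
      have "inj_on fst (orb Q)" "inj_on snd (orb Q)"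
        using uniq uniq' by (auto simp: inj_on_def)
      then show ?thesis by (metis Domain_fst Range_snd card_image)
    qed
    moreover have "card (Domain (orb Q)) < card X" using D y X by (intro psubset_card_mono) auto
    ultimately have "Range (orb Q) \<noteq> X" by auto
    then obtain x where x: "x \<in> X" "x \<notin> Range (orb Q)" using Rg by blast
    have ny: "l a y' \<noteq> y" if "a \<in> carrier E" "(y', x') \<in> Q" for a y' x'
      using y(2) that by (force simp: orb_def)
    have nx: "r a x' \<noteq> x" if "a \<in> carrier E" "(y', x') \<in> Q" for a y' x'
      using x(2) that by (force simp: orb_def)
    have ny': "l a y \<noteq> y'" if "a \<in> carrier E" "(y', x') \<in> Q" for a y' x'
      using ny[of "inv\<^bsub>E\<^esub> a" y' x'] inv_l(1)[OF that(1) y(1)] that by auto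
    have nx': "r a x \<noteq> x'" if "a \<in> carrier E" "(y', x') \<in> Q" for a y' x'
      using nx[of "inv\<^bsub>E\<^esub> a" y' x'] inv_r(1)[OF that(1) x(1)] that by auto
    have key: "u = u' \<and> v = v'"
      if a: "a \<in> carrier E" and uv: "(u, v) \<in> insert (y, x) Q" "(u', v') \<in> insert (y, x) Q"
        and eq: "l a u = u' \<or> r a v = v'" for a u v u' v'
    proof (cases "(u, v) \<in> Q")
      case True
      then have "(u', v') \<in> Q" using ny[OF a True] nx[OF a True] uv(2) eq by auto
      then show ?thesis using indepD[OF a True] eq by blast
    next
      case False
      then have "u = y" "v = x" using uv by auto
      moreover have "(u', v') \<notin> Q" using ny'[OF a] nx'[OF a] eq calculation by auto
      ultimately show ?thesis using uv by simp
    qed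
    have "indep (insert (y, x) Q)"
      unfolding indep_def
    proof (intro conjI allI impI)
      show "insert (y, x) Q \<subseteq> X \<times> X" using QX x y by auto
    next
      fix a u v u' v'
      assume "a \<in> carrier E" "(u, v) \<in> insert (y, x) Q" "(u', v') \<in> insert (y, x) Q" "l a u = u' \<or> r a v = v'"
      from key[OF this] show "u = u'" "v = v'" by simp_all
    qed
    then have "insert (y, x) Q = Q" by (rule max) (use Q(2) in auto)
    then have "(y, x) \<in> Q" by (metis insertI1)
    then show False using ny[OF E.one_closed] l1[OF y(1)] by simp
  qed
  define \<beta> where "\<beta> y = (THE x. (y, x) \<in> orb Q)" for y
  have \<beta>: "\<beta> y = x" if "(y, x) \<in> orb Q" for y x
    unfolding \<beta>_def using that uniq by blast
  have \<beta>o: "(y, \<beta> y) \<in> orb Q" if "y \<in> X" for y using dom that \<beta> by blast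
  have "inj_on \<beta> X"
  proof (rule inj_onI)
    fix y y' assume "y \<in> X" "y' \<in> X" "\<beta> y = \<beta> y'"
    then have "(y, \<beta> y) \<in> orb Q" "(y', \<beta> y) \<in> orb Q" using \<beta>o by metis+
    then show "y = y'" by (rule uniq')
  qed
  moreover have "\<beta> ` X \<subseteq> X"
  proof clarify
    fix y assume "y \<in> X"
    then have "(y, \<beta> y) \<in> orb Q" by (rule \<beta>o)
    then obtain a u v where "a \<in> carrier E" "(u, v) \<in> Q" "y = l a u" "\<beta> y = r a v" by (rule orbE)
    then show "\<beta> y \<in> X" using QX rX by auto
  qed
  ultimately have "bij_betw \<beta> X X" using X by (simp add: bij_betw_def endo_inj_surj)
  moreover have "\<beta> (l a y) = r a (\<beta> y)" if a: "a \<in> carrier E" and y: "y \<in> X" for a y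
  proof -
    obtain b u v where b: "b \<in> carrier E" "(u, v) \<in> Q" "y = l b u" "\<beta> y = r b v"
      using \<beta>o[OF y] by (rule orbE)
    have "(l (a \<otimes>\<^bsub>E\<^esub> b) u, r (a \<otimes>\<^bsub>E\<^esub> b) v) \<in> orb Q" using a b unfolding orb_def by blast
    then show ?thesis using \<beta> b a QX[OF b(2)] by (simp add: lm rm)
  qed
  moreover have "\<beta> y = x" if "(y, x) \<in> Pr" for y x
  proof (rule \<beta>)
    have "(y, x) \<in> Q" using that Q by blast
    then have "(l \<one>\<^bsub>E\<^esub> y, r \<one>\<^bsub>E\<^esub> x) \<in> orb Q" unfolding orb_def by blast
    then show "(y, x) \<in> orb Q" using l1 r1 QX[OF \<open>(y, x) \<in> Q\<close>] by simp
  qed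
  ultimately show ?thesis by (intro exI[of _ \<beta>]) auto
qed

section \<open>Fundamental groups of graphs of groups\<close>

text \<open>Since \<open>\<tau>\<close> need not be trivial on a maximal tree, \<open>gog_rep\<close> describes representations of the path group;
  \<open>tree_gauge\<close> below converts them to representations of the fundamental group.\<close>

definition gog_rep :: "('v, 'e, 'a, 'b) graph_of_groups \<Rightarrow> ('h, 'm) monoid_scheme \<Rightarrow>
    ('v \<Rightarrow> 'a \<Rightarrow> 'h) \<Rightarrow> ('e \<Rightarrow> 'h) \<Rightarrow> bool" where
  "gog_rep \<G> H \<theta> \<tau> \<longleftrightarrow>
    (\<forall>v\<in>verts (gog_graph \<G>). \<theta> v \<in> hom (vgroup \<G> v) H) \<and>
    (\<forall>e\<in>arcs (gog_graph \<G>). \<tau> e \<in> carrier H \<and> \<tau> (gog_rev \<G> e) = inv\<^bsub>H\<^esub> \<tau> e \<and>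
      (\<forall>a\<in>carrier (egroup \<G> e).
        \<tau> e \<otimes>\<^bsub>H\<^esub> \<theta> (head (gog_graph \<G>) e) (emono_omega \<G> e a) =
        \<theta> (tail (gog_graph \<G>) e) (emono \<G> e a) \<otimes>\<^bsub>H\<^esub> \<tau> e))"

text \<open>A path stands for the product \<open>t_e1 g1 t_e2 g2 ...\<close> with each
  \<open>gi\<close> at the head of its edge. No element is kept at the starting vertex: for a
  nonempty closed path it can be moved to the end by conjugation.\<close>

fun path_eval :: "('v, 'e, 'a, 'b) graph_of_groups \<Rightarrow> ('h, 'm) monoid_scheme \<Rightarrow>
    ('v \<Rightarrow> 'a \<Rightarrow> 'h) \<Rightarrow> ('e \<Rightarrow> 'h) \<Rightarrow> ('e \<times> 'a) list \<Rightarrow> 'h" where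
  "path_eval \<G> H \<theta> \<tau> [] = \<one>\<^bsub>H\<^esub>"
| "path_eval \<G> H \<theta> \<tau> ((e, g) # p) =
    \<tau> e \<otimes>\<^bsub>H\<^esub> (\<theta> (head (gog_graph \<G>) e) g \<otimes>\<^bsub>H\<^esub> path_eval \<G> H \<theta> \<tau> p)"

fun gog_path :: "('v, 'e, 'a, 'b) graph_of_groups \<Rightarrow> 'v \<Rightarrow> ('e \<times> 'a) list \<Rightarrow> 'v \<Rightarrow> bool" where
  "gog_path \<G> u [] v \<longleftrightarrow> u = v \<and> u \<in> verts (gog_graph \<G>)"
| "gog_path \<G> u ((e, g) # p) v \<longleftrightarrow> e \<in> arcs (gog_graph \<G>) \<and> tail (gog_graph \<G>) e = u \<and>
    g \<in> carrier (vgroup \<G> (head (gog_graph \<G>) e)) \<and> gog_path \<G> (head (gog_graph \<G>) e) p v"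

locale gog =
  fixes \<G> :: "('v, 'e, 'a, 'b) graph_of_groups"
    and T :: "('v, 'e) pre_digraph"
    and P :: "'e set"
  assumes fg: "finite_graph_of_groups \<G>"
    and mt: "maximal_tree (gog_graph \<G>) (gog_rev \<G>) T"
    and ori: "serre_orientation (gog_graph \<G>) (gog_rev \<G>) P"
begin

abbreviation "V \<equiv> verts (gog_graph \<G>)"
abbreviation "E \<equiv> arcs (gog_graph \<G>)"
abbreviation "hd\<^sub>\<Gamma> \<equiv> head (gog_graph \<G>)"
abbreviation "tl\<^sub>\<Gamma> \<equiv> tail (gog_graph \<G>)"
abbreviation "rv \<equiv> gog_rev \<G>"
abbreviation "Gv \<equiv> vgroup \<G>"
abbreviation "Ge \<equiv> egroup \<G>"
abbreviation "al \<equiv> emono \<G>"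
abbreviation "om \<equiv> emono_omega \<G>"

sublocale \<Gamma>: bidirected_digraph "gog_graph \<G>" rv
  using fg by (simp add: finite_graph_of_groups_def)

sublocale \<Gamma>: fin_digraph "gog_graph \<G>"
  using fg by (simp add: finite_graph_of_groups_def)

lemma group_Gv: "v \<in> V \<Longrightarrow> group (Gv v)"
  using fg by (simp add: finite_graph_of_groups_def)

lemma group_Ge: "e \<in> E \<Longrightarrow> group (Ge e)"
  using fg by (simp add: finite_graph_of_groups_def)

lemma Ge_rv: "e \<in> E \<Longrightarrow> Ge (rv e) = Ge e"
  using fg by (simp add: finite_graph_of_groups_def)

lemma al_mon: "e \<in> E \<Longrightarrow> al e \<in> mon (Ge e) (Gv (tl\<^sub>\<Gamma> e))"
  using fg by (simp add: finite_graph_of_groups_def)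

lemma om_mon: "e \<in> E \<Longrightarrow> om e \<in> mon (Ge e) (Gv (hd\<^sub>\<Gamma> e))"
  using al_mon[of "rv e"] by (simp add: Ge_rv emono_omega_def)

lemma al_hom: "e \<in> E \<Longrightarrow> al e \<in> hom (Ge e) (Gv (tl\<^sub>\<Gamma> e))"
  using al_mon by (simp add: mon_def)

lemma om_hom: "e \<in> E \<Longrightarrow> om e \<in> hom (Ge e) (Gv (hd\<^sub>\<Gamma> e))"
  using om_mon by (simp add: mon_def)

lemma al_closed: "e \<in> E \<Longrightarrow> a \<in> carrier (Ge e) \<Longrightarrow> al e a \<in> carrier (Gv (tl\<^sub>\<Gamma> e))"
  by (rule hom_in_carrier[OF al_hom])

lemma om_closed: "e \<in> E \<Longrightarrow> a \<in> carrier (Ge e) \<Longrightarrow> om e a \<in> carrier (Gv (hd\<^sub>\<Gamma> e))"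
  by (rule hom_in_carrier[OF om_hom])

lemma om_rv: "om (rv e) = al e"
  by (simp add: emono_omega_def)

lemma al_rv: "al (rv e) = om e"
  by (simp add: emono_omega_def)

lemma serre_T: "serre_tree rv T" and subgraph_T: "subgraph T (gog_graph \<G>)"
  using mt by (simp_all add: maximal_tree_def \<Gamma>.max_subgraph_def)

lemma verts_T: "verts T = V"
  using maximal_tree_spanning[OF \<Gamma>.bidirected_digraph _ mt] fg by (simp add: finite_graph_of_groups_def)

lemma T_ends: "head T = hd\<^sub>\<Gamma>" "tail T = tl\<^sub>\<Gamma>" and arcs_T: "arcs T \<subseteq> E"
  using subgraph_T by (auto simp: subgraph_def compatible_def)

lemma rv_arcs_T: "e \<in> arcs T \<Longrightarrow> rv e \<in> arcs T"
proof -
  assume e: "e \<in> arcs T"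
  interpret T: bidirected_digraph T "perm_restrict rv (arcs T)"
    using serre_T by (simp add: serre_tree_def)
  show "rv e \<in> arcs T" using T.arev_in_arcs[OF e] e by (simp add: perm_restrict_def)
qed

lemma rv_arcs_T_iff: "rv e \<in> arcs T \<longleftrightarrow> e \<in> arcs T"
  using rv_arcs_T[of e] rv_arcs_T[of "rv e"] by auto

lemma P_sub: "P \<subseteq> E" and P_cases: "e \<in> E \<Longrightarrow> e \<notin> P \<Longrightarrow> rv e \<in> P"
  and P_rv: "e \<in> P \<Longrightarrow> rv e \<notin> P"
proof -
  show "P \<subseteq> E" using ori by (simp add: serre_orientation_def)
  show "rv e \<in> P" if "e \<in> E" "e \<notin> P" using ori that by (auto simp: serre_orientation_def)
  show "rv e \<notin> P" if "e \<in> P" using ori that by (auto simp: serre_orientation_def)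
qed

text \<open>The relation of an inverse edge is that of its partner, solved for the other side, so
  the positively oriented edges suffice.\<close>

lemma gog_repI:
  assumes H: "group H" and \<theta>: "\<And>v. v \<in> V \<Longrightarrow> \<theta> v \<in> hom (Gv v) H"
    and \<tau>: "\<And>e. e \<in> P \<Longrightarrow> \<tau> e \<in> carrier H"
    and rel: "\<And>e a. e \<in> P \<Longrightarrow> a \<in> carrier (Ge e) \<Longrightarrow>
      \<tau> e \<otimes>\<^bsub>H\<^esub> \<theta> (hd\<^sub>\<Gamma> e) (om e a) = \<theta> (tl\<^sub>\<Gamma> e) (al e a) \<otimes>\<^bsub>H\<^esub> \<tau> e"
  shows "gog_rep \<G> H \<theta> (\<lambda>e. if e \<in> P then \<tau> e else inv\<^bsub>H\<^esub> \<tau> (rv e))"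
proof -
  interpret H: group H by fact
  let ?\<tau> = "\<lambda>e. if e \<in> P then \<tau> e else inv\<^bsub>H\<^esub> \<tau> (rv e)"
  have "?\<tau> e \<in> carrier H \<and> ?\<tau> (rv e) = inv\<^bsub>H\<^esub> ?\<tau> e \<and>
      (\<forall>a\<in>carrier (Ge e). ?\<tau> e \<otimes>\<^bsub>H\<^esub> \<theta> (hd\<^sub>\<Gamma> e) (om e a) = \<theta> (tl\<^sub>\<Gamma> e) (al e a) \<otimes>\<^bsub>H\<^esub> ?\<tau> e)"
    if e: "e \<in> E" for e
  proof (cases "e \<in> P")
    case True
    then show ?thesis using P_rv[OF True] \<tau>[OF True] rel[OF True] by simp
  next
    case False
    have r: "rv e \<in> P" using P_cases[OF e False] .
    have "inv\<^bsub>H\<^esub> \<tau> (rv e) \<otimes>\<^bsub>H\<^esub> \<theta> (hd\<^sub>\<Gamma> e) (om e a) = \<theta> (tl\<^sub>\<Gamma> e) (al e a) \<otimes>\<^bsub>H\<^esub> inv\<^bsub>H\<^esub> \<tau> (rv e)"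
      if a: "a \<in> carrier (Ge e)" for a
    proof -
      have c: "\<theta> (hd\<^sub>\<Gamma> e) (om e a) \<in> carrier H" "\<theta> (tl\<^sub>\<Gamma> e) (al e a) \<in> carrier H"
        using hom_in_carrier[OF \<theta> om_closed[OF e a]] hom_in_carrier[OF \<theta> al_closed[OF e a]] e by auto
      have "\<tau> (rv e) \<otimes>\<^bsub>H\<^esub> \<theta> (tl\<^sub>\<Gamma> e) (al e a) = \<theta> (hd\<^sub>\<Gamma> e) (om e a) \<otimes>\<^bsub>H\<^esub> \<tau> (rv e)"
        using rel[OF r, of a] a e by (simp add: Ge_rv om_rv al_rv)
      then have "\<theta> (tl\<^sub>\<Gamma> e) (al e a) = inv\<^bsub>H\<^esub> \<tau> (rv e) \<otimes>\<^bsub>H\<^esub> (\<theta> (hd\<^sub>\<Gamma> e) (om e a) \<otimes>\<^bsub>H\<^esub> \<tau> (rv e))"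
        using c \<tau>[OF r] H.inv_solve_left by (metis H.m_closed)
      then show ?thesis using c \<tau>[OF r] by (simp add: H.m_assoc)
    qed
    then show ?thesis using False r \<tau>[OF r] by simp
  qed
  then show ?thesis using \<theta> unfolding gog_rep_def by simp
qed

section \<open>The fundamental group and the homomorphisms out of it\<close>

definition "G = fund_group \<G> T P"
definition "vert = fund_vert \<G> T P"
definition "stab e = (if e \<in> P then word_class (fund_gens \<G> P) (fund_rels \<G> T P) [(Stable e, True)]
  else inv\<^bsub>G\<^esub> (word_class (fund_gens \<G> P) (fund_rels \<G> T P) [(Stable (rv e), True)]))"

abbreviation "cls \<equiv> word_class (fund_gens \<G> P) (fund_rels \<G> T P)"
abbreviation "wds \<equiv> lists (fund_gens \<G> P \<times> (UNIV :: bool set))"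

lemma group_G: "group G"
  by (simp add: G_def fund_group_def group_presented_group)

lemma cls_mult: "u \<in> wds \<Longrightarrow> w \<in> wds \<Longrightarrow> cls u \<otimes>\<^bsub>G\<^esub> cls w = cls (u @ w)"
  unfolding G_def fund_group_def by (rule word_class_mult)

lemma cls_closed: "u \<in> wds \<Longrightarrow> cls u \<in> carrier G"
  unfolding G_def fund_group_def presented_group_def by simp

lemma cls_Nil: "cls [] = \<one>\<^bsub>G\<^esub>"
  unfolding G_def fund_group_def presented_group_def by simp

lemma carrier_G: "carrier G = cls ` wds"
  unfolding G_def fund_group_def presented_group_def by simp

lemma cls_rel: "(l, r) \<in> fund_rels \<G> T P \<Longrightarrow> l \<in> wds \<Longrightarrow> r \<in> wds \<Longrightarrow> cls l = cls r"
  using presented_eq.rel[of "[]" "fund_gens \<G> P" "[]" l r "fund_rels \<G> T P"]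
  by (simp add: word_class_eq_iff)

lemma gen_Vert: "v \<in> V \<Longrightarrow> g \<in> carrier (Gv v) \<Longrightarrow> Vert v g \<in> fund_gens \<G> P"
  by (simp add: fund_gens_def)

lemma gen_Stable: "e \<in> P \<Longrightarrow> Stable e \<in> fund_gens \<G> P"
  by (simp add: fund_gens_def)

lemma cls_inv: "x \<in> fund_gens \<G> P \<Longrightarrow> cls [(x, False)] = inv\<^bsub>G\<^esub> cls [(x, True)]"
proof -
  assume x: "x \<in> fund_gens \<G> P"
  interpret G: group G by (rule group_G)
  have w: "[(x, b)] \<in> wds" for b using x by simp
  have "presented_eq (fund_gens \<G> P) (fund_rels \<G> T P) ([] @ [(x, False), (x, \<not> False)] @ []) ([] @ [])"
    by (rule presented_eq.cancel) (use x in auto)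
  then have "cls [(x, False), (x, True)] = cls []"
    using x by (subst word_class_eq_iff) auto
  then have "cls [(x, False)] \<otimes>\<^bsub>G\<^esub> cls [(x, True)] = \<one>\<^bsub>G\<^esub>"
    using cls_mult[OF w w, of False True] by (simp add: cls_Nil)
  then show ?thesis using G.inv_equality cls_closed[OF w] by metis
qed

lemma vert_hom: "v \<in> V \<Longrightarrow> vert v \<in> hom (Gv v) G"
proof (rule homI)
  fix g assume v: "v \<in> V" and g: "g \<in> carrier (Gv v)"
  show "vert v g \<in> carrier G"
    unfolding vert_def fund_vert_def by (rule cls_closed) (use gen_Vert[OF v g] in simp)
next
  fix g h assume v: "v \<in> V" and g: "g \<in> carrier (Gv v)" and h: "h \<in> carrier (Gv v)"
  interpret Gv: group "Gv v" by (rule group_Gv[OF v])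
  have w: "[(Vert v g, True)] \<in> wds" "[(Vert v h, True)] \<in> wds"
    "[(Vert v g, True), (Vert v h, True)] \<in> wds" "[(Vert v (g \<otimes>\<^bsub>Gv v\<^esub> h), True)] \<in> wds"
    using gen_Vert[OF v g] gen_Vert[OF v h] gen_Vert[OF v Gv.m_closed[OF g h]] by simp_all
  have "([(Vert v g, True), (Vert v h, True)], [(Vert v (g \<otimes>\<^bsub>Gv v\<^esub> h), True)]) \<in> fund_rels \<G> T P"
    unfolding fund_rels_def using v g h by blast
  from cls_rel[OF this w(3,4)] cls_mult[OF w(1,2)]
  show "vert v (g \<otimes>\<^bsub>Gv v\<^esub> h) = vert v g \<otimes>\<^bsub>G\<^esub> vert v h"
    unfolding vert_def fund_vert_def by simp
qed

lemma gog_rep_G: "gog_rep \<G> G vert stab"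
proof -
  interpret G: group G by (rule group_G)
  have "gog_rep \<G> G vert (\<lambda>e. if e \<in> P then cls [(Stable e, True)]
    else inv\<^bsub>G\<^esub> ((\<lambda>e. cls [(Stable e, True)]) (rv e)))"
  proof (rule gog_repI[OF group_G vert_hom])
    fix e assume e: "e \<in> P"
    then show "cls [(Stable e, True)] \<in> carrier G" using gen_Stable by (intro cls_closed) simp
    fix a assume a: "a \<in> carrier (Ge e)"
    have eE: "e \<in> E" using e P_sub by blast
    let ?t = "(Stable e, True)" and ?t' = "(Stable e, False)"
      and ?o = "(Vert (hd\<^sub>\<Gamma> e) (om e a), True)" and ?a = "(Vert (tl\<^sub>\<Gamma> e) (al e a), True)"
    have gs: "Stable e \<in> fund_gens \<G> P" "Vert (hd\<^sub>\<Gamma> e) (om e a) \<in> fund_gens \<G> P"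
      "Vert (tl\<^sub>\<Gamma> e) (al e a) \<in> fund_gens \<G> P"
      using gen_Stable[OF e] gen_Vert[OF _ om_closed[OF eE a]] gen_Vert[OF _ al_closed[OF eE a]] eE by auto
    have w: "[?t] \<in> wds" "[?o] \<in> wds" "[?t'] \<in> wds" "[?a] \<in> wds" "[?o, ?t'] \<in> wds" "[?t, ?o, ?t'] \<in> wds"
      using gs by simp_all
    have "([?t, ?o, ?t'], [?a]) \<in> fund_rels \<G> T P"
      unfolding fund_rels_def using e a by blast
    from cls_rel[OF this w(6,4)]
    have "cls [?t] \<otimes>\<^bsub>G\<^esub> (cls [?o] \<otimes>\<^bsub>G\<^esub> inv\<^bsub>G\<^esub> cls [?t]) = cls [?a]"
      using cls_mult[OF w(2,3)] cls_mult[OF w(1,5)] cls_inv[OF gs(1)] by simp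
    then show "cls [?t] \<otimes>\<^bsub>G\<^esub> vert (hd\<^sub>\<Gamma> e) (om e a) = vert (tl\<^sub>\<Gamma> e) (al e a) \<otimes>\<^bsub>G\<^esub> cls [?t]"
      using cls_closed[OF w(1)] cls_closed[OF w(2)] cls_closed[OF w(4)]
      unfolding vert_def fund_vert_def by (metis G.inv_closed G.inv_solve_right G.m_assoc G.m_closed)
  qed
  then show ?thesis unfolding stab_def[abs_def] by simp
qed

lemma stab_T: "e \<in> arcs T \<Longrightarrow> stab e = \<one>\<^bsub>G\<^esub>"
proof -
  interpret G: group G by (rule group_G)
  have *: "cls [(Stable e, True)] = \<one>\<^bsub>G\<^esub>" if "e \<in> arcs T" "e \<in> P" for e
  proof -
    have "([(Stable e, True)], []) \<in> fund_rels \<G> T P" unfolding fund_rels_def using that by blast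
    then show ?thesis using cls_rel gen_Stable[OF that(2)] by (fastforce simp: cls_Nil)
  qed
  assume e: "e \<in> arcs T"
  show ?thesis
  proof (cases "e \<in> P")
    case True
    then show ?thesis using *[OF e] by (simp add: stab_def)
  next
    case False
    then have "rv e \<in> P" using P_cases e arcs_T by blast
    then show ?thesis using False *[OF rv_arcs_T[OF e]] by (simp add: stab_def)
  qed
qed

text \<open>A tree has no circuit around which the values \<open>\<tau>\<close> could disagree, so
  \<open>l\<close> can be transported from a root, where it is 1.\<close>

lemma tree_gauge:
  assumes H: "group H" and \<tau>: "\<And>e. e \<in> arcs T \<Longrightarrow> \<tau> e \<in> carrier H"
    "\<And>e. e \<in> arcs T \<Longrightarrow> \<tau> (rv e) = inv\<^bsub>H\<^esub> \<tau> e"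
  shows "\<exists>l. (\<forall>v\<in>V. l v \<in> carrier H) \<and> (\<forall>e\<in>arcs T. l (hd\<^sub>\<Gamma> e) = l (tl\<^sub>\<Gamma> e) \<otimes>\<^bsub>H\<^esub> \<tau> e)"
proof -
  interpret H: group H by fact
  have "V \<noteq> {}" using fg by (simp add: finite_graph_of_groups_def strongly_connected_def)
  then obtain v0 where v0: "v0 \<in> verts T" using verts_T by blast
  have "\<exists>l. l v0 = \<one>\<^bsub>H\<^esub> \<and> (\<forall>v\<in>verts T. l v \<in> carrier H) \<and>
    (\<forall>e\<in>arcs T. l (tail T e) \<in> carrier H \<and> l (head T e) = l (tail T e) \<otimes>\<^bsub>H\<^esub> \<tau> e)"
  proof (rule serre_tree_labelling[OF serre_T _ v0])
    show "finite (verts T)" by (simp add: verts_T)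
  next
    fix e y z assume e: "e \<in> arcs T" and yz: "y \<in> carrier H \<and> z = y \<otimes>\<^bsub>H\<^esub> \<tau> e"
    then show "z \<in> carrier H \<and> y = z \<otimes>\<^bsub>H\<^esub> \<tau> (rv e)"
      using \<tau>[OF e] by (simp add: H.m_assoc)
  next
    fix e y assume "e \<in> arcs T" "y \<in> carrier H"
    then show "\<exists>z. z \<in> carrier H \<and> y \<in> carrier H \<and> z = y \<otimes>\<^bsub>H\<^esub> \<tau> e" using \<tau> by simp
  qed simp
  then show ?thesis unfolding verts_T T_ends by blast
qed

text \<open>With the gauge \<open>l\<close> of \<open>tree_gauge\<close>, the modified stable
  letters are 1 on \<open>T\<close>, and conjugating each vertex group by its \<open>l v\<close>
  preserves the edge relations. Hence every representation of the path group induces a homomorphism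
  of \<open>G\<close> that agrees with it on each vertex group up to conjugation, which affects
  neither kernels nor the weights of fixed points.\<close>

lemma rep_to_hom:
  assumes H: "group H" and rep: "gog_rep \<G> H \<theta> \<tau>"
  shows "\<exists>\<Phi>\<in>hom G H. \<exists>l. (\<forall>v\<in>V. l v \<in> carrier H) \<and>
    (\<forall>v\<in>V. \<forall>g\<in>carrier (Gv v). \<Phi> (vert v g) = l v \<otimes>\<^bsub>H\<^esub> \<theta> v g \<otimes>\<^bsub>H\<^esub> inv\<^bsub>H\<^esub> l v) \<and>
    (\<forall>e\<in>E. \<Phi> (stab e) = l (tl\<^sub>\<Gamma> e) \<otimes>\<^bsub>H\<^esub> \<tau> e \<otimes>\<^bsub>H\<^esub> inv\<^bsub>H\<^esub> l (hd\<^sub>\<Gamma> e))"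
proof -
  interpret H: group H by fact
  have \<theta>: "\<theta> v \<in> hom (Gv v) H" if "v \<in> V" for v using rep that by (simp add: gog_rep_def)
  have \<tau>: "\<tau> e \<in> carrier H" "\<tau> (rv e) = inv\<^bsub>H\<^esub> \<tau> e" if "e \<in> E" for e using rep that by (simp_all add: gog_rep_def)
  have rel: "\<tau> e \<otimes>\<^bsub>H\<^esub> \<theta> (hd\<^sub>\<Gamma> e) (om e a) = \<theta> (tl\<^sub>\<Gamma> e) (al e a) \<otimes>\<^bsub>H\<^esub> \<tau> e"
    if "e \<in> E" "a \<in> carrier (Ge e)" for e a using rep that by (simp add: gog_rep_def)
  have \<theta>c: "\<theta> v g \<in> carrier H" if "v \<in> V" "g \<in> carrier (Gv v)" for v g
    using hom_in_carrier[OF \<theta>[OF that(1)] that(2)] .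
  have can: "inv\<^bsub>H\<^esub> x \<otimes>\<^bsub>H\<^esub> (x \<otimes>\<^bsub>H\<^esub> y) = y" "x \<otimes>\<^bsub>H\<^esub> (inv\<^bsub>H\<^esub> x \<otimes>\<^bsub>H\<^esub> y) = y"
    if "x \<in> carrier H" "y \<in> carrier H" for x y using that by (simp_all add: H.m_assoc[symmetric])
  obtain l where l: "\<And>v. v \<in> V \<Longrightarrow> l v \<in> carrier H"
    and lT: "\<And>e. e \<in> arcs T \<Longrightarrow> l (hd\<^sub>\<Gamma> e) = l (tl\<^sub>\<Gamma> e) \<otimes>\<^bsub>H\<^esub> \<tau> e"
    using tree_gauge[OF H, of \<tau>] \<tau> arcs_T by blast
  define \<phi> where "\<phi> x = (case x of Vert v g \<Rightarrow> l v \<otimes>\<^bsub>H\<^esub> \<theta> v g \<otimes>\<^bsub>H\<^esub> inv\<^bsub>H\<^esub> l v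
    | Stable e \<Rightarrow> l (tl\<^sub>\<Gamma> e) \<otimes>\<^bsub>H\<^esub> \<tau> e \<otimes>\<^bsub>H\<^esub> inv\<^bsub>H\<^esub> l (hd\<^sub>\<Gamma> e))" for x
  have \<phi>V: "\<phi> (Vert v g) \<in> carrier H" if "v \<in> V" "g \<in> carrier (Gv v)" for v g
    using l[OF that(1)] \<theta>c[OF that] by (simp add: \<phi>_def)
  have \<phi>S: "\<phi> (Stable e) \<in> carrier H" if "e \<in> E" for e
    using l[OF \<Gamma>.head_in_verts[OF that]] l[OF \<Gamma>.tail_in_verts[OF that]] \<tau>[OF that] by (simp add: \<phi>_def)
  have \<phi>c: "\<phi> ` fund_gens \<G> P \<subseteq> carrier H"
    using \<phi>V \<phi>S P_sub by (auto simp: fund_gens_def)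
  have rels: "word_eval H \<phi> u = word_eval H \<phi> w" if uw: "(u, w) \<in> fund_rels \<G> T P" for u w
    using uw unfolding fund_rels_def
  proof (elim UnE CollectE exE conjE)
    fix v g h assume e: "(u, w) = ([(Vert v g, True), (Vert v h, True)], [(Vert v (g \<otimes>\<^bsub>Gv v\<^esub> h), True)])"
      and v: "v \<in> V" "g \<in> carrier (Gv v)" "h \<in> carrier (Gv v)"
    have "(l v \<otimes>\<^bsub>H\<^esub> \<theta> v g \<otimes>\<^bsub>H\<^esub> inv\<^bsub>H\<^esub> l v) \<otimes>\<^bsub>H\<^esub> (l v \<otimes>\<^bsub>H\<^esub> \<theta> v h \<otimes>\<^bsub>H\<^esub> inv\<^bsub>H\<^esub> l v) =
      l v \<otimes>\<^bsub>H\<^esub> (\<theta> v g \<otimes>\<^bsub>H\<^esub> \<theta> v h) \<otimes>\<^bsub>H\<^esub> inv\<^bsub>H\<^esub> l v"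
      using l[OF v(1)] \<theta>c[OF v(1,2)] \<theta>c[OF v(1,3)]
      by (simp add: H.m_assoc can)
    moreover have "\<theta> v (g \<otimes>\<^bsub>Gv v\<^esub> h) = \<theta> v g \<otimes>\<^bsub>H\<^esub> \<theta> v h"
      using hom_mult[OF \<theta>[OF v(1)] v(2,3)] .
    ultimately show ?thesis
      using e v \<phi>V[OF v(1,2)] \<phi>V[OF v(1,3)] l[OF v(1)] \<theta>c[OF v(1,2)] \<theta>c[OF v(1,3)] by (simp add: \<phi>_def)
  next
    fix e a assume u: "(u, w) = ([(Stable e, True), (Vert (hd\<^sub>\<Gamma> e) (om e a), True), (Stable e, False)],
      [(Vert (tl\<^sub>\<Gamma> e) (al e a), True)])" and e: "e \<in> P" "a \<in> carrier (Ge e)"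
    have eE: "e \<in> E" using e P_sub by blast
    note c = l[OF \<Gamma>.head_in_verts[OF eE]] l[OF \<Gamma>.tail_in_verts[OF eE]] \<tau>(1)[OF eE]
      \<theta>c[OF \<Gamma>.head_in_verts[OF eE] om_closed[OF eE e(2)]] \<theta>c[OF \<Gamma>.tail_in_verts[OF eE] al_closed[OF eE e(2)]]
    let ?h = "l (hd\<^sub>\<Gamma> e)" and ?t = "l (tl\<^sub>\<Gamma> e)"
    have "(?t \<otimes>\<^bsub>H\<^esub> \<tau> e \<otimes>\<^bsub>H\<^esub> inv\<^bsub>H\<^esub> ?h) \<otimes>\<^bsub>H\<^esub> ((?h \<otimes>\<^bsub>H\<^esub> \<theta> (hd\<^sub>\<Gamma> e) (om e a) \<otimes>\<^bsub>H\<^esub> inv\<^bsub>H\<^esub> ?h) \<otimes>\<^bsub>H\<^esub>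
        inv\<^bsub>H\<^esub> (?t \<otimes>\<^bsub>H\<^esub> \<tau> e \<otimes>\<^bsub>H\<^esub> inv\<^bsub>H\<^esub> ?h)) =
      ?t \<otimes>\<^bsub>H\<^esub> ((\<tau> e \<otimes>\<^bsub>H\<^esub> \<theta> (hd\<^sub>\<Gamma> e) (om e a)) \<otimes>\<^bsub>H\<^esub> (inv\<^bsub>H\<^esub> \<tau> e \<otimes>\<^bsub>H\<^esub> inv\<^bsub>H\<^esub> ?t))"
      using c by (simp add: H.m_assoc can H.inv_mult_group)
    also have "\<dots> = ?t \<otimes>\<^bsub>H\<^esub> \<theta> (tl\<^sub>\<Gamma> e) (al e a) \<otimes>\<^bsub>H\<^esub> inv\<^bsub>H\<^esub> ?t"
      unfolding rel[OF eE e(2)] using c by (simp add: H.m_assoc can)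
    finally show ?thesis using u c by (simp add: \<phi>_def)
  next
    fix f assume u: "(u, w) = ([(Stable f, True)], [])" and f: "f \<in> arcs T \<inter> P"
    have fE: "f \<in> E" using f P_sub by blast
    show ?thesis
      using u lT[of f] f \<phi>S[OF fE] l[OF \<Gamma>.tail_in_verts[OF fE]] \<tau>(1)[OF fE] by (simp add: \<phi>_def)
  qed
  have "\<exists>\<Phi>\<in>hom G H. \<forall>w\<in>wds. \<Phi> (cls w) = word_eval H \<phi> w"
    unfolding G_def fund_group_def by (rule presented_group_universal[OF H \<phi>c]) (rule rels)
  then obtain \<Phi> where \<Phi>: "\<Phi> \<in> hom G H" "\<And>w. w \<in> wds \<Longrightarrow> \<Phi> (cls w) = word_eval H \<phi> w"
    by (elim bexE) metis
  have \<Phi>V: "\<Phi> (vert v g) = l v \<otimes>\<^bsub>H\<^esub> \<theta> v g \<otimes>\<^bsub>H\<^esub> inv\<^bsub>H\<^esub> l v" if "v \<in> V" "g \<in> carrier (Gv v)" for v g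
    using \<Phi>(2)[of "[(Vert v g, True)]"] gen_Vert[OF that] \<phi>V[OF that]
    unfolding vert_def fund_vert_def by (simp add: \<phi>_def)
  have \<Phi>P: "\<Phi> (cls [(Stable e, True)]) = l (tl\<^sub>\<Gamma> e) \<otimes>\<^bsub>H\<^esub> \<tau> e \<otimes>\<^bsub>H\<^esub> inv\<^bsub>H\<^esub> l (hd\<^sub>\<Gamma> e)" if "e \<in> P" for e
    using \<Phi>(2)[of "[(Stable e, True)]"] gen_Stable[OF that] \<phi>S[of e] that P_sub by (auto simp: \<phi>_def)
  interpret \<Phi>: group_hom G H \<Phi> by (intro group_hom.intro group_hom_axioms.intro group_G H \<Phi>(1))
  have \<Phi>S: "\<Phi> (stab e) = l (tl\<^sub>\<Gamma> e) \<otimes>\<^bsub>H\<^esub> \<tau> e \<otimes>\<^bsub>H\<^esub> inv\<^bsub>H\<^esub> l (hd\<^sub>\<Gamma> e)" if e: "e \<in> E" for e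
  proof (cases "e \<in> P")
    case True
    then show ?thesis using \<Phi>P[OF True] by (simp add: stab_def)
  next
    case False
    have r: "rv e \<in> P" using P_cases[OF e False] .
    have "cls [(Stable (rv e), True)] \<in> carrier G" using gen_Stable[OF r] by (intro cls_closed) simp
    then have "\<Phi> (stab e) = inv\<^bsub>H\<^esub> \<Phi> (cls [(Stable (rv e), True)])" using False by (simp add: stab_def)
    also have "\<dots> = l (tl\<^sub>\<Gamma> e) \<otimes>\<^bsub>H\<^esub> \<tau> e \<otimes>\<^bsub>H\<^esub> inv\<^bsub>H\<^esub> l (hd\<^sub>\<Gamma> e)"
      unfolding \<Phi>P[OF r]
      using e \<tau>[OF e] l[OF \<Gamma>.head_in_verts[OF e]] l[OF \<Gamma>.tail_in_verts[OF e]]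
      by (simp add: H.inv_mult_group H.m_assoc)
    finally show ?thesis .
  qed
  show ?thesis using \<Phi>(1) l \<Phi>V \<Phi>S by blast
qed

lemma gog_path_append: "gog_path \<G> u (p @ q) w \<longleftrightarrow> (\<exists>v. gog_path \<G> u p v \<and> gog_path \<G> v q w)"
proof (induction p arbitrary: u)
  case Nil
  then show ?case by (cases q) auto
next
  case (Cons a p)
  then show ?case by (cases a) auto
qed

lemma gog_path_verts: "gog_path \<G> u p v \<Longrightarrow> u \<in> V \<and> v \<in> V"
  by (induction p arbitrary: u) auto

lemma path_eval_closed:
  assumes H: "group H" and rep: "gog_rep \<G> H \<theta> \<tau>"
  shows "gog_path \<G> u p v \<Longrightarrow> path_eval \<G> H \<theta> \<tau> p \<in> carrier H"
proof (induction p arbitrary: u)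
  case Nil
  then show ?case using group.is_monoid[OF H] by (simp add: monoid.one_closed)
next
  case (Cons a p)
  obtain e g where a: "a = (e, g)" by force
  interpret H: group H by fact
  have "\<theta> (hd\<^sub>\<Gamma> e) g \<in> carrier H" "\<tau> e \<in> carrier H"
    using Cons.prems rep a hom_in_carrier[of "\<theta> (hd\<^sub>\<Gamma> e)" "Gv (hd\<^sub>\<Gamma> e)" H g] by (auto simp: gog_rep_def)
  then show ?case using Cons a by auto
qed

lemma path_eval_append:
  assumes H: "group H" and rep: "gog_rep \<G> H \<theta> \<tau>"
  shows "gog_path \<G> u p v \<Longrightarrow> gog_path \<G> v q w \<Longrightarrow>
    path_eval \<G> H \<theta> \<tau> (p @ q) = path_eval \<G> H \<theta> \<tau> p \<otimes>\<^bsub>H\<^esub> path_eval \<G> H \<theta> \<tau> q"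
proof (induction p arbitrary: u)
  case Nil
  interpret H: group H by fact
  show ?case using path_eval_closed[OF H rep Nil(2)] by simp
next
  case (Cons a p)
  obtain e g where a: "a = (e, g)" by force
  interpret H: group H by fact
  have p: "gog_path \<G> (hd\<^sub>\<Gamma> e) p v" using Cons.prems a by simp
  have "\<theta> (hd\<^sub>\<Gamma> e) g \<in> carrier H" "\<tau> e \<in> carrier H"
    using Cons.prems rep a hom_in_carrier[of "\<theta> (hd\<^sub>\<Gamma> e)" "Gv (hd\<^sub>\<Gamma> e)" H g] by (auto simp: gog_rep_def)
  then show ?case
    using a Cons.IH[OF p Cons.prems(2)] path_eval_closed[OF H rep p] path_eval_closed[OF H rep Cons.prems(2)]
    by (simp add: H.m_assoc)
qed

text \<open>The gauge factors of consecutive steps cancel, so only those at the two ends of the path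
  remain.\<close>

lemma path_eval_hom:
  assumes H: "group H" and rep: "gog_rep \<G> H \<theta> \<tau>" and \<Phi>: "\<Phi> \<in> hom G H"
    and l: "\<forall>v\<in>V. l v \<in> carrier H"
    and V: "\<forall>v\<in>V. \<forall>g\<in>carrier (Gv v). \<Phi> (vert v g) = l v \<otimes>\<^bsub>H\<^esub> \<theta> v g \<otimes>\<^bsub>H\<^esub> inv\<^bsub>H\<^esub> l v"
    and S: "\<forall>e\<in>E. \<Phi> (stab e) = l (tl\<^sub>\<Gamma> e) \<otimes>\<^bsub>H\<^esub> \<tau> e \<otimes>\<^bsub>H\<^esub> inv\<^bsub>H\<^esub> l (hd\<^sub>\<Gamma> e)"
  shows "gog_path \<G> u p v \<Longrightarrow>
    \<Phi> (path_eval \<G> G vert stab p) = l u \<otimes>\<^bsub>H\<^esub> path_eval \<G> H \<theta> \<tau> p \<otimes>\<^bsub>H\<^esub> inv\<^bsub>H\<^esub> l v"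
proof (induction p arbitrary: u)
  case Nil
  interpret H: group H by fact
  interpret \<Phi>: group_hom G H \<Phi> by (intro group_hom.intro group_hom_axioms.intro group_G H \<Phi>)
  show ?case using Nil l by (auto simp: \<Phi>.hom_one)
next
  case (Cons a p)
  obtain e g where a: "a = (e, g)" by force
  interpret H: group H by fact
  interpret \<Phi>: group_hom G H \<Phi> by (intro group_hom.intro group_hom_axioms.intro group_G H \<Phi>)
  have p: "gog_path \<G> (hd\<^sub>\<Gamma> e) p v" and e: "e \<in> E" "u = tl\<^sub>\<Gamma> e" "g \<in> carrier (Gv (hd\<^sub>\<Gamma> e))"
    using Cons.prems a by auto
  have c: "\<theta> (hd\<^sub>\<Gamma> e) g \<in> carrier H" "\<tau> e \<in> carrier H" "l (hd\<^sub>\<Gamma> e) \<in> carrier H" "l (tl\<^sub>\<Gamma> e) \<in> carrier H"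
    "l v \<in> carrier H" "path_eval \<G> H \<theta> \<tau> p \<in> carrier H"
    using e rep l hom_in_carrier[of "\<theta> (hd\<^sub>\<Gamma> e)" "Gv (hd\<^sub>\<Gamma> e)" H g] gog_path_verts[OF p]
      path_eval_closed[OF H rep p] by (auto simp: gog_rep_def)
  have cG: "vert (hd\<^sub>\<Gamma> e) g \<in> carrier G" "stab e \<in> carrier G" "path_eval \<G> G vert stab p \<in> carrier G"
    using e hom_in_carrier[OF vert_hom e(3)] gog_rep_G path_eval_closed[OF group_G gog_rep_G p]
    by (auto simp: gog_rep_def)
  have can: "inv\<^bsub>H\<^esub> x \<otimes>\<^bsub>H\<^esub> (x \<otimes>\<^bsub>H\<^esub> y) = y"
    if "x \<in> carrier H" "y \<in> carrier H" for x y using that by (simp add: H.m_assoc[symmetric])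
  have "\<Phi> (path_eval \<G> G vert stab (a # p)) =
    \<Phi> (stab e) \<otimes>\<^bsub>H\<^esub> (\<Phi> (vert (hd\<^sub>\<Gamma> e) g) \<otimes>\<^bsub>H\<^esub> \<Phi> (path_eval \<G> G vert stab p))"
    using a cG by simp
  also have "\<Phi> (stab e) = l (tl\<^sub>\<Gamma> e) \<otimes>\<^bsub>H\<^esub> \<tau> e \<otimes>\<^bsub>H\<^esub> inv\<^bsub>H\<^esub> l (hd\<^sub>\<Gamma> e)" using S e by blast
  also have "\<Phi> (vert (hd\<^sub>\<Gamma> e) g) = l (hd\<^sub>\<Gamma> e) \<otimes>\<^bsub>H\<^esub> \<theta> (hd\<^sub>\<Gamma> e) g \<otimes>\<^bsub>H\<^esub> inv\<^bsub>H\<^esub> l (hd\<^sub>\<Gamma> e)"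
    using V e by simp
  finally show ?case using Cons.IH[OF p] a e(2) c by (simp add: H.m_assoc can)
qed

section \<open>Conjugacy and cyclically reduced paths\<close>

definition conj_to :: "('v, 'e, 'a) gog_gen word set \<Rightarrow> ('v, 'e, 'a) gog_gen word set \<Rightarrow> bool" where
  "conj_to g h \<longleftrightarrow> (\<exists>u\<in>carrier G. g = u \<otimes>\<^bsub>G\<^esub> h \<otimes>\<^bsub>G\<^esub> inv\<^bsub>G\<^esub> u)"

lemma conj_to_refl: "g \<in> carrier G \<Longrightarrow> conj_to g g"
proof -
  assume g: "g \<in> carrier G"
  interpret G: group G by (rule group_G)
  show ?thesis unfolding conj_to_def using g by (intro bexI[of _ "\<one>\<^bsub>G\<^esub>"]) simp_all
qed

lemma conj_to_trans: "conj_to g h \<Longrightarrow> conj_to h k \<Longrightarrow> k \<in> carrier G \<Longrightarrow> conj_to g k"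
proof -
  assume a: "conj_to g h" "conj_to h k" "k \<in> carrier G"
  interpret G: group G by (rule group_G)
  obtain u w where u: "u \<in> carrier G" "g = u \<otimes>\<^bsub>G\<^esub> h \<otimes>\<^bsub>G\<^esub> inv\<^bsub>G\<^esub> u"
    "w \<in> carrier G" "h = w \<otimes>\<^bsub>G\<^esub> k \<otimes>\<^bsub>G\<^esub> inv\<^bsub>G\<^esub> w" using a(1,2) unfolding conj_to_def by blast
  then have "g = (u \<otimes>\<^bsub>G\<^esub> w) \<otimes>\<^bsub>G\<^esub> k \<otimes>\<^bsub>G\<^esub> inv\<^bsub>G\<^esub> (u \<otimes>\<^bsub>G\<^esub> w)"
    using a(3) by (simp add: G.m_assoc G.inv_mult_group)
  then show ?thesis unfolding conj_to_def using u(1,3) by blast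
qed

lemma conj_to_swap: "x \<in> carrier G \<Longrightarrow> y \<in> carrier G \<Longrightarrow> conj_to (x \<otimes>\<^bsub>G\<^esub> y) (y \<otimes>\<^bsub>G\<^esub> x)"
proof -
  assume a: "x \<in> carrier G" "y \<in> carrier G"
  interpret G: group G by (rule group_G)
  have "x \<otimes>\<^bsub>G\<^esub> y = x \<otimes>\<^bsub>G\<^esub> (y \<otimes>\<^bsub>G\<^esub> x) \<otimes>\<^bsub>G\<^esub> inv\<^bsub>G\<^esub> x" using a by (simp add: G.m_assoc)
  then show ?thesis unfolding conj_to_def using a by blast
qed

abbreviation "ev \<equiv> path_eval \<G> G vert stab"

lemma vert_closed: "v \<in> V \<Longrightarrow> x \<in> carrier (Gv v) \<Longrightarrow> vert v x \<in> carrier G"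
  by (rule hom_in_carrier[OF vert_hom])

lemma stab_closed: "e \<in> E \<Longrightarrow> stab e \<in> carrier G"
  using gog_rep_G by (simp add: gog_rep_def)

lemma stab_rv: "e \<in> E \<Longrightarrow> stab (rv e) = inv\<^bsub>G\<^esub> stab e"
  using gog_rep_G by (simp add: gog_rep_def)

lemma stab_rel: "e \<in> E \<Longrightarrow> a \<in> carrier (Ge e) \<Longrightarrow>
    stab e \<otimes>\<^bsub>G\<^esub> vert (hd\<^sub>\<Gamma> e) (om e a) = vert (tl\<^sub>\<Gamma> e) (al e a) \<otimes>\<^bsub>G\<^esub> stab e"
  using gog_rep_G by (simp add: gog_rep_def)

lemma vert_mult: "v \<in> V \<Longrightarrow> x \<in> carrier (Gv v) \<Longrightarrow> y \<in> carrier (Gv v) \<Longrightarrow>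
    vert v (x \<otimes>\<^bsub>Gv v\<^esub> y) = vert v x \<otimes>\<^bsub>G\<^esub> vert v y"
  by (rule hom_mult[OF vert_hom])

lemma vert_one: "v \<in> V \<Longrightarrow> vert v \<one>\<^bsub>Gv v\<^esub> = \<one>\<^bsub>G\<^esub>"
  by (rule hom_one[OF vert_hom group_Gv group_G])

lemma ev_closed: "gog_path \<G> u p v \<Longrightarrow> ev p \<in> carrier G"
  by (rule path_eval_closed[OF group_G gog_rep_G])

lemma ev_append: "gog_path \<G> u p v \<Longrightarrow> gog_path \<G> v q w \<Longrightarrow> ev (p @ q) = ev p \<otimes>\<^bsub>G\<^esub> ev q"
  by (rule path_eval_append[OF group_G gog_rep_G])

text \<open>The element is multiplied into the last entry of the path. This keeps the length, which
  is what the minimality argument in \<open>conj_normal_form\<close> counts.\<close>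

lemma path_absorb:
  assumes p: "gog_path \<G> u p v" "p \<noteq> []" and y: "y \<in> carrier (Gv v)"
  shows "\<exists>p'. gog_path \<G> u p' v \<and> length p' = length p \<and> ev p' = ev p \<otimes>\<^bsub>G\<^esub> vert v y"
proof -
  interpret G: group G by (rule group_G)
  obtain q e g where q: "p = q @ [(e, g)]" using p(2) by (metis rev_exhaust surj_pair)
  then obtain w where w: "gog_path \<G> u q w" "gog_path \<G> w [(e, g)] v" using p(1) gog_path_append by blast
  then have e: "e \<in> E" "tl\<^sub>\<Gamma> e = w" "g \<in> carrier (Gv v)" "hd\<^sub>\<Gamma> e = v" "v \<in> V" by auto
  interpret Gv: group "Gv v" by (rule group_Gv[OF e(5)])
  have n: "gog_path \<G> w [(e, g \<otimes>\<^bsub>Gv v\<^esub> y)] v" using e y by simp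
  have "ev (q @ [(e, g \<otimes>\<^bsub>Gv v\<^esub> y)]) = ev p \<otimes>\<^bsub>G\<^esub> vert v y"
    unfolding q ev_append[OF w(1) n] ev_append[OF w]
    using ev_closed[OF w(1)] stab_closed[OF e(1)] vert_closed[OF e(5,3)] vert_closed[OF e(5) y] e
    by (simp add: vert_mult[OF e(5,3) y] G.m_assoc)
  moreover have "gog_path \<G> u (q @ [(e, g \<otimes>\<^bsub>Gv v\<^esub> y)]) v" using w(1) n gog_path_append by blast
  ultimately show ?thesis using q by (intro exI[of _ "q @ [(e, g \<otimes>\<^bsub>Gv v\<^esub> y)]"]) simp
qed

text \<open>Here the element at the initial vertex is kept, so that these sets compose like the
  morphisms of a category; \<open>one_in_paths_between\<close> then allows the end points to be
  changed at will.\<close>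

definition paths_between :: "'v \<Rightarrow> 'v \<Rightarrow> ('v, 'e, 'a) gog_gen word set set" where
  "paths_between u v = {vert u x \<otimes>\<^bsub>G\<^esub> ev p | x p. x \<in> carrier (Gv u) \<and> gog_path \<G> u p v}"

lemma paths_between_mult:
  assumes "g \<in> paths_between u v" "h \<in> paths_between v w"
  shows "g \<otimes>\<^bsub>G\<^esub> h \<in> paths_between u w"
proof -
  interpret G: group G by (rule group_G)
  obtain x p where g: "g = vert u x \<otimes>\<^bsub>G\<^esub> ev p" "x \<in> carrier (Gv u)" "gog_path \<G> u p v"
    using assms(1) unfolding paths_between_def by blast
  obtain y q where h: "h = vert v y \<otimes>\<^bsub>G\<^esub> ev q" "y \<in> carrier (Gv v)" "gog_path \<G> v q w"
    using assms(2) unfolding paths_between_def by blast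
  have V: "u \<in> V" "v \<in> V" "w \<in> V" using gog_path_verts[OF g(3)] gog_path_verts[OF h(3)] by auto
  interpret Gu: group "Gv u" by (rule group_Gv[OF V(1)])
  note c = vert_closed[OF V(1) g(2)] vert_closed[OF V(2) h(2)] ev_closed[OF g(3)] ev_closed[OF h(3)]
  show ?thesis
  proof (cases "p = []")
    case True
    then have uv: "u = v" using g(3) by simp
    then have "g \<otimes>\<^bsub>G\<^esub> h = vert u (x \<otimes>\<^bsub>Gv u\<^esub> y) \<otimes>\<^bsub>G\<^esub> ev q"
      using g h c True by (simp add: vert_mult[OF V(2)] G.m_assoc)
    moreover have "y \<in> carrier (Gv u)" using h(2) uv by simp
    then have "x \<otimes>\<^bsub>Gv u\<^esub> y \<in> carrier (Gv u)" by (rule Gu.m_closed[OF g(2)])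
    ultimately show ?thesis unfolding paths_between_def using h(3) uv by blast
  next
    case False
    from path_absorb[OF g(3) False h(2)] obtain p' where
      p': "gog_path \<G> u p' v" "ev p' = ev p \<otimes>\<^bsub>G\<^esub> vert v y" by blast
    have "g \<otimes>\<^bsub>G\<^esub> h = vert u x \<otimes>\<^bsub>G\<^esub> ev (p' @ q)"
      unfolding ev_append[OF p'(1) h(3)] using g h c p'(2) by (simp add: G.m_assoc)
    moreover have "gog_path \<G> u (p' @ q) w" using p'(1) h(3) gog_path_append by blast
    ultimately show ?thesis unfolding paths_between_def using g(2) by blast
  qed
qed

lemma path_in_paths_between: "gog_path \<G> u p v \<Longrightarrow> ev p \<in> paths_between u v"
proof -
  assume p: "gog_path \<G> u p v"
  interpret G: group G by (rule group_G)
  have u: "u \<in> V" using gog_path_verts[OF p] by simp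
  interpret Gu: group "Gv u" by (rule group_Gv[OF u])
  have "ev p = vert u \<one>\<^bsub>Gv u\<^esub> \<otimes>\<^bsub>G\<^esub> ev p" using vert_one[OF u] ev_closed[OF p] by simp
  then show ?thesis unfolding paths_between_def using p Gu.one_closed by blast
qed

lemma vert_in_paths_between: "v \<in> V \<Longrightarrow> x \<in> carrier (Gv v) \<Longrightarrow> vert v x \<in> paths_between v v"
proof -
  assume v: "v \<in> V" and x: "x \<in> carrier (Gv v)"
  interpret G: group G by (rule group_G)
  have "vert v x = vert v x \<otimes>\<^bsub>G\<^esub> ev []" "gog_path \<G> v [] v" using vert_closed[OF v x] v by simp_all
  then show ?thesis unfolding paths_between_def using x by blast
qed

lemma stab_in_paths_between: "e \<in> E \<Longrightarrow> stab e \<in> paths_between (tl\<^sub>\<Gamma> e) (hd\<^sub>\<Gamma> e)"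
proof -
  assume e: "e \<in> E"
  interpret G: group G by (rule group_G)
  interpret Gu: group "Gv (hd\<^sub>\<Gamma> e)" using e by (intro group_Gv) simp
  have "gog_path \<G> (tl\<^sub>\<Gamma> e) [(e, \<one>\<^bsub>Gv (hd\<^sub>\<Gamma> e)\<^esub>)] (hd\<^sub>\<Gamma> e)" using e by simp
  from path_in_paths_between[OF this] show ?thesis using vert_one e stab_closed[OF e] by simp
qed

text \<open>A walk in \<open>T\<close> with trivial vertex elements represents 1, because the stable
  letters of \<open>T\<close> are trivial in \<open>G\<close>.\<close>

lemma one_in_paths_between: "u \<in> V \<Longrightarrow> v \<in> V \<Longrightarrow> \<one>\<^bsub>G\<^esub> \<in> paths_between u v"
proof -
  assume uv: "u \<in> V" "v \<in> V"
  interpret G: group G by (rule group_G)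
  interpret T: wf_digraph T using subgraph_T by (simp add: subgraph_def)
  have "u \<rightarrow>\<^sup>*\<^bsub>T\<^esub> v" using serre_T uv verts_T by (simp add: serre_tree_def strongly_connected_def)
  then obtain p where "T.awalk u p v" by (auto simp: T.reachable_awalk)
  then show ?thesis
  proof (induction p arbitrary: u)
    case Nil
    then have "gog_path \<G> u [] v" by (auto simp: T.awalk_Nil_iff verts_T)
    from path_in_paths_between[OF this] show ?case by simp
  next
    case (Cons e p)
    then have e: "e \<in> arcs T" "tl\<^sub>\<Gamma> e = u" "T.awalk (hd\<^sub>\<Gamma> e) p v" by (auto simp: T.awalk_Cons_iff T_ends)
    have "\<one>\<^bsub>G\<^esub> \<in> paths_between u (hd\<^sub>\<Gamma> e)" using stab_in_paths_between[of e] e stab_T[OF e(1)] arcs_T by auto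
    from paths_between_mult[OF this Cons.IH[OF e(3)]] show ?case by simp
  qed
qed

lemma carrier_paths_between:
  assumes v0: "v0 \<in> V" and g: "g \<in> carrier G"
  shows "g \<in> paths_between v0 v0"
proof -
  interpret G: group G by (rule group_G)
  have tr: "h \<in> paths_between v0 v0" if h: "h \<in> paths_between u v" and uv: "u \<in> V" "v \<in> V" "h \<in> carrier G" for h u v
    using paths_between_mult[OF paths_between_mult[OF one_in_paths_between[OF v0 uv(1)] h]
      one_in_paths_between[OF uv(2) v0]] uv(3) by simp
  obtain w where w: "w \<in> wds" "g = cls w" using g carrier_G by blast
  have "cls w \<in> paths_between v0 v0" using w(1)
  proof (induction w rule: list.induct)
    case Nil
    then show ?case using one_in_paths_between[OF v0 v0] by (simp add: cls_Nil)
  next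
    case (Cons a w)
    obtain x b where a: "a = (x, b)" by force
    have x: "x \<in> fund_gens \<G> P" and wl: "w \<in> wds" and al: "[a] \<in> wds" using Cons.prems a by auto
    have "cls [a] \<in> paths_between v0 v0"
    proof (cases x)
      case (Vert v y)
      then have v: "v \<in> V" "y \<in> carrier (Gv v)" using x by (auto simp: fund_gens_def)
      interpret Gu: group "Gv v" by (rule group_Gv[OF v(1)])
      interpret vh: group_hom "Gv v" G "vert v"
        by (intro group_hom.intro group_hom_axioms.intro vert_hom v(1) group_G group_Gv)
      have c: "cls [(x, True)] = vert v y" using Vert by (simp add: vert_def fund_vert_def)
      show ?thesis
      proof (cases b)
        case True
        then show ?thesis using tr[OF vert_in_paths_between[OF v] v(1) v(1) vert_closed[OF v]] a c by simp
      next
        case False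
        then have "cls [a] = vert v (inv\<^bsub>Gv v\<^esub> y)" using a c cls_inv[OF x] v(2) by simp
        then show ?thesis
          using tr[OF vert_in_paths_between[OF v(1) Gu.inv_closed[OF v(2)]] v(1) v(1)
            vert_closed[OF v(1) Gu.inv_closed[OF v(2)]]] by simp
      qed
    next
      case (Stable e)
      then have e: "e \<in> P" "e \<in> E" using x P_sub by (auto simp: fund_gens_def)
      have c: "cls [(x, True)] = stab e" using Stable e(1) by (simp add: stab_def)
      have iv: "rv e \<in> E" "stab (rv e) \<in> carrier G" "tl\<^sub>\<Gamma> (rv e) \<in> V" "hd\<^sub>\<Gamma> (rv e) \<in> V"
        using e(2) stab_closed[of "rv e"] \<Gamma>.head_in_verts[of "rv e"] \<Gamma>.tail_in_verts[of "rv e"] by simp_all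
      show ?thesis
      proof (cases b)
        case True
        then show ?thesis
          using tr[OF stab_in_paths_between[OF e(2)] \<Gamma>.tail_in_verts[OF e(2)] \<Gamma>.head_in_verts[OF e(2)] stab_closed[OF e(2)]]
            a c by simp
      next
        case False
        then have "cls [a] = stab (rv e)" using a c cls_inv[OF x] stab_rv[OF e(2)] by simp
        then show ?thesis using tr[OF stab_in_paths_between[OF iv(1)] iv(3,4,2)] by simp
      qed
    qed
    from paths_between_mult[OF this Cons.IH[OF wl]] show ?case using cls_mult[OF al wl] by simp
  qed
  then show ?thesis using w by simp
qed

lemma rotate_path:
  assumes "gog_path \<G> v p v"
  shows "\<exists>u. gog_path \<G> u (rotate i p) u \<and> conj_to (ev p) (ev (rotate i p))"
proof (induction i)
  case 0
  then show ?case using assms conj_to_refl[OF ev_closed[OF assms]] by auto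
next
  case (Suc i)
  then obtain u where u: "gog_path \<G> u (rotate i p) u" "conj_to (ev p) (ev (rotate i p))" by blast
  show ?case
  proof (cases "rotate i p")
    case Nil
    then show ?thesis using u by (intro exI[of _ u]) (simp add: rotate_Suc)
  next
    case (Cons a q)
    obtain e g where a: "a = (e, g)" by force
    have 1: "gog_path \<G> u [a] (hd\<^sub>\<Gamma> e)" "gog_path \<G> (hd\<^sub>\<Gamma> e) q u" using u(1) Cons a by auto
    have r: "rotate (Suc i) p = q @ [a]" using Cons by (simp add: rotate_Suc)
    have "gog_path \<G> (hd\<^sub>\<Gamma> e) (q @ [a]) (hd\<^sub>\<Gamma> e)" using 1 gog_path_append by blast
    moreover have "ev (rotate i p) = ev [a] \<otimes>\<^bsub>G\<^esub> ev q" using ev_append[OF 1] Cons by simp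
    moreover have "ev (q @ [a]) = ev q \<otimes>\<^bsub>G\<^esub> ev [a]" using ev_append[OF 1(2,1)] .
    ultimately show ?thesis
      using conj_to_trans[OF u(2)] conj_to_swap[OF ev_closed[OF 1(1)] ev_closed[OF 1(2)]]
        ev_closed[OF 1(1)] ev_closed[OF 1(2)] group.is_monoid[OF group_G]
      unfolding r by (intro exI[of _ "hd\<^sub>\<Gamma> e"]) (simp add: monoid.m_closed)
  qed
qed

text \<open>The index is taken modulo the length, so a backtracking from the last edge to the first
  is excluded too. What is forbidden is exactly the configuration that
  \<open>backtrack_shorten\<close> removes.\<close>

definition reduced_cycle :: "('e \<times> 'a) list \<Rightarrow> bool" where
  "reduced_cycle p \<longleftrightarrow> (\<forall>i<length p. fst (p ! (Suc i mod length p)) = rv (fst (p ! i)) \<longrightarrow>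
    snd (p ! i) \<notin> om (fst (p ! i)) ` carrier (Ge (fst (p ! i))))"

text \<open>The relation \<open>t_e om_e(a) t_e^-1 = al_e(a)\<close> deletes two edges. The vertex
  element left over goes to the end of the remaining path by a conjugation, or is all that remains
  if there is no further edge.\<close>

lemma backtrack_shorten:
  assumes p: "gog_path \<G> v ((e, om e a) # (rv e, h) # q) v" and a: "a \<in> carrier (Ge e)"
  shows "(\<exists>w\<in>V. \<exists>x\<in>carrier (Gv w). conj_to (ev ((e, om e a) # (rv e, h) # q)) (vert w x)) \<or>
    (\<exists>w q'. gog_path \<G> w q' w \<and> q' \<noteq> [] \<and> length q' = length q \<and>
      conj_to (ev ((e, om e a) # (rv e, h) # q)) (ev q'))"
proof -
  interpret G: group G by (rule group_G)
  have e: "e \<in> E" "tl\<^sub>\<Gamma> e = v" "h \<in> carrier (Gv v)" "gog_path \<G> v q v" "v \<in> V"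
    using p by auto
  interpret Gv: group "Gv v" by (rule group_Gv[OF e(5)])
  let ?x = "al e a \<otimes>\<^bsub>Gv v\<^esub> h"
  have ac: "al e a \<in> carrier (Gv v)" using al_closed[OF e(1) a] e(2) by simp
  have x: "?x \<in> carrier (Gv v)" using ac e(3) by simp
  note c = vert_closed[OF e(5) ac] vert_closed[OF e(5,3)] ev_closed[OF e(4)] stab_closed[OF e(1)]
    vert_closed[OF _ om_closed[OF e(1) a]]
  have ch: "vert (hd\<^sub>\<Gamma> e) (om e a) \<in> carrier G" using c(5) e(1) by simp
  have "ev ((e, om e a) # (rv e, h) # q) =
    (stab e \<otimes>\<^bsub>G\<^esub> vert (hd\<^sub>\<Gamma> e) (om e a)) \<otimes>\<^bsub>G\<^esub> (inv\<^bsub>G\<^esub> stab e \<otimes>\<^bsub>G\<^esub> (vert v h \<otimes>\<^bsub>G\<^esub> ev q))"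
    using e c ch stab_rv[OF e(1)] by (simp add: G.m_assoc)
  also have "\<dots> = vert v (al e a) \<otimes>\<^bsub>G\<^esub> (vert v h \<otimes>\<^bsub>G\<^esub> ev q)"
    unfolding stab_rel[OF e(1) a] e(2) using c ch
    by (simp add: G.m_assoc) (simp add: G.m_assoc[symmetric])
  also have "\<dots> = vert v ?x \<otimes>\<^bsub>G\<^esub> ev q" using c by (simp add: vert_mult[OF e(5) ac e(3)] G.m_assoc)
  finally have eq: "ev ((e, om e a) # (rv e, h) # q) = vert v ?x \<otimes>\<^bsub>G\<^esub> ev q" .
  have xc: "vert v ?x \<in> carrier G" by (rule vert_closed[OF e(5) x])
  show ?thesis
  proof (cases "q = []")
    case True
    then have "ev ((e, om e a) # (rv e, h) # q) = vert v ?x" using eq xc by simp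
    then show ?thesis using conj_to_refl[OF xc] e(5) x by auto
  next
    case False
    from path_absorb[OF e(4) False x] obtain q' where
      q': "gog_path \<G> v q' v" "length q' = length q" "ev q' = ev q \<otimes>\<^bsub>G\<^esub> vert v ?x" by blast
    have "conj_to (ev ((e, om e a) # (rv e, h) # q)) (ev q')"
      unfolding eq q'(3) by (rule conj_to_swap[OF xc c(3)])
    moreover have "q' \<noteq> []" using q'(2) False by auto
    ultimately show ?thesis using q' by blast
  qed
qed

text \<open>A closed path of minimal length among those representing a conjugate of \<open>g\<close> is cyclically reduced.\<close>

lemma conj_normal_form:
  assumes g: "g \<in> carrier G"
  shows "(\<exists>w\<in>V. \<exists>x\<in>carrier (Gv w). conj_to g (vert w x)) \<or>
    (\<exists>w p. gog_path \<G> w p w \<and> p \<noteq> [] \<and> reduced_cycle p \<and> conj_to g (ev p))"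
proof (rule ccontr)
  interpret G: group G by (rule group_G)
  assume neg: "\<not> ?thesis"
  have "V \<noteq> {}" using fg by (simp add: finite_graph_of_groups_def strongly_connected_def)
  then obtain v0 where v0: "v0 \<in> V" by blast
  define Q where "Q n \<longleftrightarrow> (\<exists>w p. gog_path \<G> w p w \<and> p \<noteq> [] \<and> length p = n \<and> conj_to g (ev p))" for n
  obtain x p where xp: "g = vert v0 x \<otimes>\<^bsub>G\<^esub> ev p" "x \<in> carrier (Gv v0)" "gog_path \<G> v0 p v0"
    using carrier_paths_between[OF v0 g] unfolding paths_between_def by blast
  have pne: "p \<noteq> []"
  proof
    assume "p = []"
    then have "g = vert v0 x" using xp vert_closed[OF v0 xp(2)] by simp
    then show False using neg conj_to_refl[OF g] v0 xp(2) by auto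
  qed
  from path_absorb[OF xp(3) pne xp(2)] obtain p' where
    p': "gog_path \<G> v0 p' v0" "length p' = length p" "ev p' = ev p \<otimes>\<^bsub>G\<^esub> vert v0 x" by blast
  have "conj_to g (ev p')"
    unfolding xp(1) p'(3) by (rule conj_to_swap[OF vert_closed[OF v0 xp(2)] ev_closed[OF xp(3)]])
  moreover have "p' \<noteq> []" using p'(2) pne by auto
  ultimately have "\<exists>n. Q n" unfolding Q_def using p'(1) by blast
  then obtain n where n: "Q n" and min: "\<forall>m<n. \<not> Q m" using exists_least_iff[of Q] by blast
  obtain w p where p: "gog_path \<G> w p w" "p \<noteq> []" "length p = n" "conj_to g (ev p)"
    using n unfolding Q_def by blast
  have "\<not> reduced_cycle p" using neg p by blast
  then obtain i where i: "i < length p" "fst (p ! (Suc i mod length p)) = rv (fst (p ! i))"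
    "snd (p ! i) \<in> om (fst (p ! i)) ` carrier (Ge (fst (p ! i)))" unfolding reduced_cycle_def by blast
  \<comment> \<open>Rotating brings the offending backtracking to the front and only conjugates the
    element.\<close>
  obtain u where u: "gog_path \<G> u (rotate i p) u" "conj_to (ev p) (ev (rotate i p))"
    using rotate_path[OF p(1)] by blast
  have g_rot: "conj_to g (ev (rotate i p))" using conj_to_trans[OF p(4) u(2) ev_closed[OF u(1)]] .
  obtain e g0 where eg: "p ! i = (e, g0)" by force
  then obtain a where a: "a \<in> carrier (Ge e)" "g0 = om e a" using i(3) by auto
  have r0: "rotate i p ! 0 = (e, om e a)" using nth_rotate[of 0 p i] i(1) eg a(2) p(2) by simp
  have eE: "e \<in> E"
  proof (cases "rotate i p")
    case Nil
    then show ?thesis using p(2) by simp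
  next
    case (Cons b q)
    then show ?thesis using u(1) r0 by simp
  qed
  \<comment> \<open>For a single edge the cyclic successor is the edge itself, which is not its own
    inverse.\<close>
  have "length p \<noteq> 1"
  proof
    assume "length p = 1"
    then have "e = rv e" using i(1,2) eg by simp
    then show False using \<Gamma>.arev_neq[OF eE] by simp
  qed
  moreover have "length p \<noteq> 0" using p(2) by simp
  ultimately have l2: "length p \<ge> 2" by linarith
  have r1: "fst (rotate i p ! 1) = rv e" using nth_rotate[of 1 p i] l2 i(2) eg by (simp add: add.commute)
  obtain b q where bq: "rotate i p = b # q" using l2 by (cases "rotate i p") auto
  have "length q \<ge> 1" using arg_cong[OF bq, of length] l2 by simp
  then obtain d q0 where dq: "q = d # q0" by (cases q) auto
  obtain d1 h where d: "d = (d1, h)" by force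
  have h: "rotate i p = (e, om e a) # (rv e, h) # q0" using r0 r1 bq dq d by simp
  have "length q0 < n" using arg_cong[OF h, of length] p(3) by simp
  then have nQ: "\<not> Q (length q0)" using min by blast
  from backtrack_shorten[OF u(1)[unfolded h] a(1)] show False
  proof
    assume "\<exists>w\<in>V. \<exists>x\<in>carrier (Gv w). conj_to (ev ((e, om e a) # (rv e, h) # q0)) (vert w x)"
    then obtain w x where wx: "w \<in> V" "x \<in> carrier (Gv w)" "conj_to (ev (rotate i p)) (vert w x)"
      unfolding h by blast
    then have "conj_to g (vert w x)" using conj_to_trans[OF g_rot wx(3) vert_closed[OF wx(1,2)]] by blast
    then show False using neg wx by blast
  next
    assume "\<exists>w q'. gog_path \<G> w q' w \<and> q' \<noteq> [] \<and> length q' = length q0 \<and>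
      conj_to (ev ((e, om e a) # (rv e, h) # q0)) (ev q')"
    then obtain w q' where q': "gog_path \<G> w q' w" "q' \<noteq> []" "length q' = length q0"
      "conj_to (ev (rotate i p)) (ev q')" unfolding h by blast
    have "conj_to g (ev q')" by (rule conj_to_trans[OF g_rot q'(4) ev_closed[OF q'(1)]])
    then show False using nQ q' unfolding Q_def by blast
  qed
qed

end

section \<open>Weighted representations\<close>

lemma shift_mult: "(f \<otimes>\<^bsub>shift_group X\<^esub> g) p = f (g p)" and shift_one: "\<one>\<^bsub>shift_group X\<^esub> p = p"
  by (simp_all add: shift_group_def)

definition shift_map :: "'x set \<Rightarrow> ('x \<Rightarrow> 'x) \<Rightarrow> ('x \<Rightarrow> int) \<Rightarrow> 'x \<times> int \<Rightarrow> 'x \<times> int" where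
  "shift_map X \<beta> w = (\<lambda>(y, k). if y \<in> X then (\<beta> y, k + w y) else (y, k))"

lemma shift_map_apply: "y \<in> X \<Longrightarrow> shift_map X \<beta> w (y, k) = (\<beta> y, k + w y)"
  by (simp add: shift_map_def)

lemma shift_map_closed:
  assumes \<beta>: "bij_betw \<beta> X X"
  shows "shift_map X \<beta> w \<in> carrier (shift_group X)"
proof -
  have im: "\<beta> y \<in> X" if "y \<in> X" for y using \<beta> that by (auto simp: bij_betw_def)
  have "bij_betw (shift_map X \<beta> w) (X \<times> UNIV) (X \<times> UNIV)"
  proof (rule bij_betwI[where g = "\<lambda>(z, k). (the_inv_into X \<beta> z, k - w (the_inv_into X \<beta> z))"])
    have inj: "inj_on \<beta> X" and surj: "\<beta> ` X = X" using \<beta> by (auto simp: bij_betw_def)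
    have inv: "the_inv_into X \<beta> z \<in> X" "\<beta> (the_inv_into X \<beta> z) = z" if "z \<in> X" for z
      using the_inv_into_into[OF inj, of z X] f_the_inv_into_f[OF inj, of z] surj that by auto
    show "shift_map X \<beta> w \<in> X \<times> UNIV \<rightarrow> X \<times> UNIV" using im by (auto simp: shift_map_def)
    show "(\<lambda>(z, k). (the_inv_into X \<beta> z, k - w (the_inv_into X \<beta> z))) \<in> X \<times> UNIV \<rightarrow> X \<times> UNIV"
      using inv by auto
    fix p :: "'a \<times> int" assume "p \<in> X \<times> UNIV"
    then show "(\<lambda>(z, k). (the_inv_into X \<beta> z, k - w (the_inv_into X \<beta> z))) (shift_map X \<beta> w p) = p"
      by (auto simp: shift_map_def the_inv_into_f_f[OF inj])
  next
    have inj: "inj_on \<beta> X" and surj: "\<beta> ` X = X" using \<beta> by (auto simp: bij_betw_def)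
    fix p :: "'a \<times> int" assume "p \<in> X \<times> UNIV"
    then show "shift_map X \<beta> w ((\<lambda>(z, k). (the_inv_into X \<beta> z, k - w (the_inv_into X \<beta> z))) p) = p"
      using the_inv_into_into[OF inj, of "fst p" X] f_the_inv_into_f[OF inj, of "fst p"] surj
      by (auto simp: shift_map_def)
  qed
  moreover have "shift_map X \<beta> w p = p" if "p \<notin> X \<times> UNIV" for p
    using that by (cases p) (simp add: shift_map_def)
  ultimately have "shift_map X \<beta> w permutes X \<times> UNIV" by (rule bij_imp_permutes)
  moreover have "shift_map X \<beta> w (x, k + j) = (fst (shift_map X \<beta> w (x, k)), snd (shift_map X \<beta> w (x, k)) + j)"
    if "x \<in> X" for x k j using that by (simp add: shift_map_apply)
  ultimately show ?thesis by (simp add: shift_group_def)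
qed

lemma shift_map_comp:
  assumes "\<beta>' ` X \<subseteq> X"
  shows "shift_map X \<beta> w \<circ> shift_map X \<beta>' w' = shift_map X (\<beta> \<circ> \<beta>') (\<lambda>y. w' y + w (\<beta>' y))"
  using assms by (auto simp: shift_map_def fun_eq_iff)

lemma shift_map_cong:
  assumes "\<And>y. y \<in> X \<Longrightarrow> \<beta> y = \<beta>' y" "\<And>y. y \<in> X \<Longrightarrow> w y = w' y"
  shows "shift_map X \<beta> w = shift_map X \<beta>' w'"
  using assms by (auto simp: shift_map_def fun_eq_iff)

text \<open>All maps commute with translations, so an offset \<open>j\<close> picked up by
  \<open>c\<close> is undone by its inverse: the weight of a fixed point is a conjugation
  invariant.\<close>

lemma shift_conj:
  assumes c: "c \<in> carrier (shift_group X)" and k: "k \<in> carrier (shift_group X)"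
    and x: "x \<in> X" "k (x, 0) = (x, w)"
  shows "\<exists>x'\<in>X. (c \<otimes>\<^bsub>shift_group X\<^esub> k \<otimes>\<^bsub>shift_group X\<^esub> inv\<^bsub>shift_group X\<^esub> c) (x', 0) = (x', w)"
proof -
  interpret S: group "shift_group X" by (rule group_shift_group)
  obtain x' j where x': "c (x, 0) = (x', j)" by force
  have x'X: "x' \<in> X" using shift_groupD(2)[OF c x(1), of 0] x' by simp
  let ?c' = "inv\<^bsub>shift_group X\<^esub> c"
  have "(?c' \<otimes>\<^bsub>shift_group X\<^esub> c) (x, 0) = (x, 0)" unfolding S.l_inv[OF c] by (rule shift_one)
  then have "?c' (x', j) = (x, 0)" using x' by (simp only: shift_mult)
  then have c': "?c' (x', 0) = (x, - j)"
    using shift_groupD(1)[OF S.inv_closed[OF c] x'X, of j "- j"] by simp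
  have "k (x, - j) = (x, w - j)" using shift_groupD(1)[OF k x(1), of 0 "- j"] x(2) by simp
  moreover have "c (x, w - j) = (x', w)" using shift_groupD(1)[OF c x(1), of 0 "w - j"] x' by simp
  ultimately have "(c \<otimes>\<^bsub>shift_group X\<^esub> k \<otimes>\<^bsub>shift_group X\<^esub> ?c') (x', 0) = (x', w)"
    using c' by (simp add: shift_mult)
  then show ?thesis using x'X by blast
qed

definition shift_to_perm :: "'x set \<Rightarrow> ('x \<times> int \<Rightarrow> 'x \<times> int) \<Rightarrow> 'x \<Rightarrow> 'x" where
  "shift_to_perm X f = (\<lambda>x. if x \<in> X then fst (f (x, 0)) else x)"

lemma shift_to_perm_hom: "finite X \<Longrightarrow> shift_to_perm X \<in> hom (shift_group X) (perm_group X)"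
proof (rule homI)
  assume fin: "finite X"
  interpret S: group "shift_group X" by (rule group_shift_group)
  have mult: "shift_to_perm X (f \<otimes>\<^bsub>shift_group X\<^esub> g) = shift_to_perm X f \<circ> shift_to_perm X g"
    if f: "f \<in> carrier (shift_group X)" and g: "g \<in> carrier (shift_group X)" for f g
  proof
    fix x
    show "shift_to_perm X (f \<otimes>\<^bsub>shift_group X\<^esub> g) x = (shift_to_perm X f \<circ> shift_to_perm X g) x"
    proof (cases "x \<in> X")
      case True
      obtain y j where y: "g (x, 0) = (y, j)" by force
      have "y \<in> X" using shift_groupD(2)[OF g True, of 0] y by simp
      then show ?thesis
        using True y shift_groupD(1)[OF f \<open>y \<in> X\<close>, of 0 j] by (simp add: shift_to_perm_def shift_mult)
    qed (simp add: shift_to_perm_def)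
  qed
  fix f assume f: "f \<in> carrier (shift_group X)"
  have im: "shift_to_perm X f ` X \<subseteq> X"
    using shift_groupD(2)[OF f] by (auto simp: shift_to_perm_def)
  have "shift_to_perm X \<one>\<^bsub>shift_group X\<^esub> = id" by (auto simp: shift_to_perm_def shift_group_def)
  then have "shift_to_perm X (inv\<^bsub>shift_group X\<^esub> f) \<circ> shift_to_perm X f = id"
    using mult[OF S.inv_closed[OF f] f] f by simp
  then have "inj (shift_to_perm X f)" by (metis inj_on_id inj_on_imageI2)
  then have "inj_on (shift_to_perm X f) X" using inj_on_subset by blast
  then have "bij_betw (shift_to_perm X f) X X" using im fin by (simp add: bij_betw_def endo_inj_surj)
  then show "shift_to_perm X f \<in> carrier (perm_group X)"
    by (simp add: perm_group_def bij_imp_permutes shift_to_perm_def)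
  fix g assume g: "g \<in> carrier (shift_group X)"
  show "shift_to_perm X (f \<otimes>\<^bsub>shift_group X\<^esub> g) = shift_to_perm X f \<otimes>\<^bsub>perm_group X\<^esub> shift_to_perm X g"
    using mult[OF f g] by (simp add: perm_group_def)
qed

context gog
begin

text \<open>\<open>wt_mult\<close> is the cocycle condition for the weights of a vertex group over
  its action on \<open>X\<close>, and \<open>wt_rel\<close> says that the weights \<open>b\<close>
  of a stable letter intertwine the cocycles at its two ends.\<close>

lemma shift_rep:
  fixes X :: "'x set"
  assumes act: "\<And>v g. v \<in> V \<Longrightarrow> g \<in> carrier (Gv v) \<Longrightarrow> bij_betw (act v g) X X"
    and act_mult: "\<And>v g h y. v \<in> V \<Longrightarrow> g \<in> carrier (Gv v) \<Longrightarrow> h \<in> carrier (Gv v) \<Longrightarrow> y \<in> X \<Longrightarrow>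
      act v (g \<otimes>\<^bsub>Gv v\<^esub> h) y = act v g (act v h y)"
    and wt_mult: "\<And>v g h y. v \<in> V \<Longrightarrow> g \<in> carrier (Gv v) \<Longrightarrow> h \<in> carrier (Gv v) \<Longrightarrow> y \<in> X \<Longrightarrow>
      wt v (g \<otimes>\<^bsub>Gv v\<^esub> h) y = wt v h y + wt v g (act v h y)"
    and \<beta>: "\<And>e. e \<in> P \<Longrightarrow> bij_betw (\<beta> e) X X"
    and rel: "\<And>e a y. e \<in> P \<Longrightarrow> a \<in> carrier (Ge e) \<Longrightarrow> y \<in> X \<Longrightarrow>
      \<beta> e (act (hd\<^sub>\<Gamma> e) (om e a) y) = act (tl\<^sub>\<Gamma> e) (al e a) (\<beta> e y)"
    and wt_rel: "\<And>e a y. e \<in> P \<Longrightarrow> a \<in> carrier (Ge e) \<Longrightarrow> y \<in> X \<Longrightarrow>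
      wt (hd\<^sub>\<Gamma> e) (om e a) y + b e (act (hd\<^sub>\<Gamma> e) (om e a) y) = b e y + wt (tl\<^sub>\<Gamma> e) (al e a) (\<beta> e y)"
  shows "gog_rep \<G> (shift_group X) (\<lambda>v g. shift_map X (act v g) (wt v g))
    (\<lambda>e. if e \<in> P then shift_map X (\<beta> e) (b e)
      else inv\<^bsub>shift_group X\<^esub> shift_map X (\<beta> (rv e)) (b (rv e)))"
proof (rule gog_repI[OF group_shift_group])
  have mult: "f \<otimes>\<^bsub>shift_group X\<^esub> g = f \<circ> g" for f g by (simp add: shift_group_def)
  have actX: "act v g ` X \<subseteq> X" if "v \<in> V" "g \<in> carrier (Gv v)" for v g
    using act[OF that] by (simp add: bij_betw_def)
  fix v assume v: "v \<in> V"
  interpret Gv: group "Gv v" by (rule group_Gv[OF v])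
  show "(\<lambda>g. shift_map X (act v g) (wt v g)) \<in> hom (Gv v) (shift_group X)"
  proof (rule homI)
    fix g h assume g: "g \<in> carrier (Gv v)" and h: "h \<in> carrier (Gv v)"
    show "shift_map X (act v (g \<otimes>\<^bsub>Gv v\<^esub> h)) (wt v (g \<otimes>\<^bsub>Gv v\<^esub> h)) =
      shift_map X (act v g) (wt v g) \<otimes>\<^bsub>shift_group X\<^esub> shift_map X (act v h) (wt v h)"
      unfolding mult shift_map_comp[OF actX[OF v h]]
      by (rule shift_map_cong) (use act_mult[OF v g h] wt_mult[OF v g h] in simp_all)
  qed (use act[OF v] shift_map_closed in blast)
next
  have mult: "f \<otimes>\<^bsub>shift_group X\<^esub> g = f \<circ> g" for f g by (simp add: shift_group_def)
  have actX: "act v g ` X \<subseteq> X" if "v \<in> V" "g \<in> carrier (Gv v)" for v g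
    using act[OF that] by (simp add: bij_betw_def)
  fix e assume e: "e \<in> P"
  then have eE: "e \<in> E" using P_sub by blast
  show "shift_map X (\<beta> e) (b e) \<in> carrier (shift_group X)" by (rule shift_map_closed[OF \<beta>[OF e]])
  fix a assume a: "a \<in> carrier (Ge e)"
  have \<beta>X: "\<beta> e ` X \<subseteq> X" using \<beta>[OF e] by (simp add: bij_betw_def)
  have oX: "act (hd\<^sub>\<Gamma> e) (om e a) ` X \<subseteq> X"
    using actX[OF \<Gamma>.head_in_verts[OF eE] om_closed[OF eE a]] .
  show "shift_map X (\<beta> e) (b e) \<otimes>\<^bsub>shift_group X\<^esub>
      shift_map X (act (hd\<^sub>\<Gamma> e) (om e a)) (wt (hd\<^sub>\<Gamma> e) (om e a)) =
    shift_map X (act (tl\<^sub>\<Gamma> e) (al e a)) (wt (tl\<^sub>\<Gamma> e) (al e a)) \<otimes>\<^bsub>shift_group X\<^esub> shift_map X (\<beta> e) (b e)"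
    unfolding mult shift_map_comp[OF oX] shift_map_comp[OF \<beta>X]
    by (rule shift_map_cong) (use rel[OF e a] wt_rel[OF e a] in simp_all)
qed

text \<open>The fixed point is carried along twice by \<open>shift_conj\<close>: once for the gauge
  at \<open>v\<close>, once for the conjugation that takes \<open>vert v y\<close> to
  \<open>g\<close>.\<close>

lemma virtual_retract_of_vert_weight:
  assumes fin: "finite X" and rep: "gog_rep \<G> (shift_group X) \<theta> \<tau>" and g: "g \<in> carrier G"
    and v: "v \<in> V" "y \<in> carrier (Gv v)" "conj_to g (vert v y)"
    and x: "x \<in> X" "\<theta> v y (x, 0) = (x, w)" "w \<noteq> 0"
  shows "virtual_retract (generate G {g}) G"
proof -
  let ?H = "shift_group X"
  interpret H: group ?H by (rule group_shift_group)
  obtain \<Phi> l where \<Phi>: "\<Phi> \<in> hom G ?H" "\<forall>v\<in>V. l v \<in> carrier ?H"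
    "\<forall>v\<in>V. \<forall>g\<in>carrier (Gv v). \<Phi> (vert v g) = l v \<otimes>\<^bsub>?H\<^esub> \<theta> v g \<otimes>\<^bsub>?H\<^esub> inv\<^bsub>?H\<^esub> l v"
    using rep_to_hom[OF group_shift_group rep] by blast
  interpret \<Phi>: group_hom G ?H \<Phi> by (intro group_hom.intro group_hom_axioms.intro group_G group_shift_group \<Phi>)
  have th: "\<theta> v y \<in> carrier ?H"
    using rep v(1) hom_in_carrier[of "\<theta> v" "Gv v" ?H y] v(2) by (simp add: gog_rep_def)
  obtain u where u: "u \<in> carrier G" "g = u \<otimes>\<^bsub>G\<^esub> vert v y \<otimes>\<^bsub>G\<^esub> inv\<^bsub>G\<^esub> u"
    using v(3) by (auto simp: conj_to_def)
  obtain x' where x': "x' \<in> X" "\<Phi> (vert v y) (x', 0) = (x', w)"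
    using shift_conj[OF _ th x(1,2), of "l v"] \<Phi>(2,3) v by auto
  have "\<Phi> g = \<Phi> u \<otimes>\<^bsub>?H\<^esub> \<Phi> (vert v y) \<otimes>\<^bsub>?H\<^esub> inv\<^bsub>?H\<^esub> \<Phi> u"
    unfolding u(2) using u(1) vert_closed[OF v(1,2)] by simp
  then obtain x'' where "x'' \<in> X" "\<Phi> g (x'', 0) = (x'', w)"
    using shift_conj[OF \<Phi>.hom_closed[OF u(1)] \<Phi>.hom_closed[OF vert_closed[OF v(1,2)]] x'] by auto
  then show ?thesis using virtual_retract_of_weight[OF group_G \<Phi>(1) fin g] x(3) by blast
qed

lemma virtual_retract_of_path_weight:
  assumes fin: "finite X" and rep: "gog_rep \<G> (shift_group X) \<theta> \<tau>" and g: "g \<in> carrier G"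
    and p: "gog_path \<G> v p v" "conj_to g (ev p)"
    and x: "x \<in> X" "path_eval \<G> (shift_group X) \<theta> \<tau> p (x, 0) = (x, w)" "w \<noteq> 0"
  shows "virtual_retract (generate G {g}) G"
proof -
  let ?H = "shift_group X"
  interpret H: group ?H by (rule group_shift_group)
  obtain \<Phi> l where \<Phi>: "\<Phi> \<in> hom G ?H" "\<forall>v\<in>V. l v \<in> carrier ?H"
    "\<forall>v\<in>V. \<forall>g\<in>carrier (Gv v). \<Phi> (vert v g) = l v \<otimes>\<^bsub>?H\<^esub> \<theta> v g \<otimes>\<^bsub>?H\<^esub> inv\<^bsub>?H\<^esub> l v"
    "\<forall>e\<in>E. \<Phi> (stab e) = l (tl\<^sub>\<Gamma> e) \<otimes>\<^bsub>?H\<^esub> \<tau> e \<otimes>\<^bsub>?H\<^esub> inv\<^bsub>?H\<^esub> l (hd\<^sub>\<Gamma> e)"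
    using rep_to_hom[OF group_shift_group rep] by blast
  interpret \<Phi>: group_hom G ?H \<Phi> by (intro group_hom.intro group_hom_axioms.intro group_G group_shift_group \<Phi>)
  have v: "v \<in> V" using gog_path_verts[OF p(1)] by simp
  have pe: "\<Phi> (ev p) = l v \<otimes>\<^bsub>?H\<^esub> path_eval \<G> ?H \<theta> \<tau> p \<otimes>\<^bsub>?H\<^esub> inv\<^bsub>?H\<^esub> l v"
    by (rule path_eval_hom[OF group_shift_group rep \<Phi> p(1)])
  have th: "path_eval \<G> ?H \<theta> \<tau> p \<in> carrier ?H" by (rule path_eval_closed[OF group_shift_group rep p(1)])
  obtain u where u: "u \<in> carrier G" "g = u \<otimes>\<^bsub>G\<^esub> ev p \<otimes>\<^bsub>G\<^esub> inv\<^bsub>G\<^esub> u"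
    using p(2) by (auto simp: conj_to_def)
  obtain x' where x': "x' \<in> X" "\<Phi> (ev p) (x', 0) = (x', w)"
    using shift_conj[OF _ th x(1,2), of "l v"] \<Phi>(2) pe v by auto
  have "\<Phi> g = \<Phi> u \<otimes>\<^bsub>?H\<^esub> \<Phi> (ev p) \<otimes>\<^bsub>?H\<^esub> inv\<^bsub>?H\<^esub> \<Phi> u"
    unfolding u(2) using u(1) ev_closed[OF p(1)] by simp
  then obtain x'' where "x'' \<in> X" "\<Phi> g (x'', 0) = (x'', w)"
    using shift_conj[OF \<Phi>.hom_closed[OF u(1)] \<Phi>.hom_closed[OF ev_closed[OF p(1)]] x'] by auto
  then show ?thesis using virtual_retract_of_weight[OF group_G \<Phi>(1) fin g] x(3) by blast
qed

text \<open>Vertex groups fix every point and translate the fibre over \<open>x\<close> by the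
  functional \<open>f x\<close>; stable letters permute the points with weight 0. The weight
  relation then says precisely that \<open>\<pi> e\<close> matches functionals on the edge
  group.\<close>

lemma virtual_retract_of_functional:
  assumes fin: "finite X"
    and f: "\<And>x v. x \<in> X \<Longrightarrow> v \<in> V \<Longrightarrow> f x v \<in> hom (Gv v) integer_group"
    and \<pi>: "\<And>e. e \<in> P \<Longrightarrow> bij_betw (\<pi> e) X X"
    and f\<pi>: "\<And>e a x. e \<in> P \<Longrightarrow> a \<in> carrier (Ge e) \<Longrightarrow> x \<in> X \<Longrightarrow>
      f x (hd\<^sub>\<Gamma> e) (om e a) = f (\<pi> e x) (tl\<^sub>\<Gamma> e) (al e a)"
    and g: "g \<in> carrier G" and v: "v \<in> V" "y \<in> carrier (Gv v)" "conj_to g (vert v y)"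
    and x: "x \<in> X" "f x v y \<noteq> 0"
  shows "virtual_retract (generate G {g}) G"
proof -
  have "gog_rep \<G> (shift_group X) (\<lambda>v g. shift_map X ((\<lambda>v g. id) v g) ((\<lambda>v g x. f x v g) v g))
    (\<lambda>e. if e \<in> P then shift_map X (\<pi> e) ((\<lambda>e x. 0) e)
      else inv\<^bsub>shift_group X\<^esub> shift_map X (\<pi> (rv e)) ((\<lambda>e x. 0) (rv e)))"
  proof (rule shift_rep)
    fix v g h x assume "v \<in> V" "g \<in> carrier (Gv v)" "h \<in> carrier (Gv v)" "x \<in> X"
    then show "f x v (g \<otimes>\<^bsub>Gv v\<^esub> h) = f x v h + f (id x) v g"
      using hom_mult[OF f[of x v], of g h] by simp
  qed (use \<pi> f\<pi> in auto)
  from virtual_retract_of_vert_weight[OF fin this g v x(1)] show ?thesis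
    using x by (simp add: shift_map_apply)
qed

end

lemma (in group) conj_cancel:
  assumes "u \<in> carrier G" "z \<in> carrier G"
  shows "inv u \<otimes> (u \<otimes> z) = z" "u \<otimes> (inv u \<otimes> z) = z"
  using assms by (simp_all add: m_assoc[symmetric])

lemma (in group) conj_eq_one_iff:
  assumes "u \<in> carrier G" "z \<in> carrier G"
  shows "u \<otimes> z \<otimes> inv u = \<one> \<longleftrightarrow> z = \<one>"
proof
  assume "u \<otimes> z \<otimes> inv u = \<one>"
  moreover have "inv u \<otimes> (u \<otimes> z \<otimes> inv u) \<otimes> u = z" using assms by (simp add: m_assoc conj_cancel)
  ultimately show "z = \<one>" using assms by simp
qed (use assms in simp)

lemma (in group) int_pow_conj:
  assumes u: "u \<in> carrier G" and z: "z \<in> carrier G"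
  shows "(u \<otimes> z \<otimes> inv u) [^] (k::int) = u \<otimes> (z [^] k) \<otimes> inv u"
proof -
  have "(\<lambda>z. u \<otimes> z \<otimes> inv u) \<in> hom G G"
    by (rule homI) (use u in \<open>simp_all add: m_assoc conj_cancel\<close>)
  then interpret cj: group_hom G G "\<lambda>z. u \<otimes> z \<otimes> inv u" by unfold_locales
  show ?thesis using cj.hom_int_pow[OF z] by simp
qed

section \<open>Permutation representations from finite quotients of the vertex groups\<close>

context gog
begin

text \<open>The maps \<open>\<psi> v\<close> are not asked to come from a map of \<open>G\<close>:
  only the kernels on each edge group have to agree. As \<open>F\<close> acts freely on itself,
  these kernels are the stabilisers, so the edge group acts in isomorphic ways at its two ends and a
  stable letter can be found.\<close>

definition compatible_quotient :: "('f, 'm) monoid_scheme \<Rightarrow> ('v \<Rightarrow> 'a \<Rightarrow> 'f) \<Rightarrow> bool" where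
  "compatible_quotient F \<psi> \<longleftrightarrow> group F \<and> finite (carrier F) \<and> (\<forall>v\<in>V. \<psi> v \<in> hom (Gv v) F) \<and>
    (\<forall>e\<in>E. \<forall>a\<in>carrier (Ge e). \<psi> (hd\<^sub>\<Gamma> e) (om e a) = \<one>\<^bsub>F\<^esub> \<longleftrightarrow> \<psi> (tl\<^sub>\<Gamma> e) (al e a) = \<one>\<^bsub>F\<^esub>)"

text \<open>The regular representation of \<open>F\<close> on disjoint copies of \<open>F\<close>, indexed by natural numbers.\<close>

definition layer_act :: "('f, 'm) monoid_scheme \<Rightarrow> ('v \<Rightarrow> 'a \<Rightarrow> 'f) \<Rightarrow> 'v \<Rightarrow> 'a \<Rightarrow> 'f \<times> nat \<Rightarrow> 'f \<times> nat" where
  "layer_act F \<psi> v g = (\<lambda>(f, i). (\<psi> v g \<otimes>\<^bsub>F\<^esub> f, i))"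

text \<open>Every point stabiliser in an edge group, at either end, is the common kernel, so
  \<open>equivariant_matching\<close> applies and extends the prescribed pairs \<open>Pr e\<close>
  to a stable letter. Its weight \<open>b e\<close> is constant on the orbits of the edge group
  because the vertex groups act without weights.\<close>

lemma regular_rep:
  fixes F :: "('f, 'm) monoid_scheme" and n :: nat
  defines "X \<equiv> carrier F \<times> {..<n}"
  assumes \<psi>: "compatible_quotient F \<psi>"
    and Pr: "\<And>e. e \<in> P \<Longrightarrow> Pr e \<subseteq> X \<times> X"
    and Prl: "\<And>e a y x y' x'. e \<in> P \<Longrightarrow> a \<in> carrier (Ge e) \<Longrightarrow> (y, x) \<in> Pr e \<Longrightarrow> (y', x') \<in> Pr e \<Longrightarrow>
      layer_act F \<psi> (hd\<^sub>\<Gamma> e) (om e a) y = y' \<Longrightarrow> (y, x) = (y', x')"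
    and Prr: "\<And>e a y x y' x'. e \<in> P \<Longrightarrow> a \<in> carrier (Ge e) \<Longrightarrow> (y, x) \<in> Pr e \<Longrightarrow> (y', x') \<in> Pr e \<Longrightarrow>
      layer_act F \<psi> (tl\<^sub>\<Gamma> e) (al e a) x = x' \<Longrightarrow> (y, x) = (y', x')"
    and b: "\<And>e a y. e \<in> P \<Longrightarrow> a \<in> carrier (Ge e) \<Longrightarrow> y \<in> X \<Longrightarrow>
      b e (layer_act F \<psi> (hd\<^sub>\<Gamma> e) (om e a) y) = b e y"
  shows "\<exists>\<beta>. (\<forall>e\<in>P. bij_betw (\<beta> e) X X \<and> (\<forall>(y, x)\<in>Pr e. \<beta> e y = x)) \<and>
    gog_rep \<G> (shift_group X) (\<lambda>v g. shift_map X (layer_act F \<psi> v g) (\<lambda>_. 0))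
      (\<lambda>e. if e \<in> P then shift_map X (\<beta> e) (b e)
        else inv\<^bsub>shift_group X\<^esub> shift_map X (\<beta> (rv e)) (b (rv e)))"
proof -
  have gF: "group F" and finF: "finite (carrier F)" and hom: "\<And>v. v \<in> V \<Longrightarrow> \<psi> v \<in> hom (Gv v) F"
    and ker: "\<And>e a. e \<in> E \<Longrightarrow> a \<in> carrier (Ge e) \<Longrightarrow>
      \<psi> (hd\<^sub>\<Gamma> e) (om e a) = \<one>\<^bsub>F\<^esub> \<longleftrightarrow> \<psi> (tl\<^sub>\<Gamma> e) (al e a) = \<one>\<^bsub>F\<^esub>"
    using \<psi> by (auto simp: compatible_quotient_def)
  interpret F: group F by fact
  have finX: "finite X" using finF by (simp add: X_def)
  have pc: "\<psi> v g \<in> carrier F" if "v \<in> V" "g \<in> carrier (Gv v)" for v g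
    using hom_in_carrier[OF hom[OF that(1)] that(2)] .
  have actX: "layer_act F \<psi> v g y \<in> X" if "v \<in> V" "g \<in> carrier (Gv v)" "y \<in> X" for v g y
    using that pc[OF that(1,2)] by (auto simp: layer_act_def X_def)
  have act1: "layer_act F \<psi> v \<one>\<^bsub>Gv v\<^esub> y = y" if "v \<in> V" "y \<in> X" for v y
    using hom_one[OF hom[OF that(1)] group_Gv[OF that(1)] gF] that by (auto simp: layer_act_def X_def)
  have actm: "layer_act F \<psi> v (g \<otimes>\<^bsub>Gv v\<^esub> h) y = layer_act F \<psi> v g (layer_act F \<psi> v h y)"
    if "v \<in> V" "g \<in> carrier (Gv v)" "h \<in> carrier (Gv v)" "y \<in> X" for v g h y
    using hom_mult[OF hom[OF that(1)] that(2,3)] pc[OF that(1,2)] pc[OF that(1,3)] that(4)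
    by (auto simp: layer_act_def X_def F.m_assoc)
  have fix1: "layer_act F \<psi> v g y = y \<longleftrightarrow> \<psi> v g = \<one>\<^bsub>F\<^esub>"
    if "v \<in> V" "g \<in> carrier (Gv v)" "y \<in> X" for v g y
    using pc[OF that(1,2)] that(3) by (auto simp: layer_act_def X_def)
  have actbij: "bij_betw (layer_act F \<psi> v g) X X" if v: "v \<in> V" and g: "g \<in> carrier (Gv v)" for v g
  proof (rule bij_betwI[where g = "layer_act F \<psi> v (inv\<^bsub>Gv v\<^esub> g)"])
    interpret Gv: group "Gv v" by (rule group_Gv[OF v])
    show "layer_act F \<psi> v g \<in> X \<rightarrow> X" "layer_act F \<psi> v (inv\<^bsub>Gv v\<^esub> g) \<in> X \<rightarrow> X"
      using actX[OF v g] actX[OF v Gv.inv_closed[OF g]] by auto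
    fix y assume y: "y \<in> X"
    show "layer_act F \<psi> v (inv\<^bsub>Gv v\<^esub> g) (layer_act F \<psi> v g y) = y"
      using actm[OF v Gv.inv_closed[OF g] g y] act1[OF v y] g by simp
    show "layer_act F \<psi> v g (layer_act F \<psi> v (inv\<^bsub>Gv v\<^esub> g) y) = y"
      using actm[OF v g Gv.inv_closed[OF g] y] act1[OF v y] g by simp
  qed
  have "\<exists>\<beta>. bij_betw \<beta> X X \<and> (\<forall>a\<in>carrier (Ge e). \<forall>y\<in>X.
      \<beta> (layer_act F \<psi> (hd\<^sub>\<Gamma> e) (om e a) y) = layer_act F \<psi> (tl\<^sub>\<Gamma> e) (al e a) (\<beta> y)) \<and> (\<forall>(y, x)\<in>Pr e. \<beta> y = x)"
    if e: "e \<in> P" for e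
  proof -
    have eE: "e \<in> E" using e P_sub by blast
    note hv = \<Gamma>.head_in_verts[OF eE] and tv = \<Gamma>.tail_in_verts[OF eE]
    show ?thesis
    proof (rule equivariant_matching[OF group_Ge[OF eE] finX])
      fix a y assume "a \<in> carrier (Ge e)" "y \<in> X"
      then show "layer_act F \<psi> (hd\<^sub>\<Gamma> e) (om e a) y \<in> X" "layer_act F \<psi> (tl\<^sub>\<Gamma> e) (al e a) y \<in> X"
        using actX[OF hv om_closed[OF eE]] actX[OF tv al_closed[OF eE]] by blast+
    next
      fix y assume y: "y \<in> X"
      show "layer_act F \<psi> (hd\<^sub>\<Gamma> e) (om e \<one>\<^bsub>Ge e\<^esub>) y = y"
        unfolding hom_one[OF om_hom[OF eE] group_Ge[OF eE] group_Gv[OF hv]] by (rule act1[OF hv y])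
      show "layer_act F \<psi> (tl\<^sub>\<Gamma> e) (al e \<one>\<^bsub>Ge e\<^esub>) y = y"
        unfolding hom_one[OF al_hom[OF eE] group_Ge[OF eE] group_Gv[OF tv]] by (rule act1[OF tv y])
    next
      fix a c y assume a: "a \<in> carrier (Ge e)" and c: "c \<in> carrier (Ge e)" and y: "y \<in> X"
      show "layer_act F \<psi> (hd\<^sub>\<Gamma> e) (om e (a \<otimes>\<^bsub>Ge e\<^esub> c)) y =
          layer_act F \<psi> (hd\<^sub>\<Gamma> e) (om e a) (layer_act F \<psi> (hd\<^sub>\<Gamma> e) (om e c) y)"
        unfolding hom_mult[OF om_hom[OF eE] a c] by (rule actm[OF hv om_closed[OF eE a] om_closed[OF eE c] y])
      show "layer_act F \<psi> (tl\<^sub>\<Gamma> e) (al e (a \<otimes>\<^bsub>Ge e\<^esub> c)) y =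
          layer_act F \<psi> (tl\<^sub>\<Gamma> e) (al e a) (layer_act F \<psi> (tl\<^sub>\<Gamma> e) (al e c) y)"
        unfolding hom_mult[OF al_hom[OF eE] a c] by (rule actm[OF tv al_closed[OF eE a] al_closed[OF eE c] y])
    next
      fix a y x assume a: "a \<in> carrier (Ge e)" and yx: "y \<in> X" "x \<in> X"
      show "layer_act F \<psi> (hd\<^sub>\<Gamma> e) (om e a) y = y \<longleftrightarrow> layer_act F \<psi> (tl\<^sub>\<Gamma> e) (al e a) x = x"
        unfolding fix1[OF hv om_closed[OF eE a] yx(1)] fix1[OF tv al_closed[OF eE a] yx(2)] by (rule ker[OF eE a])
    next
      show "Pr e \<subseteq> X \<times> X" by (rule Pr[OF e])
    next
      fix a y x y' x'
      assume "a \<in> carrier (Ge e)" "(y, x) \<in> Pr e" "(y', x') \<in> Pr e" "layer_act F \<psi> (hd\<^sub>\<Gamma> e) (om e a) y = y'"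
      then show "(y, x) = (y', x')" by (rule Prl[OF e])
    next
      fix a y x y' x'
      assume "a \<in> carrier (Ge e)" "(y, x) \<in> Pr e" "(y', x') \<in> Pr e" "layer_act F \<psi> (tl\<^sub>\<Gamma> e) (al e a) x = x'"
      then show "(y, x) = (y', x')" by (rule Prr[OF e])
    qed
  qed
  then have "\<exists>\<beta>. \<forall>e\<in>P. bij_betw (\<beta> e) X X \<and> (\<forall>a\<in>carrier (Ge e). \<forall>y\<in>X.
      \<beta> e (layer_act F \<psi> (hd\<^sub>\<Gamma> e) (om e a) y) = layer_act F \<psi> (tl\<^sub>\<Gamma> e) (al e a) (\<beta> e y)) \<and>
      (\<forall>(y, x)\<in>Pr e. \<beta> e y = x)"
    by (intro bchoice ballI)
  then obtain \<beta> where \<beta>': "\<forall>e\<in>P. bij_betw (\<beta> e) X X \<and> (\<forall>a\<in>carrier (Ge e). \<forall>y\<in>X.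
      \<beta> e (layer_act F \<psi> (hd\<^sub>\<Gamma> e) (om e a) y) = layer_act F \<psi> (tl\<^sub>\<Gamma> e) (al e a) (\<beta> e y)) \<and>
      (\<forall>(y, x)\<in>Pr e. \<beta> e y = x)"
    by (elim exE)
  then have \<beta>: "\<And>e. e \<in> P \<Longrightarrow> bij_betw (\<beta> e) X X"
    "\<And>e a y. e \<in> P \<Longrightarrow> a \<in> carrier (Ge e) \<Longrightarrow> y \<in> X \<Longrightarrow>
      \<beta> e (layer_act F \<psi> (hd\<^sub>\<Gamma> e) (om e a) y) = layer_act F \<psi> (tl\<^sub>\<Gamma> e) (al e a) (\<beta> e y)"
    "\<And>e. e \<in> P \<Longrightarrow> \<forall>(y, x)\<in>Pr e. \<beta> e y = x"
    by simp_all
  have "gog_rep \<G> (shift_group X) (\<lambda>v g. shift_map X (layer_act F \<psi> v g) ((\<lambda>v g _. 0) v g))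
      (\<lambda>e. if e \<in> P then shift_map X (\<beta> e) (b e)
        else inv\<^bsub>shift_group X\<^esub> shift_map X (\<beta> (rv e)) (b (rv e)))"
    by (rule shift_rep) (use actbij actm \<beta> b in simp_all)
  then show ?thesis using \<beta> by (intro exI[of _ \<beta>]) simp
qed

text \<open>One copy of the regular representation suffices, without prescribed pairs. Forgetting
  weights maps \<open>G\<close> to a finite group of permutations, and a power of \<open>y\<close>
  that acts trivially there fixes the point 1 of \<open>F\<close>, so it lies in the kernel of
  \<open>\<psi> v\<close>.\<close>

lemma virtual_retract_of_quotient_faithful:
  assumes \<psi>: "compatible_quotient F \<psi>" and g: "g \<in> carrier G"
    and v: "v \<in> V" "y \<in> carrier (Gv v)" "conj_to g (vert v y)"
    and faith: "\<And>k::int. \<psi> v (y [^]\<^bsub>Gv v\<^esub> k) = \<one>\<^bsub>F\<^esub> \<Longrightarrow> y [^]\<^bsub>Gv v\<^esub> k = \<one>\<^bsub>Gv v\<^esub>"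
  shows "virtual_retract (generate G {g}) G"
proof -
  let ?X = "carrier F \<times> {..<1::nat}"
  have gF: "group F" and finF: "finite (carrier F)" and hom: "\<psi> v \<in> hom (Gv v) F"
    using \<psi> v by (auto simp: compatible_quotient_def)
  interpret F: group F by fact
  interpret G: group G by (rule group_G)
  interpret Gv: group "Gv v" by (rule group_Gv[OF v(1)])
  have finX: "finite ?X" using finF by simp
  have "\<exists>\<beta>. (\<forall>e\<in>P. bij_betw (\<beta> e) ?X ?X \<and> (\<forall>(y, x)\<in>{}. \<beta> e y = x)) \<and>
    gog_rep \<G> (shift_group ?X) (\<lambda>v g. shift_map ?X (layer_act F \<psi> v g) (\<lambda>_. 0))
      (\<lambda>e. if e \<in> P then shift_map ?X (\<beta> e) (\<lambda>_. 0)
        else inv\<^bsub>shift_group ?X\<^esub> shift_map ?X (\<beta> (rv e)) (\<lambda>_. 0))"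
    by (rule regular_rep[OF \<psi>, of "\<lambda>_. {}" 1 "\<lambda>_ _. 0"]) simp_all
  then obtain \<tau> where rep: "gog_rep \<G> (shift_group ?X) (\<lambda>v g. shift_map ?X (layer_act F \<psi> v g) (\<lambda>_. 0)) \<tau>"
    by blast
  let ?H = "shift_group ?X" and ?\<theta> = "\<lambda>v g. shift_map ?X (layer_act F \<psi> v g) (\<lambda>_. 0)"
  interpret H: group ?H by (rule group_shift_group)
  obtain \<Phi> l where \<Phi>: "\<Phi> \<in> hom G ?H" "\<forall>v\<in>V. l v \<in> carrier ?H"
    "\<forall>v\<in>V. \<forall>g\<in>carrier (Gv v). \<Phi> (vert v g) = l v \<otimes>\<^bsub>?H\<^esub> ?\<theta> v g \<otimes>\<^bsub>?H\<^esub> inv\<^bsub>?H\<^esub> l v"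
    using rep_to_hom[OF group_shift_group rep] by blast
  let ?\<Psi> = "shift_to_perm ?X \<circ> \<Phi>"
  let ?S = "perm_group ?X"
  interpret S: group ?S by (rule group_perm_group)
  have sp: "shift_to_perm ?X \<in> hom ?H ?S" by (rule shift_to_perm_hom[OF finX])
  have \<Psi>: "?\<Psi> \<in> hom G ?S" using hom_compose[OF \<Phi>(1) sp] .
  interpret sp: group_hom ?H ?S "shift_to_perm ?X"
    by (intro group_hom.intro group_hom_axioms.intro group_shift_group group_perm_group sp)
  interpret \<Psi>: group_hom G ?S ?\<Psi>
    by (intro group_hom.intro group_hom_axioms.intro group_G group_perm_group \<Psi>)
  have finS: "finite (carrier ?S)" using finite_permutations[OF finX] by (simp add: perm_group_def)
  obtain u where u: "u \<in> carrier G" "g = u \<otimes>\<^bsub>G\<^esub> vert v y \<otimes>\<^bsub>G\<^esub> inv\<^bsub>G\<^esub> u"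
    using v(3) by (auto simp: conj_to_def)
  have vh: "vert v (y [^]\<^bsub>Gv v\<^esub> (k::int)) = vert v y [^]\<^bsub>G\<^esub> k" for k
  proof -
    interpret vh: group_hom "Gv v" G "vert v"
      by (intro group_hom.intro group_hom_axioms.intro vert_hom v(1) group_G group_Gv)
    show ?thesis using vh.hom_int_pow[OF v(2)] by simp
  qed
  have gk: "g [^]\<^bsub>G\<^esub> (k::int) = u \<otimes>\<^bsub>G\<^esub> (vert v y [^]\<^bsub>G\<^esub> k) \<otimes>\<^bsub>G\<^esub> inv\<^bsub>G\<^esub> u" for k
    unfolding u(2) by (rule G.int_pow_conj[OF u(1) vert_closed[OF v(1,2)]])
  have "g [^]\<^bsub>G\<^esub> k = \<one>\<^bsub>G\<^esub>" if k: "?\<Psi> (g [^]\<^bsub>G\<^esub> k) = \<one>\<^bsub>?S\<^esub>" for k :: int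
  proof -
    let ?z = "y [^]\<^bsub>Gv v\<^esub> k"
    have z: "?z \<in> carrier (Gv v)" using v(2) by simp
    have vc: "vert v ?z \<in> carrier G" by (rule vert_closed[OF v(1) z])
    have "?\<Psi> u \<otimes>\<^bsub>?S\<^esub> ?\<Psi> (vert v ?z) \<otimes>\<^bsub>?S\<^esub> inv\<^bsub>?S\<^esub> ?\<Psi> u = \<one>\<^bsub>?S\<^esub>"
    proof -
      have "?\<Psi> (u \<otimes>\<^bsub>G\<^esub> vert v ?z \<otimes>\<^bsub>G\<^esub> inv\<^bsub>G\<^esub> u) = \<one>\<^bsub>?S\<^esub>" using k unfolding gk vh[symmetric] .
      then show ?thesis
        using \<Psi>.hom_mult[OF G.m_closed[OF u(1) vc] G.inv_closed[OF u(1)]] \<Psi>.hom_mult[OF u(1) vc]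
          \<Psi>.hom_inv[OF u(1)] by simp
    qed
    then have "?\<Psi> (vert v ?z) = \<one>\<^bsub>?S\<^esub>"
      using S.conj_eq_one_iff[OF \<Psi>.hom_closed[OF u(1)] \<Psi>.hom_closed[OF vc]] by blast
    moreover have th: "?\<theta> v ?z \<in> carrier ?H"
    proof -
      have "?\<theta> v \<in> hom (Gv v) ?H" using rep v(1) by (simp add: gog_rep_def)
      then show ?thesis using hom_in_carrier z by metis
    qed
    have lv: "l v \<in> carrier ?H" using \<Phi>(2) v(1) by simp
    have "?\<Psi> (vert v ?z) = shift_to_perm ?X (l v) \<otimes>\<^bsub>?S\<^esub> shift_to_perm ?X (?\<theta> v ?z) \<otimes>\<^bsub>?S\<^esub>
        inv\<^bsub>?S\<^esub> shift_to_perm ?X (l v)"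
    proof -
      have "?\<Psi> (vert v ?z) = shift_to_perm ?X (l v \<otimes>\<^bsub>?H\<^esub> ?\<theta> v ?z \<otimes>\<^bsub>?H\<^esub> inv\<^bsub>?H\<^esub> l v)"
        using \<Phi>(3) v(1) z by simp
      then show ?thesis
        using sp.hom_mult[OF H.m_closed[OF lv th] H.inv_closed[OF lv]] sp.hom_mult[OF lv th] sp.hom_inv[OF lv]
        by simp
    qed
    ultimately have "shift_to_perm ?X (?\<theta> v ?z) = \<one>\<^bsub>?S\<^esub>"
      using S.conj_eq_one_iff[OF sp.hom_closed[OF lv] sp.hom_closed[OF th]] by simp
    then have "shift_to_perm ?X (?\<theta> v ?z) (\<one>\<^bsub>F\<^esub>, 0) = (\<one>\<^bsub>F\<^esub>, 0)" by (simp add: perm_group_def)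
    then have "\<psi> v ?z = \<one>\<^bsub>F\<^esub>"
      using hom_in_carrier[OF hom z] by (simp add: shift_to_perm_def shift_map_def layer_act_def)
    then have "?z = \<one>\<^bsub>Gv v\<^esub>" by (rule faith)
    then show ?thesis unfolding gk vh[symmetric] using vert_one[OF v(1)] u(1) by simp
  qed
  then show ?thesis by (rule virtual_retract_of_faithful[OF group_G group_perm_group \<Psi> finS g])
qed

lemma gog_path_nth:
  assumes "gog_path \<G> u p v" "i < length p"
  shows "fst (p ! i) \<in> E" "snd (p ! i) \<in> carrier (Gv (hd\<^sub>\<Gamma> (fst (p ! i))))"
  using assms by (induction p arbitrary: u i) (auto simp: nth_Cons' split: if_splits)

text \<open>There is one copy of \<open>F\<close> for each edge, and the point 1 of copy
  \<open>i\<close> represents the start of edge \<open>i\<close>. In a product the last factor acts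
  first: the entry of edge \<open>i\<close> carries \<open>(1, nx i)\<close> to
  \<open>(x i, nx i)\<close>, and its stable letter takes this to \<open>(1, i)\<close>. The path
  thus runs through all copies backwards and closes up.\<close>

lemma virtual_retract_of_reduced_cycle:
  assumes \<psi>: "compatible_quotient F \<psi>" and g: "g \<in> carrier G"
    and p: "gog_path \<G> v p v" "p \<noteq> []" "conj_to g (ev p)"
    and red: "\<And>i a. i < length p \<Longrightarrow> fst (p ! (Suc i mod length p)) = rv (fst (p ! i)) \<Longrightarrow>
      a \<in> carrier (Ge (fst (p ! i))) \<Longrightarrow>
      \<psi> (hd\<^sub>\<Gamma> (fst (p ! i))) (snd (p ! i)) \<noteq> \<psi> (hd\<^sub>\<Gamma> (fst (p ! i))) (om (fst (p ! i)) a)"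
  shows "virtual_retract (generate G {g}) G"
proof -
  define n where "n = length p"
  define X where "X = carrier F \<times> {..<n}"
  define E' where "E' i = fst (p ! i)" for i
  define x where "x i = \<psi> (hd\<^sub>\<Gamma> (E' i)) (snd (p ! i))" for i
  define nx where "nx i = Suc i mod n" for i
  have n0: "n > 0" using p(2) by (simp add: n_def)
  have gF: "group F" and finF: "finite (carrier F)" and hom: "\<And>v. v \<in> V \<Longrightarrow> \<psi> v \<in> hom (Gv v) F"
    using \<psi> by (auto simp: compatible_quotient_def)
  interpret F: group F by fact
  have finX: "finite X" using finF by (simp add: X_def)
  have pE: "E' i \<in> E" and pg: "snd (p ! i) \<in> carrier (Gv (hd\<^sub>\<Gamma> (E' i)))" if "i < n" for i
    using gog_path_nth[OF p(1), of i] that by (auto simp: E'_def n_def)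
  have xF: "x i \<in> carrier F" if "i < n" for i
    unfolding x_def by (rule hom_in_carrier[OF hom pg[OF that]]) (use pE[OF that] in simp)
  have nxn: "nx i < n" for i using n0 by (simp add: nx_def)
  have nx_inj: "i = j" if "i < n" "j < n" "nx i = nx j" for i j
    using that by (auto simp: nx_def mod_Suc split: if_splits)
  have omF: "\<psi> (hd\<^sub>\<Gamma> e) (om e a) \<in> carrier F" if "e \<in> E" "a \<in> carrier (Ge e)" for e a
    by (rule hom_in_carrier[OF hom om_closed[OF that]]) (use that in simp)
  have no_back: "x i \<noteq> \<psi> (hd\<^sub>\<Gamma> e) (om e a)"
    if "i < n" "E' i = e" "E' (nx i) = rv e" "a \<in> carrier (Ge e)" for i e a
    using red[of i a] that by (auto simp: x_def E'_def nx_def n_def)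
  \<comment> \<open>The same condition after inverting the edge group element, for the case where
    the orbit is entered from the other of the two points.\<close>
  have no_back': "\<psi> (hd\<^sub>\<Gamma> e) (om e a) \<otimes>\<^bsub>F\<^esub> x i \<noteq> \<one>\<^bsub>F\<^esub>"
    if i: "i < n" "E' i = e" "E' (nx i) = rv e" "a \<in> carrier (Ge e)" for i e a
  proof
    assume eq: "\<psi> (hd\<^sub>\<Gamma> e) (om e a) \<otimes>\<^bsub>F\<^esub> x i = \<one>\<^bsub>F\<^esub>"
    have e: "e \<in> E" using pE[OF i(1)] i(2) by simp
    interpret Ge: group "Ge e" by (rule group_Ge[OF e])
    have hv: "hd\<^sub>\<Gamma> e \<in> V" using e by simp
    interpret h: group_hom "Gv (hd\<^sub>\<Gamma> e)" F "\<psi> (hd\<^sub>\<Gamma> e)"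
      by (intro group_hom.intro group_hom_axioms.intro hom hv group_Gv gF)
    interpret o: group_hom "Ge e" "Gv (hd\<^sub>\<Gamma> e)" "om e"
      by (intro group_hom.intro group_hom_axioms.intro om_hom e group_Ge group_Gv hv)
    have "x i = inv\<^bsub>F\<^esub> \<psi> (hd\<^sub>\<Gamma> e) (om e a)"
      using eq F.inv_equality[of "x i"] omF[OF e i(4)] xF[OF i(1)] F.inv_comm by metis
    also have "\<dots> = \<psi> (hd\<^sub>\<Gamma> e) (om e (inv\<^bsub>Ge e\<^esub> a))" using i(4) om_closed[OF e i(4)] by simp
    finally show False using no_back[OF i(1-3) Ge.inv_closed[OF i(4)]] by simp
  qed
  let ?L = "\<lambda>e a. layer_act F \<psi> (hd\<^sub>\<Gamma> e) (om e a)"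
  have L: "?L e a (f, i) = (\<psi> (hd\<^sub>\<Gamma> e) (om e a) \<otimes>\<^bsub>F\<^esub> f, i)" for e a f i by (simp add: layer_act_def)
  \<comment> \<open>The vertices of the path become the points \<open>(\<one>, i)\<close> and \<open>(x i, nx i)\<close>; the stable letter of its
    \<open>i\<close>-th edge has to send the latter to the former, and reducedness makes these demands compatible.\<close>
  define src where "src e = {((x i, nx i), (\<one>\<^bsub>F\<^esub>, i)) | i. i < n \<and> E' i = e}" for e
  \<comment> \<open>A passage through \<open>rv e\<close> prescribes a value of the inverse of the
    stable letter of \<open>e\<close>, hence the converse.\<close>
  define Pr where "Pr e = src e \<union> (src (rv e))\<inverse>" for e
  have srcI: "((x i, nx i), (\<one>\<^bsub>F\<^esub>, i)) \<in> src (E' i)" if "i < n" for i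
    using that unfolding src_def by blast
  have srcE: "\<exists>i<n. E' i = e \<and> y = (x i, nx i) \<and> z = (\<one>\<^bsub>F\<^esub>, i)" if "(y, z) \<in> src e" for y z e
    using that unfolding src_def mem_Collect_eq prod.inject by (elim exE conjE) (intro exI conjI)
  have Pr_rv: "Pr (rv e) = (Pr e)\<inverse>" for e by (auto simp: Pr_def)
  have PrE: "(\<exists>i<n. E' i = e \<and> y = (x i, nx i) \<and> z = (\<one>\<^bsub>F\<^esub>, i)) \<or>
      (\<exists>i<n. E' i = rv e \<and> y = (\<one>\<^bsub>F\<^esub>, i) \<and> z = (x i, nx i))" if "(y, z) \<in> Pr e" for y z e
  proof -
    from that have "(y, z) \<in> src e \<or> (z, y) \<in> src (rv e)" by (simp add: Pr_def)
    then show ?thesis using srcE[of y z e] srcE[of z y "rv e"] by auto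
  qed
  have PrX: "Pr e \<subseteq> X \<times> X" for e
  proof (rule subrelI)
    fix y z assume "(y, z) \<in> Pr e"
    from PrE[OF this] show "(y, z) \<in> X \<times> X"
      by (elim disjE exE conjE) (use xF nxn in \<open>simp_all add: X_def\<close>)
  qed
  \<comment> \<open>Different passages in the same direction lie in different copies. Passages in
    opposite directions meet one orbit only if one directly follows the other: a backtracking whose
    entry agrees in \<open>F\<close> with an edge group element.\<close>
  have key: "(y, z) = (y', z')"
    if e: "e \<in> E" and a: "a \<in> carrier (Ge e)" and yz: "(y, z) \<in> Pr e" "(y', z') \<in> Pr e" and eq: "?L e a y = y'"
    for e a y z y' z'
    using PrE[OF yz(1)] PrE[OF yz(2)]
  proof (elim disjE exE conjE)
    fix i j assume "i < n" "j < n" "y = (x i, nx i)" "z = (\<one>\<^bsub>F\<^esub>, i)" "y' = (x j, nx j)" "z' = (\<one>\<^bsub>F\<^esub>, j)"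
    then show ?thesis using eq nx_inj[of i j] L by auto
  next
    fix i j assume "i < n" "j < n" "y = (\<one>\<^bsub>F\<^esub>, i)" "z = (x i, nx i)" "y' = (\<one>\<^bsub>F\<^esub>, j)" "z' = (x j, nx j)"
    then show ?thesis using eq L by auto
  next
    fix i j assume i: "i < n" "E' i = e" "y = (x i, nx i)" and j: "j < n" "E' j = rv e" "y' = (\<one>\<^bsub>F\<^esub>, j)"
    then have "\<psi> (hd\<^sub>\<Gamma> e) (om e a) \<otimes>\<^bsub>F\<^esub> x i = \<one>\<^bsub>F\<^esub>" "nx i = j" using eq L by auto
    then show ?thesis using no_back'[OF i(1,2) _ a] j by blast
  next
    fix i j assume i: "i < n" "E' i = rv e" "y = (\<one>\<^bsub>F\<^esub>, i)" and j: "j < n" "E' j = e" "y' = (x j, nx j)"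
    then have "\<psi> (hd\<^sub>\<Gamma> e) (om e a) = x j" "nx j = i" using eq L omF[OF e a] by auto
    then show ?thesis using no_back[OF j(1,2) _ a] i by auto
  qed
  define m where "m = n - 1"
  have m: "m < n" "nx m = 0" using n0 by (auto simp: m_def nx_def)
  define orb where "orb e y y0 \<longleftrightarrow> (\<exists>a\<in>carrier (Ge e). y = ?L e a y0)" for e y y0
  \<comment> \<open>Only the traversal of the last edge of the path, in its own orbit, carries a weight.\<close>
  define b where "b e y = (if E' m = e \<and> orb e y (x m, 0) then 1
    else if E' m = rv e \<and> orb e y (\<one>\<^bsub>F\<^esub>, m) then - 1 else (0 :: int))" for e y
  have orb_inv: "orb e (?L e a y) y0 \<longleftrightarrow> orb e y y0" if e: "e \<in> E" and a: "a \<in> carrier (Ge e)" and y: "y \<in> X" "y0 \<in> X"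
    for e a y y0
  proof -
    interpret Ge: group "Ge e" by (rule group_Ge[OF e])
    have Lm: "?L e (c \<otimes>\<^bsub>Ge e\<^esub> d) z = ?L e c (?L e d z)" if "c \<in> carrier (Ge e)" "d \<in> carrier (Ge e)" "z \<in> X" for c d z
    proof -
      have "\<psi> (hd\<^sub>\<Gamma> e) (om e (c \<otimes>\<^bsub>Ge e\<^esub> d)) = \<psi> (hd\<^sub>\<Gamma> e) (om e c) \<otimes>\<^bsub>F\<^esub> \<psi> (hd\<^sub>\<Gamma> e) (om e d)"
        using hom_mult[OF hom om_closed[OF e that(1)] om_closed[OF e that(2)]] hom_mult[OF om_hom[OF e] that(1,2)] e
        by simp
      then show ?thesis using that(3) omF[OF e that(1)] omF[OF e that(2)] by (auto simp: L X_def F.m_assoc)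
    qed
    have L1: "?L e \<one>\<^bsub>Ge e\<^esub> z = z" if "z \<in> X" for z
    proof -
      have hv: "hd\<^sub>\<Gamma> e \<in> V" using e by simp
      have "\<psi> (hd\<^sub>\<Gamma> e) (om e \<one>\<^bsub>Ge e\<^esub>) = \<one>\<^bsub>F\<^esub>"
        using hom_one[OF om_hom[OF e] group_Ge[OF e] group_Gv[OF hv]] hom_one[OF hom[OF hv] group_Gv[OF hv] gF] by simp
      then show ?thesis using that by (auto simp: L X_def)
    qed
    show ?thesis
    proof
      assume "orb e (?L e a y) y0"
      then obtain c where c: "c \<in> carrier (Ge e)" "?L e a y = ?L e c y0" unfolding orb_def by blast
      have "y = ?L e (inv\<^bsub>Ge e\<^esub> a) (?L e a y)"
        using Lm[OF Ge.inv_closed[OF a] a y(1)] L1[OF y(1)] a by simp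
      also have "\<dots> = ?L e (inv\<^bsub>Ge e\<^esub> a \<otimes>\<^bsub>Ge e\<^esub> c) y0"
        using Lm[OF Ge.inv_closed[OF a] c(1) y(2)] c(2) by simp
      finally show "orb e y y0" unfolding orb_def using a c(1) by (intro bexI[of _ "inv\<^bsub>Ge e\<^esub> a \<otimes>\<^bsub>Ge e\<^esub> c"]) simp_all
    next
      assume "orb e y y0"
      then obtain c where c: "c \<in> carrier (Ge e)" "y = ?L e c y0" unfolding orb_def by blast
      then have "?L e a y = ?L e (a \<otimes>\<^bsub>Ge e\<^esub> c) y0" using Lm[OF a c(1) y(2)] by simp
      then show "orb e (?L e a y) y0" unfolding orb_def using a c(1) by (intro bexI[of _ "a \<otimes>\<^bsub>Ge e\<^esub> c"]) simp_all
    qed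
  qed
  have orb_self: "orb e z z" if "e \<in> E" "z \<in> X" for e z
  proof -
    interpret Ge: group "Ge e" by (rule group_Ge[OF that(1)])
    have hv: "hd\<^sub>\<Gamma> e \<in> V" using that by simp
    have "\<psi> (hd\<^sub>\<Gamma> e) (om e \<one>\<^bsub>Ge e\<^esub>) = \<one>\<^bsub>F\<^esub>"
      using hom_one[OF om_hom[OF that(1)] group_Ge[OF that(1)] group_Gv[OF hv]]
        hom_one[OF hom[OF hv] group_Gv[OF hv] gF] by simp
    then show ?thesis unfolding orb_def using that(2) Ge.one_closed by (intro bexI[of _ "\<one>\<^bsub>Ge e\<^esub>"]) (auto simp: L X_def)
  qed
  have X0: "(x m, 0) \<in> X" "(\<one>\<^bsub>F\<^esub>, i) \<in> X" "(x i, nx i) \<in> X" if "i < n" for i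
    using xF m n0 that nxn by (auto simp: X_def)
  let ?\<theta> = "\<lambda>v g. shift_map X (layer_act F \<psi> v g) (\<lambda>_. 0)"
  have "\<exists>\<beta>. (\<forall>e\<in>P. bij_betw (\<beta> e) X X \<and> (\<forall>(y, x)\<in>Pr e. \<beta> e y = x)) \<and>
    gog_rep \<G> (shift_group X) ?\<theta> (\<lambda>e. if e \<in> P then shift_map X (\<beta> e) (b e)
      else inv\<^bsub>shift_group X\<^esub> shift_map X (\<beta> (rv e)) (b (rv e)))"
  proof (rule regular_rep[OF \<psi>, where n = n, folded X_def])
    fix e assume "e \<in> P" show "Pr e \<subseteq> X \<times> X" by (rule PrX)
  next
    fix e a y z y' z'
    assume "e \<in> P" "a \<in> carrier (Ge e)" "(y, z) \<in> Pr e" "(y', z') \<in> Pr e" "?L e a y = y'"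
    then show "(y, z) = (y', z')" using key[of e a y z y' z'] P_sub by blast
  next
    fix e a y z y' z'
    assume e: "e \<in> P" and a: "a \<in> carrier (Ge e)" and yz: "(y, z) \<in> Pr e" "(y', z') \<in> Pr e"
      and eq: "layer_act F \<psi> (tl\<^sub>\<Gamma> e) (al e a) z = z'"
    have eE: "e \<in> E" using e P_sub by blast
    have 1: "(z, y) \<in> Pr (rv e)" "(z', y') \<in> Pr (rv e)" using yz by (simp_all add: Pr_rv)
    have 2: "rv e \<in> E" "a \<in> carrier (Ge (rv e))" using eE a by (simp_all add: Ge_rv)
    have 3: "?L (rv e) a z = z'" using eq eE by (simp add: om_rv)
    have "(z, y) = (z', y')" by (rule key[OF 2 1 3])
    then show "(y, z) = (y', z')" by simp
  next
    fix e a y assume e: "e \<in> P" and a: "a \<in> carrier (Ge e)" and y: "y \<in> X"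
    have eE: "e \<in> E" using e P_sub by blast
    show "b e (?L e a y) = b e y"
      unfolding b_def using orb_inv[OF eE a y X0(1)[OF m(1)]] orb_inv[OF eE a y X0(2)[OF m(1)]] by simp
  qed
  then obtain \<beta> where \<beta>: "\<forall>e\<in>P. bij_betw (\<beta> e) X X \<and> (\<forall>(y, x)\<in>Pr e. \<beta> e y = x)"
    and rep: "gog_rep \<G> (shift_group X) ?\<theta> (\<lambda>e. if e \<in> P then shift_map X (\<beta> e) (b e)
      else inv\<^bsub>shift_group X\<^esub> shift_map X (\<beta> (rv e)) (b (rv e)))"
    by (elim exE conjE)
  define \<tau> where "\<tau> e = (if e \<in> P then shift_map X (\<beta> e) (b e)
      else inv\<^bsub>shift_group X\<^esub> shift_map X (\<beta> (rv e)) (b (rv e)))" for e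
  have rep: "gog_rep \<G> (shift_group X) ?\<theta> \<tau>" using rep unfolding \<tau>_def .
  interpret H: group "shift_group X" by (rule group_shift_group)
  \<comment> \<open>The cases are the two orientations of the edge. In the second the stable letter
    is the inverse of a weighted map, whence the \<open>- 1\<close> in \<open>b\<close>. For
    \<open>i \<noteq> m\<close> the weighted orbit is missed, either by its copy or by
    reducedness.\<close>
  have step: "\<tau> (E' i) ((x i, nx i), k) = ((\<one>\<^bsub>F\<^esub>, i), k + (if i = m then 1 else 0))" if i: "i < n" for i k
  proof (cases "E' i \<in> P")
    case True
    have "((x i, nx i), (\<one>\<^bsub>F\<^esub>, i)) \<in> Pr (E' i)" using srcI[OF i] by (simp add: Pr_def)
    then have \<beta>i: "\<beta> (E' i) (x i, nx i) = (\<one>\<^bsub>F\<^esub>, i)" using \<beta> True by fastforce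
    have "b (E' i) (x i, nx i) = (if i = m then 1 else 0)"
    proof (cases "i = m")
      case True
      then show ?thesis using orb_self[OF pE[OF i] X0(3)[OF i]] m(2) by (simp add: b_def)
    next
      case False
      have "nx i \<noteq> 0" using nx_inj[OF i m(1)] m(2) False by auto
      then have 1: "\<not> orb (E' i) (x i, nx i) (x m, 0)" by (auto simp: orb_def L)
      have 2: "\<not> orb (E' i) (x i, nx i) (\<one>\<^bsub>F\<^esub>, m)" if Em: "E' m = rv (E' i)"
      proof
        assume "orb (E' i) (x i, nx i) (\<one>\<^bsub>F\<^esub>, m)"
        then obtain a where a: "a \<in> carrier (Ge (E' i))" "x i = \<psi> (hd\<^sub>\<Gamma> (E' i)) (om (E' i) a)" "nx i = m"
          using omF[OF pE[OF i]] by (auto simp: orb_def L)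
        then show False using no_back[OF i HOL.refl _ a(1)] Em by simp
      qed
      show ?thesis using 1 2 False by (simp add: b_def)
    qed
    then show ?thesis using True \<beta>i X0(3)[OF i] by (simp add: \<tau>_def shift_map_apply)
  next
    case False
    let ?e = "rv (E' i)"
    have eP: "?e \<in> P" by (rule P_cases[OF pE[OF i] False])
    then have eE: "?e \<in> E" using P_sub by blast
    have "((\<one>\<^bsub>F\<^esub>, i), (x i, nx i)) \<in> Pr ?e" using srcI[OF i] by (simp add: Pr_def)
    then have \<beta>i: "\<beta> ?e (\<one>\<^bsub>F\<^esub>, i) = (x i, nx i)" using \<beta> eP by fastforce
    have "b ?e (\<one>\<^bsub>F\<^esub>, i) = (if i = m then - 1 else 0)"
    proof (cases "i = m")
      case True
      have "E' m \<noteq> ?e" using \<Gamma>.arev_neq[OF pE[OF i]] True by simp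
      then show ?thesis using orb_self[OF eE X0(2)[OF i]] True by (simp add: b_def)
    next
      case False
      have 1: "\<not> orb ?e (\<one>\<^bsub>F\<^esub>, i) (x m, 0)" if Em: "E' m = ?e"
      proof
        assume "orb ?e (\<one>\<^bsub>F\<^esub>, i) (x m, 0)"
        then obtain a where a: "a \<in> carrier (Ge ?e)" "\<one>\<^bsub>F\<^esub> = \<psi> (hd\<^sub>\<Gamma> ?e) (om ?e a) \<otimes>\<^bsub>F\<^esub> x m" "i = 0"
          unfolding orb_def by (auto simp: L)
        have "E' (nx m) = rv ?e" using a(3) m(2) by simp
        from no_back'[OF m(1) Em this a(1)] show False using a(2) by simp
      qed
      have 2: "\<not> orb ?e (\<one>\<^bsub>F\<^esub>, i) (\<one>\<^bsub>F\<^esub>, m)" using False by (auto simp: orb_def L)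
      show ?thesis using 1 2 False by (simp add: b_def)
    qed
    then have 1: "shift_map X (\<beta> ?e) (b ?e) ((\<one>\<^bsub>F\<^esub>, i), k + (if i = m then 1 else 0)) = ((x i, nx i), k)"
      using \<beta>i X0(2)[OF i] by (simp add: shift_map_apply)
    define f where "f = shift_map X (\<beta> ?e) (b ?e)"
    have c: "f \<in> carrier (shift_group X)"
      using \<beta> eP unfolding f_def by (intro shift_map_closed) blast
    have "(inv\<^bsub>shift_group X\<^esub> f \<otimes>\<^bsub>shift_group X\<^esub> f) q = q" for q
      unfolding H.l_inv[OF c] by (rule shift_one)
    from this[of "((\<one>\<^bsub>F\<^esub>, i), k + (if i = m then 1 else 0))"]
    have "(inv\<^bsub>shift_group X\<^esub> f) ((x i, nx i), k) = ((\<one>\<^bsub>F\<^esub>, i), k + (if i = m then 1 else 0))"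
      unfolding shift_mult using 1 unfolding f_def[symmetric] by simp
    then show ?thesis using False by (simp add: \<tau>_def f_def)
  qed
  \<comment> \<open>The induction starts at the end of the path, where edge \<open>m\<close>
    contributes the weight 1 at once; \<open>i mod n\<close> identifies the end of the path with its
    start in copy 0.\<close>
  have walk: "path_eval \<G> (shift_group X) ?\<theta> \<tau> (drop i p) ((\<one>\<^bsub>F\<^esub>, 0), 0) =
      ((\<one>\<^bsub>F\<^esub>, i mod n), if i < n then 1 else 0)" if "i \<le> n" for i
    using that
  proof (induction "n - i" arbitrary: i)
    case 0
    then show ?case by (simp add: n_def shift_one)
  next
    case (Suc d)
    then have i: "i < n" and d: "d = n - Suc i" by auto
    have dr: "drop i p = (E' i, snd (p ! i)) # drop (Suc i) p"
      using i Cons_nth_drop_Suc[of i p] by (simp add: n_def E'_def)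
    have IH: "path_eval \<G> (shift_group X) ?\<theta> \<tau> (drop (Suc i) p) ((\<one>\<^bsub>F\<^esub>, 0), 0) =
      ((\<one>\<^bsub>F\<^esub>, nx i), if Suc i < n then 1 else 0)" using Suc(1)[OF d] i by (simp add: nx_def)
    have "?\<theta> (hd\<^sub>\<Gamma> (E' i)) (snd (p ! i)) ((\<one>\<^bsub>F\<^esub>, nx i), k) = ((x i, nx i), k)" for k
      using X0(2)[OF nxn] xF[OF i] by (simp add: shift_map_apply layer_act_def x_def)
    then have "path_eval \<G> (shift_group X) ?\<theta> \<tau> (drop i p) ((\<one>\<^bsub>F\<^esub>, 0), 0) =
        \<tau> (E' i) ((x i, nx i), if Suc i < n then 1 else 0)"
      unfolding dr by (simp add: shift_mult IH)
    also have "\<dots> = ((\<one>\<^bsub>F\<^esub>, i), (if Suc i < n then 1 else 0) + (if i = m then 1 else 0))" by (rule step[OF i])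
    finally show ?case using i by (auto simp: m_def)
  qed
  have "path_eval \<G> (shift_group X) ?\<theta> \<tau> p ((\<one>\<^bsub>F\<^esub>, 0), 0) = ((\<one>\<^bsub>F\<^esub>, 0), 1)"
    using walk[of 0] n0 by simp
  moreover have "(\<one>\<^bsub>F\<^esub>, 0) \<in> X" using X0(2)[OF n0] .
  ultimately show ?thesis
    using virtual_retract_of_path_weight[OF finX rep g p(1,3)] by (metis zero_neq_one)
qed

end

text \<open>The value \<open>d\<close> is prescribed before divisibility comes in: start from the
  trivial map on \<open>B\<close>, adjoin \<open>x\<close>, and only then extend to all of
  \<open>A\<close>.\<close>

lemma hom_extending_value:
  assumes A: "comm_group A" "finitely_generated_group A"
    and D: "comm_group D" "divisible_group D" and B: "subgroup B A" and x: "x \<in> carrier A"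
    and d: "d \<in> carrier D" "\<And>k::int. x [^]\<^bsub>A\<^esub> k \<in> B \<Longrightarrow> d [^]\<^bsub>D\<^esub> k = \<one>\<^bsub>D\<^esub>"
  shows "\<exists>f\<in>hom A D. f x = d \<and> (\<forall>b\<in>B. f b = \<one>\<^bsub>D\<^esub>)"
proof -
  interpret A: comm_group A by fact
  interpret D: comm_group D by fact
  have "subgroup (B \<times> {\<one>\<^bsub>D\<^esub>}) (A \<times>\<times> D)"
    by (intro DirProd_subgroups A.is_group D.is_group B D.triv_subgroup)
  then have "partial_hom A D (B \<times> {\<one>\<^bsub>D\<^esub>})" by (auto simp: partial_hom_def)
  then obtain R where R: "partial_hom A D R" "B \<times> {\<one>\<^bsub>D\<^esub>} \<subseteq> R" "(x, d) \<in> R"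
    using partial_hom_adjoin[OF A(1) D(1) _ x d(1), of "B \<times> {\<one>\<^bsub>D\<^esub>}"] d(2) by auto
  obtain f where f: "f \<in> hom A D" "\<forall>(x, d)\<in>R. f x = d" using partial_hom_extend[OF A D R(1)] by blast
  have "f x = d" using f(2) R(3) by auto
  moreover have "f b = \<one>\<^bsub>D\<^esub>" if "b \<in> B" for b using f(2) R(2) that by auto
  ultimately show ?thesis using f(1) by blast
qed

section \<open>Rational characters and characters of finite order\<close>

definition rat_group :: "rat monoid" where
  "rat_group = \<lparr>carrier = UNIV, mult = (+), one = 0\<rparr>"

text \<open>\<open>\<rat>/\<int>\<close>, with representatives in \<open>[0, 1)\<close>.\<close>

definition QZ :: "rat monoid" where
  "QZ = \<lparr>carrier = {0..<1}, mult = (\<lambda>x y. frac (x + y)), one = 0\<rparr>"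

lemma rat_group_simps [simp]:
  "carrier rat_group = UNIV" "x \<otimes>\<^bsub>rat_group\<^esub> y = x + y" "\<one>\<^bsub>rat_group\<^esub> = 0"
  by (simp_all add: rat_group_def)

lemma comm_group_rat_group: "comm_group rat_group"
  by (rule comm_groupI) (auto intro: exI[of _ "- x" for x])

lemma rat_group_int_pow [simp]: "x [^]\<^bsub>rat_group\<^esub> (k::int) = of_int k * x"
proof -
  interpret rat_group: comm_group rat_group by (rule comm_group_rat_group)
  have "(\<lambda>k. of_int k * x) \<in> hom integer_group rat_group" by (rule homI) (simp_all add: distrib_right)
  then interpret h: group_hom integer_group rat_group "\<lambda>k. of_int k * x"
    by (intro group_hom.intro group_hom_axioms.intro group_integer_group rat_group.is_group)
  show ?thesis using h.hom_int_pow[of 1 k] by simp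
qed

lemma divisible_rat_group: "divisible_group rat_group"
  unfolding divisible_group_def
proof (intro ballI allI impI)
  fix d :: rat and n :: nat assume n: "n > 0"
  have "(d / of_nat n) [^]\<^bsub>rat_group\<^esub> n = (d / of_nat n) [^]\<^bsub>rat_group\<^esub> (int n)" by (simp add: int_pow_int)
  also have "\<dots> = d" unfolding rat_group_int_pow using n by simp
  finally show "\<exists>d'\<in>carrier rat_group. d' [^]\<^bsub>rat_group\<^esub> n = d" by auto
qed

lemma QZ_simps [simp]:
  "x \<in> carrier QZ \<longleftrightarrow> 0 \<le> x \<and> x < 1" "x \<otimes>\<^bsub>QZ\<^esub> y = frac (x + y)" "\<one>\<^bsub>QZ\<^esub> = 0"
  by (auto simp: QZ_def)

lemma frac_frac_add: "frac (frac x + y) = frac (x + y)" "frac (x + frac y) = frac (x + y)" for x y :: rat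
  by (simp_all add: frac_def floor_add algebra_simps)

lemma comm_group_QZ: "comm_group QZ"
proof (rule comm_groupI)
  fix x assume "x \<in> carrier QZ"
  then show "\<exists>y\<in>carrier QZ. y \<otimes>\<^bsub>QZ\<^esub> x = \<one>\<^bsub>QZ\<^esub>"
    by (intro bexI[of _ "frac (- x)"]) (simp_all add: frac_frac_add frac_lt_1)
qed (auto simp: frac_lt_1 frac_frac_add frac_eq add.assoc add.commute add.left_commute)

lemma frac_hom_QZ: "frac \<in> hom rat_group QZ"
  by (rule homI) (simp_all add: frac_lt_1 frac_frac_add)

lemma QZ_int_pow: "x \<in> carrier QZ \<Longrightarrow> x [^]\<^bsub>QZ\<^esub> (k::int) = frac (of_int k * x)"
proof -
  assume x: "x \<in> carrier QZ"
  interpret h: group_hom rat_group QZ frac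
    by (intro group_hom.intro group_hom_axioms.intro frac_hom_QZ comm_group.axioms(2) comm_group_QZ comm_group_rat_group)
  show ?thesis using h.hom_int_pow[of x k] x by (simp add: frac_eq)
qed

lemma divisible_QZ: "divisible_group QZ"
  unfolding divisible_group_def
proof (intro ballI allI impI)
  fix d :: rat and n :: nat assume n: "n > 0" and d: "d \<in> carrier QZ"
  have "0 \<le> d / of_nat n" using d by simp
  moreover have "d / of_nat n \<le> d" using d n by (simp add: divide_le_eq mult_le_cancel_left1)
  ultimately have c: "d / of_nat n \<in> carrier QZ" using d by simp
  have "(d / of_nat n) [^]\<^bsub>QZ\<^esub> n = (d / of_nat n) [^]\<^bsub>QZ\<^esub> (int n)" by (simp add: int_pow_int)
  also have "\<dots> = d" unfolding QZ_int_pow[OF c] using n d by (simp add: frac_eq)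
  finally show "\<exists>d'\<in>carrier QZ. d' [^]\<^bsub>QZ\<^esub> n = d" using c by blast
qed

lemma rat_character:
  assumes A: "comm_group A" "finitely_generated_group A" and x: "x \<in> carrier A"
    and inf: "\<And>k::int. x [^]\<^bsub>A\<^esub> k = \<one>\<^bsub>A\<^esub> \<Longrightarrow> k = 0"
  shows "\<exists>f\<in>hom A rat_group. f x = 1"
proof -
  interpret A: comm_group A by fact
  have "\<exists>f\<in>hom A rat_group. f x = 1 \<and> (\<forall>b\<in>{\<one>\<^bsub>A\<^esub>}. f b = \<one>\<^bsub>rat_group\<^esub>)"
    by (rule hom_extending_value[OF A comm_group_rat_group divisible_rat_group A.triv_subgroup x])
      (use inf in auto)
  then show ?thesis by blast
qed

text \<open>If \<open>x\<close> has finite order \<open>n\<close> modulo \<open>B\<close>, the value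
  1/n is faithful on the cyclic group it generates modulo \<open>B\<close>. If the order is
  infinite, no character into the torsion group \<rat>/\<int> is faithful there, so only the
  separation of \<open>x\<close> from \<open>B\<close> is claimed.\<close>

lemma QZ_character:
  assumes A: "comm_group A" "finitely_generated_group A" and B: "subgroup B A" and x: "x \<in> carrier A"
  shows "\<exists>f\<in>hom A QZ. (\<forall>b\<in>B. f b = 0) \<and> (x \<notin> B \<longrightarrow> f x \<noteq> 0) \<and>
    ((\<exists>m>0. x [^]\<^bsub>A\<^esub> (m::nat) \<in> B) \<longrightarrow> (\<forall>k::int. f (x [^]\<^bsub>A\<^esub> k) = 0 \<longrightarrow> x [^]\<^bsub>A\<^esub> k \<in> B))"
proof -
  interpret A: comm_group A by fact
  interpret QZ: comm_group QZ by (rule comm_group_QZ)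
  show ?thesis
  proof (cases "\<exists>m>0. x [^]\<^bsub>A\<^esub> (m::nat) \<in> B")
    case True
    define Q where "Q m \<longleftrightarrow> m > 0 \<and> x [^]\<^bsub>A\<^esub> m \<in> B" for m :: nat
    have "\<exists>m. Q m" using True by (auto simp: Q_def)
    then obtain n where "Q n" and min: "\<forall>m<n. \<not> Q m" using exists_least_iff[of Q] by blast
    then have n: "n > 0" "x [^]\<^bsub>A\<^esub> n \<in> B" by (simp_all add: Q_def)
    have dvd: "int n dvd k" if k: "x [^]\<^bsub>A\<^esub> k \<in> B" for k :: int
    proof -
      let ?q = "k div int n"
      have "(x [^]\<^bsub>A\<^esub> n) [^]\<^bsub>A\<^esub> (- ?q) \<in> B" using A.subgroup_int_pow_closed[OF B n(2)] .
      then have p: "x [^]\<^bsub>A\<^esub> (int n * (- ?q)) \<in> B"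
        using A.int_pow_pow[OF x, of "int n" "- ?q"] by (simp add: int_pow_int)
      have "x [^]\<^bsub>A\<^esub> (k + int n * (- ?q)) \<in> B"
        unfolding A.int_pow_mult[OF x] by (rule subgroup.m_closed[OF B k p])
      moreover have "k + int n * (- ?q) = int (nat (k mod int n))"
        using n(1) by (simp add: minus_mult_div_eq_mod)
      ultimately have 1: "x [^]\<^bsub>A\<^esub> (nat (k mod int n)) \<in> B" by (simp only: int_pow_int)
      have 2: "nat (k mod int n) < n" using n(1) by (simp add: nat_less_iff)
      have "\<not> nat (k mod int n) > 0" using min 1 2 by (auto simp: Q_def)
      then have "k mod int n = 0" using n(1) pos_mod_sign[of "int n" k] by linarith
      then show ?thesis by (rule mod_0_imp_dvd)
    qed
    \<comment> \<open>For \<open>n = 1\<close> the value has to be 0, which \<open>frac\<close>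
      takes care of.\<close>
    let ?d = "frac (1 / of_nat n :: rat)"
    have dc: "?d \<in> carrier QZ" by (simp add: frac_lt_1)
    have fr: "frac (of_int k * ?d) = frac (of_int k / of_nat n)" for k :: int
    proof -
      interpret h: group_hom rat_group QZ frac
        by (intro group_hom.intro group_hom_axioms.intro frac_hom_QZ comm_group.axioms(2) comm_group_QZ comm_group_rat_group)
      show ?thesis using h.hom_int_pow[of "1 / of_nat n" k] QZ_int_pow[OF dc, of k] by simp
    qed
    have "\<exists>f\<in>hom A QZ. f x = ?d \<and> (\<forall>b\<in>B. f b = \<one>\<^bsub>QZ\<^esub>)"
    proof (rule hom_extending_value[OF A comm_group_QZ divisible_QZ B x dc])
      fix k :: int assume "x [^]\<^bsub>A\<^esub> k \<in> B"
      then obtain q where "k = int n * q" using dvd by blast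
      then show "?d [^]\<^bsub>QZ\<^esub> k = \<one>\<^bsub>QZ\<^esub>"
        unfolding QZ_int_pow[OF dc] fr QZ_simps(3) using n(1) by simp
    qed
    then obtain f where f: "f \<in> hom A QZ" "f x = ?d" "\<And>b. b \<in> B \<Longrightarrow> f b = 0" by auto
    interpret f: group_hom A QZ f by unfold_locales (rule f(1))
    have pw: "x [^]\<^bsub>A\<^esub> k \<in> B" if k: "f (x [^]\<^bsub>A\<^esub> k) = 0" for k :: int
    proof -
      have "frac (of_int k / of_nat n :: rat) = 0"
        using k unfolding f.hom_int_pow[OF x] f(2) QZ_int_pow[OF dc] fr .
      then obtain q where "of_int k / of_nat n = (of_int q :: rat)" by (auto elim: Ints_cases)
      then have "(of_int k :: rat) = of_int (int n * q)" using n(1) by (simp add: field_simps)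
      then have "k = int n * q" by (simp only: of_int_eq_iff)
      then have "x [^]\<^bsub>A\<^esub> k = (x [^]\<^bsub>A\<^esub> n) [^]\<^bsub>A\<^esub> q" using A.int_pow_pow[OF x, of "int n" q] by (simp add: int_pow_int)
      then show ?thesis using A.subgroup_int_pow_closed[OF B n(2)] by simp
    qed
    have "x \<in> B" if "f x = 0" using pw[of 1] that x by simp
    then show ?thesis using f pw by blast
  next
    case False
    have k0: "k = 0" if k: "x [^]\<^bsub>A\<^esub> k \<in> B" for k :: int
    proof (rule ccontr)
      assume "k \<noteq> 0"
      then have "nat \<bar>k\<bar> > 0" by simp
      moreover have "x [^]\<^bsub>A\<^esub> (nat \<bar>k\<bar>) \<in> B"
      proof (cases "k > 0")
        case True
        then show ?thesis using k int_pow_int[of A x "nat k"] by simp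
      next
        case False
        have "x [^]\<^bsub>A\<^esub> (- k) \<in> B" using subgroup.m_inv_closed[OF B k] A.int_pow_neg[OF x] by simp
        then show ?thesis using False int_pow_int[of A x "nat (- k)"] \<open>k \<noteq> 0\<close> by simp
      qed
      ultimately show False using False by blast
    qed
    \<comment> \<open>Only the exponent 0 takes \<open>x\<close> into \<open>B\<close>, so every
      value is allowed; 1/2 is simply a nonzero one.\<close>
    have "\<exists>f\<in>hom A QZ. f x = 1 / 2 \<and> (\<forall>b\<in>B. f b = \<one>\<^bsub>QZ\<^esub>)"
    proof (rule hom_extending_value[OF A comm_group_QZ divisible_QZ B x])
      fix k :: int assume "x [^]\<^bsub>A\<^esub> k \<in> B"
      then have "k = 0" by (rule k0)
      then show "(1 / 2) [^]\<^bsub>QZ\<^esub> k = \<one>\<^bsub>QZ\<^esub>" by simp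
    qed simp
    then obtain f where f: "f \<in> hom A QZ" "f x = 1 / 2" "\<forall>b\<in>B. f b = \<one>\<^bsub>QZ\<^esub>" by blast
    have "f x \<noteq> 0" using f(2) by simp
    show ?thesis
    proof (intro bexI[OF _ f(1)] conjI impI)
      show "\<forall>b\<in>B. f b = 0" using f(3) by simp
      show "f x \<noteq> 0" by fact
      assume "\<exists>m>0. x [^]\<^bsub>A\<^esub> (m::nat) \<in> B"
      with False show "\<forall>k::int. f (x [^]\<^bsub>A\<^esub> k) = 0 \<longrightarrow> x [^]\<^bsub>A\<^esub> k \<in> B" by (rule notE)
    qed
  qed
qed

text \<open>For \<open>M > 0\<close> this is the cyclic group of order \<open>M\<close>, as a
  subgroup of \<open>QZ\<close>, so that a character with denominators dividing \<open>M\<close>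
  takes its values there unchanged.\<close>

definition finite_QZ :: "nat \<Rightarrow> rat monoid" where
  "finite_QZ M = QZ\<lparr>carrier := {q \<in> carrier QZ. of_nat M * q \<in> \<int>}\<rparr>"

lemma subgroup_finite_QZ: "subgroup {q \<in> carrier QZ. of_nat M * q \<in> \<int>} QZ"
proof -
  interpret QZ: comm_group QZ by (rule comm_group_QZ)
  have fr: "of_nat M * frac q \<in> \<int>" if "of_nat M * q \<in> \<int>" for q :: rat
    using that by (simp add: frac_def right_diff_distrib)
  have inv: "inv\<^bsub>QZ\<^esub> q = frac (- q)" if "q \<in> carrier QZ" for q
    using QZ_int_pow[OF that, of "- 1"] QZ.int_pow_neg[OF that, of 1] that by (simp add: QZ.int_pow_1)
  show ?thesis
  proof (rule QZ.subgroupI)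
    show "{q \<in> carrier QZ. of_nat M * q \<in> \<int>} \<noteq> {}" by (auto intro: exI[of _ 0])
  next
    fix a assume "a \<in> {q \<in> carrier QZ. of_nat M * q \<in> \<int>}"
    then show "inv\<^bsub>QZ\<^esub> a \<in> {q \<in> carrier QZ. of_nat M * q \<in> \<int>}"
      using inv[of a] fr[of "- a"] by (simp add: frac_lt_1)
  next
    fix a b assume "a \<in> {q \<in> carrier QZ. of_nat M * q \<in> \<int>}" "b \<in> {q \<in> carrier QZ. of_nat M * q \<in> \<int>}"
    then show "a \<otimes>\<^bsub>QZ\<^esub> b \<in> {q \<in> carrier QZ. of_nat M * q \<in> \<int>}"
      using fr[of "a + b"] by (simp add: frac_lt_1 distrib_left)
  qed auto
qed

lemma group_finite_QZ: "group (finite_QZ M)"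
proof -
  interpret QZ: comm_group QZ by (rule comm_group_QZ)
  show ?thesis unfolding finite_QZ_def by (rule QZ.subgroup_imp_group[OF subgroup_finite_QZ])
qed

lemma finite_carrier_finite_QZ:
  assumes "M > 0"
  shows "finite (carrier (finite_QZ M))"
proof (rule finite_subset)
  show "carrier (finite_QZ M) \<subseteq> (\<lambda>k. of_int k / of_nat M) ` {0..int M}"
  proof
    fix q assume q: "q \<in> carrier (finite_QZ M)"
    then obtain k where k: "of_nat M * q = of_int k" by (auto simp: finite_QZ_def elim: Ints_cases)
    then have qk: "q = of_int k / of_nat M" using assms by (simp add: field_simps)
    have q01: "0 \<le> q" "q < 1" using q by (auto simp: finite_QZ_def)
    have "0 \<le> (of_int k :: rat)" using k q01(1) by (metis mult_nonneg_nonneg of_nat_0_le_iff)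
    moreover have "(of_int k :: rat) \<le> of_int (int M)"
      using k q01 by (simp add: mult_left_le flip: k)
    ultimately have "k \<in> {0..int M}" by (simp only: of_int_0_le_iff of_int_le_iff atLeastAtMost_iff)
    then show "q \<in> (\<lambda>k. of_int k / of_nat M) ` {0..int M}" using qk by blast
  qed
qed simp

lemma common_denominator_list:
  assumes "finite S" "\<And>s. s \<in> S \<Longrightarrow> \<exists>M>0::nat. Q s M" "\<And>s M N. Q s M \<Longrightarrow> Q s (N * M)"
  shows "\<exists>M>0::nat. \<forall>s\<in>S. Q s M"
  using assms(1,2)
proof (induction S)
  case (insert s S)
  obtain M where M: "M > 0" "\<forall>s\<in>S. Q s M" using insert by auto
  obtain N where N: "N > 0" "Q s N" using insert by auto
  have "Q s (M * N)" using assms(3)[OF N(2)] .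
  moreover have "\<forall>s\<in>S. Q s (M * N)" using M(2) assms(3) mult.commute by metis
  ultimately show ?case using M(1) N(1) by (intro exI[of _ "M * N"]) simp
qed auto

lemma rat_denominator: "\<exists>M>0. of_nat M * q \<in> \<int>" for q :: rat
proof -
  obtain a b where "quotient_of q = (a, b)" by force
  then have q: "q = of_int a / of_int b" "b > 0" using quotient_of_div quotient_of_denom_pos by blast+
  then have "of_nat (nat b) * q = of_int a" by simp
  then have "of_nat (nat b) * q \<in> \<int>" by simp
  moreover have "nat b > 0" using q(2) by simp
  ultimately show ?thesis by blast
qed

lemma mult_in_Ints_mult: "of_nat M * q \<in> \<int> \<Longrightarrow> of_nat (N * M) * q \<in> \<int>" for q :: rat
  using Ints_mult[OF Ints_of_nat, of "of_nat M * q" N] by (simp add: mult.assoc)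

lemma hom_generate_in:
  assumes A: "group A" and D: "group D" and f: "f \<in> hom A D" and K: "subgroup K D"
    and S: "S \<subseteq> carrier A" "f ` S \<subseteq> K" and g: "g \<in> generate A S"
  shows "f g \<in> K"
proof -
  interpret f: group_hom A D f by (intro group_hom.intro group_hom_axioms.intro A D f)
  have gc: "generate A S \<subseteq> carrier A" using f.G.generate_incl[OF S(1)] .
  show ?thesis using g
  proof (induction rule: generate.induct)
    case one
    then show ?case using subgroup.one_closed[OF K] by simp
  next
    case (incl h)
    then show ?case using S by blast
  next
    case (inv h)
    then have "h \<in> carrier A" "f h \<in> K" using S by blast+
    then show ?case using subgroup.m_inv_closed[OF K] by simp
  next
    case (eng g h)
    then have "g \<in> carrier A" "h \<in> carrier A" using gc by blast+
    then show ?case using subgroup.m_closed[OF K] eng by simp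
  qed
qed

lemma hom_rat_denominator:
  assumes A: "group A" "finitely_generated_group A" and f: "f \<in> hom A rat_group"
  shows "\<exists>M>0::nat. \<forall>g\<in>carrier A. of_nat M * f g \<in> \<int>"
proof -
  interpret R: comm_group rat_group by (rule comm_group_rat_group)
  obtain S where S: "finite S" "S \<subseteq> carrier A" "carrier A = generate A S"
    using A(2) by (auto simp: finitely_generated_group_def)
  obtain M where M: "M > 0" "\<forall>s\<in>S. of_nat M * f s \<in> \<int>"
    using common_denominator_list[of S "\<lambda>s M. of_nat M * f s \<in> \<int>"] S(1) rat_denominator
    by (metis (no_types, lifting) Ints_mult Ints_of_nat mult.assoc of_nat_mult)
  have K: "subgroup {q. of_nat M * q \<in> \<int>} rat_group"
  proof (rule R.subgroupI)
    fix a assume a: "a \<in> {q :: rat. of_nat M * q \<in> \<int>}"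
    have "inv\<^bsub>rat_group\<^esub> a = - a" by (rule R.inv_equality) simp_all
    then show "inv\<^bsub>rat_group\<^esub> a \<in> {q. of_nat M * q \<in> \<int>}" using a by simp
  next
    show "{q :: rat. of_nat M * q \<in> \<int>} \<noteq> {}" by (auto intro: exI[of _ 0])
  qed (auto simp: distrib_left)
  have "of_nat M * f g \<in> \<int>" if "g \<in> carrier A" for g
    using hom_generate_in[OF A(1) R.is_group f K S(2), of g] M(2) that S(3) by auto
  then show ?thesis using M(1) by blast
qed

lemma hom_QZ_denominator:
  assumes A: "group A" "finitely_generated_group A" and f: "f \<in> hom A QZ"
  shows "\<exists>M>0::nat. \<forall>g\<in>carrier A. of_nat M * f g \<in> \<int>"
proof -
  interpret R: comm_group QZ by (rule comm_group_QZ)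
  obtain S where S: "finite S" "S \<subseteq> carrier A" "carrier A = generate A S"
    using A(2) by (auto simp: finitely_generated_group_def)
  obtain M where M: "M > 0" "\<forall>s\<in>S. of_nat M * f s \<in> \<int>"
    using common_denominator_list[of S "\<lambda>s M. of_nat M * f s \<in> \<int>"] S(1) rat_denominator
    by (metis (no_types, lifting) Ints_mult Ints_of_nat mult.assoc of_nat_mult)
  have im: "f ` S \<subseteq> {q \<in> carrier QZ. of_nat M * q \<in> \<int>}" using M(2) S(2) hom_in_carrier[OF f] by blast
  have "of_nat M * f g \<in> \<int>" if "g \<in> carrier A" for g
    using hom_generate_in[OF A(1) R.is_group f subgroup_finite_QZ S(2) im, of g] that S(3) by simp
  then show ?thesis using M(1) by blast
qed

section \<open>Compatible families of characters of the vertex groups\<close>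

context gog
begin

text \<open>For abelian \<open>D\<close> such a family amounts to a homomorphism from the
  abelianized tree group to \<open>D\<close>, the stable letters of \<open>T\<close> being trivial.
  Working with families postpones the abelianization to \<open>family_of_hom\<close> and
  \<open>hom_of_family\<close>.\<close>

definition tree_family :: "('d, 'm) monoid_scheme \<Rightarrow> ('v \<Rightarrow> 'a \<Rightarrow> 'd) \<Rightarrow> bool" where
  "tree_family D f \<longleftrightarrow> (\<forall>v\<in>V. f v \<in> hom (Gv v) D) \<and>
    (\<forall>e\<in>arcs T. \<forall>a\<in>carrier (Ge e). f (tl\<^sub>\<Gamma> e) (al e a) = f (hd\<^sub>\<Gamma> e) (om e a))"

lemma tree_familyD:
  assumes "tree_family D f"
  shows "v \<in> V \<Longrightarrow> f v \<in> hom (Gv v) D"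
    and "e \<in> arcs T \<Longrightarrow> a \<in> carrier (Ge e) \<Longrightarrow> f (tl\<^sub>\<Gamma> e) (al e a) = f (hd\<^sub>\<Gamma> e) (om e a)"
  using assms by (simp_all add: tree_family_def)

end

locale gog_cyclic = gog \<G> T P
  for \<G> :: "('v, 'e, 'a, 'b) graph_of_groups" and T :: "('v, 'e) pre_digraph" and P :: "'e set" +
  fixes c :: "'e \<Rightarrow> 'b"
  assumes ab: "\<And>v. v \<in> V \<Longrightarrow> comm_group (Gv v)" and fin_gen: "\<And>v. v \<in> V \<Longrightarrow> finitely_generated_group (Gv v)"
    and c: "\<And>e. e \<in> E - arcs T \<Longrightarrow> c e \<in> carrier (Ge e)"
    and cyc: "\<And>e. e \<in> E - arcs T \<Longrightarrow> carrier (Ge e) = generate (Ge e) {c e}"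
    and c_rv: "\<And>e. e \<in> E - arcs T \<Longrightarrow> c (rv e) = c e"
begin

abbreviation "NT \<equiv> E - arcs T"

lemma rv_NT: "e \<in> NT \<Longrightarrow> rv e \<in> NT"
  using rv_arcs_T_iff by simp

lemma edge_power: "e \<in> NT \<Longrightarrow> x \<in> carrier (Ge e) \<Longrightarrow> \<exists>k::int. x = c e [^]\<^bsub>Ge e\<^esub> k"
proof -
  assume e: "e \<in> NT" and x: "x \<in> carrier (Ge e)"
  interpret Ge: group "Ge e" using e by (intro group_Ge) simp
  have "x \<in> generate (Ge e) {c e}" using x cyc[OF e] by blast
  then show ?thesis unfolding Ge.generate_pow[OF c[OF e]] by blast
qed

abbreviation "ae e \<equiv> al e (c e)"

lemma ae_closed: "e \<in> NT \<Longrightarrow> ae e \<in> carrier (Gv (tl\<^sub>\<Gamma> e))"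
  using al_closed c by blast

lemma al_power: "e \<in> NT \<Longrightarrow> al e (c e [^]\<^bsub>Ge e\<^esub> (k::int)) = ae e [^]\<^bsub>Gv (tl\<^sub>\<Gamma> e)\<^esub> k"
proof -
  assume e: "e \<in> NT"
  then have "group_hom (Ge e) (Gv (tl\<^sub>\<Gamma> e)) (al e)"
    by (intro group_hom.intro group_hom_axioms.intro group_Ge group_Gv al_hom) auto
  then show ?thesis using group_hom.hom_int_pow c[OF e] by fastforce
qed

text \<open>Across an edge of \<open>T\<close> the values on the image of the edge group are forced.
  They form a partial homomorphism because \<open>om e\<close> is injective, and it extends to the
  next vertex group because \<open>D\<close> is divisible. A tree imposes no further
  condition.\<close>

lemma extend_family:
  assumes D: "comm_group D" "divisible_group D" and v0: "v0 \<in> V" and f0: "f0 \<in> hom (Gv v0) D"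
  shows "\<exists>f. tree_family D f \<and> f v0 = f0"
proof -
  have "\<exists>f. f v0 = f0 \<and> (\<forall>v\<in>verts T. f v \<in> hom (Gv v) D) \<and>
    (\<forall>e\<in>arcs T. \<forall>a\<in>carrier (Ge e). f (tail T e) (al e a) = f (head T e) (om e a))"
  proof (rule serre_tree_labelling[OF serre_T])
    show "finite (verts T)" by (simp add: verts_T)
    show "v0 \<in> verts T" using v0 by (simp add: verts_T)
    show "f0 \<in> hom (Gv v0) D" by fact
  next
    fix e y z assume e: "e \<in> arcs T" and "\<forall>a\<in>carrier (Ge e). y (al e a) = z (om e a)"
    then show "\<forall>a\<in>carrier (Ge (rv e)). z (al (rv e) a) = y (om (rv e) a)"
      using arcs_T Ge_rv[of e] by (auto simp: om_rv al_rv)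
  next
    fix e y assume e: "e \<in> arcs T" and y: "y \<in> hom (Gv (tail T e)) D"
    have eE: "e \<in> E" using e arcs_T by blast
    note y = y[unfolded T_ends]
    interpret D: comm_group D by fact
    interpret Ge: group "Ge e" by (rule group_Ge[OF eE])
    have hv: "hd\<^sub>\<Gamma> e \<in> V" and tv: "tl\<^sub>\<Gamma> e \<in> V" using eE by simp_all
    interpret Gh: comm_group "Gv (hd\<^sub>\<Gamma> e)" by (rule ab[OF hv])
    interpret P: group "Gv (hd\<^sub>\<Gamma> e) \<times>\<times> D" by (intro DirProd_group Gh.is_group D.is_group)
    let ?h = "\<lambda>a. (om e a, y (al e a))"
    have "?h \<in> hom (Ge e) (Gv (hd\<^sub>\<Gamma> e) \<times>\<times> D)"
    proof (rule homI)
      fix a assume a: "a \<in> carrier (Ge e)"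
      show "?h a \<in> carrier (Gv (hd\<^sub>\<Gamma> e) \<times>\<times> D)"
        using om_closed[OF eE a] hom_in_carrier[OF y al_closed[OF eE a]] by simp
    next
      fix a b assume a: "a \<in> carrier (Ge e)" and b: "b \<in> carrier (Ge e)"
      show "?h (a \<otimes>\<^bsub>Ge e\<^esub> b) = ?h a \<otimes>\<^bsub>Gv (hd\<^sub>\<Gamma> e) \<times>\<times> D\<^esub> ?h b"
        using hom_mult[OF om_hom[OF eE] a b] hom_mult[OF al_hom[OF eE] a b]
          hom_mult[OF y al_closed[OF eE a] al_closed[OF eE b]] by simp
    qed
    then interpret h: group_hom "Ge e" "Gv (hd\<^sub>\<Gamma> e) \<times>\<times> D" ?h by unfold_locales
    have "partial_hom (Gv (hd\<^sub>\<Gamma> e)) D (?h ` carrier (Ge e))"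
      unfolding partial_hom_def
    proof (intro conjI allI impI)
      show "subgroup (?h ` carrier (Ge e)) (Gv (hd\<^sub>\<Gamma> e) \<times>\<times> D)"
        using h.subgroup_img_is_subgroup[OF Ge.subgroup_self] .
      fix d assume "(\<one>\<^bsub>Gv (hd\<^sub>\<Gamma> e)\<^esub>, d) \<in> ?h ` carrier (Ge e)"
      then obtain a where a: "a \<in> carrier (Ge e)" "om e a = \<one>\<^bsub>Gv (hd\<^sub>\<Gamma> e)\<^esub>" "d = y (al e a)" by auto
      have "om e \<one>\<^bsub>Ge e\<^esub> = \<one>\<^bsub>Gv (hd\<^sub>\<Gamma> e)\<^esub>" by (rule hom_one[OF om_hom[OF eE] group_Ge[OF eE] group_Gv[OF hv]])
      then have "a = \<one>\<^bsub>Ge e\<^esub>" using om_mon[OF eE] a(1,2) Ge.one_closed by (auto simp: mon_def inj_on_def)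
      then show "d = \<one>\<^bsub>D\<^esub>"
        using a(3) hom_one[OF al_hom[OF eE] group_Ge[OF eE] group_Gv[OF tv]] hom_one[OF y group_Gv[OF tv] D.is_group]
        by simp
    qed
    from partial_hom_extend[OF ab[OF hv] fin_gen[OF hv] D this]
    obtain z where z: "z \<in> hom (Gv (hd\<^sub>\<Gamma> e)) D" "\<forall>(x, d)\<in>?h ` carrier (Ge e). z x = d"
      by (rule bexE)
    have "z (om e a) = y (al e a)" if "a \<in> carrier (Ge e)" for a
      using bspec[OF z(2) imageI[OF that]] by simp
    then show "\<exists>z. z \<in> hom (Gv (head T e)) D \<and> (\<forall>a\<in>carrier (Ge e). y (al e a) = z (om e a))"
      unfolding T_ends using z(1) by (intro exI[of _ z]) simp
  qed
  then obtain f where "f v0 = f0" "\<forall>v\<in>V. f v \<in> hom (Gv v) D"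
    "\<forall>e\<in>arcs T. \<forall>a\<in>carrier (Ge e). f (tl\<^sub>\<Gamma> e) (al e a) = f (hd\<^sub>\<Gamma> e) (om e a)"
    unfolding verts_T T_ends by (elim exE conjE)
  then show ?thesis unfolding tree_family_def by (intro exI[of _ f] conjI)
qed

lemma family_rat_denominator:
  assumes "tree_family rat_group f"
  shows "\<exists>M>0::nat. \<forall>v\<in>V. \<forall>g\<in>carrier (Gv v). of_nat M * f v g \<in> \<int>"
proof (rule common_denominator_list[of V "\<lambda>v M. \<forall>g\<in>carrier (Gv v). of_nat M * f v g \<in> \<int>"])
  fix v assume v: "v \<in> V"
  show "\<exists>M>0. \<forall>g\<in>carrier (Gv v). of_nat M * f v g \<in> \<int>"
    by (rule hom_rat_denominator[OF group_Gv[OF v] fin_gen[OF v] tree_familyD(1)[OF assms v]])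
next
  fix v and M N :: nat assume "\<forall>g\<in>carrier (Gv v). of_nat M * f v g \<in> \<int>"
  then show "\<forall>g\<in>carrier (Gv v). of_nat (N * M) * f v g \<in> \<int>"
    using mult_in_Ints_mult by blast
qed simp

lemma family_QZ_denominator:
  assumes "tree_family QZ f"
  shows "\<exists>M>0::nat. \<forall>v\<in>V. \<forall>g\<in>carrier (Gv v). of_nat M * f v g \<in> \<int>"
proof (rule common_denominator_list[of V "\<lambda>v M. \<forall>g\<in>carrier (Gv v). of_nat M * f v g \<in> \<int>"])
  fix v assume v: "v \<in> V"
  show "\<exists>M>0. \<forall>g\<in>carrier (Gv v). of_nat M * f v g \<in> \<int>"
    by (rule hom_QZ_denominator[OF group_Gv[OF v] fin_gen[OF v] tree_familyD(1)[OF assms v]])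
next
  fix v and M N :: nat assume "\<forall>g\<in>carrier (Gv v). of_nat M * f v g \<in> \<int>"
  then show "\<forall>g\<in>carrier (Gv v). of_nat (N * M) * f v g \<in> \<int>"
    using mult_in_Ints_mult by blast
qed simp

lemma family_power:
  assumes D: "group D" and f: "tree_family D f" and e: "e \<in> NT"
  shows "f (tl\<^sub>\<Gamma> e) (al e (c e [^]\<^bsub>Ge e\<^esub> (k::int))) = f (tl\<^sub>\<Gamma> e) (ae e) [^]\<^bsub>D\<^esub> k"
proof -
  have tv: "tl\<^sub>\<Gamma> e \<in> V" using e by simp
  interpret h: group_hom "Gv (tl\<^sub>\<Gamma> e)" D "f (tl\<^sub>\<Gamma> e)"
    by (intro group_hom.intro group_hom_axioms.intro D group_Gv tv tree_familyD(1)[OF f])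
  show ?thesis unfolding al_power[OF e] by (rule h.hom_int_pow[OF ae_closed[OF e]])
qed

end

text \<open>Near independence without the tensor product: \<open>J\<close> indexes the independent
  elements, \<open>idx\<close> and \<open>sg\<close> record of which of them \<open>ae e\<close> is
  a copy and with which sign, and \<open>\<phi>\<close> is the dual family. The real vector space
  does not see torsion, so the relation between \<open>ae e\<close> and its copy is stated through
  rational functionals, in \<open>family_ae\<close>.\<close>

locale gog_coords = gog_cyclic \<G> T P c
  for \<G> :: "('v, 'e, 'a, 'b) graph_of_groups" and T :: "('v, 'e) pre_digraph" and P :: "'e set"
    and c :: "'e \<Rightarrow> 'b" +
  fixes J :: "'e set" and idx :: "'e \<Rightarrow> 'e" and sg :: "'e \<Rightarrow> int" and \<phi> :: "'e \<Rightarrow> 'v \<Rightarrow> 'a \<Rightarrow> rat"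
  assumes J: "J \<subseteq> NT" and idx: "\<And>e. e \<in> NT \<Longrightarrow> idx e \<in> J"
    and sg: "\<And>e. e \<in> NT \<Longrightarrow> sg e = 1 \<or> sg e = - 1"
    and \<phi>: "\<And>j. j \<in> J \<Longrightarrow> tree_family rat_group (\<phi> j)"
    and \<phi>_ae: "\<And>j e. j \<in> J \<Longrightarrow> e \<in> NT \<Longrightarrow> \<phi> j (tl\<^sub>\<Gamma> e) (ae e) = (if idx e = j then of_int (sg e) else 0)"
    and family_ae: "\<And>h e. tree_family rat_group h \<Longrightarrow> e \<in> NT \<Longrightarrow>
      h (tl\<^sub>\<Gamma> e) (ae e) = of_int (sg e) * h (tl\<^sub>\<Gamma> (idx e)) (ae (idx e))"
begin

lemma finite_J: "finite J"
  using J finite_subset by (metis \<Gamma>.finite_arcs finite_Diff)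

text \<open>The coordinates \<open>\<phi>\<^sub>j/M\<close> make every \<open>a\<^sub>e\<close> have order exactly \<open>M\<close> in \<open>F\<close>, so that the two images of an edge
  group outside the tree have the same kernel.\<close>

lemma quotient_separating:
  assumes I0: "finite (I0 :: nat set)" and \<chi>: "\<And>i. i \<in> I0 \<Longrightarrow> tree_family QZ (\<chi> i)"
  shows "\<exists>(F :: (nat + 'e \<Rightarrow> rat) monoid) \<psi>. compatible_quotient F \<psi> \<and>
    (\<forall>i\<in>I0. \<forall>v\<in>V. \<forall>g h. \<psi> v g = \<psi> v h \<longrightarrow> \<chi> i v g = \<chi> i v h) \<and>
    (\<forall>i\<in>I0. \<forall>v\<in>V. \<forall>g. \<psi> v g = \<one>\<^bsub>F\<^esub> \<longrightarrow> \<chi> i v g = 0)"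
proof -
  note mul = mult_in_Ints_mult
  have "\<exists>M>0::nat. \<forall>i\<in>I0. \<forall>v\<in>V. \<forall>g\<in>carrier (Gv v). of_nat M * \<chi> i v g \<in> \<int>"
  proof (rule common_denominator_list[OF I0])
    fix i assume "i \<in> I0"
    then show "\<exists>M>0::nat. \<forall>v\<in>V. \<forall>g\<in>carrier (Gv v). of_nat M * \<chi> i v g \<in> \<int>"
      by (intro family_QZ_denominator \<chi>)
  next
    fix i and M N :: nat assume "\<forall>v\<in>V. \<forall>g\<in>carrier (Gv v). of_nat M * \<chi> i v g \<in> \<int>"
    then show "\<forall>v\<in>V. \<forall>g\<in>carrier (Gv v). of_nat (N * M) * \<chi> i v g \<in> \<int>"
      using mul by simp
  qed
  \<comment> \<open>With this \<open>M\<close> the order of \<open>\<chi> i\<close> at every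
    \<open>ae e\<close> divides \<open>M\<close>, so the coordinates \<open>\<chi>\<close> do not
    disturb the common order that the \<open>\<phi>\<close> are going to produce.\<close>
  then obtain M where M: "M > 0" "\<forall>i\<in>I0. \<forall>v\<in>V. \<forall>g\<in>carrier (Gv v). of_nat M * \<chi> i v g \<in> \<int>" by blast
  have "\<exists>M>0::nat. \<forall>j\<in>J. \<forall>v\<in>V. \<forall>g\<in>carrier (Gv v). of_nat M * \<phi> j v g \<in> \<int>"
  proof (rule common_denominator_list[OF finite_J])
    fix i assume "i \<in> J"
    then show "\<exists>M>0::nat. \<forall>v\<in>V. \<forall>g\<in>carrier (Gv v). of_nat M * \<phi> i v g \<in> \<int>"
      by (intro family_rat_denominator \<phi>)
  next
    fix i and M N :: nat assume "\<forall>v\<in>V. \<forall>g\<in>carrier (Gv v). of_nat M * \<phi> i v g \<in> \<int>"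
    then show "\<forall>v\<in>V. \<forall>g\<in>carrier (Gv v). of_nat (N * M) * \<phi> i v g \<in> \<int>"
      using mul by simp
  qed
  then obtain N where N: "N > 0" "\<forall>j\<in>J. \<forall>v\<in>V. \<forall>g\<in>carrier (Gv v). of_nat N * \<phi> j v g \<in> \<int>" by blast
  define I where "I = Inl ` I0 \<union> Inr ` J"
  have finI: "finite I" using I0 finite_J by (simp add: I_def)
  define X where "X k v g = (case k of Inl i \<Rightarrow> \<chi> i v g | Inr j \<Rightarrow> frac (\<phi> j v g / of_nat M))" for k v g
  interpret QZ: comm_group QZ by (rule comm_group_QZ)
  have Xf: "tree_family QZ (X k)" if "k \<in> I" for k
  proof (cases k)
    case (Inl i)
    then have "X k = \<chi> i" by (intro ext) (simp add: X_def)
    then show ?thesis using \<chi> that Inl by (auto simp: I_def)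
  next
    case (Inr j)
    then have j: "j \<in> J" using that by (auto simp: I_def)
    have X: "X k = (\<lambda>v g. frac (\<phi> j v g / of_nat M))" using Inr by (intro ext) (simp add: X_def)
    show ?thesis unfolding tree_family_def X
    proof (intro conjI ballI)
      fix v assume v: "v \<in> V"
      show "(\<lambda>g. frac (\<phi> j v g / of_nat M)) \<in> hom (Gv v) QZ"
      proof (rule homI)
        fix g h assume "g \<in> carrier (Gv v)" "h \<in> carrier (Gv v)"
        then have "\<phi> j v (g \<otimes>\<^bsub>Gv v\<^esub> h) = \<phi> j v g + \<phi> j v h"
          using hom_mult[OF tree_familyD(1)[OF \<phi>[OF j] v]] by simp
        then show "frac (\<phi> j v (g \<otimes>\<^bsub>Gv v\<^esub> h) / of_nat M) =
            frac (\<phi> j v g / of_nat M) \<otimes>\<^bsub>QZ\<^esub> frac (\<phi> j v h / of_nat M)"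
          by (simp add: frac_frac_add add_divide_distrib)
      qed (simp add: frac_lt_1)
    next
      fix e a assume "e \<in> arcs T" "a \<in> carrier (Ge e)"
      then show "frac (\<phi> j (tl\<^sub>\<Gamma> e) (al e a) / of_nat M) = frac (\<phi> j (hd\<^sub>\<Gamma> e) (om e a) / of_nat M)"
        using tree_familyD(2)[OF \<phi>[OF j]] by simp
    qed
  qed
  \<comment> \<open>Two denominators meet here: \<open>\<chi>\<close> has \<open>M\<close>, whereas
    \<open>\<phi>\<close> has \<open>N\<close> and is divided by \<open>M\<close>.\<close>
  let ?F = "finite_QZ (M * N)"
  have XF: "X k v g \<in> carrier ?F" if k: "k \<in> I" and v: "v \<in> V" and g: "g \<in> carrier (Gv v)" for k v g
  proof -
    have 1: "X k v g \<in> carrier QZ" by (rule hom_in_carrier[OF tree_familyD(1)[OF Xf[OF k] v] g])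
    have "of_nat (M * N) * X k v g \<in> \<int>"
    proof (cases k)
      case (Inl i)
      then have "of_nat M * X k v g \<in> \<int>" using M(2) k v g by (auto simp: I_def X_def)
      then show ?thesis using mul[of M "X k v g" N] by (simp add: mult.commute)
    next
      case (Inr j)
      then have "of_nat N * \<phi> j v g \<in> \<int>" using N(2) k v g by (auto simp: I_def)
      then have "of_nat (M * N) * (\<phi> j v g / of_nat M) \<in> \<int>" using M(1) by simp
      then show ?thesis using Inr by (simp add: X_def frac_def right_diff_distrib)
    qed
    then show ?thesis using 1 by (simp add: finite_QZ_def)
  qed
  define F where "F = product_group I (\<lambda>_. ?F)"
  define \<psi> where "\<psi> v g = (\<lambda>k\<in>I. X k v g)" for v g
  have F1: "\<one>\<^bsub>F\<^esub> = (\<lambda>k\<in>I. 0)" by (simp add: F_def finite_QZ_def)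
  have eq1: "\<psi> v g = \<one>\<^bsub>F\<^esub> \<longleftrightarrow> (\<forall>k\<in>I. X k v g = 0)" for v g
    unfolding F1 \<psi>_def by (auto simp: restrict_def fun_eq_iff)
  have hom: "\<psi> v \<in> hom (Gv v) F" if v: "v \<in> V" for v
  proof (rule homI)
    fix g assume "g \<in> carrier (Gv v)"
    then show "\<psi> v g \<in> carrier F" using XF[OF _ v] by (simp add: \<psi>_def F_def)
  next
    fix g h assume "g \<in> carrier (Gv v)" "h \<in> carrier (Gv v)"
    then have "X k v (g \<otimes>\<^bsub>Gv v\<^esub> h) = X k v g \<otimes>\<^bsub>QZ\<^esub> X k v h" if "k \<in> I" for k
      using hom_mult[OF tree_familyD(1)[OF Xf[OF that] v]] by blast
    then show "\<psi> v (g \<otimes>\<^bsub>Gv v\<^esub> h) = \<psi> v g \<otimes>\<^bsub>F\<^esub> \<psi> v h"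
      unfolding \<psi>_def F_def mult_product_group by (intro restrict_ext) (simp add: finite_QZ_def)
  qed
  \<comment> \<open>At the \<open>k\<close>-th power the coordinate \<open>idx e\<close> is
    \<plusminus>k/M modulo 1, so it vanishes only if \<open>M\<close> divides \<open>k\<close>. The
    criterion is the same for \<open>e\<close> and for \<open>rv e\<close>.\<close>
  have ker: "\<psi> (tl\<^sub>\<Gamma> e) (al e (c e [^]\<^bsub>Ge e\<^esub> k)) = \<one>\<^bsub>F\<^esub> \<longleftrightarrow> int M dvd k" if e: "e \<in> NT" for e and k :: int
  proof -
    have tv: "tl\<^sub>\<Gamma> e \<in> V" using e by simp
    have Xp: "X i (tl\<^sub>\<Gamma> e) (al e (c e [^]\<^bsub>Ge e\<^esub> k)) = frac (of_int k * X i (tl\<^sub>\<Gamma> e) (ae e))" if i: "i \<in> I" for i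
      unfolding family_power[OF QZ.is_group Xf[OF i] e]
      by (rule QZ_int_pow[OF hom_in_carrier[OF tree_familyD(1)[OF Xf[OF i] tv] ae_closed[OF e]]])
    have \<phi>p: "\<phi> j (tl\<^sub>\<Gamma> e) (al e (c e [^]\<^bsub>Ge e\<^esub> k)) = of_int k * \<phi> j (tl\<^sub>\<Gamma> e) (ae e)" if j: "j \<in> J" for j
      unfolding family_power[OF comm_group.axioms(2)[OF comm_group_rat_group] \<phi>[OF j] e] by simp
    show ?thesis
    proof
      assume "\<psi> (tl\<^sub>\<Gamma> e) (al e (c e [^]\<^bsub>Ge e\<^esub> k)) = \<one>\<^bsub>F\<^esub>"
      then have "X (Inr (idx e)) (tl\<^sub>\<Gamma> e) (al e (c e [^]\<^bsub>Ge e\<^esub> k)) = 0"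
        unfolding eq1 using idx[OF e] by (simp add: I_def)
      then have "of_int k * of_int (sg e) / of_nat M \<in> (\<int> :: rat set)"
        using \<phi>p[OF idx[OF e]] \<phi>_ae[OF idx[OF e] e] by (simp add: X_def)
      then obtain q where "of_int k * of_int (sg e) / of_nat M = (of_int q :: rat)" by (auto elim: Ints_cases)
      then have "(of_int (k * sg e) :: rat) = of_int (int M * q)" using M(1) by (simp add: field_simps)
      then have "k * sg e = int M * q" by (simp only: of_int_eq_iff)
      then have "int M dvd k * sg e" by simp
      then show "int M dvd k" using sg[OF e] by auto
    next
      assume "int M dvd k"
      then obtain q where q: "k = int M * q" by blast
      have "X i (tl\<^sub>\<Gamma> e) (al e (c e [^]\<^bsub>Ge e\<^esub> k)) = 0" if i: "i \<in> I" for i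
      proof (cases i)
        case (Inl i')
        then have "of_nat M * X i (tl\<^sub>\<Gamma> e) (ae e) \<in> \<int>" using M(2) i tv ae_closed[OF e] by (auto simp: I_def X_def)
        then have "of_int q * (of_nat M * X i (tl\<^sub>\<Gamma> e) (ae e)) \<in> \<int>" by (rule Ints_mult[OF Ints_of_int])
        then show ?thesis unfolding Xp[OF i] using q by (simp add: mult_ac)
      next
        case (Inr j)
        then have j: "j \<in> J" using i by (auto simp: I_def)
        show ?thesis using Inr \<phi>p[OF j] \<phi>_ae[OF j e] q M(1) by (simp add: X_def)
      qed
      then show "\<psi> (tl\<^sub>\<Gamma> e) (al e (c e [^]\<^bsub>Ge e\<^esub> k)) = \<one>\<^bsub>F\<^esub>" unfolding eq1 by blast
    qed
  qed
  have "compatible_quotient F \<psi>"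
    unfolding compatible_quotient_def
  proof (intro conjI ballI)
    show "group F" unfolding F_def by (rule product_group) (rule group_finite_QZ)
    show "finite (carrier F)"
      unfolding F_def using finI finite_carrier_finite_QZ[of "M * N"] M(1) N(1) by (simp add: finite_PiE)
  next
    fix v assume "v \<in> V" then show "\<psi> v \<in> hom (Gv v) F" by (rule hom)
  next
    fix e a assume e: "e \<in> E" and a: "a \<in> carrier (Ge e)"
    show "\<psi> (hd\<^sub>\<Gamma> e) (om e a) = \<one>\<^bsub>F\<^esub> \<longleftrightarrow> \<psi> (tl\<^sub>\<Gamma> e) (al e a) = \<one>\<^bsub>F\<^esub>"
    proof (cases "e \<in> arcs T")
      case True
      then show ?thesis unfolding eq1 using tree_familyD(2)[OF Xf _ a] by simp
    next
      case False
      then have n: "e \<in> NT" using e by simp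
      obtain k :: int where k: "a = c e [^]\<^bsub>Ge e\<^esub> k" using edge_power[OF n a] by blast
      have "\<psi> (hd\<^sub>\<Gamma> e) (om e a) = \<one>\<^bsub>F\<^esub> \<longleftrightarrow> int M dvd k"
        using ker[OF rv_NT[OF n], of k] e k c_rv[OF n] Ge_rv[OF e] by (simp add: al_rv)
      then show ?thesis using ker[OF n, of k] k by simp
    qed
  qed
  moreover have "\<chi> i v g = \<chi> i v h" if "i \<in> I0" "\<psi> v g = \<psi> v h" for i v g h
  proof -
    have "\<psi> v g (Inl i) = \<psi> v h (Inl i)" using that(2) by simp
    then show ?thesis using that(1) by (simp add: \<psi>_def I_def X_def)
  qed
  moreover have "\<chi> i v g = 0" if "i \<in> I0" "\<psi> v g = \<one>\<^bsub>F\<^esub>" for i v g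
  proof -
    have "X (Inl i) v g = 0" using that unfolding eq1 by (simp add: I_def)
    then show ?thesis by (simp add: X_def)
  qed
  ultimately show ?thesis by (intro exI[of _ F] exI[of _ \<psi>]) blast
qed

text \<open>At a backtracking point the entry lies outside the image of the edge group. As the
  vertex group is abelian and finitely generated, some character kills this image but not the entry,
  and it extends over the tree. The finitely many characters obtained enter one finite
  quotient.\<close>

lemma virtual_retract_hyperbolic:
  assumes g: "g \<in> carrier G" and p: "gog_path \<G> w p w" "p \<noteq> []" "conj_to g (ev p)" and red: "reduced_cycle p"
  shows "virtual_retract (generate G {g}) G"
proof -
  let ?e = "\<lambda>i. fst (p ! i)" and ?x = "\<lambda>i. snd (p ! i)"
  define I0 where "I0 = {i. i < length p \<and> fst (p ! (Suc i mod length p)) = rv (fst (p ! i))}"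
  have finI: "finite I0" by (simp add: I0_def)
  have "\<exists>f. tree_family QZ f \<and> f (hd\<^sub>\<Gamma> (?e i)) (?x i) \<noteq> 0 \<and>
      (\<forall>a\<in>carrier (Ge (?e i)). f (hd\<^sub>\<Gamma> (?e i)) (om (?e i) a) = 0)" if i: "i \<in> I0" for i
  proof -
    have il: "i < length p" using i by (simp add: I0_def)
    have eE: "?e i \<in> E" and x: "?x i \<in> carrier (Gv (hd\<^sub>\<Gamma> (?e i)))" using gog_path_nth[OF p(1) il] by simp_all
    have hv: "hd\<^sub>\<Gamma> (?e i) \<in> V" using eE by simp
    have nb: "?x i \<notin> om (?e i) ` carrier (Ge (?e i))"
      using red i by (simp add: reduced_cycle_def I0_def)
    interpret o: group_hom "Ge (?e i)" "Gv (hd\<^sub>\<Gamma> (?e i))" "om (?e i)"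
      by (intro group_hom.intro group_hom_axioms.intro om_hom eE group_Ge group_Gv hv)
    have B: "subgroup (om (?e i) ` carrier (Ge (?e i))) (Gv (hd\<^sub>\<Gamma> (?e i)))"
      using o.subgroup_img_is_subgroup[OF o.G.subgroup_self] .
    obtain f0 where f0: "f0 \<in> hom (Gv (hd\<^sub>\<Gamma> (?e i))) QZ" "\<forall>b\<in>om (?e i) ` carrier (Ge (?e i)). f0 b = 0" "f0 (?x i) \<noteq> 0"
      using QZ_character[OF ab[OF hv] fin_gen[OF hv] B x] nb by blast
    obtain f where "tree_family QZ f" "f (hd\<^sub>\<Gamma> (?e i)) = f0"
      using extend_family[OF comm_group_QZ divisible_QZ hv f0(1)] by blast
    then show ?thesis using f0(2,3) by (intro exI[of _ f]) simp
  qed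
  then have "\<exists>\<chi>. \<forall>i\<in>I0. tree_family QZ (\<chi> i) \<and> \<chi> i (hd\<^sub>\<Gamma> (?e i)) (?x i) \<noteq> 0 \<and>
      (\<forall>a\<in>carrier (Ge (?e i)). \<chi> i (hd\<^sub>\<Gamma> (?e i)) (om (?e i) a) = 0)"
    by (intro bchoice ballI)
  then obtain \<chi> where \<chi>: "\<forall>i\<in>I0. tree_family QZ (\<chi> i) \<and> \<chi> i (hd\<^sub>\<Gamma> (?e i)) (?x i) \<noteq> 0 \<and>
      (\<forall>a\<in>carrier (Ge (?e i)). \<chi> i (hd\<^sub>\<Gamma> (?e i)) (om (?e i) a) = 0)" by (elim exE)
  obtain F :: "(nat + 'e \<Rightarrow> rat) monoid" and \<psi> where \<psi>: "compatible_quotient F \<psi>"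
    and sep: "\<forall>i\<in>I0. \<forall>v\<in>V. \<forall>g h. \<psi> v g = \<psi> v h \<longrightarrow> \<chi> i v g = \<chi> i v h"
    using quotient_separating[OF finI, of \<chi>] \<chi> by blast
  show ?thesis
  proof (rule virtual_retract_of_reduced_cycle[OF \<psi> g p])
    fix i a assume i: "i < length p" "fst (p ! (Suc i mod length p)) = rv (?e i)" and a: "a \<in> carrier (Ge (?e i))"
    then have iI: "i \<in> I0" by (simp add: I0_def)
    have hv: "hd\<^sub>\<Gamma> (?e i) \<in> V" using gog_path_nth[OF p(1) i(1)] by simp
    have "\<chi> i (hd\<^sub>\<Gamma> (?e i)) (?x i) \<noteq> \<chi> i (hd\<^sub>\<Gamma> (?e i)) (om (?e i) a)" using \<chi> iI a by simp
    then show "\<psi> (hd\<^sub>\<Gamma> (?e i)) (?x i) \<noteq> \<psi> (hd\<^sub>\<Gamma> (?e i)) (om (?e i) a)" using sep iI hv by blast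
  qed
qed

text \<open>With the trivial subgroup, \<open>QZ_character\<close> yields a character faithful on
  the finite group generated by \<open>y\<close>; a quotient having it among its coordinates is
  faithful there too.\<close>

lemma virtual_retract_elliptic_torsion:
  assumes g: "g \<in> carrier G" and v: "v \<in> V" "y \<in> carrier (Gv v)" "conj_to g (vert v y)"
    and tor: "m > 0" "y [^]\<^bsub>Gv v\<^esub> (m::nat) = \<one>\<^bsub>Gv v\<^esub>"
  shows "virtual_retract (generate G {g}) G"
proof -
  interpret Gv: comm_group "Gv v" by (rule ab[OF v(1)])
  obtain f0 where f0: "f0 \<in> hom (Gv v) QZ" "\<And>k::int. f0 (y [^]\<^bsub>Gv v\<^esub> k) = 0 \<Longrightarrow> y [^]\<^bsub>Gv v\<^esub> k = \<one>\<^bsub>Gv v\<^esub>"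
    using QZ_character[OF ab[OF v(1)] fin_gen[OF v(1)] Gv.triv_subgroup v(2)] tor by auto
  obtain f where f: "tree_family QZ f" "f v = f0"
    using extend_family[OF comm_group_QZ divisible_QZ v(1) f0(1)] by blast
  obtain F :: "(nat + 'e \<Rightarrow> rat) monoid" and \<psi> where \<psi>: "compatible_quotient F \<psi>"
    and sep: "\<forall>i\<in>{0::nat}. \<forall>v\<in>V. \<forall>g. \<psi> v g = \<one>\<^bsub>F\<^esub> \<longrightarrow> f v g = 0"
    using quotient_separating[of "{0}" "\<lambda>_. f"] f(1) by blast
  show ?thesis
    by (rule virtual_retract_of_quotient_faithful[OF \<psi> g v]) (use sep v(1) f(2) f0(2) in auto)
qed

end

lemma of_int_floor_Ints: "x \<in> \<int> \<Longrightarrow> of_int \<lfloor>x\<rfloor> = x" for x :: rat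
  by (auto elim: Ints_cases)

section \<open>Elements of infinite order in vertex groups\<close>

context gog_coords
begin

text \<open>The floor is applied to integral values only, where it is additive; it merely converts
  rational numbers to type \<open>int\<close>.\<close>

lemma floor_hom:
  assumes f: "tree_family rat_group f" and v: "v \<in> V"
    and M: "\<And>g. g \<in> carrier (Gv v) \<Longrightarrow> of_nat M * f v g \<in> \<int>"
  shows "(\<lambda>g. s * \<lfloor>of_nat M * f v g\<rfloor>) \<in> hom (Gv v) integer_group"
proof (rule homI)
  fix g h assume g: "g \<in> carrier (Gv v)" and h: "h \<in> carrier (Gv v)"
  have "f v (g \<otimes>\<^bsub>Gv v\<^esub> h) = f v g + f v h" using hom_mult[OF tree_familyD(1)[OF f v] g h] by simp
  then have "\<lfloor>of_nat M * f v (g \<otimes>\<^bsub>Gv v\<^esub> h)\<rfloor> = \<lfloor>of_nat M * f v g\<rfloor> + \<lfloor>of_nat M * f v h\<rfloor>"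
    using M[OF g] M[OF h] by (auto simp: distrib_left elim!: Ints_cases)
  then show "s * \<lfloor>of_nat M * f v (g \<otimes>\<^bsub>Gv v\<^esub> h)\<rfloor> =
      (s * \<lfloor>of_nat M * f v g\<rfloor>) \<otimes>\<^bsub>integer_group\<^esub> (s * \<lfloor>of_nat M * f v h\<rfloor>)"
    by (simp add: distrib_left)
qed simp

lemma family_power_rat:
  assumes "tree_family rat_group f" "e \<in> NT"
  shows "f (tl\<^sub>\<Gamma> e) (al e (c e [^]\<^bsub>Ge e\<^esub> (k::int))) = of_int k * f (tl\<^sub>\<Gamma> e) (ae e)"
    and "f (hd\<^sub>\<Gamma> e) (om e (c e [^]\<^bsub>Ge e\<^esub> (k::int))) = of_int k * f (tl\<^sub>\<Gamma> (rv e)) (ae (rv e))"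
proof -
  note p = family_power[OF comm_group.axioms(2)[OF comm_group_rat_group] assms(1)]
  show "f (tl\<^sub>\<Gamma> e) (al e (c e [^]\<^bsub>Ge e\<^esub> k)) = of_int k * f (tl\<^sub>\<Gamma> e) (ae e)"
    using p[OF assms(2), of k] by simp
  show "f (hd\<^sub>\<Gamma> e) (om e (c e [^]\<^bsub>Ge e\<^esub> k)) = of_int k * f (tl\<^sub>\<Gamma> (rv e)) (ae (rv e))"
    using p[OF rv_NT[OF assms(2)], of k] assms(2) c_rv[OF assms(2)] Ge_rv[of e] by (simp add: al_rv)
qed

text \<open>The stable letter of \<open>e\<close> exchanges the functionals \<open>\<plusminus>\<phi>\<^sub>j\<close> belonging to its two ends, with the sign that
  makes them agree on the edge group.\<close>

lemma virtual_retract_coordinate: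
  assumes g: "g \<in> carrier G" and v: "v \<in> V" "y \<in> carrier (Gv v)" "conj_to g (vert v y)"
    and j: "j \<in> J" "\<phi> j v y \<noteq> 0"
  shows "virtual_retract (generate G {g}) G"
proof -
  have "\<exists>N>0::nat. \<forall>j\<in>J. \<forall>v\<in>V. \<forall>g\<in>carrier (Gv v). of_nat N * \<phi> j v g \<in> \<int>"
  proof (rule common_denominator_list[OF finite_J])
    fix i assume "i \<in> J"
    then show "\<exists>M>0::nat. \<forall>v\<in>V. \<forall>g\<in>carrier (Gv v). of_nat M * \<phi> i v g \<in> \<int>"
      by (intro family_rat_denominator \<phi>)
  next
    fix i and M N :: nat assume "\<forall>v\<in>V. \<forall>g\<in>carrier (Gv v). of_nat M * \<phi> i v g \<in> \<int>"
    then show "\<forall>v\<in>V. \<forall>g\<in>carrier (Gv v). of_nat (N * M) * \<phi> i v g \<in> \<int>" using mult_in_Ints_mult by simp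
  qed
  then obtain N where N: "N > 0" "\<And>j v g. j \<in> J \<Longrightarrow> v \<in> V \<Longrightarrow> g \<in> carrier (Gv v) \<Longrightarrow> of_nat N * \<phi> j v g \<in> \<int>" by blast
  \<comment> \<open>A point is a functional together with a sign, since passing from one end of an
    edge to the other may reverse it.\<close>
  define X where "X = J \<times> {1, - 1 :: int}"
  define f where "f x v g = snd x * \<lfloor>of_nat N * \<phi> (fst x) v g\<rfloor>" for x v g
  \<comment> \<open>The functional that detects \<open>ae (rv e)\<close>, at the head, must go to
    the one that detects \<open>ae e\<close>, at the tail. The transposition completes this to a
    bijection of \<open>J\<close>: all other functionals vanish at the head end and go to ones
    vanishing at the tail end. The product of signs makes the two nonzero values equal.\<close>
  define \<pi> where "\<pi> e x = (if e \<in> arcs T then x else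
    (transpose (idx e) (idx (rv e)) (fst x), sg (rv e) * sg e * snd x))" for e x
  have fval: "(of_int (f x v g) :: rat) = of_int (snd x) * (of_nat N * \<phi> (fst x) v g)"
    if "x \<in> X" "v \<in> V" "g \<in> carrier (Gv v)" for x v g
    using of_int_floor_Ints[OF N(2)[of "fst x" v g]] that by (auto simp: f_def X_def)
  have \<pi>X: "\<pi> e x \<in> X" if e: "e \<in> E" and x: "x \<in> X" for e x
  proof (cases "e \<in> arcs T")
    case False
    then have n: "e \<in> NT" using e by simp
    show ?thesis using x idx[OF n] idx[OF rv_NT[OF n]] sg[OF n] sg[OF rv_NT[OF n]]
      by (auto simp: \<pi>_def X_def transpose_def)
  qed (use x in \<open>simp add: \<pi>_def\<close>)
  have \<pi>\<pi>: "\<pi> e (\<pi> e x) = x" if e: "e \<in> E" for e x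
  proof (cases "e \<in> arcs T")
    case False
    then have n: "e \<in> NT" using e by simp
    show ?thesis using sg[OF n] sg[OF rv_NT[OF n]] by (auto simp: \<pi>_def prod_eq_iff)
  qed (simp add: \<pi>_def)
  show ?thesis
  proof (rule virtual_retract_of_functional[of X f \<pi> g v y "(j, 1)"])
    show "finite X" using finite_J by (simp add: X_def)
  next
    fix x v assume "x \<in> X" "v \<in> V"
    then show "f x v \<in> hom (Gv v) integer_group"
      unfolding f_def[abs_def] by (intro floor_hom \<phi> N(2)) (auto simp: X_def)
  next
    fix e assume "e \<in> P"
    then have e: "e \<in> E" using P_sub by blast
    show "bij_betw (\<pi> e) X X"
      by (rule bij_betwI[where g = "\<pi> e"]) (use \<pi>X[OF e] \<pi>\<pi>[OF e] in auto)
  next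
    fix e a x assume "e \<in> P" and a: "a \<in> carrier (Ge e)" and x: "x \<in> X"
    then have e: "e \<in> E" using P_sub by blast
    have xJ: "fst x \<in> J" using x by (auto simp: X_def)
    have hv: "hd\<^sub>\<Gamma> e \<in> V" "tl\<^sub>\<Gamma> e \<in> V" using e by simp_all
    have "(of_int (f x (hd\<^sub>\<Gamma> e) (om e a)) :: rat) = of_int (f (\<pi> e x) (tl\<^sub>\<Gamma> e) (al e a))"
    proof (cases "e \<in> arcs T")
      case True
      then show ?thesis
        using tree_familyD(2)[OF \<phi>[OF xJ] True a] by (simp add: f_def \<pi>_def)
    next
      case False
      then have n: "e \<in> NT" using e by simp
      obtain k :: int where k: "a = c e [^]\<^bsub>Ge e\<^esub> k" using edge_power[OF n a] by blast
      have pJ: "fst (\<pi> e x) \<in> J" using \<pi>X[OF e x] by (auto simp: X_def)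
      have 1: "\<phi> (fst x) (hd\<^sub>\<Gamma> e) (om e a) = of_int k * (if idx (rv e) = fst x then of_int (sg (rv e)) else 0)"
        unfolding k family_power_rat(2)[OF \<phi>[OF xJ] n] \<phi>_ae[OF xJ rv_NT[OF n]] ..
      have 2: "\<phi> (fst (\<pi> e x)) (tl\<^sub>\<Gamma> e) (al e a) = of_int k * (if idx e = fst (\<pi> e x) then of_int (sg e) else 0)"
        unfolding k family_power_rat(1)[OF \<phi>[OF pJ] n] \<phi>_ae[OF pJ n] ..
      have 3: "idx e = fst (\<pi> e x) \<longleftrightarrow> idx (rv e) = fst x"
        using False by (auto simp: \<pi>_def transpose_def split: if_splits)
      have 4: "snd (\<pi> e x) = sg (rv e) * sg e * snd x" using False by (simp add: \<pi>_def)
      have 5: "(of_int (sg e) :: rat) * of_int (sg e) = 1" using sg[OF n] by auto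
      show ?thesis
        unfolding fval[OF x hv(1) om_closed[OF e a]] fval[OF \<pi>X[OF e x] hv(2) al_closed[OF e a]] 1 2 3 4
        using sg[OF n] by (auto simp: mult_ac)
    qed
    then show "f x (hd\<^sub>\<Gamma> e) (om e a) = f (\<pi> e x) (tl\<^sub>\<Gamma> e) (al e a)" by (simp only: of_int_eq_iff)
  next
    show "(j, 1) \<in> X" using j(1) by (simp add: X_def)
    have "(of_int (f (j, 1) v y) :: rat) \<noteq> 0"
      using fval[of "(j, 1)" v y] j v N(1) by (simp add: X_def)
    then show "f (j, 1) v y \<noteq> 0" by simp
  qed (use g v in auto)
qed

text \<open>A functional that vanishes on the edge groups outside \<open>T\<close> agrees at both
  ends of every edge, so it extends to \<open>G\<close> with value 0 at the stable letters and a
  single point can carry it; \<open>M\<close> clears its denominators.\<close>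

lemma virtual_retract_orthogonal:
  assumes g: "g \<in> carrier G" and v: "v \<in> V" "y \<in> carrier (Gv v)" "conj_to g (vert v y)"
    and h: "tree_family rat_group h" "\<And>e. e \<in> NT \<Longrightarrow> h (tl\<^sub>\<Gamma> e) (ae e) = 0" "h v y \<noteq> 0"
  shows "virtual_retract (generate G {g}) G"
proof -
  obtain M where M: "M > 0" "\<And>v g. v \<in> V \<Longrightarrow> g \<in> carrier (Gv v) \<Longrightarrow> of_nat M * h v g \<in> \<int>"
    using family_rat_denominator[OF h(1)] by blast
  define f where "f (x :: unit) v g = 1 * \<lfloor>of_nat M * h v g\<rfloor>" for x v g
  show ?thesis
  proof (rule virtual_retract_of_functional[of "{()}" f "\<lambda>_. id" g v y "()"])
    fix x v assume "v \<in> V"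
    then show "f x v \<in> hom (Gv v) integer_group"
      unfolding f_def[abs_def] by (intro floor_hom h(1) M(2))
  next
    fix e a x assume "e \<in> P" and a: "a \<in> carrier (Ge e)"
    then have e: "e \<in> E" using P_sub by blast
    have "h (hd\<^sub>\<Gamma> e) (om e a) = h (tl\<^sub>\<Gamma> e) (al e a)"
    proof (cases "e \<in> arcs T")
      case True
      then show ?thesis using tree_familyD(2)[OF h(1) True a] by simp
    next
      case False
      then have n: "e \<in> NT" using e by simp
      obtain k :: int where k: "a = c e [^]\<^bsub>Ge e\<^esub> k" using edge_power[OF n a] by blast
      show ?thesis
        unfolding k family_power_rat[OF h(1) n] h(2)[OF n] h(2)[OF rv_NT[OF n]] by simp
    qed
    then show "f x (hd\<^sub>\<Gamma> e) (om e a) = f (id x) (tl\<^sub>\<Gamma> e) (al e a)" by (simp add: f_def)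
  next
    show "f () v y \<noteq> 0"
    proof
      assume "f () v y = 0"
      then have "of_int \<lfloor>of_nat M * h v y\<rfloor> = (0 :: rat)" unfolding f_def mult_1 by simp
      then have "of_nat M * h v y = 0" using of_int_floor_Ints[OF M(2)[OF v(1,2)]] by metis
      then show False using M(1) h(3) by simp
    qed
  qed (use g v in auto)
qed

text \<open>If all coordinates vanish at \<open>y\<close>, a functional with value 1 at
  \<open>y\<close> keeps this value when multiples of them are subtracted. The coefficients are its
  values at the independent elements, and \<open>family_ae\<close> carries the vanishing over to
  every \<open>ae e\<close>.\<close>

lemma virtual_retract_elliptic_infinite:
  assumes g: "g \<in> carrier G" and v: "v \<in> V" "y \<in> carrier (Gv v)" "conj_to g (vert v y)"
    and inf: "\<And>k::int. y [^]\<^bsub>Gv v\<^esub> k = \<one>\<^bsub>Gv v\<^esub> \<Longrightarrow> k = 0"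
  shows "virtual_retract (generate G {g}) G"
proof (cases "\<exists>j\<in>J. \<phi> j v y \<noteq> 0")
  case True
  then show ?thesis using virtual_retract_coordinate[OF g v] by blast
next
  case False
  obtain f0 where f0: "f0 \<in> hom (Gv v) rat_group" "f0 y = 1"
    using rat_character[OF ab[OF v(1)] fin_gen[OF v(1)] v(2) inf] by blast
  obtain h where h: "tree_family rat_group h" "h v = f0"
    using extend_family[OF comm_group_rat_group divisible_rat_group v(1) f0(1)] by blast
  \<comment> \<open>Subtracting the coordinates leaves a functional that vanishes on every \<open>ae e\<close>.\<close>
  define h' where "h' w x = h w x - (\<Sum>j\<in>J. h (tl\<^sub>\<Gamma> j) (ae j) * \<phi> j w x)" for w x
  have "tree_family rat_group h'"
    unfolding tree_family_def
  proof (intro conjI ballI)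
    fix w assume w: "w \<in> V"
    show "h' w \<in> hom (Gv w) rat_group"
    proof (rule homI)
      fix a b assume a: "a \<in> carrier (Gv w)" and b: "b \<in> carrier (Gv w)"
      have 1: "h w (a \<otimes>\<^bsub>Gv w\<^esub> b) = h w a + h w b" using hom_mult[OF tree_familyD(1)[OF h(1) w] a b] by simp
      have "\<phi> j w (a \<otimes>\<^bsub>Gv w\<^esub> b) = \<phi> j w a + \<phi> j w b" if "j \<in> J" for j
        using hom_mult[OF tree_familyD(1)[OF \<phi>[OF that] w] a b] by simp
      then have "(\<Sum>j\<in>J. h (tl\<^sub>\<Gamma> j) (ae j) * \<phi> j w (a \<otimes>\<^bsub>Gv w\<^esub> b)) =
          (\<Sum>j\<in>J. h (tl\<^sub>\<Gamma> j) (ae j) * \<phi> j w a) + (\<Sum>j\<in>J. h (tl\<^sub>\<Gamma> j) (ae j) * \<phi> j w b)"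
        by (simp add: distrib_left sum.distrib)
      then show "h' w (a \<otimes>\<^bsub>Gv w\<^esub> b) = h' w a \<otimes>\<^bsub>rat_group\<^esub> h' w b" by (simp add: h'_def 1)
    qed simp
  next
    fix e a assume e: "e \<in> arcs T" "a \<in> carrier (Ge e)"
    have "\<phi> j (tl\<^sub>\<Gamma> e) (al e a) = \<phi> j (hd\<^sub>\<Gamma> e) (om e a)" if "j \<in> J" for j
      using tree_familyD(2)[OF \<phi>[OF that] e] .
    then show "h' (tl\<^sub>\<Gamma> e) (al e a) = h' (hd\<^sub>\<Gamma> e) (om e a)"
      using tree_familyD(2)[OF h(1) e] by (simp add: h'_def)
  qed
  moreover have "h' (tl\<^sub>\<Gamma> e) (ae e) = 0" if e: "e \<in> NT" for e
  proof -
    have "(\<Sum>j\<in>J. h (tl\<^sub>\<Gamma> j) (ae j) * \<phi> j (tl\<^sub>\<Gamma> e) (ae e)) =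
        (\<Sum>j\<in>J. if idx e = j then h (tl\<^sub>\<Gamma> j) (ae j) * of_int (sg e) else 0)"
      by (rule sum.cong) (simp_all add: \<phi>_ae[OF _ e])
    also have "\<dots> = h (tl\<^sub>\<Gamma> (idx e)) (ae (idx e)) * of_int (sg e)"
      using finite_J idx[OF e] by (simp add: sum.delta')
    finally show ?thesis using family_ae[OF h(1) e] by (simp add: h'_def)
  qed
  moreover have "h' v y \<noteq> 0" using False h(2) f0(2) by (simp add: h'_def)
  ultimately show ?thesis by (rule virtual_retract_orthogonal[OF g v])
qed

lemma property_VRC_G: "property_VRC G"
  unfolding property_VRC_def
proof
  fix g assume g: "g \<in> carrier G"
  from conj_normal_form[OF g] show "virtual_retract (generate G {g}) G"
  proof
    assume "\<exists>w\<in>V. \<exists>x\<in>carrier (Gv w). conj_to g (vert w x)"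
    then obtain w x where x: "w \<in> V" "x \<in> carrier (Gv w)" "conj_to g (vert w x)" by blast
    interpret Gw: group "Gv w" by (rule group_Gv[OF x(1)])
    show ?thesis
    proof (cases "\<exists>m>0. x [^]\<^bsub>Gv w\<^esub> (m::nat) = \<one>\<^bsub>Gv w\<^esub>")
      case True
      then show ?thesis using virtual_retract_elliptic_torsion[OF g x] by blast
    next
      case False
      have "k = 0" if k: "x [^]\<^bsub>Gv w\<^esub> k = \<one>\<^bsub>Gv w\<^esub>" for k :: int
      proof (rule ccontr)
        assume "k \<noteq> 0"
        have "x [^]\<^bsub>Gv w\<^esub> (nat \<bar>k\<bar>) = \<one>\<^bsub>Gv w\<^esub>"
        proof (cases "k > 0")
          case True
          then show ?thesis using k int_pow_int[of "Gv w" x "nat k"] by simp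
        next
          case False
          then show ?thesis
            using k Gw.int_pow_neg[OF x(2), of k] int_pow_int[of "Gv w" x "nat (- k)"] by simp
        qed
        then show False using False \<open>k \<noteq> 0\<close> by (metis zero_less_abs_iff zero_less_nat_eq)
      qed
      then show ?thesis by (rule virtual_retract_elliptic_infinite[OF g x])
    qed
  next
    assume "\<exists>w p. gog_path \<G> w p w \<and> p \<noteq> [] \<and> reduced_cycle p \<and> conj_to g (ev p)"
    then show ?thesis using virtual_retract_hyperbolic[OF g] by blast
  qed
qed

end

section \<open>Functionals from near independence\<close>

definition real_group :: "real monoid" where
  "real_group = \<lparr>carrier = UNIV, mult = (+), one = 0\<rparr>"

lemma real_group_simps [simp]:
  "carrier real_group = UNIV" "x \<otimes>\<^bsub>real_group\<^esub> y = x + y" "\<one>\<^bsub>real_group\<^esub> = 0"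
  by (simp_all add: real_group_def)

lemma comm_group_real_group: "comm_group real_group"
  by (rule comm_groupI) (auto intro: exI[of _ "- x" for x])

lemma inv_real_group [simp]: "inv\<^bsub>real_group\<^esub> x = - x"
proof -
  interpret R: comm_group real_group by (rule comm_group_real_group)
  show ?thesis by (rule R.inv_equality) simp_all
qed

text \<open>The rule sending \<open>(a, r)\<close> to \<open>r f(a)\<close> is bilinear, so it
  respects the defining relations; it is the real functional that \<open>f\<close> induces on the
  tensor product.\<close>

lemma tensor_real_functional:
  assumes A: "comm_group A" and f: "f \<in> hom A rat_group"
  shows "\<exists>L. L \<in> hom (tensor_real_free A) real_group \<and>
    (\<forall>a\<in>carrier A. \<forall>r. L (frag_of (a, r)) = r * of_rat (f a)) \<and> (\<forall>x\<in>tensor_real_kernel A. L x = 0)"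
proof -
  interpret A: comm_group A by fact
  interpret R: comm_group real_group by (rule comm_group_real_group)
  interpret F: comm_group "tensor_real_free A" by (rule comm_group_tensor_real_free)
  obtain L where L: "L \<in> hom (free_Abelian_group (carrier A \<times> UNIV)) real_group"
    "\<And>x. x \<in> carrier A \<times> UNIV \<Longrightarrow> L (frag_of x) = (\<lambda>(a, r). r * of_rat (f a)) x"
    using R.free_Abelian_group_universal[of "\<lambda>(a, r). r * of_rat (f a)" "carrier A \<times> UNIV"] by auto
  have Lh: "L \<in> hom (tensor_real_free A) real_group" using L(1) by (simp add: tensor_real_free_def)
  have Lf: "L (frag_of (a, r)) = r * of_rat (f a)" if "a \<in> carrier A" for a r using L(2)[of "(a, r)"] that by simp
  interpret L: group_hom "tensor_real_free A" real_group L by unfold_locales (rule Lh)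
  have Ld: "L (x - y) = L x - L y" if "x \<in> carrier (tensor_real_free A)" "y \<in> carrier (tensor_real_free A)" for x y
  proof -
    have "L (x \<otimes>\<^bsub>tensor_real_free A\<^esub> inv\<^bsub>tensor_real_free A\<^esub> y) = L x - L y"
      using that L.hom_mult[OF that(1) F.inv_closed[OF that(2)]] by simp
    then show ?thesis using inv_tensor_real_free[OF that(2)] by simp
  qed
  have "L ` tensor_real_rels A \<subseteq> {0}"
  proof
    fix z assume "z \<in> L ` tensor_real_rels A"
    then obtain x where x: "x \<in> tensor_real_rels A" "z = L x" by blast
    from x(1) show "z \<in> {0}" unfolding tensor_real_rels_def
    proof (elim UnE CollectE exE conjE)
      fix a b r assume e: "x = frag_of (a \<otimes>\<^bsub>A\<^esub> b, r) - frag_of (a, r) - frag_of (b, r)"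
        and c: "a \<in> carrier A" "b \<in> carrier A"
      have "f (a \<otimes>\<^bsub>A\<^esub> b) = f a + f b" using hom_mult[OF f c] by simp
      then show ?thesis using x(2) e c by (simp add: Ld diff_tensor_real_free Lf of_rat_add distrib_left)
    next
      fix a r s assume e: "x = frag_of (a, r + s) - frag_of (a, r) - frag_of (a, s)" and c: "a \<in> carrier A"
      show ?thesis using x(2) e c by (simp add: Ld diff_tensor_real_free Lf distrib_right)
    qed
  qed
  then have "L x = 0" if "x \<in> tensor_real_kernel A" for x
    using hom_generate_in[OF F.is_group R.is_group Lh R.triv_subgroup tensor_real_rels_subset[OF A], of x] that
    by (simp add: tensor_real_kernel_def)
  then show ?thesis using Lh Lf by blast
qed

lemma tensor_image_in_carrier:
  "a \<in> carrier A \<Longrightarrow> tensor_real_image A a \<in> carrier (tensor_real A)"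
  by (auto simp: tensor_real_def tensor_real_image_def FactGroup_def RCOSETS_def)

text \<open>In the real vector space elements are compared up to torsion only, but rational
  functionals do not see torsion: the functional induced by \<open>f\<close> takes equal values on
  representatives of one coset.\<close>

lemma hom_eq_of_tensor_image:
  assumes A: "comm_group A" and f: "f \<in> hom A rat_group" and ab: "a \<in> carrier A" "b \<in> carrier A"
    and eq: "tensor_real_image A a = of_int s \<odot>\<^bsub>tensor_real A\<^esub> tensor_real_image A b"
  shows "f a = of_int s * f b"
proof -
  interpret F: comm_group "tensor_real_free A" by (rule comm_group_tensor_real_free)
  interpret N: normal "tensor_real_kernel A" "tensor_real_free A" by (rule tensor_real_kernel_normal[OF A])
  obtain L where L: "L \<in> hom (tensor_real_free A) real_group"
    "\<And>a r. a \<in> carrier A \<Longrightarrow> L (frag_of (a, r)) = r * of_rat (f a)" "\<And>x. x \<in> tensor_real_kernel A \<Longrightarrow> L x = 0"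
    using tensor_real_functional[OF A f] by blast
  let ?q = "\<lambda>x. tensor_real_kernel A #>\<^bsub>tensor_real_free A\<^esub> x"
  have c: "frag_of (a, 1) \<in> carrier (tensor_real_free A)" "frag_of (b, 1) \<in> carrier (tensor_real_free A)"
    "frag_of (b, of_int s) \<in> carrier (tensor_real_free A)" using ab by simp_all
  have "?q (frag_of (a, 1)) = ?q (frag_of (b, of_int s))"
    using eq smult_tensor_real[OF A c(2), of "of_int s"] by (simp add: tensor_real_image_def)
  moreover have "frag_of (a, 1) \<in> ?q (frag_of (a, 1))" by (rule F.rcos_self[OF c(1) N.subgroup_axioms])
  ultimately obtain k where k: "k \<in> tensor_real_kernel A" "frag_of (a, 1) = k \<otimes>\<^bsub>tensor_real_free A\<^esub> frag_of (b, of_int s)"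
    unfolding r_coset_def by blast
  have kc: "k \<in> carrier (tensor_real_free A)" using k(1) N.subset by blast
  have "L (frag_of (a, 1)) = L k + L (frag_of (b, of_int s))"
    unfolding k(2) using hom_mult[OF L(1) kc c(3)] by simp
  then have "of_rat (f a) = (of_int s * of_rat (f b) :: real)" using L(2,3) ab k(1) by simp
  also have "\<dots> = of_rat (of_int s * f b)" by (simp add: of_rat_mult)
  finally show ?thesis by (simp only: of_rat_eq_iff)
qed

lemma tensor_image_hom:
  assumes A: "comm_group A"
  shows "tensor_real_image A \<in> hom A (add_monoid (tensor_real A))"
proof (rule homI)
  let ?F = "tensor_real_free A" and ?N = "tensor_real_kernel A"
  interpret A: comm_group A by fact
  interpret F: comm_group ?F by (rule comm_group_tensor_real_free)
  interpret N: normal ?N ?F by (rule tensor_real_kernel_normal[OF A])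
  show "tensor_real_image A a \<in> carrier (add_monoid (tensor_real A))" if "a \<in> carrier A" for a
    using tensor_image_in_carrier[OF that] by simp
  fix a b assume ab: "a \<in> carrier A" "b \<in> carrier A"
  have c: "frag_of (a, 1) \<in> carrier ?F" "frag_of (b, 1) \<in> carrier ?F" "frag_of (a \<otimes>\<^bsub>A\<^esub> b, 1) \<in> carrier ?F"
    using ab by simp_all
  have s: "frag_of (a, 1) + frag_of (b, 1) \<in> carrier ?F" using F.m_closed[OF c(1,2)] by simp
  have "frag_of (a \<otimes>\<^bsub>A\<^esub> b, 1) - frag_of (a, 1) - frag_of (b, 1) \<in> tensor_real_rels A"
    unfolding tensor_real_rels_def using ab by blast
  then have "frag_of (a \<otimes>\<^bsub>A\<^esub> b, 1) - frag_of (a, 1) - frag_of (b, 1) \<in> ?N"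
    unfolding tensor_real_kernel_def by (rule generate.incl)
  moreover have "frag_of (a \<otimes>\<^bsub>A\<^esub> b, 1) =
      (frag_of (a \<otimes>\<^bsub>A\<^esub> b, 1) - frag_of (a, 1) - frag_of (b, 1)) \<otimes>\<^bsub>?F\<^esub> (frag_of (a, 1) + frag_of (b, 1))"
    by simp
  ultimately have "frag_of (a \<otimes>\<^bsub>A\<^esub> b, 1) \<in> ?N #>\<^bsub>?F\<^esub> (frag_of (a, 1) + frag_of (b, 1))"
    unfolding r_coset_def by blast
  then have "?N #>\<^bsub>?F\<^esub> frag_of (a \<otimes>\<^bsub>A\<^esub> b, 1) = ?N #>\<^bsub>?F\<^esub> (frag_of (a, 1) + frag_of (b, 1))"
    using F.repr_independence[OF _ s N.subgroup_axioms] by simp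
  also have "\<dots> = (?N #>\<^bsub>?F\<^esub> frag_of (a, 1)) <#>\<^bsub>?F\<^esub> (?N #>\<^bsub>?F\<^esub> frag_of (b, 1))"
    using N.rcos_sum[OF c(1,2)] by simp
  finally show "tensor_real_image A (a \<otimes>\<^bsub>A\<^esub> b) =
      tensor_real_image A a \<otimes>\<^bsub>add_monoid (tensor_real A)\<^esub> tensor_real_image A b"
    by (simp add: tensor_real_image_def tensor_real_def FactGroup_def)
qed

lemma tensor_image_int_pow:
  assumes A: "comm_group A" and a: "a \<in> carrier A"
  shows "tensor_real_image A (a [^]\<^bsub>A\<^esub> (k::int)) = of_int k \<odot>\<^bsub>tensor_real A\<^esub> tensor_real_image A a"
proof -
  let ?M = "tensor_real A" and ?t = "tensor_real_image A a"
  interpret A: comm_group A by fact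
  interpret M: Module.module "class_ring :: real ring" ?M by (rule module_tensor_real[OF A])
  have t: "?t \<in> carrier ?M" by (rule tensor_image_in_carrier[OF a])
  interpret h: group_hom A "add_monoid ?M" "tensor_real_image A"
    by (intro group_hom.intro group_hom_axioms.intro A.is_group M.a_group tensor_image_hom[OF A])
  have "(\<lambda>k. of_int k \<odot>\<^bsub>?M\<^esub> ?t) \<in> hom integer_group (add_monoid ?M)"
  proof (rule homI)
    fix k l :: int
    show "of_int (k \<otimes>\<^bsub>integer_group\<^esub> l) \<odot>\<^bsub>?M\<^esub> ?t =
        (of_int k \<odot>\<^bsub>?M\<^esub> ?t) \<otimes>\<^bsub>add_monoid ?M\<^esub> (of_int l \<odot>\<^bsub>?M\<^esub> ?t)"
      using M.smult_l_distr[of "of_int k" "of_int l" ?t] t by simp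
  qed (use M.smult_closed[OF _ t] in simp)
  then interpret z: group_hom integer_group "add_monoid ?M" "\<lambda>k. of_int k \<odot>\<^bsub>?M\<^esub> ?t"
    by (intro group_hom.intro group_hom_axioms.intro group_integer_group M.a_group)
  have "of_int k \<odot>\<^bsub>?M\<^esub> ?t = (of_int 1 \<odot>\<^bsub>?M\<^esub> ?t) [^]\<^bsub>add_monoid ?M\<^esub> k"
    using z.hom_int_pow[of 1 k] by simp
  also have "of_int 1 \<odot>\<^bsub>?M\<^esub> ?t = ?t" using M.smult_one[OF t] by simp
  finally show ?thesis using h.hom_int_pow[OF a, of k] by simp
qed

lemma tensor_image_finprod:
  assumes A: "comm_group A" and "finite J" "\<And>j. j \<in> J \<Longrightarrow> a j \<in> carrier A"
  shows "tensor_real_image A (finprod A a J) = (\<Oplus>\<^bsub>tensor_real A\<^esub>j\<in>J. tensor_real_image A (a j))"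
proof -
  interpret A: comm_group A by fact
  interpret M: Module.module "class_ring :: real ring" "tensor_real A" by (rule module_tensor_real[OF A])
  interpret h: group_hom A "add_monoid (tensor_real A)" "tensor_real_image A"
    by (intro group_hom.intro group_hom_axioms.intro A.is_group M.a_group tensor_image_hom[OF A])
  show ?thesis using assms(2,3)
  proof (induction J)
    case empty
    then show ?case using h.hom_one by simp
  next
    case (insert x J)
    have aJ: "a \<in> J \<rightarrow> carrier A" by (intro Pi_I insert(4)) simp
    have 1: "a x \<in> carrier A" "finprod A a J \<in> carrier A" "a \<in> J \<rightarrow> carrier A"
      using insert(4)[of x] A.finprod_closed[OF aJ] aJ by simp_all
    have 2: "(\<lambda>j. tensor_real_image A (a j)) \<in> J \<rightarrow> carrier (tensor_real A)"
      by (intro Pi_I tensor_image_in_carrier insert(4)) simp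
    show ?case
    proof -
      have "finprod A a (insert x J) = a x \<otimes>\<^bsub>A\<^esub> finprod A a J"
        by (rule A.finprod_insert[OF insert(1,2) 1(3,1)])
      then have "tensor_real_image A (finprod A a (insert x J)) =
          tensor_real_image A (a x) \<oplus>\<^bsub>tensor_real A\<^esub> tensor_real_image A (finprod A a J)"
        using h.hom_mult[OF 1(1,2)] by simp
      also have "\<dots> = tensor_real_image A (a x) \<oplus>\<^bsub>tensor_real A\<^esub> (\<Oplus>\<^bsub>tensor_real A\<^esub>j\<in>J. tensor_real_image A (a j))"
        using insert(3,4) by simp
      also have "\<dots> = (\<Oplus>\<^bsub>tensor_real A\<^esub>j\<in>insert x J. tensor_real_image A (a j))"
        by (rule M.finsum_insert[OF insert(1,2) 2 tensor_image_in_carrier[OF 1(1)], symmetric])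
      finally show ?thesis .
    qed
  qed
qed

text \<open>A multiplicative relation with integer exponents becomes a linear relation with real
  coefficients among the images. Injectivity allows the coefficients to be indexed by vectors, as
  \<open>lincomb\<close> requires.\<close>

lemma independent_of_tensor_image:
  assumes A: "comm_group A" and J: "finite J" and a: "\<And>j. j \<in> J \<Longrightarrow> a j \<in> carrier A"
    and inj: "inj_on (\<lambda>j. tensor_real_image A (a j)) J"
    and ind: "\<not> module.lin_dep class_ring (tensor_real A) ((\<lambda>j. tensor_real_image A (a j)) ` J)"
    and one: "finprod A (\<lambda>j. a j [^]\<^bsub>A\<^esub> (k j :: int)) J = \<one>\<^bsub>A\<^esub>" and j: "j \<in> J"
  shows "k j = 0"
proof (rule ccontr)
  assume kj: "k j \<noteq> 0"
  let ?M = "tensor_real A" and ?t = "\<lambda>j. tensor_real_image A (a j)"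
  interpret A: comm_group A by fact
  interpret M: Module.module "class_ring :: real ring" ?M by (rule module_tensor_real[OF A])
  interpret h: group_hom A "add_monoid ?M" "tensor_real_image A"
    by (intro group_hom.intro group_hom_axioms.intro A.is_group M.a_group tensor_image_hom[OF A])
  define b where "b v = (of_int (k (inv_into J ?t v)) :: real)" for v
  have bt: "b (?t i) = of_int (k i)" if "i \<in> J" for i
    using inv_into_f_f[OF inj that] by (simp add: b_def)
  have tc: "?t i \<in> carrier ?M" if "i \<in> J" for i by (rule tensor_image_in_carrier[OF a[OF that]])
  have "M.lincomb b (?t ` J) = (\<Oplus>\<^bsub>?M\<^esub>v\<in>?t ` J. b v \<odot>\<^bsub>?M\<^esub> v)" by (simp add: M.lincomb_def)
  also have "\<dots> = (\<Oplus>\<^bsub>?M\<^esub>i\<in>J. b (?t i) \<odot>\<^bsub>?M\<^esub> ?t i)"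
    by (rule M.finsum_reindex[OF _ inj]) (use tc M.smult_closed in auto)
  also have "\<dots> = (\<Oplus>\<^bsub>?M\<^esub>i\<in>J. tensor_real_image A (a i [^]\<^bsub>A\<^esub> k i))"
    by (rule M.finsum_cong') (auto simp: bt tensor_image_int_pow[OF A] a intro!: M.smult_closed tc)
  also have "\<dots> = tensor_real_image A (finprod A (\<lambda>j. a j [^]\<^bsub>A\<^esub> k j) J)"
    using tensor_image_finprod[OF A J, of "\<lambda>j. a j [^]\<^bsub>A\<^esub> k j"] a by simp
  also have "\<dots> = \<zero>\<^bsub>?M\<^esub>" unfolding one using h.hom_one by simp
  finally have "M.lincomb b (?t ` J) = \<zero>\<^bsub>?M\<^esub>" .
  moreover have "b (?t j) \<noteq> \<zero>\<^bsub>class_ring\<^esub>" using bt[OF j] kj by simp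
  moreover have "b \<in> ?t ` J \<rightarrow> carrier class_ring" by simp
  moreover have "finite (?t ` J)" "?t j \<in> ?t ` J" using J j by simp_all
  ultimately have "M.lin_dep (?t ` J)"
    unfolding M.lin_dep_def by (intro exI[of _ "?t ` J"] exI[of _ b] exI[of _ "?t j"] conjI subset_refl)
  then show False using ind by contradiction
qed

text \<open>Sending a product of powers of the \<open>a j\<close> to the exponent of
  \<open>a i\<close> is well defined by independence over the integers, and it extends to all of
  \<open>A\<close> because the rational numbers are divisible. The dual functionals are thus
  rational from the outset.\<close>

lemma dual_family:
  assumes A: "comm_group A" "finitely_generated_group A" and J: "finite J"
    and a: "\<And>j. j \<in> J \<Longrightarrow> a j \<in> carrier A"
    and ind: "\<And>k j. finprod A (\<lambda>j. a j [^]\<^bsub>A\<^esub> (k j :: int)) J = \<one>\<^bsub>A\<^esub> \<Longrightarrow> j \<in> J \<Longrightarrow> k j = 0"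
    and i: "i \<in> J"
  shows "\<exists>f\<in>hom A rat_group. \<forall>j\<in>J. f (a j) = (if j = i then 1 else 0)"
proof -
  interpret A: comm_group A by fact
  interpret R: comm_group rat_group by (rule comm_group_rat_group)
  interpret P: group "A \<times>\<times> rat_group" by (intro DirProd_group A.is_group R.is_group)
  let ?p = "\<lambda>k. finprod A (\<lambda>j. a j [^]\<^bsub>A\<^esub> (k j :: int)) J"
  have pc: "?p k \<in> carrier A" for k by (rule A.finprod_closed) (use a in auto)
  have pm: "?p (\<lambda>j. k j + l j) = ?p k \<otimes>\<^bsub>A\<^esub> ?p l" for k l
  proof -
    have "?p k \<otimes>\<^bsub>A\<^esub> ?p l = finprod A (\<lambda>j. a j [^]\<^bsub>A\<^esub> k j \<otimes>\<^bsub>A\<^esub> a j [^]\<^bsub>A\<^esub> l j) J"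
      by (rule A.finprod_multf[symmetric]) (use a in auto)
    also have "\<dots> = ?p (\<lambda>j. k j + l j)"
      by (rule A.finprod_cong') (use a in \<open>auto simp: A.int_pow_mult\<close>)
    finally show ?thesis ..
  qed
  define R where "R = (\<lambda>k. (?p k, of_int (k i) :: rat)) ` UNIV"
  have RI: "(?p k, of_int (k i)) \<in> R" for k by (simp add: R_def)
  have p0: "?p (\<lambda>_. 0) = \<one>\<^bsub>A\<^esub>" by simp
  have "partial_hom A rat_group R"
    unfolding partial_hom_def
  proof (intro conjI allI impI)
    show "subgroup R (A \<times>\<times> rat_group)"
    proof (rule P.subgroupI)
      show "R \<subseteq> carrier (A \<times>\<times> rat_group)" using pc by (auto simp: R_def)
      show "R \<noteq> {}" by (simp add: R_def)
    next
      fix x assume "x \<in> R"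
      then obtain k where k: "x = (?p k, of_int (k i))" by (auto simp: R_def)
      have "?p (\<lambda>j. - k j) \<otimes>\<^bsub>A\<^esub> ?p k = \<one>\<^bsub>A\<^esub>"
        unfolding pm[of "\<lambda>j. - k j" k, symmetric] by simp
      then have 1: "inv\<^bsub>A\<^esub> ?p k = ?p (\<lambda>j. - k j)" by (rule A.inv_equality[OF _ pc pc])
      have 2: "inv\<^bsub>rat_group\<^esub> (of_int (k i)) = of_int (- k i)" by (rule R.inv_equality) simp_all
      have "inv\<^bsub>A \<times>\<times> rat_group\<^esub> x = (?p (\<lambda>j. - k j), of_int (- k i))"
        unfolding k 1[symmetric] 2[symmetric] by (rule inv_DirProd[OF A.is_group R.is_group pc]) simp
      then show "inv\<^bsub>A \<times>\<times> rat_group\<^esub> x \<in> R" using RI[of "\<lambda>j. - k j"] by (simp only:)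
    next
      fix x y assume "x \<in> R" "y \<in> R"
      then obtain k l where k: "x = (?p k, of_int (k i))" "y = (?p l, of_int (l i))" by (auto simp: R_def)
      have "x \<otimes>\<^bsub>A \<times>\<times> rat_group\<^esub> y = (?p (\<lambda>j. k j + l j), of_int (k i + l i))"
        unfolding k pm mult_DirProd of_int_add rat_group_simps ..
      then show "x \<otimes>\<^bsub>A \<times>\<times> rat_group\<^esub> y \<in> R" using RI[of "\<lambda>j. k j + l j"] by (simp only:)
    qed
    fix d assume "(\<one>\<^bsub>A\<^esub>, d) \<in> R"
    then obtain k where k: "?p k = \<one>\<^bsub>A\<^esub>" "d = of_int (k i)" by (auto simp: R_def)
    then show "d = \<one>\<^bsub>rat_group\<^esub>" using ind[OF k(1) i] by simp
  qed
  from partial_hom_extend[OF A comm_group_rat_group divisible_rat_group this]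
  obtain f where f: "f \<in> hom A rat_group" "\<forall>(x, d)\<in>R. f x = d" by (rule bexE)
  have "f (a j) = (if j = i then 1 else 0)" if j: "j \<in> J" for j
  proof -
    have "?p (\<lambda>l. if j = l then 1 else 0) = finprod A (\<lambda>l. if j = l then a l else \<one>\<^bsub>A\<^esub>) J"
      by (rule A.finprod_cong') (use a in \<open>auto simp: A.int_pow_1\<close>)
    also have "\<dots> = a j" by (rule A.finprod_singleton[OF j J]) (use a in auto)
    finally have "(a j, of_int (if j = i then 1 else 0)) \<in> R"
      using RI[of "\<lambda>l. if j = l then 1 else 0"] by simp
    from bspec[OF f(2) this] show ?thesis by simp
  qed
  then show ?thesis using f(1) by blast
qed

text \<open>This translates near independence into rational functionals, the form used by
  \<open>gog_coords\<close>: duals exist for the independent subset, and their values at the other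
  elements follow from \<open>idx\<close> and \<open>sg\<close>.\<close>

lemma nearly_independent_coordinates:
  assumes A: "comm_group A" "finitely_generated_group A" and I: "finite I"
    and a: "\<And>i. i \<in> I \<Longrightarrow> a i \<in> carrier A" and ni: "nearly_independent_in A I a"
  shows "\<exists>J\<subseteq>I. \<exists>idx (sg :: 'i \<Rightarrow> int) \<phi>. (\<forall>i\<in>I. idx i \<in> J \<and> (sg i = 1 \<or> sg i = - 1)) \<and>
    (\<forall>f\<in>hom A rat_group. \<forall>i\<in>I. f (a i) = of_int (sg i) * f (a (idx i))) \<and>
    (\<forall>j\<in>J. \<phi> j \<in> hom A rat_group \<and> (\<forall>i\<in>I. \<phi> j (a i) = (if idx i = j then of_int (sg i) else 0)))"
proof -
  let ?t = "\<lambda>i. tensor_real_image A (a i)"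
  obtain J where J: "J \<subseteq> I" "inj_on ?t J" "\<not> module.lin_dep class_ring (tensor_real A) (?t ` J)"
    and near: "\<forall>i\<in>I. \<exists>j\<in>J. \<exists>\<epsilon>\<in>{1, - 1}. ?t i = \<epsilon> \<odot>\<^bsub>tensor_real A\<^esub> ?t j"
    using ni unfolding nearly_independent_in_def nearly_linearly_independent_def by blast
  have finJ: "finite J" using J(1) I finite_subset by blast
  have "\<forall>i\<in>I. \<exists>p. fst p \<in> J \<and> (snd p = (1::int) \<or> snd p = - 1) \<and> ?t i = of_int (snd p) \<odot>\<^bsub>tensor_real A\<^esub> ?t (fst p)"
  proof
    fix i assume "i \<in> I"
    then obtain j \<epsilon> where j: "j \<in> J" "\<epsilon> \<in> {1, - 1}" "?t i = \<epsilon> \<odot>\<^bsub>tensor_real A\<^esub> ?t j" using near by blast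
    then have "\<exists>s::int. (s = 1 \<or> s = - 1) \<and> of_int s = \<epsilon>"
      by (auto intro: exI[of _ "1::int"] exI[of _ "- 1::int"])
    then obtain s :: int where "s = 1 \<or> s = - 1" "of_int s = \<epsilon>" by blast
    then show "\<exists>p. fst p \<in> J \<and> (snd p = (1::int) \<or> snd p = - 1) \<and> ?t i = of_int (snd p) \<odot>\<^bsub>tensor_real A\<^esub> ?t (fst p)"
      using j by (intro exI[of _ "(j, s)"]) simp
  qed
  then obtain p where p: "\<forall>i\<in>I. fst (p i) \<in> J \<and> (snd (p i) = (1::int) \<or> snd (p i) = - 1) \<and>
    ?t i = of_int (snd (p i)) \<odot>\<^bsub>tensor_real A\<^esub> ?t (fst (p i))" by (elim bchoice[THEN exE])
  define idx where "idx i = fst (p i)" for i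
  define sg where "sg i = snd (p i)" for i
  have ix: "idx i \<in> J" "sg i = 1 \<or> sg i = - 1" "?t i = of_int (sg i) \<odot>\<^bsub>tensor_real A\<^esub> ?t (idx i)" if "i \<in> I" for i
    using p that by (simp_all add: idx_def sg_def)
  have aJ: "a j \<in> carrier A" if "j \<in> J" for j using a J(1) that by blast
  have fam: "f (a i) = of_int (sg i) * f (a (idx i))" if f: "f \<in> hom A rat_group" and i: "i \<in> I" for f i
    by (rule hom_eq_of_tensor_image[OF A(1) f a[OF i] aJ[OF ix(1)[OF i]] ix(3)[OF i]])
  have "\<forall>j\<in>J. \<exists>f. f \<in> hom A rat_group \<and> (\<forall>i\<in>J. f (a i) = (if i = j then 1 else 0))"
  proof
    fix j assume j: "j \<in> J"
    have "\<exists>f\<in>hom A rat_group. \<forall>i\<in>J. f (a i) = (if i = j then 1 else 0)"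
    proof (rule dual_family[OF A finJ aJ _ j])
      fix k i assume 1: "finprod A (\<lambda>j. a j [^]\<^bsub>A\<^esub> (k j :: int)) J = \<one>\<^bsub>A\<^esub>" and 2: "i \<in> J"
      show "k i = 0" by (rule independent_of_tensor_image[OF A(1) finJ _ J(2,3) 1 2]) (rule aJ)
    qed
    then show "\<exists>f. f \<in> hom A rat_group \<and> (\<forall>i\<in>J. f (a i) = (if i = j then 1 else 0))" by blast
  qed
  then obtain \<phi> where \<phi>: "\<forall>j\<in>J. \<phi> j \<in> hom A rat_group \<and> (\<forall>i\<in>J. \<phi> j (a i) = (if i = j then 1 else 0))"
    by (elim bchoice[THEN exE])
  have "\<phi> j (a i) = (if idx i = j then of_int (sg i) else 0)" if j: "j \<in> J" and i: "i \<in> I" for i j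
    using fam[of "\<phi> j" i] \<phi> ix(1)[OF i] j i by simp
  then show ?thesis
    using J(1) ix(1,2) fam \<phi> by (intro exI[of _ J] exI[of _ idx] exI[of _ sg] exI[of _ \<phi>] conjI) auto
qed

section \<open>The abelianization of the tree group\<close>

lemma restrict_gog_simps [simp]:
  "gog_graph (restrict_gog \<G> T) = T" "gog_rev (restrict_gog \<G> T) = perm_restrict (gog_rev \<G>) (arcs T)"
  "vgroup (restrict_gog \<G> T) = vgroup \<G>" "egroup (restrict_gog \<G> T) = egroup \<G>"
  "emono (restrict_gog \<G> T) = emono \<G>"
  by (simp_all add: restrict_gog_def)

text \<open>On arcs of \<open>T\<close> the restricted inversion agrees with \<open>rv\<close>, so
  it yields no new circuits, and \<open>T\<close> is a maximal tree of itself because no larger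
  subgraph of it exists.\<close>

lemma (in gog) gog_restrict: "gog (restrict_gog \<G> T) T (P \<inter> arcs T)"
proof
  let ?r = "perm_restrict rv (arcs T)"
  show "finite_graph_of_groups (restrict_gog \<G> T)" by (rule finite_graph_of_groups_restrict[OF fg mt])
  have wT: "wf_digraph T" using subgraph_T by (simp add: subgraph_def)
  interpret T: wf_digraph T by fact
  have rr: "perm_restrict ?r (arcs T) = ?r" by (auto simp: perm_restrict_def fun_eq_iff)
  have circ: "serre_circuit T rv p" if p: "serre_circuit T ?r p" for p
  proof -
    have cyc: "T.cycle p" and red: "\<And>i. Suc i < length p \<Longrightarrow> p ! Suc i \<noteq> ?r (p ! i)"
      using p by (auto simp: serre_circuit_def)
    have "set p \<subseteq> arcs T" using cyc by (auto simp: T.cycle_def T.awalk_def)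
    then have "p ! i \<in> arcs T" if "i < length p" for i using that nth_mem by blast
    then have "?r (p ! i) = rv (p ! i)" if "i < length p" for i using that by (simp add: perm_restrict_def)
    then show ?thesis using cyc red unfolding serre_circuit_def by (metis Suc_lessD)
  qed
  have st: "serre_tree ?r T"
    using serre_T circ unfolding serre_tree_def rr by blast
  have eq: "H = T" if "subgraph T H" "subgraph H T" for H
  proof -
    have "verts H = verts T" "arcs H = arcs T" "tail H = tail T" "head H = head T"
      using that by (auto simp: subgraph_def compatible_def)
    then show ?thesis by simp
  qed
  show "maximal_tree (gog_graph (restrict_gog \<G> T)) (gog_rev (restrict_gog \<G> T)) T"
    unfolding maximal_tree_def restrict_gog_simps T.max_subgraph_def
    using T.subgraph_refl st eq by blast
  have 1: "arcs T \<subseteq> (P \<inter> arcs T) \<union> ?r ` (P \<inter> arcs T)"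
  proof
    fix e assume e: "e \<in> arcs T"
    show "e \<in> (P \<inter> arcs T) \<union> ?r ` (P \<inter> arcs T)"
    proof (cases "e \<in> P")
      case False
      then have "rv e \<in> P \<inter> arcs T" using P_cases e arcs_T rv_arcs_T[OF e] by blast
      moreover have "e = ?r (rv e)" using rv_arcs_T[OF e] by (simp add: perm_restrict_def)
      ultimately show ?thesis by blast
    qed (use e in simp)
  qed
  have 2: "?r e \<in> arcs T \<and> ?r e \<notin> P" if "e \<in> P \<inter> arcs T" for e
    using that rv_arcs_T P_rv by (simp add: perm_restrict_def)
  show "serre_orientation (gog_graph (restrict_gog \<G> T)) (gog_rev (restrict_gog \<G> T)) (P \<inter> arcs T)"
    unfolding serre_orientation_def restrict_gog_simps using 1 2 by blast
qed

context gog_cyclic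
begin

sublocale TG: gog "restrict_gog \<G> T" T "P \<inter> arcs T"
  by (rule gog_restrict)

definition "AT = abelianization TG.G"
definition "av v g = abelianization_hom TG.G (TG.vert v g)"

lemma comm_group_AT: "comm_group AT"
  unfolding AT_def abelianization_def by (rule group.derived_quot_is_comm_group[OF TG.group_G])

lemma derived_normal: "derived TG.G (carrier TG.G) \<lhd> TG.G"
  by (rule group.derived_self_is_normal[OF TG.group_G])

lemma abelianization_hom_hom: "abelianization_hom TG.G \<in> hom TG.G AT"
  unfolding AT_def abelianization_def abelianization_hom_def[abs_def]
  by (rule normal.r_coset_hom_Mod[OF derived_normal])

lemma TG_om: "e \<in> arcs T \<Longrightarrow> emono_omega (restrict_gog \<G> T) e = om e"
  by (rule ext) (simp add: emono_omega_def perm_restrict_def)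

lemma av_hom: "v \<in> V \<Longrightarrow> av v \<in> hom (Gv v) AT"
proof -
  assume v: "v \<in> V"
  have "TG.vert v \<in> hom (Gv v) TG.G" using TG.vert_hom[of v] v by (simp add: verts_T)
  from hom_compose[OF this abelianization_hom_hom] show ?thesis by (simp add: av_def[abs_def] comp_def)
qed

lemma av_family: "tree_family AT av"
  unfolding tree_family_def
proof (intro conjI ballI)
  fix v assume "v \<in> V" then show "av v \<in> hom (Gv v) AT" by (rule av_hom)
next
  fix e a assume e: "e \<in> arcs T" and a: "a \<in> carrier (Ge e)"
  interpret TGG: group TG.G by (rule TG.group_G)
  have eE: "e \<in> E" using e arcs_T by blast
  have c: "TG.vert (hd\<^sub>\<Gamma> e) (om e a) \<in> carrier TG.G" "TG.vert (tl\<^sub>\<Gamma> e) (al e a) \<in> carrier TG.G"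
    using TG.vert_closed[of "hd\<^sub>\<Gamma> e" "om e a"] TG.vert_closed[of "tl\<^sub>\<Gamma> e" "al e a"]
      om_closed[OF eE a] al_closed[OF eE a] eE by (simp_all add: verts_T)
  have "TG.vert (hd\<^sub>\<Gamma> e) (om e a) = TG.vert (tl\<^sub>\<Gamma> e) (al e a)"
    using TG.stab_rel[of e a] TG.stab_T[OF e] e a c TG_om[OF e] by (simp add: T_ends)
  then show "av (tl\<^sub>\<Gamma> e) (al e a) = av (hd\<^sub>\<Gamma> e) (om e a)" by (simp add: av_def)
qed

lemma family_of_hom: "f \<in> hom AT D \<Longrightarrow> tree_family D (\<lambda>v g. f (av v g))"
  using hom_compose[OF av_hom] tree_familyD(2)[OF av_family]
  by (fastforce simp: tree_family_def comp_def)

text \<open>The family is a representation of the tree group with trivial stable letters. In the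
  commutative group \<open>D\<close> the gauge conjugations disappear and commutators die, so the
  homomorphism factors through the abelianization.\<close>

lemma hom_of_family:
  assumes D: "comm_group D" and h: "tree_family D h"
  shows "\<exists>f\<in>hom AT D. \<forall>v\<in>V. \<forall>g\<in>carrier (Gv v). f (av v g) = h v g"
proof -
  interpret D: comm_group D by fact
  have rep: "gog_rep (restrict_gog \<G> T) D h (\<lambda>_. \<one>\<^bsub>D\<^esub>)"
    unfolding gog_rep_def restrict_gog_simps
  proof (intro conjI ballI)
    fix v assume "v \<in> verts T" then show "h v \<in> hom (Gv v) D" using tree_familyD(1)[OF h] by (simp add: verts_T)
  next
    fix e a assume e: "e \<in> arcs T" and a: "a \<in> carrier (Ge e)"
    have eE: "e \<in> E" using e arcs_T by blast
    have "h (tl\<^sub>\<Gamma> e) (al e a) \<in> carrier D"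
      by (rule hom_in_carrier[OF tree_familyD(1)[OF h] al_closed[OF eE a]]) (use eE in simp)
    then show "\<one>\<^bsub>D\<^esub> \<otimes>\<^bsub>D\<^esub> h (head T e) (emono_omega (restrict_gog \<G> T) e a) = h (tail T e) (al e a) \<otimes>\<^bsub>D\<^esub> \<one>\<^bsub>D\<^esub>"
      using tree_familyD(2)[OF h e a] by (simp add: T_ends TG_om[OF e])
  qed simp_all
  from TG.rep_to_hom[OF D.is_group rep] obtain \<Phi> l where \<Phi>: "\<Phi> \<in> hom TG.G D"
    and l: "\<forall>v\<in>verts T. l v \<in> carrier D"
    and \<Phi>v: "\<forall>v\<in>verts T. \<forall>g\<in>carrier (Gv v). \<Phi> (TG.vert v g) = l v \<otimes>\<^bsub>D\<^esub> h v g \<otimes>\<^bsub>D\<^esub> inv\<^bsub>D\<^esub> l v"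
    unfolding restrict_gog_simps by blast
  interpret \<Phi>: group_hom TG.G D \<Phi> by (intro group_hom.intro group_hom_axioms.intro TG.group_G D.is_group \<Phi>)
  let ?N = "derived TG.G (carrier TG.G)"
  have ds: "derived_set TG.G (carrier TG.G) \<subseteq> carrier TG.G" by (rule \<Phi>.G.derived_set_in_carrier) simp
  have im: "\<Phi> ` derived_set TG.G (carrier TG.G) \<subseteq> {\<one>\<^bsub>D\<^esub>}"
  proof (rule image_subsetI)
    fix x assume "x \<in> derived_set TG.G (carrier TG.G)"
    then obtain y z where yz: "y \<in> carrier TG.G" "z \<in> carrier TG.G"
      "x = y \<otimes>\<^bsub>TG.G\<^esub> z \<otimes>\<^bsub>TG.G\<^esub> inv\<^bsub>TG.G\<^esub> y \<otimes>\<^bsub>TG.G\<^esub> inv\<^bsub>TG.G\<^esub> z" by auto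
    have "\<Phi> x = \<Phi> y \<otimes>\<^bsub>D\<^esub> \<Phi> z \<otimes>\<^bsub>D\<^esub> inv\<^bsub>D\<^esub> \<Phi> y \<otimes>\<^bsub>D\<^esub> inv\<^bsub>D\<^esub> \<Phi> z" using yz by simp
    also have "\<dots> = (\<Phi> y \<otimes>\<^bsub>D\<^esub> inv\<^bsub>D\<^esub> \<Phi> y) \<otimes>\<^bsub>D\<^esub> (\<Phi> z \<otimes>\<^bsub>D\<^esub> inv\<^bsub>D\<^esub> \<Phi> z)"
      using \<Phi>.hom_closed[OF yz(1)] \<Phi>.hom_closed[OF yz(2)] by (simp only: D.m_ac D.inv_closed D.m_closed)
    also have "\<dots> = \<one>\<^bsub>D\<^esub>" using \<Phi>.hom_closed[OF yz(1)] \<Phi>.hom_closed[OF yz(2)] by simp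
    finally show "\<Phi> x \<in> {\<one>\<^bsub>D\<^esub>}" by simp
  qed
  have "?N \<subseteq> kernel TG.G D \<Phi>"
  proof
    fix x assume x: "x \<in> ?N"
    then have "\<Phi> x \<in> {\<one>\<^bsub>D\<^esub>}"
      unfolding derived_def by (rule hom_generate_in[OF TG.group_G D.is_group \<Phi> D.triv_subgroup ds im])
    moreover have "x \<in> carrier TG.G" using x normal_imp_subgroup[OF derived_normal] subgroup.subset by blast
    ultimately show "x \<in> kernel TG.G D \<Phi>" by (simp add: kernel_def)
  qed
  from \<Phi>.FactGroup_universal_kernel[OF derived_normal this]
  obtain f where f: "f \<in> hom (TG.G Mod ?N) D" "\<And>x. x \<in> carrier TG.G \<Longrightarrow> f (?N #>\<^bsub>TG.G\<^esub> x) = \<Phi> x" by blast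
  have "f (av v g) = h v g" if v: "v \<in> V" and g: "g \<in> carrier (Gv v)" for v g
  proof -
    have vT: "v \<in> verts T" using v by (simp add: verts_T)
    have c: "TG.vert v g \<in> carrier TG.G" using TG.vert_closed[of v g] vT g by simp
    have hc: "h v g \<in> carrier D" by (rule hom_in_carrier[OF tree_familyD(1)[OF h v] g])
    have lc: "l v \<in> carrier D" using l vT by blast
    have "f (av v g) = l v \<otimes>\<^bsub>D\<^esub> h v g \<otimes>\<^bsub>D\<^esub> inv\<^bsub>D\<^esub> l v"
      using f(2)[OF c] \<Phi>v vT g by (simp add: av_def abelianization_hom_def)
    also have "\<dots> = (l v \<otimes>\<^bsub>D\<^esub> inv\<^bsub>D\<^esub> l v) \<otimes>\<^bsub>D\<^esub> h v g" using hc lc by (simp only: D.m_ac D.inv_closed D.m_closed)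
    also have "\<dots> = h v g" using hc lc by simp
    finally show ?thesis .
  qed
  then show ?thesis using f(1) unfolding AT_def abelianization_def by blast
qed

text \<open>All stable letters of the tree group belong to \<open>T\<close> and are trivial, so the
  images of finitely many generators of each vertex group suffice.\<close>

lemma fin_gen_AT: "finitely_generated_group AT"
proof -
  interpret A: comm_group AT by (rule comm_group_AT)
  interpret TGG: group TG.G by (rule TG.group_G)
  interpret \<rho>: group_hom TG.G AT "abelianization_hom TG.G"
    by (intro group_hom.intro group_hom_axioms.intro TG.group_G A.is_group abelianization_hom_hom)
  have "\<forall>v\<in>V. \<exists>S. finite S \<and> S \<subseteq> carrier (Gv v) \<and> carrier (Gv v) = generate (Gv v) S"
    using fin_gen by (simp add: finitely_generated_group_def)
  then obtain S where S: "\<forall>v\<in>V. finite (S v) \<and> S v \<subseteq> carrier (Gv v) \<and> carrier (Gv v) = generate (Gv v) (S v)"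
    by (elim bchoice[THEN exE])
  define U where "U = (\<Union>v\<in>V. av v ` S v)"
  have U: "finite U" using S by (simp add: U_def)
  have Uc: "U \<subseteq> carrier AT" using S hom_in_carrier[OF av_hom] unfolding U_def by blast
  have K: "subgroup (generate AT U) AT" by (rule A.generate_is_subgroup[OF Uc])
  have avK: "av v g \<in> generate AT U" if v: "v \<in> V" and g: "g \<in> carrier (Gv v)" for v g
  proof (rule hom_generate_in[OF group_Gv[OF v] A.is_group av_hom[OF v] K, of "S v"])
    show "S v \<subseteq> carrier (Gv v)" "g \<in> generate (Gv v) (S v)" using S v g by auto
    show "av v ` S v \<subseteq> generate AT U" using v unfolding U_def by (blast intro: generate.incl)
  qed
  let ?\<rho> = "abelianization_hom TG.G"
  have "?\<rho> (TG.cls w) \<in> generate AT U" if "w \<in> TG.wds" for w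
    using that
  proof (induction w rule: list.induct)
    case Nil
    show ?case unfolding TG.cls_Nil \<rho>.hom_one by (rule generate.one)
  next
    case (Cons a w)
    obtain x b where a: "a = (x, b)" by force
    have x: "x \<in> fund_gens (restrict_gog \<G> T) (P \<inter> arcs T)" and w: "w \<in> TG.wds" and aw: "[a] \<in> TG.wds"
      using Cons.prems a by auto
    have xw: "[(x, True)] \<in> TG.wds" using x by simp
    have "?\<rho> (TG.cls [(x, True)]) \<in> generate AT U"
    proof (cases x)
      case (Vert v g)
      then have "v \<in> V" "g \<in> carrier (Gv v)" using x by (auto simp: fund_gens_def verts_T)
      from avK[OF this] show ?thesis using Vert by (simp add: av_def TG.vert_def fund_vert_def)
    next
      case (Stable e)
      then have e: "e \<in> P \<inter> arcs T" using x by (auto simp: fund_gens_def)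
      have "TG.cls [(x, True)] = \<one>\<^bsub>TG.G\<^esub>" using TG.stab_T[of e] e Stable by (simp add: TG.stab_def)
      then show ?thesis using \<rho>.hom_one generate.one[of AT U] by simp
    qed
    then have "?\<rho> (TG.cls [a]) \<in> generate AT U"
      using a TG.cls_inv[OF x] TG.cls_closed[OF xw] subgroup.m_inv_closed[OF K] by (cases b) simp_all
    then show ?case
      using TG.cls_mult[OF aw w] TG.cls_closed[OF aw] TG.cls_closed[OF w] Cons.IH[OF w]
        \<rho>.hom_mult[OF TG.cls_closed[OF aw] TG.cls_closed[OF w]] subgroup.m_closed[OF K] by simp
  qed
  then have *: "?\<rho> x \<in> generate AT U" if "x \<in> carrier TG.G" for x using that unfolding TG.carrier_G by blast
  have "carrier AT \<subseteq> generate AT U"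
  proof
    fix X assume "X \<in> carrier AT"
    then have "X \<in> rcosets\<^bsub>TG.G\<^esub> (derived TG.G (carrier TG.G))"
      unfolding AT_def abelianization_def FactGroup_def partial_object.simps .
    then obtain g where g: "g \<in> carrier TG.G" "X = derived TG.G (carrier TG.G) #>\<^bsub>TG.G\<^esub> g"
      unfolding RCOSETS_def by (elim UN_E singletonE)
    show "X \<in> generate AT U" using *[OF g(1)] unfolding g(2) abelianization_hom_def .
  qed
  then have "carrier AT = generate AT U" by (rule subset_antisym[OF _ A.generate_incl[OF Uc]])
  then show ?thesis unfolding finitely_generated_group_def using U Uc by (intro exI[of _ U] conjI)
qed

text \<open>Functionals on the abelianization pull back to families by \<open>family_of_hom\<close>.
  Conversely \<open>hom_of_family\<close> turns an arbitrary rational family into a functional, to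
  which the relation between \<open>ae e\<close> and \<open>ae (idx e)\<close> applies; this is how
  \<open>family_ae\<close> arises.\<close>

lemma property_VRC_of_nearly_independent:
  assumes "nearly_independent_in AT NT (\<lambda>e. av (tl\<^sub>\<Gamma> e) (ae e))"
  shows "property_VRC G"
proof -
  have "finite NT" by simp
  moreover have "av (tl\<^sub>\<Gamma> e) (ae e) \<in> carrier AT" if "e \<in> NT" for e
    using hom_in_carrier[OF av_hom ae_closed[OF that]] that by simp
  ultimately obtain J idx sg \<phi> where J: "J \<subseteq> NT"
    and ix: "\<forall>e\<in>NT. idx e \<in> J \<and> (sg e = 1 \<or> sg e = (- 1 :: int))"
    and fam: "\<forall>f\<in>hom AT rat_group. \<forall>e\<in>NT. f (av (tl\<^sub>\<Gamma> e) (ae e)) =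
      of_int (sg e) * f (av (tl\<^sub>\<Gamma> (idx e)) (ae (idx e)))"
    and \<phi>: "\<forall>j\<in>J. \<phi> j \<in> hom AT rat_group \<and>
      (\<forall>e\<in>NT. \<phi> j (av (tl\<^sub>\<Gamma> e) (ae e)) = (if idx e = j then of_int (sg e) else 0))"
    using nearly_independent_coordinates[OF comm_group_AT fin_gen_AT _ _ assms] by blast
  interpret gog_coords \<G> T P c J idx sg "\<lambda>j v g. \<phi> j (av v g)"
  proof
    fix h e assume h: "tree_family rat_group h" and e: "e \<in> NT"
    obtain f where f: "f \<in> hom AT rat_group" "\<And>v g. v \<in> V \<Longrightarrow> g \<in> carrier (Gv v) \<Longrightarrow> f (av v g) = h v g"
      using hom_of_family[OF comm_group_rat_group h] by blast
    have i: "idx e \<in> NT" using ix e J by blast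
    have "f (av (tl\<^sub>\<Gamma> e) (ae e)) = h (tl\<^sub>\<Gamma> e) (ae e)" using f(2) ae_closed[OF e] e by simp
    moreover have "f (av (tl\<^sub>\<Gamma> (idx e)) (ae (idx e))) = h (tl\<^sub>\<Gamma> (idx e)) (ae (idx e))" using f(2) ae_closed[OF i] i by simp
    ultimately show "h (tl\<^sub>\<Gamma> e) (ae e) = of_int (sg e) * h (tl\<^sub>\<Gamma> (idx e)) (ae (idx e))"
      using fam f(1) e by metis
  next
    fix j assume "j \<in> J" then show "tree_family rat_group (\<lambda>v g. \<phi> j (av v g))" using \<phi> by (intro family_of_hom) blast
  qed (use J ix \<phi> in auto)
  show ?thesis by (rule property_VRC_G)
qed

end

theorem theorem10p1:
  fixes \<G> :: "('v, 'e, 'a, 'b) graph_of_groups"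
    and T :: "('v, 'e) pre_digraph"
    and P :: "'e set"
    and c :: "'e \<Rightarrow> 'b"
  assumes "finite_graph_of_groups \<G>"
    and "\<forall>v\<in>verts (gog_graph \<G>). comm_group (vgroup \<G> v) \<and> finitely_generated_group (vgroup \<G> v)"
    and "maximal_tree (gog_graph \<G>) (gog_rev \<G>) T"
    and "serre_orientation (gog_graph \<G>) (gog_rev \<G>) P"
    and "\<forall>e\<in>arcs (gog_graph \<G>) - arcs T.
           c e \<in> carrier (egroup \<G> e) \<and> carrier (egroup \<G> e) = generate (egroup \<G> e) {c e} \<and>
           c (gog_rev \<G> e) = c e"
    and "nearly_independent_in (abelianization (tree_group \<G> T P)) (arcs (gog_graph \<G>) - arcs T)
           (\<lambda>e. abelianization_hom (tree_group \<G> T P)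
                  (tree_group_vert \<G> T P (tail (gog_graph \<G>) e) (emono \<G> e (c e))))"
  shows "property_VRC (fund_group \<G> T P)"
proof -
  interpret gog_cyclic \<G> T P c
    by (intro gog_cyclic.intro gog.intro gog_cyclic_axioms.intro) (use assms(1-5) in auto)
  have "TG.G = tree_group \<G> T P" "TG.vert = tree_group_vert \<G> T P"
    by (simp_all add: TG.G_def tree_group_def TG.vert_def tree_group_vert_def)
  then have "nearly_independent_in AT NT (\<lambda>e. av (tl\<^sub>\<Gamma> e) (ae e))"
    using assms(6) by (simp add: AT_def av_def)
  then have "property_VRC G" by (rule property_VRC_of_nearly_independent)
  then show ?thesis by (simp add: G_def)
qed

end
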